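(* Let $\lambda_1,\ldots,\lambda_n\in\mathcal{W}P^+$ and put $\pi_\Lambda=\pi_{\lambda_1}\otimes\cdots\otimes\pi_{\lambda_n}$. Suppose $\pi_\Lambda$ is a dominant path, i.e. $\pi_\Lambda(t)\in\sum_{\eta\in P^+}\mathbb{R}_{\ge0}\eta$ for all $t\in[0,1]$, and set $\lambda=\lambda_1+\cdots+\lambda_n$ (which lies in $P^+$). Then the assignment $F\pi_\lambda\mapsto F\pi_\Lambda$ ($F\in\mathcal{F}$) is a well-defined isomorphism of crystals $\mathbb{B}(\lambda)\xrightarrow{\ \cong\ }\mathcal{F}\pi_\Lambda$, where $\mathcal{F}\pi_\Lambda$ denotes the set of nonzero paths $F\pi_\Lambda$, $F\in\mathcal{F}$.
   Context: Borcherds–Cartan datum: $I$ is a countable set and $A=(a_{ij})_{i,j\in I}$ satisfies: $a_{ii}=2$ or $a_{ii}\in\mathbb{Z}_{\le0}$; $a_{ij}\in\mathbb{Z}_{\le 0}$ for $i\ne j$; $a_{ij}=0\iff a_{ji}=0$ for $i\neq j$. $I^{re}=\{i:a_{ii}=2\}$, $I^{im}=I\setminus I^{re}$. Fix $(A,\{\alpha_i\},\{\alpha_i^\vee\},P,P^\vee)$ with $P^\vee$ a free $\mathbb{Z}$-module, $P=\mathrm{Hom}_{\mathbb Z}(P^\vee,\mathbb Z)$, $\mathfrak h=P^\vee\otimes\mathbb C$, $\alpha_i^\vee\in P^\vee$, $\alpha_i\in P$, $\alpha_i^\vee(\alpha_j)=a_{ij}$, both families linearly independent. $P^+=\{\lambda\in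 P:\alpha_i^\vee(\lambda)\ge 0\ \forall i\}$. $\Delta^+$ = positive roots of the generalized Kac–Moody algebra. $r_i(\mu)=\mu-\alpha_i^\vee(\mu)\alpha_i$ on $\mathfrak h^*$; $\mathcal W_{re}$ = group generated by $r_i$, $i\in I^{re}$; $\Delta^+_{re}=\mathcal W_{re}\{\alpha_i\}_{i\in I^{re}}\cap\Delta^+$, $\Delta_{im}=\mathcal W_{re}\{\alpha_i\}_{i\in I^{im}}$; for $\beta=w\alpha_i$ ($w\in\mathcal W_{re}$) in $\Delta^+_{re}\sqcup\Delta_{im}$, $\beta^\vee=w\alpha_i^\vee$ and $r_\beta=wr_iw^{-1}$ (well defined). The monoid $\mathcal W$ is generated by $r_i$ ($i\in I$) with relations $r_i^2=1$ ($i\in I^{re}$); $(r_ir_j)^m=(r_jr_i)^m=1$ for $i\ne j\in I^{re}$ when the order $m$ of $r_ir_j$ in $GL(\mathfrak h^* )$ lies in $\{2,3,4,6\}$; $r_ir_j=r_jr_i$ if $i\in I^{im}$, $j\ne i$, $a_{ij}=0$; it acts on $\mathfrak h^*$ via $r_i$. $\mathcal WP^+=\{w\lambda: w\in\mathcal W,\lambda\in P^+\}$. For $\lambda\in P^+$, $\mathcal W\lambda$ is ordered by: $\mu\ge\nu$ iff there are $\mu=\lambda_0,\ldots,\lambda_k=\nu$ in $\mathcal W\lambda$ and $\beta_s\in\Delta^+_{re}\sqcup\Delta_{im}$ with $\lambda_{s-1}=r_{\beta_s}\lambda_s$, $\beta_s^\vee(\lambda_s)>0$; $\mu\xleftarrow{\beta}\nu$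 means $\mu=r_\beta\nu$, $\beta^\vee(\nu)>0$ and $\mu$ covers $\nu$. For rational $a\in(0,1]$, an $a$-chain for $(\mu,\nu)$ is $\mu=\nu_0\xleftarrow{\beta_1}\nu_1\cdots\xleftarrow{\beta_k}\nu_k=\nu$ with $a\beta_s^\vee(\nu_s)\in\mathbb Z_{>0}$ if $\beta_s$ real and $=1$ if $\beta_s\in\Delta_{im}$. Paths: $\mathbb P$ = piecewise-linear continuous $\pi:[0,1]\to\mathfrak h_{\mathbb R}^*$ ($\mathfrak h_{\mathbb R}$ a real form containing the $\alpha_i^\vee$), $\pi(0)=0$, $\pi(1)\in P$, not identified up to reparametrization; $\mathbf 0$ an extra element. $H_i^\pi(t)=\alpha_i^\vee(\pi(t))$, $m_i^\pi=\min\{H_i^\pi(t):H_i^\pi(t)\in\mathbb Z\}$. Root operators (fixing $\mathbf 0$): $f_+^i=\max\{t:H_i^\pi(t)=m_i^\pi\}$; if $f_+^i=1$, $f_i\pi=\mathbf 0$; else $f_-^i=\min\{t\ge f_+^i:H_i^\pi(t)=m_i^\pi+1\}$ and $f_i\pi(t)=\pi(t)$ on $[0,f_+^i]$, $\pi(t)-(H_i^\pi(t)-m_i^\pi)\alpha_i$ on $[f_+^i,f_-^i]$, $\pi(t)-\alpha_i$ on $[f_-^i,1]$. For $i\in I^{re}$: $e_+^i=\min\{t:H_i^\pi(t)=m_i^\pi\}$; if $e_+^i=0$, $e_i\pi=\mathbf0$; else $e_-^i=\max\{t\le e_+^i:H_i^\pi(t)=m_i^\pi+1\}$ and $e_i\pi(t)=\pi(t)$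 on $[0,e_-^i]$, $\pi(t)-(H_i^\pi(t)-m_i^\pi-1)\alpha_i$ on $[e_-^i,e_+^i]$, $\pi(t)+\alpha_i$ on $[e_+^i,1]$. For $i\in I^{im}$: $e_-^i=f_+^i$; $e_i\pi=\mathbf0$ if $e_-^i=1$ or $H_i^\pi<m_i^\pi+1-a_{ii}$ on $[e_-^i,1]$; else $e_+^i=\min\{t\ge e_-^i:H_i^\pi(t)=m_i^\pi+1-a_{ii}\}$, $e_i\pi=\mathbf 0$ if $H_i^\pi(s)\le m_i^\pi-a_{ii}$ for some $s\ge e_+^i$, and otherwise $e_i\pi(t)=\pi(t)$ on $[0,e_-^i]$, $\pi(t)+\frac{1}{1-a_{ii}}(H_i^\pi(t)-m_i^\pi)\alpha_i$ on $[e_-^i,e_+^i]$, $\pi(t)+\alpha_i$ on $[e_+^i,1]$. $\mathcal F$ = monoid generated by the $f_i$. $\pi_\mu(t)=t\mu$. Concatenation: $(\pi_1\otimes\cdots\otimes\pi_n)(t)=\sum_{l<m}\pi_l(1)+\pi_m(nt-m+1)$ for $t\in[\frac{m-1}n,\frac mn]$. GLS paths of shape $\lambda\in P^+$: $\pi=(\lambda_1,\ldots,\lambda_k;a_0,\ldots,a_k)$, $\lambda_1>\cdots>\lambda_k$ in $\mathcal W\lambda$, rationals $0=a_0<\cdots<a_k=1$, with an $a_s$-chain for $(\lambda_s,\lambda_{s+1})$ ($1\le s<k$) and a $1$-chain for $(\lambda_k,\lambda)$; as a path, $\pi(t)=\sum_{l<s}(a_l-a_{l-1})\lambda_l+(t-a_{s-1})\lambda_s$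 on $[a_{s-1},a_s]$. $\mathbb B(\lambda)$ = set of these; $\mathbb B(\lambda)=\{F\pi_\lambda:F\in\mathcal F\}\setminus\{\mathbf0\}$. Crystal structure on a set $B\subset\mathbb P$ stable (up to $\mathbf 0$) under all $f_i$ and $e_i$, $i\in I^{re}$: $\mathrm{wt}(\pi)=\pi(1)$; for $i\in I^{re}$, $\varepsilon_i=-m_i^\pi$, $\varphi_i=H_i^\pi(1)-m_i^\pi$; for $i\in I^{im}$, $\varepsilon_i=0$, $\varphi_i=\alpha_i^\vee(\pi(1))$; Kashiwara operators are the root operators $f_i$ and $e_i$ ($i\in I^{re}$), while for $i\in I^{im}$, $e_i\pi$ is the root-operator image if it lies in $B$ and $\mathbf0$ otherwise. This applies to $B=\mathbb B(\lambda)$ and $B=\mathcal F\pi_\Lambda$. An isomorphism of crystals is a bijection preserving $\mathrm{wt},\varepsilon_i,\varphi_i$ and commuting with all $e_i,f_i$. *)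

theory Defs
  imports Complex_Main "HOL-Library.Countable_Set"
begin

text \<open>P^vee is the free Z-module with basis indexed by the type 'b: its elements are the
finitely supported functions 'b => int.  P = Hom(P^vee, Z) is the set of all functions
'b => int, h_R = P^vee (x) R (finitely supported 'b => real) and h_R^* = all functions
'b => real.  The pairing is the (finite) sum over the support of the coweight.\<close>

type_synonym 'b wt = "'b \<Rightarrow> int"
type_synonym 'b rwt = "'b \<Rightarrow> real"
type_synonym 'b path = "real \<Rightarrow> 'b rwt"

definition pairZ :: "'b wt \<Rightarrow> 'b wt \<Rightarrow> int" where
  "pairZ h \<mu> = (\<Sum>b\<in>{b. h b \<noteq> 0}. h b * \<mu> b)"

definition pairR :: "'b wt \<Rightarrow> 'b rwt \<Rightarrow> real" where
  "pairR h v = (\<Sum>b\<in>{b. h b \<noteq> 0}. real_of_int (h b) * v b)"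

definition embR :: "'b wt \<Rightarrow> 'b rwt" where
  "embR \<mu> = (\<lambda>b. real_of_int (\<mu> b))"

definition cartan :: "('i \<Rightarrow> 'b wt) \<Rightarrow> ('i \<Rightarrow> 'b wt) \<Rightarrow> 'i \<Rightarrow> 'i \<Rightarrow> int" where
  "cartan cor al i j = pairZ (cor i) (al j)"

definition lin_indep_fam :: "'i set \<Rightarrow> ('i \<Rightarrow> 'b wt) \<Rightarrow> bool" where
  "lin_indep_fam I v \<longleftrightarrow> (\<forall>S c. finite S \<longrightarrow> S \<subseteq> I \<longrightarrow>
      (\<lambda>b. \<Sum>i\<in>S. c i * real_of_int (v i b)) = (\<lambda>b. 0) \<longrightarrow> (\<forall>i\<in>S. c i = (0::real)))"

definition BC_datum :: "'i set \<Rightarrow> ('i \<Rightarrow> 'b wt) \<Rightarrow> ('i \<Rightarrow> 'b wt) \<Rightarrow> bool" where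
  "BC_datum I cor al \<longleftrightarrow> countable I
     \<and> (\<forall>i\<in>I. finite {b. cor i b \<noteq> 0})
     \<and> (\<forall>i\<in>I. cartan cor al i i = 2 \<or> cartan cor al i i \<le> 0)
     \<and> (\<forall>i\<in>I. \<forall>j\<in>I. i \<noteq> j \<longrightarrow> cartan cor al i j \<le> 0
                        \<and> (cartan cor al i j = 0 \<longleftrightarrow> cartan cor al j i = 0))
     \<and> lin_indep_fam I cor \<and> lin_indep_fam I al"

definition is_real :: "('i \<Rightarrow> 'b wt) \<Rightarrow> ('i \<Rightarrow> 'b wt) \<Rightarrow> 'i \<Rightarrow> bool" where
  "is_real cor al i \<longleftrightarrow> cartan cor al i i = 2"

definition Pplus :: "'i set \<Rightarrow> ('i \<Rightarrow> 'b wt) \<Rightarrow> 'b wt set" where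
  "Pplus I cor = {\<mu>. \<forall>i\<in>I. pairZ (cor i) \<mu> \<ge> 0}"

definition refl_r :: "('i \<Rightarrow> 'b wt) \<Rightarrow> ('i \<Rightarrow> 'b wt) \<Rightarrow> 'i \<Rightarrow> 'b wt \<Rightarrow> 'b wt" where
  "refl_r cor al i \<mu> = (\<lambda>b. \<mu> b - pairZ (cor i) \<mu> * al i b)"

text \<open>W P^+ : the monoid W acts on h^* through the r_i, so its orbit of lambda is the set
of images of lambda under finite words in the r_i (i in I).\<close>
definition WPplus :: "'i set \<Rightarrow> ('i \<Rightarrow> 'b wt) \<Rightarrow> ('i \<Rightarrow> 'b wt) \<Rightarrow> 'b wt set" where
  "WPplus I cor al = {fold (refl_r cor al) ws lam | ws lam. ws \<in> lists I \<and> lam \<in> Pplus I cor}"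

definition clamp :: "real \<Rightarrow> real" where
  "clamp t = max 0 (min 1 t)"

definition Hf :: "('i \<Rightarrow> 'b wt) \<Rightarrow> 'i \<Rightarrow> 'b path \<Rightarrow> real \<Rightarrow> real" where
  "Hf cor i \<pi> t = pairR (cor i) (\<pi> t)"

definition mH :: "('i \<Rightarrow> 'b wt) \<Rightarrow> 'i \<Rightarrow> 'b path \<Rightarrow> real" where
  "mH cor i \<pi> = Min {x. \<exists>t\<in>{0..1}. x = Hf cor i \<pi> t \<and> x \<in> \<int>}"

definition f_op :: "('i \<Rightarrow> 'b wt) \<Rightarrow> ('i \<Rightarrow> 'b wt) \<Rightarrow> 'i \<Rightarrow> 'b path \<Rightarrow> 'b path option" where
  "f_op cor al i \<pi> =
    (let H = Hf cor i \<pi>; m = mH cor i \<pi>; a = embR (al i);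
         fp = Sup {t\<in>{0..1}. H t = m} in
     if fp = 1 then None else
     (let fm = Inf {t\<in>{fp..1}. H t = m + 1} in
      Some (\<lambda>s. let t = clamp s in
              if t \<le> fp then \<pi> t
              else if t \<le> fm then (\<lambda>b. \<pi> t b - (H t - m) * a b)
              else (\<lambda>b. \<pi> t b - a b))))"

definition e_re :: "('i \<Rightarrow> 'b wt) \<Rightarrow> ('i \<Rightarrow> 'b wt) \<Rightarrow> 'i \<Rightarrow> 'b path \<Rightarrow> 'b path option" where
  "e_re cor al i \<pi> =
    (let H = Hf cor i \<pi>; m = mH cor i \<pi>; a = embR (al i);
         ep = Inf {t\<in>{0..1}. H t = m} in
     if ep = 0 then None else
     (let em = Sup {t\<in>{0..ep}. H t = m + 1} in
      Some (\<lambda>s. let t = clamp s in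
              if t \<le> em then \<pi> t
              else if t \<le> ep then (\<lambda>b. \<pi> t b - (H t - m - 1) * a b)
              else (\<lambda>b. \<pi> t b + a b))))"

definition e_im :: "('i \<Rightarrow> 'b wt) \<Rightarrow> ('i \<Rightarrow> 'b wt) \<Rightarrow> 'i \<Rightarrow> 'b path \<Rightarrow> 'b path option" where
  "e_im cor al i \<pi> =
    (let H = Hf cor i \<pi>; m = mH cor i \<pi>; a = embR (al i);
         aii = real_of_int (cartan cor al i i);
         em = Sup {t\<in>{0..1}. H t = m} in
     if em = 1 \<or> (\<forall>t\<in>{em..1}. H t < m + 1 - aii) then None else
     (let ep = Inf {t\<in>{em..1}. H t = m + 1 - aii} in
      if (\<exists>s\<in>{ep..1}. H s \<le> m - aii) then None else
      Some (\<lambda>s. let t = clamp s in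
              if t \<le> em then \<pi> t
              else if t \<le> ep then (\<lambda>b. \<pi> t b + (1 / (1 - aii)) * (H t - m) * a b)
              else (\<lambda>b. \<pi> t b + a b))))"

definition e_op :: "('i \<Rightarrow> 'b wt) \<Rightarrow> ('i \<Rightarrow> 'b wt) \<Rightarrow> 'i \<Rightarrow> 'b path \<Rightarrow> 'b path option" where
  "e_op cor al i \<pi> = (if is_real cor al i then e_re cor al i \<pi> else e_im cor al i \<pi>)"

text \<open>Elements of the monoid F, given by words in the f_i; None plays the role of the
extra element 0, which is fixed by all root operators.\<close>
fun apply_F :: "('i \<Rightarrow> 'b wt) \<Rightarrow> ('i \<Rightarrow> 'b wt) \<Rightarrow> 'i list \<Rightarrow> 'b path \<Rightarrow> 'b path option" where
  "apply_F cor al [] \<pi> = Some \<pi>"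
| "apply_F cor al (i # ws) \<pi> = Option.bind (apply_F cor al ws \<pi>) (f_op cor al i)"

definition F_orbit :: "'i set \<Rightarrow> ('i \<Rightarrow> 'b wt) \<Rightarrow> ('i \<Rightarrow> 'b wt) \<Rightarrow> 'b path \<Rightarrow> 'b path set" where
  "F_orbit I cor al \<pi> = {p. \<exists>ws\<in>lists I. apply_F cor al ws \<pi> = Some p}"

definition pi_path :: "'b wt \<Rightarrow> 'b path" where
  "pi_path \<mu> = (\<lambda>s b. clamp s * real_of_int (\<mu> b))"

definition concat_paths :: "'b path list \<Rightarrow> 'b path" where
  "concat_paths ps = (\<lambda>s b. let t = clamp s; n = length ps;
       k = min (n - 1) (nat \<lfloor>real n * t\<rfloor>) in
     (\<Sum>l<k. (ps ! l) 1 b) + (ps ! k) (real n * t - real k) b)"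

definition Bpath :: "'i set \<Rightarrow> ('i \<Rightarrow> 'b wt) \<Rightarrow> ('i \<Rightarrow> 'b wt) \<Rightarrow> 'b wt \<Rightarrow> 'b path set" where
  "Bpath I cor al lam = F_orbit I cor al (pi_path lam)"

definition dominant_path :: "'i set \<Rightarrow> ('i \<Rightarrow> 'b wt) \<Rightarrow> 'b path \<Rightarrow> bool" where
  "dominant_path I cor \<pi> \<longleftrightarrow> (\<forall>t\<in>{0..1}. \<exists>S c. finite S \<and> S \<subseteq> Pplus I cor
      \<and> (\<forall>\<eta>\<in>S. c \<eta> \<ge> (0::real)) \<and> \<pi> t = (\<lambda>b. \<Sum>\<eta>\<in>S. c \<eta> * real_of_int (\<eta> b)))"

definition c_wt :: "'b path \<Rightarrow> 'b rwt" where
  "c_wt \<pi> = \<pi> 1"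

definition c_eps :: "('i \<Rightarrow> 'b wt) \<Rightarrow> ('i \<Rightarrow> 'b wt) \<Rightarrow> 'i \<Rightarrow> 'b path \<Rightarrow> real" where
  "c_eps cor al i \<pi> = (if is_real cor al i then - mH cor i \<pi> else 0)"

definition c_phi :: "('i \<Rightarrow> 'b wt) \<Rightarrow> ('i \<Rightarrow> 'b wt) \<Rightarrow> 'i \<Rightarrow> 'b path \<Rightarrow> real" where
  "c_phi cor al i \<pi> = (if is_real cor al i then Hf cor i \<pi> 1 - mH cor i \<pi> else pairR (cor i) (\<pi> 1))"

definition c_e :: "('i \<Rightarrow> 'b wt) \<Rightarrow> ('i \<Rightarrow> 'b wt) \<Rightarrow> 'b path set \<Rightarrow> 'i \<Rightarrow> 'b path \<Rightarrow> 'b path option" where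
  "c_e cor al B i \<pi> = (if is_real cor al i then e_op cor al i \<pi>
      else (case e_op cor al i \<pi> of None \<Rightarrow> None | Some p \<Rightarrow> if p \<in> B then Some p else None))"

definition c_f :: "('i \<Rightarrow> 'b wt) \<Rightarrow> ('i \<Rightarrow> 'b wt) \<Rightarrow> 'i \<Rightarrow> 'b path \<Rightarrow> 'b path option" where
  "c_f cor al i \<pi> = f_op cor al i \<pi>"

definition crystal_iso :: "'i set \<Rightarrow> ('i \<Rightarrow> 'b wt) \<Rightarrow> ('i \<Rightarrow> 'b wt) \<Rightarrow> 'b path set \<Rightarrow> 'b path set
    \<Rightarrow> ('b path \<Rightarrow> 'b path) \<Rightarrow> bool" where
  "crystal_iso I cor al B B' \<Phi> \<longleftrightarrow> bij_betw \<Phi> B B'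
     \<and> (\<forall>b\<in>B. c_wt (\<Phi> b) = c_wt b)
     \<and> (\<forall>b\<in>B. \<forall>i\<in>I. c_eps cor al i (\<Phi> b) = c_eps cor al i b
                   \<and> c_phi cor al i (\<Phi> b) = c_phi cor al i b
                   \<and> map_option \<Phi> (c_f cor al i b) = c_f cor al i (\<Phi> b)
                   \<and> map_option \<Phi> (c_e cor al B i b) = c_e cor al B' i (\<Phi> b))"

definition wsum :: "'b wt list \<Rightarrow> 'b wt" where
  "wsum ls = (\<lambda>b. sum_list (map (\<lambda>\<mu>. \<mu> b) ls))"

end

theory Submission
  imports Defs "HOL-Analysis.Elementary_Metric_Spaces"
begin

text \<open>
  Replace every imaginary index \<open>i\<close> by copies \<open>(i, k)\<close> with diagonal entry \<open>2\<close>, each of which may be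
  applied at most once. Since \<open>f\<^sub>i\<close> only sees the pairing with \<open>i\<close>, the word in the \<open>f\<^sub>i\<close> becomes a
  word in root operators of a Kac-Moody matrix, in which all indices are real and \<open>e\<close> inverts \<open>f\<close>.

  In the Kac-Moody case the dominant polygon is deformed, one vertex after the other, to the straight
  path. All paths of the family carry directions \<open>w d\<^sub>k\<close> whose change at a time \<open>t\<close> is described by chains of
  reflections that are integral at the point reached; this makes all minima integers, and being Lipschitz
  in the parameter they are constant. Hence a word in the \<open>e\<close> and \<open>f\<close> kills all members of the family or
  none, and a word fixing the straight path fixes the deformed path as well: the result is dominant, and the
  root coefficients of its points at rational times are rational and continuous in the parameter, so zero.
  Two words in the \<open>f\<close> agree on a path iff a suitable word in the \<open>e\<close> and \<open>f\<close> fixes it.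

  Returning to the given matrix loses nothing: a copy of an imaginary index contributes a ramp that starts
  at a vertex of the polygon, and the ramps of the successive copies are ordered, so that they are
  determined by their sum.
\<close>

section \<open>The Coxeter group of a Cartan matrix with diagonal entries 2\<close>

text \<open>The obstacle is that a deformed path has a vertex off the weight lattice, so integrality
  of minima cannot be read off the vertices and has to survive every root operator. It is kept as a
  local condition: the two directions at a time are joined by a chain of integral reflections, and
  such chains can be reflected at one end or at both, as in the lifting property of Bruhat order. A
  direction \<open>w d\<close> may have a stabilizer, so that a vanishing slope has no canonical
  sign; labels therefore remember \<open>w\<close> itself, and the sign of a zero slope is read off
  \<open>w rho\<close>. Vectors keep only what the argument uses: \<open>vH\<close> holds the
  pairings with the simple coroots, \<open>vC\<close> the multiples of the simple roots subtracted
  so far. In this way simple roots are independent for every matrix and every index set. A copy of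
  an imaginary index may be used only once because its pairing with itself is 2 instead of the
  original diagonal entry; a copy not yet used has the original pairing with all the used
  ones.\<close>

datatype 'l vec = Vec (vH: "'l \<Rightarrow> real") (vC: "'l \<Rightarrow> real")

instantiation vec :: (type) real_vector
begin
definition "0 = Vec (\<lambda>_. 0) (\<lambda>_. 0)"
definition "x + y = Vec (\<lambda>l. vH x l + vH y l) (\<lambda>l. vC x l + vC y l)"
definition "x - y = Vec (\<lambda>l. vH x l - vH y l) (\<lambda>l. vC x l - vC y l)"
definition "- x = Vec (\<lambda>l. - vH x l) (\<lambda>l. - vC x l)"
definition "c *\<^sub>R x = Vec (\<lambda>l. c * vH x l) (\<lambda>l. c * vC x l)"
instance
  by standard (auto simp: zero_vec_def plus_vec_def minus_vec_def uminus_vec_def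
      scaleR_vec_def algebra_simps)
end

lemma vec_simps [simp]:
  "vH 0 l = 0" "vC 0 l = 0"
  "vH (x + y) l = vH x l + vH y l" "vC (x + y) l = vC x l + vC y l"
  "vH (x - y) l = vH x l - vH y l" "vC (x - y) l = vC x l - vC y l"
  "vH (- x) l = - vH x l" "vC (- x) l = - vC x l"
  "vH (c *\<^sub>R x) l = c * vH x l" "vC (c *\<^sub>R x) l = c * vC x l"
  by (simp_all add: zero_vec_def plus_vec_def minus_vec_def uminus_vec_def scaleR_vec_def)

lemma vec_eqI: "(\<And>l. vH x l = vH y l) \<Longrightarrow> (\<And>l. vC x l = vC y l) \<Longrightarrow> x = y"
  by (cases x; cases y) auto

definition domt :: "'l vec \<Rightarrow> bool" where
  "domt x \<longleftrightarrow> (\<forall>l. 0 \<le> vH x l)"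

definition rho :: "'l vec" where
  "rho = Vec (\<lambda>_. 1) (\<lambda>_. 0)"

lemma rho_simps [simp]: "vH rho l = 1" "vC rho l = 0"
  by (simp_all add: rho_def)

section \<open>Alternating words and rank two root systems\<close>

fun altw :: "nat \<Rightarrow> 'l \<Rightarrow> 'l \<Rightarrow> 'l list" where
  "altw 0 x y = []"
| "altw (Suc n) x y = altw n y x @ [y]"

lemma length_altw [simp]: "length (altw n x y) = n"
  by (induction n arbitrary: x y) auto

lemma altw_add: "\<exists>pre. altw (k + m) x y = pre @ altw m x y"
proof (induction m arbitrary: x y)
  case (Suc m)
  obtain pre where "altw (k + m) y x = pre @ altw m y x" using Suc by blast
  then show ?case by auto
qed auto

lemma altw_or_rep:
  assumes "set w \<subseteq> {x, y}"
  shows "w = altw (length w) x y \<or> w = altw (length w) y x \<or> (\<exists>p k q. w = p @ k # k # q)"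
  using assms
proof (induction w rule: rev_induct)
  case (snoc k w)
  have k: "k = x \<or> k = y" and w: "set w \<subseteq> {x, y}" using snoc.prems by auto
  consider (rep) "\<exists>p k q. w = p @ k # k # q" | (alt) "w = altw (length w) x y \<or> w = altw (length w) y x"
    using snoc.IH[OF w] by blast
  then show ?case
  proof cases
    case rep
    then obtain p k' q where "w = p @ k' # k' # q" by blast
    then have "w @ [k] = p @ k' # k' # (q @ [k])" by simp
    then show ?thesis by blast
  next
    case alt
    show ?thesis
    proof (cases w rule: rev_cases)
      case Nil
      then show ?thesis using k by auto
    next
      case (snoc w' k')
      show ?thesis
      proof (cases "k = k'")
        case True
        then have "w @ [k] = w' @ k # k # []" using snoc by simp
        then show ?thesis by blast
      next
        case False
        obtain n where n: "length w = Suc n" using snoc by simp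
        have "(w = altw (length w) x y \<and> k' = y) \<or> (w = altw (length w) y x \<and> k' = x)"
          using alt n snoc by auto
        then show ?thesis using False k by auto
      qed
    qed
  qed
qed auto

text \<open>The recurrence satisfied by the roots of a rank two system under alternating words.\<close>

lemma rank2_recurrence_pos:
  fixes A B :: "nat \<Rightarrow> real" and p q :: nat
  assumes A1: "A 1 = A 0 + p * B 0" and B1: "B 1 = B 0 + q * A 0"
    and A: "\<And>n. A (Suc (Suc n)) = p * B (Suc n) - A n"
    and B: "\<And>n. B (Suc (Suc n)) = q * A (Suc n) - B n"
    and pq0: "p = 0 \<longleftrightarrow> q = 0"
    and n: "4 \<le> p * q \<or> (p * q = 0 \<and> n < 2) \<or> (p * q = 1 \<and> n < 3) \<or> (p * q = 2 \<and> n < 4)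
             \<or> (p * q = 3 \<and> n < 6)"
    and pos: "0 \<le> A 0" "0 \<le> B 0"
  shows "0 \<le> A n \<and> (0 < A 0 \<longrightarrow> 0 < B 0 \<longrightarrow> 0 < A n)"
proof (cases "4 \<le> p * q")
  case True
  then have pq: "4 \<le> real p * real q"
    by (metis of_nat_le_iff of_nat_mult of_nat_numeral)
  \<comment> \<open>The invariant \<open>2 * A n \<le> p * B (Suc n)\<close> gives
    \<open>A n \<le> A (Suc (Suc n))\<close>. It reproduces itself because
    \<open>p * q / 2 \<ge> 2\<close>.\<close>
  have "0 \<le> A n \<and> 0 \<le> B n \<and> 0 \<le> A (Suc n) \<and> 0 \<le> B (Suc n) \<and> 2 * A n \<le> p * B (Suc n)
     \<and> 2 * B n \<le> q * A (Suc n) \<and> (0 < A 0 \<longrightarrow> 0 < B 0 \<longrightarrow> 0 < A n \<and> 0 < A (Suc n))" for n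
  proof (induction n)
    case 0
    have 1: "2 * A 0 \<le> p * (q * A 0)"
      using pq pos mult_right_mono[of 2 "real p * real q" "A 0"] by (simp add: mult.assoc)
    have 2: "2 * B 0 \<le> q * (p * B 0)"
      using pq pos mult_right_mono[of 2 "real p * real q" "B 0"] by (simp add: ac_simps)
    have 3: "0 \<le> p * B 0" "0 \<le> q * A 0" using pos by auto
    have "A (Suc 0) = A 0 + p * B 0" "B (Suc 0) = B 0 + q * A 0" using A1 B1 by simp_all
    then have "2 * A 0 \<le> p * B (Suc 0)" "2 * B 0 \<le> q * A (Suc 0)" "0 \<le> A (Suc 0)" "0 \<le> B (Suc 0)"
      "0 < A 0 \<longrightarrow> 0 < A (Suc 0)"
      unfolding \<open>A (Suc 0) = _\<close> \<open>B (Suc 0) = _\<close> distrib_left using 1 2 3 pos by linarith+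
    then show ?case using pos by auto
  next
    case (Suc n)
    have "p * B (Suc (Suc n)) \<ge> 2 * A (Suc n)"
    proof -
      have "p * B n \<le> p * (q * A (Suc n) / 2)"
        using Suc by (intro mult_left_mono) auto
      moreover have "2 * A (Suc n) \<le> real p * real q * A (Suc n) / 2"
        using pq Suc mult_right_mono[of 4 "real p * real q" "A (Suc n)"] by auto
      ultimately show ?thesis by (simp add: B algebra_simps)
    qed
    moreover have "q * A (Suc (Suc n)) \<ge> 2 * B (Suc n)"
    proof -
      have "q * A n \<le> q * (p * B (Suc n) / 2)"
        using Suc by (intro mult_left_mono) auto
      moreover have "2 * B (Suc n) \<le> real p * real q * B (Suc n) / 2"
        using pq Suc mult_right_mono[of 4 "real p * real q" "B (Suc n)"] by auto
      ultimately show ?thesis by (simp add: A algebra_simps)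
    qed
    moreover have "A (Suc (Suc n)) \<ge> A n" "B (Suc (Suc n)) \<ge> B n" using Suc by (auto simp: A B)
    ultimately show ?case using Suc by auto
  qed
  then show ?thesis by blast
next
  case False
  have A2: "A 2 = p * B 1 - A 0" using A[of 0] by (simp add: numeral_2_eq_2)
  have A3: "A 3 = p * B 2 - A 1" using A[of 1] by (simp add: numeral_2_eq_2 numeral_3_eq_3)
  have A4: "A 4 = p * B 3 - A 2" using A[of 2] by (simp add: eval_nat_numeral)
  have A5: "A 5 = p * B 4 - A 3" using A[of 3] by (simp add: eval_nat_numeral)
  have B2: "B 2 = q * A 1 - B 0" using B[of 0] by (simp add: numeral_2_eq_2)
  have B3: "B 3 = q * A 2 - B 1" using B[of 1] by (simp add: numeral_2_eq_2 numeral_3_eq_3)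
  have B4: "B 4 = q * A 3 - B 2" using B[of 2] by (simp add: eval_nat_numeral)
  note eqs = A1 A2 A3 A4 A5 B1 B2 B3 B4
  have c: "(p = 0 \<and> q = 0 \<and> n < 2) \<or> (p = 1 \<and> q = 1 \<and> n < 3) \<or> (p = 1 \<and> q = 2 \<and> n < 4)
     \<or> (p = 2 \<and> q = 1 \<and> n < 4) \<or> (p = 1 \<and> q = 3 \<and> n < 6) \<or> (p = 3 \<and> q = 1 \<and> n < 6)"
  proof -
    have "(p * q = 0 \<and> n < 2) \<or> (p * q = 1 \<and> n < 3) \<or> (p * q = 2 \<and> n < 4) \<or> (p * q = 3 \<and> n < 6)"
      using n False by blast
    moreover have "p * q = 2 \<Longrightarrow> (p = 1 \<and> q = 2) \<or> (p = 2 \<and> q = 1)"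
    proof -
      assume h: "p * q = 2"
      then have "p dvd 2" by (metis dvd_triv_left)
      then have "p \<le> 2" by (simp add: dvd_imp_le)
      then have "p = 0 \<or> p = 1 \<or> p = 2" by auto
      with h show ?thesis by auto
    qed
    moreover have "p * q = 3 \<Longrightarrow> (p = 1 \<and> q = 3) \<or> (p = 3 \<and> q = 1)"
    proof -
      assume h: "p * q = 3"
      then have "p dvd 3" by (metis dvd_triv_left)
      then have "p \<le> 3" by (simp add: dvd_imp_le)
      then have "p = 0 \<or> p = 1 \<or> p = 2 \<or> p = 3" by auto
      with h show ?thesis by (elim disjE; simp; presburger)
    qed
    moreover have "p * q = 0 \<Longrightarrow> p = 0 \<and> q = 0" using pq0 by auto
    moreover have "p * q = 1 \<Longrightarrow> p = 1 \<and> q = 1" by simp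
    ultimately show ?thesis by metis
  qed
  have n6: "n < 6 \<Longrightarrow> n = 0 \<or> n = 1 \<or> n = 2 \<or> n = 3 \<or> n = 4 \<or> n = 5" by auto
  have n4: "n < 4 \<Longrightarrow> n = 0 \<or> n = 1 \<or> n = 2 \<or> n = 3" by auto
  have n3: "n < 3 \<Longrightarrow> n = 0 \<or> n = 1 \<or> n = 2" by auto
  have n2: "n < 2 \<Longrightarrow> n = 0 \<or> n = 1" by auto
  note eqs' = eqs pos
  from c show ?thesis
    apply (elim disjE conjE)
    subgoal apply (drule n2) using eqs' by (elim disjE; simp; linarith?)
    subgoal apply (drule n3) using eqs' by (elim disjE; simp; linarith?)
    subgoal apply (drule n4) using eqs' by (elim disjE; simp; linarith?)
    subgoal apply (drule n4) using eqs' by (elim disjE; simp; linarith?)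
    subgoal apply (drule n6) using eqs' by (elim disjE; simp; linarith?)
    subgoal apply (drule n6) using eqs' by (elim disjE; simp; linarith?)
    done
qed

section \<open>Simple reflections, real roots and coroots\<close>

locale km =
  fixes a :: "'l \<Rightarrow> 'l \<Rightarrow> int"
  assumes a_diag [simp]: "a l l = 2"
    and a_off: "l \<noteq> m \<Longrightarrow> a l m \<le> 0"
    and a_zero: "a l m = 0 \<Longrightarrow> a m l = 0"
begin

definition al :: "'l \<Rightarrow> 'l vec" where
  "al j = Vec (\<lambda>l. of_int (a l j)) (\<lambda>m. if m = j then -1 else 0)"

definition s :: "'l \<Rightarrow> 'l vec \<Rightarrow> 'l vec" where
  "s j x = x - vH x j *\<^sub>R al j"

lemma al_simps [simp]: "vH (al j) l = of_int (a l j)" "vC (al j) m = (if m = j then -1 else 0)"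
  by (simp_all add: al_def)

lemma s_add: "s j (x + y) = s j x + s j y" and s_scale: "s j (c *\<^sub>R x) = c *\<^sub>R s j x"
  and s_diff: "s j (x - y) = s j x - s j y"
  by (simp_all add: s_def algebra_simps)

lemma s_s [simp]: "s j (s j x) = x"
  by (simp add: s_def algebra_simps)

lemma vH_s: "vH (s j x) l = vH x l - vH x j * of_int (a l j)"
  by (simp add: s_def)

lemma vC_s: "vC (s j x) m = vC x m + (if m = j then vH x j else 0)"
  by (simp add: s_def)

fun act :: "'l list \<Rightarrow> 'l vec \<Rightarrow> 'l vec" where
  "act [] x = x"
| "act (j # w) x = s j (act w x)"

lemma act_append: "act (u @ w) x = act u (act w x)"
  by (induction u) auto

lemma act_add: "act w (x + y) = act w x + act w y" and act_scale: "act w (c *\<^sub>R x) = c *\<^sub>R act w x"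
  and act_diff: "act w (x - y) = act w x - act w y"
  by (induction w) (auto simp: s_add s_scale s_diff)

lemma act_rev [simp]: "act (rev w) (act w x) = x" "act w (act (rev w) x) = x"
proof -
  show 1: "act (rev w) (act w x) = x" for w
    by (induction w arbitrary: x) (auto simp: act_append)
  show "act w (act (rev w) x) = x" using 1[of "rev w"] by simp
qed

lemma act_zero [simp]: "act w 0 = 0"
  using act_scale[of w 0 0] by simp

lemma act_minus: "act w (- x) = - act w x"
  using act_scale[of w "-1" x] by simp

text \<open>The pairing of \<open>x\<close> with the real coroot obtained by applying
  \<open>u\<close> to the simple coroot \<open>k\<close>, written without a dual space. The matching
  real root is \<open>rt u k\<close>, and \<open>refw u k\<close> is a word for the
  reflection.\<close>

definition phi :: "'l list \<Rightarrow> 'l \<Rightarrow> 'l vec \<Rightarrow> real" where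
  "phi u k x = vH (act (rev u) x) k"

definition rt :: "'l list \<Rightarrow> 'l \<Rightarrow> 'l vec" where
  "rt u k = act u (al k)"

definition refw :: "'l list \<Rightarrow> 'l \<Rightarrow> 'l list" where
  "refw u k = u @ k # rev u"

lemma act_refw: "act (refw u k) x = x - phi u k x *\<^sub>R rt u k"
  by (simp add: refw_def act_append s_def act_diff act_scale phi_def rt_def)

lemma phi_Nil [simp]: "phi [] k x = vH x k"
  by (simp add: phi_def)

lemma phi_Cons: "phi (j # u) k x = phi u k (s j x)"
  by (simp add: phi_def act_append)

lemma phi_append: "phi (u @ w) k x = phi w k (act (rev u) x)"
  by (simp add: phi_def act_append)

lemma phi_snoc: "phi (u @ [t]) k x = phi u k x - phi u t x * of_int (a k t)"
  by (simp add: phi_def vH_s)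

lemma phi_snoc_same: "phi (u @ [k]) k x = - phi u k x"
  by (simp add: phi_snoc)

lemma rt_snoc: "rt (u @ [t]) k = rt u k - of_int (a t k) *\<^sub>R rt u t"
  by (simp add: rt_def act_append s_def act_diff act_scale)

lemma rt_snoc_same: "rt (u @ [k]) k = - rt u k"
  by (simp add: rt_snoc scaleR_2)

lemma phi_lin: "phi u k (x + y) = phi u k x + phi u k y" "phi u k (x - y) = phi u k x - phi u k y"
  "phi u k (c *\<^sub>R x) = c * phi u k x" "phi u k (- x) = - phi u k x" "phi u k 0 = 0"
  by (simp_all add: phi_def act_add act_diff act_scale act_minus)

lemma phi_rt [simp]: "phi u k (rt u k) = 2"
  by (simp add: phi_def rt_def)

section \<open>Length and the sign of real roots\<close>

definition len :: "'l list \<Rightarrow> nat" where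
  "len w = (LEAST n. \<exists>v. length v = n \<and> act v = act w)"

lemma len_le: "act v = act w \<Longrightarrow> len w \<le> length v"
  unfolding len_def by (rule Least_le) auto

lemma len_red: "\<exists>v. length v = len w \<and> act v = act w"
  unfolding len_def by (rule LeastI_ex) auto

lemma len_cong: "act v = act w \<Longrightarrow> len v = len w"
  by (simp add: len_def)

lemma act_cong_append: "act u = act u' \<Longrightarrow> act w = act w' \<Longrightarrow> act (u @ w) = act (u' @ w')"
  by (rule ext) (simp add: act_append)

lemma act_cong_rev: assumes "act v = act w" shows "act (rev v) = act (rev w)"
proof
  fix x
  have "act (rev w) x = act (rev v) (act v (act (rev w) x))" by (simp only: act_rev)
  also have "\<dots> = act (rev v) x" by (simp only: assms act_rev)
  finally show "act (rev v) x = act (rev w) x" by (rule sym)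
qed

lemma phi_cong: "act v = act w \<Longrightarrow> phi v k = phi w k"
  by (rule ext) (simp only: phi_def act_cong_rev[of v w])

lemma rt_cong: "act v = act w \<Longrightarrow> rt v k = rt w k"
  by (simp add: rt_def)

lemma len_rev: "len (rev w) = len w"
proof -
  have "len (rev w) \<le> len w" for w
  proof -
    obtain v where v: "length v = len w" "act v = act w" using len_red by blast
    show ?thesis using len_le[OF act_cong_rev[OF v(2)]] v(1) by simp
  qed
  from this[of w] this[of "rev w"] show ?thesis by simp
qed

lemma len_append: "len (u @ w) \<le> len u + len w"
proof -
  obtain u' where u: "length u' = len u" "act u' = act u" using len_red by blast
  obtain w' where w: "length w' = len w" "act w' = act w" using len_red by blast
  show ?thesis using len_le[OF act_cong_append[OF u(2) w(2)]] u(1) w(1) by simp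
qed

lemma len_length: "len w \<le> length w"
  by (rule len_le) simp

text \<open>Positivity of a real root, demanded of the coroot (on dominant vectors, strictly on
  \<open>rho\<close>) and of the root. The last inequality points downwards because
  \<open>al j\<close> has \<open>vC\<close> equal to -1.\<close>

definition pos :: "'l list \<Rightarrow> 'l \<Rightarrow> bool" where
  "pos u k \<longleftrightarrow> (\<forall>x. domt x \<longrightarrow> 0 \<le> phi u k x) \<and> 0 < phi u k rho \<and> (\<forall>m. vC (rt u k) m \<le> 0)"

lemma pos_cong: "act v = act w \<Longrightarrow> pos v k = pos w k"
  using phi_cong[of v w k] rt_cong[of v w k] by (simp add: pos_def)

abbreviation comb :: "'l \<Rightarrow> 'l \<Rightarrow> 'l vec \<Rightarrow> real \<Rightarrow> real \<Rightarrow> 'l vec" where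
  "comb i j y \<xi> \<zeta> \<equiv> y - \<xi> *\<^sub>R al i - \<zeta> *\<^sub>R al j"

lemma s_comb1: "s i (comb i j y \<xi> \<zeta>) = comb i j y (vH y i - \<xi> - \<zeta> * of_int (a i j)) \<zeta>"
  by (rule vec_eqI) (simp_all add: s_def algebra_simps)

lemma s_comb2: "s j (comb i j y \<xi> \<zeta>) = comb i j y \<xi> (vH y j - \<zeta> - \<xi> * of_int (a j i))"
  by (rule vec_eqI) (simp_all add: s_def algebra_simps)

text \<open>The order of a product of two simple reflections in the crystallographic cases, with 0
  standing for infinite order.\<close>

definition mst :: "'l \<Rightarrow> 'l \<Rightarrow> nat" where
  "mst i j = (if a i j * a j i = 0 then 2 else if a i j * a j i = 1 then 3
      else if a i j * a j i = 2 then 4 else if a i j * a j i = 3 then 6 else 0)"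

lemma braid:
  assumes "i \<noteq> j"
  shows "act (altw (mst i j) i j) = act (altw (mst i j) j i)"
proof
  fix y
  have y: "y = comb i j y 0 0" by simp
  define p q where "p = nat (- a i j)" and "q = nat (- a j i)"
  have pq: "a i j = - int p" "a j i = - int q"
    using a_off[of i j] a_off[of j i] assms by (auto simp: p_def q_def)
  have z: "p = 0 \<longleftrightarrow> q = 0" using a_zero[of i j] a_zero[of j i] pq by auto
  have m: "mst i j = (if p * q = 0 then 2 else if p * q = 1 then 3 else if p * q = 2 then 4
     else if p * q = 3 then 6 else 0)"
  proof -
    have "a i j * a j i = int (p * q)" by (simp add: pq)
    moreover have "int (p * q) = 1 \<longleftrightarrow> p * q = 1" "int (p * q) = 2 \<longleftrightarrow> p * q = 2"
      "int (p * q) = 3 \<longleftrightarrow> p * q = 3" "int (p * q) = 0 \<longleftrightarrow> p * q = 0" by linarith+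
    ultimately show ?thesis unfolding mst_def by presburger
  qed
  \<comment> \<open>Both words move \<open>y\<close> only within the plane through \<open>y\<close>
    spanned by the two simple roots, so the relation reduces to an identity between two
    coordinates.\<close>
  define cb where "cb \<xi> \<zeta> = comb i j y \<xi> \<zeta>" for \<xi> \<zeta>
  have c1: "s i (cb \<xi> \<zeta>) = cb (vH y i - \<xi> + \<zeta> * p) \<zeta>" for \<xi> \<zeta>
    unfolding cb_def s_comb1 by (simp add: pq)
  have c2: "s j (cb \<xi> \<zeta>) = cb \<xi> (vH y j - \<zeta> + \<xi> * q)" for \<xi> \<zeta>
    unfolding cb_def s_comb2 by (simp add: pq)
  consider "p = 0 \<and> q = 0" | "p = 1 \<and> q = 1" | "p = 1 \<and> q = 2" | "p = 2 \<and> q = 1"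
    | "p = 1 \<and> q = 3" | "p = 3 \<and> q = 1" | "p * q \<ge> 4"
  proof -
    have "p * q < 4 \<Longrightarrow> p > 0 \<Longrightarrow> q > 0 \<Longrightarrow> p < 4 \<and> q < 4"
    proof -
      assume h: "p * q < 4" "p > 0" "q > 0"
      have "p * 1 \<le> p * q" "1 * q \<le> p * q" using h by (intro mult_le_mono; simp)+
      then show ?thesis using h by linarith
    qed
    moreover have "p < 4 \<Longrightarrow> p = 0 \<or> p = 1 \<or> p = 2 \<or> p = 3" "q < 4 \<Longrightarrow> q = 0 \<or> q = 1 \<or> q = 2 \<or> q = 3" by auto
    ultimately show ?thesis using that z by (cases "p * q < 4") (auto simp: not_less)
  qed
  then have "act (altw (mst i j) i j) (cb 0 0) = act (altw (mst i j) j i) (cb 0 0)"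
  proof cases
    case 7
    then have "\<not> p * q = 0" "\<not> p * q = 1" "\<not> p * q = 2" "\<not> p * q = 3" by linarith+
    then have "mst i j = 0" by (simp only: m if_False)
    then show ?thesis by simp
  qed (simp_all add: m c1 c2 eval_nat_numeral algebra_simps)
  then show "act (altw (mst i j) i j) y = act (altw (mst i j) j i) y"
    by (simp add: cb_def)
qed


lemma phi_altw:
  "phi (v @ altw (Suc n) i j) i x = phi (v @ altw n j i) i x - of_int (a i j) * phi (v @ altw n j i) j x"
  using phi_snoc[of "v @ altw n j i" j i x] by (simp add: mult.commute)

lemma rt_altw:
  "rt (v @ altw (Suc n) i j) i = rt (v @ altw n j i) i - of_int (a j i) *\<^sub>R rt (v @ altw n j i) j"
  using rt_snoc[of "v @ altw n j i" j i] by simp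

lemma phi_altw_same: "phi (v @ altw (Suc n) j i) i x = - phi (v @ altw n i j) i x"
  using phi_snoc_same[of "v @ altw n i j" i x] by simp

lemma rt_altw_same: "rt (v @ altw (Suc n) j i) i = - rt (v @ altw n i j) i"
  using rt_snoc_same[of "v @ altw n i j" i] by simp

lemma mst_cases:
  assumes "i \<noteq> j" "mst i j = 0 \<or> n < mst i j"
  defines "p \<equiv> nat (- a i j)" and "q \<equiv> nat (- a j i)"
  shows "4 \<le> p * q \<or> (p * q = 0 \<and> n < 2) \<or> (p * q = 1 \<and> n < 3) \<or> (p * q = 2 \<and> n < 4)
             \<or> (p * q = 3 \<and> n < 6)" "p = 0 \<longleftrightarrow> q = 0" "a i j = - int p" "a j i = - int q"
proof -
  show pq: "a i j = - int p" "a j i = - int q"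
    using a_off[of i j] a_off[of j i] assms by (auto simp: p_def q_def)
  show "p = 0 \<longleftrightarrow> q = 0" using a_zero[of i j] a_zero[of j i] pq by auto
  have e: "a i j * a j i = int (p * q)" by (simp add: pq)
  have "int (p * q) = 1 \<longleftrightarrow> p * q = 1" "int (p * q) = 2 \<longleftrightarrow> p * q = 2"
      "int (p * q) = 3 \<longleftrightarrow> p * q = 3" "int (p * q) = 0 \<longleftrightarrow> p * q = 0" by linarith+
  then have "mst i j = (if p * q = 0 then 2 else if p * q = 1 then 3 else if p * q = 2 then 4
     else if p * q = 3 then 6 else 0)" unfolding mst_def e by presburger
  then show "4 \<le> p * q \<or> (p * q = 0 \<and> n < 2) \<or> (p * q = 1 \<and> n < 3) \<or> (p * q = 2 \<and> n < 4)
             \<or> (p * q = 3 \<and> n < 6)" using assms(2) by presburger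
qed

text \<open>Along alternating words the coroots and the roots obtained from the two given ones
  satisfy the rank two recurrence. The roots do so with the two matrix entries exchanged.\<close>

lemma pos_altw:
  assumes "i \<noteq> j" "mst i j = 0 \<or> n < mst i j" "pos v i" "pos v j"
  shows "pos (v @ altw n i j) i"
proof -
  define p q where "p = nat (- a i j)" and "q = nat (- a j i)"
  note mc = mst_cases[OF assms(1,2), folded p_def q_def]
  have phi: "0 \<le> phi (v @ altw n i j) i x \<and> (0 < phi v i x \<longrightarrow> 0 < phi v j x \<longrightarrow> 0 < phi (v @ altw n i j) i x)"
    if "0 \<le> phi v i x" "0 \<le> phi v j x" for x
  proof -
    let ?A = "\<lambda>n. phi (v @ altw n i j) i x" and ?B = "\<lambda>n. phi (v @ altw n j i) j x"
    have "0 \<le> ?A n \<and> (0 < ?A 0 \<longrightarrow> 0 < ?B 0 \<longrightarrow> 0 < ?A n)"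
    proof (rule rank2_recurrence_pos[where p = p and q = q])
      show "?A 1 = ?A 0 + real p * ?B 0" using phi_altw[of v 0 i j x] mc(3) by simp
      show "?B 1 = ?B 0 + real q * ?A 0" using phi_altw[of v 0 j i x] mc(4) by simp
      show "?A (Suc (Suc n)) = real p * ?B (Suc n) - ?A n" for n
        unfolding phi_altw[of v "Suc n" i j x] phi_altw_same[of v n j i x] mc(3) by simp
      show "?B (Suc (Suc n)) = real q * ?A (Suc n) - ?B n" for n
        unfolding phi_altw[of v "Suc n" j i x] phi_altw_same[of v n i j x] mc(4) by simp
    qed (use mc that in auto)
    then show ?thesis by simp
  qed
  have rt: "vC (rt (v @ altw n i j) i) m \<le> 0" for m
  proof -
    let ?A = "\<lambda>n. - vC (rt (v @ altw n i j) i) m" and ?B = "\<lambda>n. - vC (rt (v @ altw n j i) j) m"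
    have "0 \<le> ?A n \<and> (0 < ?A 0 \<longrightarrow> 0 < ?B 0 \<longrightarrow> 0 < ?A n)"
    proof (rule rank2_recurrence_pos[where p = q and q = p])
      show "?A 1 = ?A 0 + real q * ?B 0" using rt_altw[of v 0 i j] mc(4) by simp
      show "?B 1 = ?B 0 + real p * ?A 0" using rt_altw[of v 0 j i] mc(3) by simp
      show "?A (Suc (Suc n)) = real q * ?B (Suc n) - ?A n" for n
        unfolding rt_altw[of v "Suc n" i j] rt_altw_same[of v n j i] mc(4) by simp
      show "?B (Suc (Suc n)) = real p * ?A (Suc n) - ?B n" for n
        unfolding rt_altw[of v "Suc n" j i] rt_altw_same[of v n i j] mc(3) by simp
    qed (use mc assms(3,4) in \<open>auto simp: pos_def mult.commute\<close>)
    then show ?thesis by simp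
  qed
  show ?thesis using phi[of rho] phi rt assms(3,4) unfolding pos_def by (auto simp: less_imp_le)
qed

definition lenI :: "'l set \<Rightarrow> 'l list \<Rightarrow> nat" where
  "lenI S w = (LEAST n. \<exists>v. length v = n \<and> set v \<subseteq> S \<and> act v = act w)"

lemma act_cancel: "act (p @ k # k # q) = act (p @ q)"
  by (rule ext) (simp add: act_append)

text \<open>Humphreys' argument: factor \<open>w\<close> through the dihedral subgroup generated by the last letter
  of a reduced word and \<open>k\<close>.\<close>

lemma pos_if_len: "len w \<le> len (w @ [k]) \<Longrightarrow> pos w k"
proof (induction "len w" arbitrary: w k rule: less_induct)
  case less
  obtain w0 where w0: "length w0 = len w" "act w0 = act w" using len_red by blast
  show ?case
  proof (cases w0 rule: rev_cases)
    case Nil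
    have "pos [] k" by (auto simp: pos_def domt_def rt_def)
    then show ?thesis using w0 Nil pos_cong by metis
  next
    case (snoc w1 t)
    have tk: "t \<noteq> k"
    proof
      assume t: "t = k"
      have "act w1 = act (w0 @ [k])" using act_cancel[of w1 k "[]"] snoc t by simp
      also have "\<dots> = act (w @ [k])" by (rule act_cong_append) (use w0 in auto)
      finally have "len (w @ [k]) \<le> length w1" by (rule len_le)
      then show False using less.prems w0 snoc by simp
    qed
    define P where "P v c \<longleftrightarrow> set c \<subseteq> {k, t} \<and> act (v @ c) = act w \<and> len v + length c = len w" for v c
    have "len w1 = length w1"
    proof -
      have "len w = len (w1 @ [t])" using len_cong w0 snoc by metis
      also have "\<dots> \<le> len w1 + len [t]" by (rule len_append)
      also have "\<dots> \<le> len w1 + 1" using len_length[of "[t]"] by simp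
      finally show ?thesis using w0 snoc len_length[of w1] by simp
    qed
    then have P1: "P w1 [t]" using w0 snoc by (auto simp: P_def)
    \<comment> \<open>The shortest possible \<open>v\<close> is a minimal coset representative for
      the dihedral subgroup: neither generator shortens it from the right, so the induction
      hypothesis applies to \<open>v\<close> with both letters.\<close>
    define n where "n = (LEAST n. \<exists>v c. P v c \<and> len v = n)"
    have "\<exists>v c. P v c \<and> len v = n" unfolding n_def by (rule LeastI_ex) (use P1 in blast)
    then obtain v c where P: "P v c" and n: "len v = n" by blast
    have min: "P v' c' \<Longrightarrow> len v \<le> len v'" for v' c'
      unfolding n n_def by (rule Least_le) blast
    have lv: "len v < len w" using min[OF P1] \<open>len w1 = length w1\<close> w0 snoc by simp
    have up: "len v \<le> len (v @ [r])" if "r \<in> {k, t}" for r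
    proof (rule ccontr)
      assume h: "\<not> len v \<le> len (v @ [r])"
      have e: "act ((v @ [r]) @ (r # c)) = act w"
        using act_cancel[of v r c] P by (simp add: P_def)
      have "len w = len ((v @ [r]) @ (r # c))" using e len_cong by metis
      also have "\<dots> \<le> len (v @ [r]) + len (r # c)" by (rule len_append)
      also have "\<dots> \<le> len (v @ [r]) + length (r # c)" using len_length[of "r # c"] by simp
      finally have "P (v @ [r]) (r # c)" using h P e that unfolding P_def by auto
      from min[OF this] h show False by simp
    qed
    have pv: "pos v k" "pos v t" using less.hyps[OF lv up] by auto
    have cmin: "length c \<le> length c'" if "act c' = act c" for c'
    proof -
      have "act (v @ c') = act w" using act_cong_append[OF refl that] P by (simp add: P_def)
      then have "len w = len (v @ c')" using len_cong by metis
      also have "\<dots> \<le> len v + length c'" using len_append[of v c'] len_length[of c'] by simp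
      finally show ?thesis using P by (simp add: P_def)
    qed
    have ck: "length c \<le> length c'" if "act c' = act (c @ [k])" for c'
    proof -
      have "act (v @ c') = act (v @ c @ [k])" using act_cong_append[OF refl that] by simp
      also have "\<dots> = act (w @ [k])" using act_cong_append[of "v @ c" w "[k]" "[k]"] P by (simp add: P_def)
      finally have "len (w @ [k]) = len (v @ c')" using len_cong by metis
      also have "\<dots> \<le> len v + length c'" using len_append[of v c'] len_length[of c'] by simp
      finally show ?thesis using P less.prems by (simp add: P_def)
    qed
    have sc: "set c \<subseteq> {k, t}" using P by (simp add: P_def)
    have norep: "\<not> (\<exists>p r q. c = p @ r # r # q)"
    proof
      assume "\<exists>p r q. c = p @ r # r # q"
      then obtain p r q where "c = p @ r # r # q" by blast
      then show False using cmin[of "p @ q"] act_cancel[of p r q] by simp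
    qed
    \<comment> \<open>If \<open>c\<close> ended in \<open>k\<close>, appending \<open>k\<close>
      would cancel that letter, against \<open>ck\<close>.\<close>
    have alt: "c = altw (length c) k t"
    proof -
      have "c = altw (length c) k t \<or> c = altw (length c) t k"
        using altw_or_rep[OF sc] norep by blast
      moreover have "c = altw (length c) k t" if h: "c = altw (length c) t k"
      proof (cases "length c")
        case (Suc m)
        then have "c = altw m k t @ [k]" using h by simp
        then have "act (altw m k t) = act (c @ [k])" using act_cancel[of "altw m k t" k "[]"] by simp
        then show ?thesis using ck[of "altw m k t"] Suc by simp
      qed auto
      ultimately show ?thesis by blast
    qed
    \<comment> \<open>Otherwise the braid relation rewrites \<open>c\<close> so that it ends in
      \<open>k\<close>, and appending \<open>k\<close> shortens it, again against
      \<open>ck\<close>.\<close>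
    have "mst k t = 0 \<or> length c < mst k t"
    proof (rule ccontr)
      assume h: "\<not> ?thesis"
      then obtain r where r: "length c = r + mst k t" by (metis add.commute le_Suc_ex not_less)
      obtain pre where pre: "c = pre @ altw (mst k t) k t" using alt altw_add[of r "mst k t" k t] r by metis
      obtain m where m: "mst k t = Suc m" using h by (cases "mst k t") auto
      have "act (c @ [k]) = act (pre @ altw (mst k t) t k @ [k])"
        using act_cong_append[OF act_cong_append[OF refl braid[of k t]] refl, of pre "[k]"] tk pre
        by simp
      also have "\<dots> = act (pre @ altw m k t)"
        using act_cancel[of "pre @ altw m k t" k "[]"] by (simp add: m)
      finally show False using ck[of "pre @ altw m k t"] pre m by simp
    qed
    then have "pos (v @ altw (length c) k t) k" using tk pv by (intro pos_altw) auto
    then have "pos (v @ c) k" using alt by simp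
    then show ?thesis using pos_cong P unfolding P_def by blast
  qed
qed

lemma pos_dich: "pos w k \<or> pos (w @ [k]) k"
proof (cases "len w \<le> len (w @ [k])")
  case False
  have "act ((w @ [k]) @ [k]) = act w" using act_cancel[of w k "[]"] by simp
  then have "len ((w @ [k]) @ [k]) = len w" by (rule len_cong)
  then show ?thesis using pos_if_len[of "w @ [k]" k] False by simp
qed (use pos_if_len in blast)

lemma pos_not_both: "\<not> (pos w k \<and> pos (w @ [k]) k)"
  by (auto simp: pos_def phi_snoc_same)

end

section \<open>Dominant vectors, walls and simple coroots\<close>

context km
begin

lemma red_cases:
  "act w = act [] \<or> (\<exists>j w1. act w = act (j # w1) \<and> len w1 < len w \<and> pos (rev w1) j)"
proof -
  obtain w0 where w0: "length w0 = len w" "act w0 = act w" using len_red by blast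
  show ?thesis
  proof (cases w0)
    case (Cons j w1)
    have "len w1 \<le> length w1" by (rule len_length)
    moreover have "len (rev w1 @ [j]) = len w"
      using len_rev[of "j # w1"] len_cong[OF w0(2)] Cons by simp
    ultimately have "len w1 < len w" "pos (rev w1) j"
      using pos_if_len[of "rev w1" j] w0(1) Cons by (auto simp: len_rev)
    then show ?thesis using w0(2) Cons by metis
  qed (use w0 in auto)
qed

text \<open>Induction along a reduced word: each new letter on the left lengthens the element, so
  the pairing it reflects by is nonnegative on the image of a dominant vector.\<close>

lemma act_induct [case_names id Cons]:
  assumes id: "\<And>w. act w = act [] \<Longrightarrow> P w"
    and Cons: "\<And>w j w1. act w = act (j # w1) \<Longrightarrow> pos (rev w1) j \<Longrightarrow> P w1 \<Longrightarrow> P w"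
  shows "P w"
proof (induction "len w" arbitrary: w rule: less_induct)
  case less
  show ?case using red_cases[of w] less id Cons by blast
qed

lemma phi_rev: "phi (rev w) j x = vH (act w x) j"
  by (simp add: phi_def)

text \<open>Along a reduced word every reflection subtracts a nonnegative multiple of a simple root,
  that is, raises \<open>vC\<close>.\<close>

lemma act_dom_ge: "domt d \<Longrightarrow> vC d m \<le> vC (act w d) m"
proof (induction w rule: act_induct)
  case (id w)
  then show ?case by simp
next
  case (Cons w j w1)
  have "0 \<le> vH (act w1 d) j" using Cons unfolding pos_def phi_rev by blast
  then show ?case using Cons by (auto simp: vC_s)
qed

lemma act_dom_eq: "domt d \<Longrightarrow> (\<And>m. vC (act w d) m \<le> vC d m) \<Longrightarrow> act w d = d"
proof (induction w rule: act_induct)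
  case (id w)
  then show ?case by simp
next
  case (Cons w j w1)
  have 1: "0 \<le> vH (act w1 d) j" using Cons unfolding pos_def phi_rev by blast
  have 2: "vC (act w d) m = vC (act w1 d) m + (if m = j then vH (act w1 d) j else 0)" for m
    using Cons(1) by (simp add: vC_s)
  have "vC (act w1 d) m \<le> vC d m" for m
    using 1 2[of m] Cons.prems(2)[of m] by (auto split: if_splits)
  then have e: "act w1 d = d" using Cons by blast
  have "vH (act w1 d) j = 0" using 1 2[of j] Cons.prems(2)[of j] e by simp
  then show ?case using Cons(1) e by (simp add: s_def)
qed

lemma act_dom_unique: "domt d \<Longrightarrow> domt (act w d) \<Longrightarrow> act w d = d"
proof (induction w rule: act_induct)
  case (id w)
  then show ?case by simp
next
  case (Cons w j w1)
  have 1: "0 \<le> vH (act w1 d) j" using Cons unfolding pos_def phi_rev by blast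
  have "vH (act w d) j = - vH (act w1 d) j" using Cons(1) by (simp add: vH_s)
  moreover have "0 \<le> vH (act w d) j" using Cons.prems(2) by (simp add: domt_def)
  ultimately have "vH (act w1 d) j = 0" using 1 by linarith
  then have "act w d = act w1 d" using Cons(1) by (simp add: s_def)
  then show ?case using Cons by simp
qed

text \<open>If the inverse had a nonempty reduced word, its first letter would be a simple root made
  negative by \<open>w\<close>.\<close>

lemma act_id_if_pos: assumes "\<And>k. pos w k" shows "act w = act []"
proof -
  have "\<not> (\<exists>j w1. act (rev w) = act (j # w1) \<and> len w1 < len (rev w) \<and> pos (rev w1) j)"
  proof
    assume "\<exists>j w1. act (rev w) = act (j # w1) \<and> len w1 < len (rev w) \<and> pos (rev w1) j"
    then obtain j w1 where h: "act (rev w) = act (j # w1)" "pos (rev w1) j" by blast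
    have "act w = act (rev w1 @ [j])" using act_cong_rev[OF h(1)] by simp
    then have "pos (rev w1 @ [j]) j" using assms[of j] pos_cong by blast
    then show False using h(2) pos_not_both by blast
  qed
  then have "act (rev w) = act []" using red_cases[of "rev w"] by blast
  then show ?thesis using act_cong_rev[of "rev w" "[]"] by simp
qed

lemma len_Cons_less: "vH (act w rho) j < 0 \<Longrightarrow> len (j # w) < len w"
proof (rule ccontr)
  assume h: "vH (act w rho) j < 0" "\<not> len (j # w) < len w"
  have "len (rev w @ [j]) = len (j # w)" using len_rev[of "j # w"] by simp
  then have "pos (rev w) j" using h(2) pos_if_len[of "rev w" j] by (simp add: len_rev)
  then show False using h(1) unfolding pos_def phi_rev by simp
qed

lemma act_int: "(\<And>l. vH x l \<in> \<int>) \<Longrightarrow> vH (act w x) k \<in> \<int>"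
  by (induction w arbitrary: k) (auto simp: vH_s)

lemma phi_int: "(\<And>l. vH x l \<in> \<int>) \<Longrightarrow> phi u k x \<in> \<int>"
  by (simp add: phi_def act_int)

lemma phi_al_int [simp]: "phi u k (al j) \<in> \<int>"
  by (simp add: phi_int)

lemma rt_int [simp]: "vH (rt u k) j \<in> \<int>"
  unfolding rt_def by (rule act_int) simp

lemma phi_act: "phi u k (act w x) = phi (rev w @ u) k x"
  by (simp add: phi_append)

text \<open>Regularity of \<open>rho\<close>: by \<open>pos_dich\<close> every real coroot has a
  strict sign on it. This is why breaking ties by \<open>rho\<close> always decides.\<close>

lemma phi_rho_nz: "phi u k (act w rho) \<noteq> 0"
proof
  assume "phi u k (act w rho) = 0"
  then have "phi (rev w @ u) k rho = 0" by (simp add: phi_act)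
  then show False using pos_dich[of "rev w @ u" k] phi_snoc_same[of "rev w @ u" k rho]
    by (auto simp: pos_def)
qed

lemma act_null: assumes "\<And>l. vH x l = 0" shows "act w x = x"
  by (induction w) (simp_all add: s_def assms)

definition unit :: "'l \<Rightarrow> 'l vec" where
  "unit j = Vec (\<lambda>l. if l = j then 1 else 0) (\<lambda>_. 0)"

lemma unit_simps [simp]: "vH (unit j) l = (if l = j then 1 else 0)" "vC (unit j) l = 0"
  by (simp_all add: unit_def)

lemma domt_unit: "domt (unit j)"
  by (simp add: domt_def)

text \<open>A vector on the wall of \<open>j\<close> is a difference of two dominant vectors on that
  wall, up to a vector without pairings, which the group fixes. So the coroot is a multiple of the
  simple one, and the factor is 1 since it is positive and a unit of the integers.\<close>

lemma phi_eq_simple: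
  assumes z: "\<And>x. domt x \<Longrightarrow> vH x j = 0 \<Longrightarrow> phi u k x = 0" and p: "0 < phi u k rho"
  shows "phi u k x = vH x j"
proof -
  have z': "phi u k x = 0" if x: "vH x j = 0" for x
  proof -
    define y where "y = Vec (\<lambda>l. max (vH x l) 0) (\<lambda>_. 0)"
    define y' where "y' = Vec (\<lambda>l. max (- vH x l) 0) (\<lambda>_. 0)"
    have "phi u k y = 0" "phi u k y' = 0"
      using x by (auto intro!: z simp: y_def y'_def domt_def)
    moreover have "phi u k (x - (y - y')) = 0"
    proof -
      have n: "vH (x - (y - y')) l = 0" for l by (simp add: y_def y'_def)
      show ?thesis unfolding phi_def act_null[OF n] by (rule n)
    qed
    ultimately show ?thesis by (simp add: phi_lin)
  qed
  define c where "c = phi u k (unit j)"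
  have c: "phi u k x = vH x j * c" for x
    using z'[of "x - vH x j *\<^sub>R unit j"] by (simp add: phi_lin c_def)
  have cpos: "0 < c" using p c[of rho] by simp
  have "c \<in> \<int>" unfolding c_def by (rule phi_int) simp
  then obtain n where n: "c = of_int n" by (elim Ints_cases)
  have "vH (act u (unit k)) j \<in> \<int>" by (rule act_int) simp
  then obtain m where m: "vH (act u (unit k)) j = of_int m" by (elim Ints_cases)
  have "phi u k (act u (unit k)) = 1" by (simp add: phi_def)
  then have "of_int (m * n) = (1::real)" using c n m by simp
  then have "m * n = 1" using of_int_eq_1_iff by blast
  then have "n = 1" using cpos n by (simp add: zmult_eq_1_iff)
  then show ?thesis using c n by simp
qed

text \<open>A root is not determined by its coroot a priori. Composing with \<open>s j\<close> in
  the two orders gives the transvection along \<open>w0\<close> and its inverse; both would move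
  \<open>unit j\<close> up in the other pairings and in \<open>vC\<close>, which forces
  \<open>w0\<close> to vanish.\<close>

lemma refl_eq_simple:
  assumes e: "\<And>x. phi u k x = vH x j"
  shows "act (refw u k) x = s j x"
proof -
  define w0 where "w0 = al j - rt u k"
  have r2: "vH (rt u k) j = 2" using phi_rt[of u k] unfolding e .
  have z1: "act (j # refw u k) x = x + vH x j *\<^sub>R w0" for x
    by (simp add: act_refw e s_def r2 w0_def algebra_simps)
  have z2: "act (refw u k @ [j]) x = x - vH x j *\<^sub>R w0" for x
    by (simp add: act_append act_refw e s_def r2 w0_def algebra_simps)
  have pz: "0 \<le> vH (act w (unit j)) l" if "vH (act w (unit l)) l = 1" for w l
  proof -
    have "\<not> pos (rev w @ [l]) l"
    proof
      assume "pos (rev w @ [l]) l"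
      then have "0 \<le> phi (rev w @ [l]) l (unit l)" using domt_unit unfolding pos_def by blast
      then show False using that by (simp add: phi_snoc_same phi_rev)
    qed
    then have "pos (rev w) l" using pos_dich by blast
    then show ?thesis using domt_unit unfolding pos_def phi_rev by blast
  qed
  have "vH w0 l = 0" for l
  proof (cases "l = j")
    case True
    then show ?thesis by (simp add: w0_def r2)
  next
    case False
    have "0 \<le> vH (act (j # refw u k) (unit j)) l" "0 \<le> vH (act (refw u k @ [j]) (unit j)) l"
      by (rule pz; simp only: z1 z2; use False in simp)+
    then show ?thesis unfolding z1 z2 using False by simp
  qed
  moreover have "vC w0 m = 0" for m
    using act_dom_ge[OF domt_unit[of j], of m "j # refw u k"] act_dom_ge[OF domt_unit[of j], of m "refw u k @ [j]"]
    unfolding z1 z2 by simp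
  ultimately have "w0 = 0" by (intro vec_eqI) auto
  then have "rt u k = al j" by (simp add: w0_def)
  then show ?thesis by (simp add: act_refw e s_def)
qed

text \<open>A positive coroot that \<open>s j\<close> makes negative vanishes on all dominant
  vectors of the wall of \<open>j\<close>, so \<open>phi_eq_simple\<close> applies. Thus
  \<open>s j\<close> permutes the other positive coroots.\<close>

lemma wall:
  assumes "pos u k" "\<not> pos (j # u) k"
  shows "phi u k x = vH x j"
proof (rule phi_eq_simple)
  show "0 < phi u k rho" using assms by (simp add: pos_def)
  fix x :: "'l vec" assume x: "domt x" "vH x j = 0"
  have "pos ((j # u) @ [k]) k" using pos_dich[of "j # u" k] assms by blast
  then have "0 \<le> - phi (j # u) k x" using x(1) phi_snoc_same[of "j # u" k x] unfolding pos_def by metis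
  then have "phi u k x \<le> 0" using x(2) by (simp add: phi_Cons s_def)
  then show "phi u k x = 0" using assms x by (auto simp: pos_def order.antisym)
qed

lemma pos_Nil [simp]: "pos [] k"
  by (auto simp: pos_def domt_def rt_def)

section \<open>Labels of directions and chains of integral reflections\<close>

type_synonym 'k lab = "nat \<times> ('k vec \<Rightarrow> 'k vec)"

text \<open>Group elements occur in labels as functions and not as words, so that labels are equal
  when the elements are.\<close>

definition inW :: "('l vec \<Rightarrow> 'l vec) \<Rightarrow> bool" where
  "inW f \<longleftrightarrow> (\<exists>w. f = act w)"

lemma inW_s: "inW f \<Longrightarrow> inW (s j \<circ> f)"
  unfolding inW_def by (metis act.simps(2) comp_apply ext)

lemma inW_act: "inW f \<Longrightarrow> inW (act u \<circ> f)"
  unfolding inW_def by (metis act_append comp_apply ext)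

lemma inW_id: "inW id"
  unfolding inW_def by (rule exI[of _ "[]"]) auto

definition dv :: "(nat \<Rightarrow> 'l vec) \<Rightarrow> 'l lab \<Rightarrow> 'l vec" where
  "dv d D = snd D (d (fst D))"

text \<open>The sign of the coroot on the direction perturbed from \<open>w d\<close> to
  \<open>w (d + \<epsilon> rho)\<close> with infinitesimal \<epsilon> > 0. It is never zero, so one
  of two opposite coroots always counts as positive.\<close>

definition lexpos :: "(nat \<Rightarrow> 'l vec) \<Rightarrow> 'l list \<Rightarrow> 'l \<Rightarrow> 'l lab \<Rightarrow> bool" where
  "lexpos d u k D \<longleftrightarrow> 0 < phi u k (dv d D) \<or> phi u k (dv d D) = 0 \<and> 0 < phi u k (snd D rho)"

definition sD :: "'l \<Rightarrow> 'l lab \<Rightarrow> 'l lab" where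
  "sD j D = (fst D, s j \<circ> snd D)"

definition tD :: "'l list \<Rightarrow> 'l \<Rightarrow> 'l lab \<Rightarrow> 'l lab" where
  "tD u k D = (fst D, act (refw u k) \<circ> snd D)"

text \<open>One step of a chain from the right direction to the left direction of a path at the point
  \<open>x\<close>: either a reflection in a positive real root that is integral at \<open>x\<close>, or a change of leg. The
  last conjuncts replace the covering condition in the definition of a Lakshmibai-Seshadri chain.\<close>

definition step :: "(nat \<Rightarrow> 'l vec) \<Rightarrow> 'l vec \<Rightarrow> 'l lab \<Rightarrow> 'l lab \<Rightarrow> bool" where
  "step d x D D' \<longleftrightarrow> inW (snd D) \<and>
    ((\<exists>u k. pos u k \<and> phi u k x \<in> \<int> \<and> lexpos d u k D \<and> D' = tD u k D \<and>
       (\<forall>v i. pos v i \<longrightarrow> phi v i x \<notin> \<int> \<longrightarrow> \<not> pos (refw u k @ v) i \<longrightarrow>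
          lexpos d v i D \<longrightarrow> lexpos d v i D')) \<or>
     (fst D = Suc (fst D') \<and> snd D' = snd D \<and>
       (\<forall>v i. pos v i \<longrightarrow> phi v i x \<notin> \<int> \<longrightarrow> lexpos d v i D \<longrightarrow> lexpos d v i D')))"

abbreviation germ :: "(nat \<Rightarrow> 'l vec) \<Rightarrow> 'l vec \<Rightarrow> 'l lab \<Rightarrow> 'l lab \<Rightarrow> bool" where
  "germ d x \<equiv> (step d x)\<^sup>*\<^sup>*"

lemma dv_s [simp]: "dv d (sD j D) = s j (dv d D)" and fst_sD [simp]: "fst (sD j D) = fst D"
  and snd_sD [simp]: "snd (sD j D) = s j \<circ> snd D"
  by (simp_all add: dv_def sD_def)

lemma dv_t [simp]: "dv d (tD u k D) = act (refw u k) (dv d D)" and fst_tD [simp]: "fst (tD u k D) = fst D"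
  and snd_tD [simp]: "snd (tD u k D) = act (refw u k) \<circ> snd D"
  by (simp_all add: dv_def tD_def)

lemma sD_sD [simp]: "sD j (sD j D) = D"
  by (simp add: sD_def comp_def)

lemma rev_refw [simp]: "rev (refw u k) = refw u k"
  by (simp add: refw_def)

lemma lexpos_s: "lexpos d v i (sD j D) = lexpos d (j # v) i D"
  by (simp add: lexpos_def phi_Cons)

lemma lexpos_t: "lexpos d v i (tD u k D) = lexpos d (refw u k @ v) i D"
  by (simp add: lexpos_def phi_append)

lemma lexpos_cong: "(\<And>x. phi v i x = phi v' i' x) \<Longrightarrow> lexpos d v i D = lexpos d v' i' D"
  by (simp add: lexpos_def)

lemma lexpos_opp:
  assumes "inW (snd D)" "\<And>x. phi v i x = - phi v' i' x"
  shows "lexpos d v i D \<longleftrightarrow> \<not> lexpos d v' i' D"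
proof -
  have "phi v' i' (snd D rho) \<noteq> 0" using assms(1) phi_rho_nz by (auto simp: inW_def)
  then show ?thesis by (auto simp: lexpos_def assms(2))
qed

lemma lexpos_sD_same: "inW (snd D) \<Longrightarrow> lexpos d [] j (sD j D) \<longleftrightarrow> \<not> lexpos d [] j D"
  unfolding lexpos_s by (rule lexpos_opp) (auto simp: phi_Cons vH_s)

lemma step_inW: "step d x D D' \<Longrightarrow> inW (snd D) \<and> inW (snd D')"
  by (auto simp: step_def tD_def intro: inW_act)

lemma germ_inW: "germ d x D D' \<Longrightarrow> inW (snd D) \<longleftrightarrow> inW (snd D')"
  by (induction rule: rtranclp_induct) (auto dest: step_inW)

text \<open>If positivity were lost, the last conjunct of \<open>step\<close> would leave only the
  case that the reflection keeps the simple root \<open>j\<close> positive. As the reflection lowers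
  the pairing with \<open>j\<close>, its coroot must then be the simple one, which is integral at
  \<open>x\<close>, against the assumption on \<open>j\<close>.\<close>

lemma step_sign:
  assumes st: "step d x D D'" and ni: "vH x j \<notin> \<int>" and lp: "lexpos d [] j D"
  shows "lexpos d [] j D'"
proof (rule ccontr)
  assume n: "\<not> lexpos d [] j D'"
  from st consider
    (real) u k where "pos u k" "phi u k x \<in> \<int>" "lexpos d u k D" "D' = tD u k D"
       "\<forall>v i. pos v i \<longrightarrow> phi v i x \<notin> \<int> \<longrightarrow> \<not> pos (refw u k @ v) i \<longrightarrow> lexpos d v i D \<longrightarrow> lexpos d v i D'"
    | (gen) "\<forall>v i. pos v i \<longrightarrow> phi v i x \<notin> \<int> \<longrightarrow> lexpos d v i D \<longrightarrow> lexpos d v i D'"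
    unfolding step_def by blast
  then show False
  proof cases
    case gen
    then show False using n lp ni pos_Nil[of j] by (metis phi_Nil)
  next
    case real
    define r where "r = vH (rt u k) j"
    have v1: "vH (act (refw u k) y) j = vH y j - phi u k y * r" for y
      by (simp add: act_refw r_def)
    \<comment> \<open>Losing the sign means that a positive multiple of the root has been
      subtracted. The comparison is made first for the direction itself and, when that gives zero,
      for the \<open>rho\<close> part.\<close>
    have rpos: "0 < r"
    proof (rule ccontr)
      assume "\<not> 0 < r"
      then have r: "r \<le> 0" by simp
      have hD: "snd D' rho = act (refw u k) (snd D rho)" using real(4) by simp
      let ?P = "phi u k (dv d D)" and ?Q = "phi u k (snd D rho)"
      have P0: "0 \<le> ?P" using real(3) by (auto simp: lexpos_def)
      have e1: "vH (dv d D') j = vH (dv d D) j - ?P * r" using real(4) by (simp add: v1)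
      have e2: "vH (snd D' rho) j = vH (snd D rho) j - ?Q * r" unfolding hD v1 ..
      have Pr: "?P * r \<le> 0" using P0 r by (simp add: mult_nonneg_nonpos)
      have d0: "0 \<le> vH (dv d D) j" using lp by (auto simp: lexpos_def)
      have n1: "vH (dv d D') j \<le> 0" "vH (dv d D') j = 0 \<Longrightarrow> vH (snd D' rho) j \<le> 0"
        using n by (auto simp: lexpos_def not_less)
      have z: "vH (dv d D) j = 0" "?P * r = 0" using n1(1) e1 Pr d0 by linarith+
      then have h1: "0 < vH (snd D rho) j" using lp by (auto simp: lexpos_def)
      have h2: "vH (snd D' rho) j \<le> 0" using n1(2) e1 z by simp
      then have "0 < ?Q * r" using e2 h1 by linarith
      then have "?Q < 0" "r \<noteq> 0" using r by (auto simp: zero_less_mult_iff)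
      then have "?P = 0" using z by simp
      then have "0 < ?Q" using real(3) by (auto simp: lexpos_def)
      then show False using \<open>?Q < 0\<close> by simp
    qed
    show False
    proof (cases "pos (refw u k @ []) j")
      case False
      then show False using real(5) n lp ni pos_Nil[of j] by (metis phi_Nil)
    next
      case True
      have "phi u k y = vH y j" for y
      proof (rule phi_eq_simple)
        show "0 < phi u k rho" using real(1) by (simp add: pos_def)
        fix y :: "'l vec" assume y: "domt y" "vH y j = 0"
        have "0 \<le> phi (refw u k) j y" using True y by (simp add: pos_def)
        then have "phi u k y * r \<le> 0" using y(2) by (simp add: phi_def v1)
        then have "phi u k y \<le> 0" using rpos by (simp add: mult_le_0_iff)
        then show "phi u k y = 0" using real(1) y by (auto simp: pos_def order.antisym)
      qed
      then show False using real(2) ni by simp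
    qed
  qed
qed

text \<open>Since \<open>s j\<close> keeps the sign of every positive root except the simple one, a
  step is carried to a step, unless it is the simple reflection itself and its two ends are
  exchanged. The assumption \<open>corr\<close> says that \<open>x'\<close> behaves like
  \<open>s j x\<close> as far as integrality is concerned.\<close>

lemma step_refl:
  assumes st: "step d x D D'"
    and corr: "\<And>v i. phi v i x' \<in> \<int> \<longleftrightarrow> phi (j # v) i x \<in> \<int>"
    and same: "vH x j \<in> \<int> \<or> (lexpos d [] j D \<longleftrightarrow> lexpos d [] j D')"
  shows "step d x' (sD j D) (sD j D') \<or> (vH x j \<in> \<int> \<and> D' = sD j D \<and> lexpos d [] j D)"
proof -
  have W: "inW (snd D)" "inW (snd D')" using step_inW[OF st] by auto
  have W': "inW (snd (sD j D))" using W inW_s by simp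
  \<comment> \<open>The clause of the new step for the one positive root that \<open>s j\<close>
    makes negative. It is not inherited from the old step but follows from
    \<open>same\<close>.\<close>
  have simple: "lexpos d (j # v) i D'"
    if "phi v i x' \<notin> \<int>" "lexpos d (j # v) i D" "\<And>y. phi v i y = vH y j" for v i
  proof -
    have ni: "vH x j \<notin> \<int>" using that(1) that(3) corr[of v i] by (simp add: phi_Cons vH_s)
    have o: "lexpos d (j # v) i E \<longleftrightarrow> \<not> lexpos d [] j E" if "inW (snd E)" for E
      using that by (rule lexpos_opp) (simp add: phi_Cons that(1) vH_s \<open>\<And>y. phi v i y = vH y j\<close>)
    show ?thesis using o W same ni that(2) by blast
  qed
  from st consider
    (real) u k where "pos u k" "phi u k x \<in> \<int>" "lexpos d u k D" "D' = tD u k D"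
       "\<And>v i. pos v i \<Longrightarrow> phi v i x \<notin> \<int> \<Longrightarrow> \<not> pos (refw u k @ v) i \<Longrightarrow> lexpos d v i D \<Longrightarrow> lexpos d v i D'"
    | (gen) "fst D = Suc (fst D')" "snd D' = snd D"
       "\<And>v i. pos v i \<Longrightarrow> phi v i x \<notin> \<int> \<Longrightarrow> lexpos d v i D \<Longrightarrow> lexpos d v i D'"
    unfolding step_def by blast
  then show ?thesis
  proof cases
    case gen
    have "lexpos d v i (sD j D')" if "pos v i" "phi v i x' \<notin> \<int>" "lexpos d v i (sD j D)" for v i
      unfolding lexpos_s
    proof (cases "pos (j # v) i")
      case True
      then show "lexpos d (j # v) i D'" using gen(3) that corr by (auto simp: lexpos_s)
    next
      case False
      then show "lexpos d (j # v) i D'" using simple wall that by (auto simp: lexpos_s)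
    qed
    then have "step d x' (sD j D) (sD j D')" using W' gen(1,2) unfolding step_def by simp
    then show ?thesis ..
  next
    case real
    show ?thesis
    proof (cases "pos (j # u) k")
      case False
      have e: "phi u k y = vH y j" for y using wall[OF real(1) False] .
      have "D' = sD j D" using real(4) refl_eq_simple[OF e] by (simp add: sD_def tD_def comp_def)
      moreover have "lexpos d [] j D" using real(3) lexpos_cong[of u k "[]" j] e by simp
      ultimately show ?thesis using real(2) e by simp
    next
      case True
      have "lexpos d v i (sD j D')"
        if v: "pos v i" "phi v i x' \<notin> \<int>" "\<not> pos (refw (j # u) k @ v) i" "lexpos d v i (sD j D)" for v i
        unfolding lexpos_s
      proof (cases "pos (j # v) i")
        case False
        then show "lexpos d (j # v) i D'" using simple wall v by (auto simp: lexpos_s)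
      next
        case pv: True
        show "lexpos d (j # v) i D'"
        proof (cases "pos (refw u k @ (j # v)) i")
          case False
          then show ?thesis using real(5)[OF pv _ False] v corr by (auto simp: lexpos_s)
        next
          \<comment> \<open>Here the reflection carries the root in question to the simple root
            \<open>j\<close>, so its signs at the two ends are those of \<open>j\<close> at the ends
            in exchanged order, and \<open>same\<close> applies.\<close>
          case True
          have "\<not> pos (j # (refw u k @ (j # v))) i" using v(3) by (simp add: refw_def)
          from wall[OF True this] have e: "phi (j # v) i (act (refw u k) y) = vH y j" for y
            by (simp add: phi_append)
          have inv: "act (refw u k) (act (refw u k) y) = y" for y
            using act_rev(1)[of "refw u k" y] by simp
          have e': "phi (j # v) i y = vH (act (refw u k) y) j" for y
            using e[of "act (refw u k) y"] by (simp add: inv)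
          have "vH x j \<notin> \<int>"
          proof
            assume "vH x j \<in> \<int>"
            then have "phi (j # v) i x \<in> \<int>" unfolding e' act_refw using real(2) by simp
            then show False using v(2) corr by simp
          qed
          then have sm: "lexpos d [] j D \<longleftrightarrow> lexpos d [] j D'" using same by blast
          have "lexpos d (j # v) i D' \<longleftrightarrow> lexpos d [] j D"
            unfolding real(4) lexpos_t by (rule lexpos_cong) (simp add: phi_append e)
          moreover have "lexpos d (j # v) i D \<longleftrightarrow> lexpos d [] j D'"
            unfolding real(4) lexpos_t by (rule lexpos_cong) (simp add: e', simp add: phi_def)
          ultimately show ?thesis using v(4) sm by (simp add: lexpos_s)
        qed
      qed
      moreover have "phi (j # u) k x' \<in> \<int>" using corr[of "j # u" k] real(2) by (simp add: phi_Cons)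
      moreover have "lexpos d (j # u) k (sD j D)"
        unfolding lexpos_s using real(3) lexpos_cong[of "j # j # u" k u k] by (simp add: phi_Cons)
      moreover have "sD j D' = tD (j # u) k (sD j D)"
        using real(4) by (simp add: sD_def tD_def refw_def act_append comp_def)
      ultimately have "step d x' (sD j D) (sD j D')"
        using W' True unfolding step_def by blast
      then show ?thesis ..
    qed
  qed
qed

lemma step_cong:
  assumes "\<And>v i. phi v i x' \<in> \<int> \<longleftrightarrow> phi v i x \<in> \<int>"
  shows "step d x' = step d x"
  by (intro ext) (simp add: step_def assms)

lemma int_s: assumes "vH x j \<in> \<int>" shows "phi (j # v) i x \<in> \<int> \<longleftrightarrow> phi v i x \<in> \<int>"
proof -
  have e: "phi (j # v) i x = phi v i x - vH x j * phi v i (al j)"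
    by (simp add: phi_Cons s_def phi_lin)
  have "vH x j * phi v i (al j) \<in> \<int>" using assms by simp
  then show ?thesis unfolding e by (metis Ints_diff Ints_add diff_add_cancel)
qed

lemma int_shift: assumes "m \<in> \<int>" shows "phi v i (x + m *\<^sub>R al j) \<in> \<int> \<longleftrightarrow> phi v i x \<in> \<int>"
proof -
  have e: "phi v i (x + m *\<^sub>R al j) = phi v i x + m * phi v i (al j)"
    by (simp add: phi_lin)
  have "m * phi v i (al j) \<in> \<int>" using assms by simp
  then show ?thesis unfolding e by (metis Ints_diff Ints_add add_diff_cancel_right')
qed

text \<open>The last clause of \<open>step\<close> is void here: only the simple root itself becomes
  negative, and it is integral at \<open>x\<close>.\<close>

lemma step_simple:
  assumes "vH x j \<in> \<int>" "lexpos d [] j D" "inW (snd D)"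
  shows "step d x D (sD j D)"
proof -
  have "lexpos d v i (sD j D)"
    if "pos v i" "phi v i x \<notin> \<int>" "\<not> pos (refw [] j @ v) i" for v i
    using wall[of v i j x] that assms(1) by (simp add: refw_def)
  moreover have "sD j D = tD [] j D" by (simp add: sD_def tD_def refw_def comp_def)
  ultimately show ?thesis unfolding step_def using assms pos_Nil[of j] phi_Nil by metis
qed

lemma germ_sign: "germ d x N M \<Longrightarrow> vH x j \<notin> \<int> \<Longrightarrow> lexpos d [] j N \<Longrightarrow> lexpos d [] j M"
  by (induction rule: rtranclp_induct) (auto intro: step_sign)

text \<open>Lifting property. The chain is reflected up to its first label that is negative for
  \<open>j\<close>; from there a simple step leads back to the given chain. If the chain passes from
  a label to its own reflection, its remainder already is what is wanted.\<close>

lemma germ_left: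
  assumes "germ d x N M" "vH x j \<in> \<int>" "inW (snd N)" "\<not> (lexpos d [] j N \<and> lexpos d [] j M)"
  shows "germ d x (sD j N) M"
proof (cases "lexpos d [] j N")
  case False
  then have "step d x (sD j N) N"
    using step_simple[OF assms(2), of d "sD j N"] assms(3) by (simp add: lexpos_sD_same inW_s)
  then show ?thesis using assms(1) by simp
next
  case True
  then have M: "\<not> lexpos d [] j M" using assms(4) by blast
  show ?thesis using assms(1) True
  proof (induction rule: converse_rtranclp_induct)
    case base
    then show ?case using M by blast
  next
    case (step N D)
    from step_refl[OF step(1), of x j] consider "step d x (sD j N) (sD j D)" | "D = sD j N"
      using int_s[OF assms(2)] assms(2) by blast
    then show ?case
    proof cases
      case 1
      show ?thesis
      proof (cases "lexpos d [] j D")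
        case True
        then show ?thesis using 1 step.IH by simp
      next
        case False
        have "step d x (sD j D) D"
          using step_simple[OF assms(2), of d "sD j D"] False step_inW[OF step(1)]
          by (simp add: lexpos_sD_same inW_s)
        then show ?thesis using 1 step(2) by (meson converse_rtranclp_into_rtranclp)
      qed
    qed (use step(2) in simp)
  qed
qed

lemma germ_right:
  assumes "germ d x N M" "vH x j \<in> \<int>" "inW (snd N)" "lexpos d [] j N \<or> lexpos d [] j M"
  shows "germ d x N (sD j M)"
proof (cases "lexpos d [] j M")
  case True
  then have "step d x M (sD j M)"
    using step_simple[OF assms(2), of d M] assms(3) germ_inW[OF assms(1)] by simp
  then show ?thesis using assms(1) by simp
next
  case False
  then have N: "lexpos d [] j N" using assms(4) by blast
  show ?thesis using assms(1) False
  proof (induction rule: rtranclp_induct)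
    case base
    then show ?case using N by blast
  next
    case (step D M)
    from step_refl[OF step(2), of x j] consider "step d x (sD j D) (sD j M)" | "M = sD j D"
      using int_s[OF assms(2)] assms(2) by blast
    then show ?case
    proof cases
      case 1
      show ?thesis
      proof (cases "lexpos d [] j D")
        case False
        then show ?thesis using 1 step.IH by (meson rtranclp.rtrancl_into_rtrancl)
      next
        case True
        have "step d x D (sD j D)"
          using step_simple[OF assms(2), of d D] True step_inW[OF step(2)] by simp
        then show ?thesis using 1 step(1) by (meson rtranclp.rtrancl_into_rtrancl)
      qed
    qed (use step(1) in simp)
  qed
qed

text \<open>For an integral pairing both ends can be reflected one after the other by the lifting
  properties. Otherwise all labels of the chain have the same sign for \<open>j\<close> by
  \<open>step_sign\<close>, and the chain is reflected step by step.\<close>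

lemma germ_both:
  assumes g: "germ d x N M" and W: "inW (snd N)" and sm: "lexpos d [] j N \<longleftrightarrow> lexpos d [] j M"
    and m: "m \<in> \<int>" and x': "x' = s j x + m *\<^sub>R al j"
  shows "germ d x' (sD j N) (sD j M)"
proof -
  have corr: "phi v i x' \<in> \<int> \<longleftrightarrow> phi (j # v) i x \<in> \<int>" for v i
    unfolding x' int_shift[OF m] by (simp add: phi_Cons)
  show ?thesis
  proof (cases "vH x j \<in> \<int>")
    case True
    have eq: "step d x' = step d x" by (rule step_cong) (simp add: corr int_s[OF True])
    have "germ d x (sD j N) (sD j M)"
    proof (cases "lexpos d [] j N")
      case pN: True
      have 1: "germ d x N (sD j M)" by (rule germ_right) (use g True W pN in auto)
      show ?thesis by (rule germ_left) (use 1 True W pN sm germ_inW[OF g] lexpos_sD_same in auto)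
    next
      case nN: False
      have 1: "germ d x (sD j N) M" by (rule germ_left) (use g True W nN in auto)
      show ?thesis by (rule germ_right) (use 1 True W nN sm inW_s lexpos_sD_same in auto)
    qed
    then show ?thesis by (simp add: eq)
  next
    case False
    note st = step_refl[where x = x and x' = x' and j = j and d = d, OF _ corr]
    show ?thesis
    proof (cases "lexpos d [] j N")
      case pN: True
      have "germ d x' (sD j N) (sD j M) \<and> lexpos d [] j M" using g
      proof (induction rule: rtranclp_induct)
        case (step D D')
        then show ?case using st[OF step(2)] step_sign[OF step(2) False] False
          by (meson rtranclp.rtrancl_into_rtrancl)
      qed (use pN in simp)
      then show ?thesis ..
    next
      case nN: False
      then have nM: "\<not> lexpos d [] j M" using sm by simp
      have "germ d x' (sD j N) (sD j M) \<and> \<not> lexpos d [] j N" using g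
      proof (induction rule: converse_rtranclp_induct)
        case (step D D')
        then show ?case using st[OF step(1)] step_sign[OF step(1) False] False
          by (meson converse_rtranclp_into_rtranclp)
      qed (use nM in simp)
      then show ?thesis ..
    qed
  qed
qed

end

section \<open>Minima of piecewise monotone functions\<close>

definition mn :: "(real \<Rightarrow> real) \<Rightarrow> real" where
  "mn h = Min {x. \<exists>t\<in>{0..1}. x = h t \<and> x \<in> \<int>}"

definition fpl :: "(real \<Rightarrow> real) \<Rightarrow> real" where
  "fpl h = Sup {t\<in>{0..1}. h t = mn h}"

definition fmi :: "(real \<Rightarrow> real) \<Rightarrow> real" where
  "fmi h = Inf {t\<in>{fpl h..1}. h t = mn h + 1}"

text \<open>The multiple of the simple root that f subtracts at time \<open>t\<close>;
  \<open>epsi\<close> is the multiple added by e.\<close>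

definition fphi :: "(real \<Rightarrow> real) \<Rightarrow> real \<Rightarrow> real" where
  "fphi h t = (if t \<le> fpl h then 0 else if t \<le> fmi h then h t - mn h else 1)"

definition epl :: "(real \<Rightarrow> real) \<Rightarrow> real" where
  "epl h = Inf {t\<in>{0..1}. h t = mn h}"

definition emi :: "(real \<Rightarrow> real) \<Rightarrow> real" where
  "emi h = Sup {t\<in>{0..epl h}. h t = mn h + 1}"

definition epsi :: "(real \<Rightarrow> real) \<Rightarrow> real \<Rightarrow> real" where
  "epsi h t = (if t \<le> emi h then 0 else if t \<le> epl h then mn h + 1 - h t else 1)"

text \<open>The upper bound \<open>B\<close> makes the set of integral values finite, so that
  \<open>Min\<close> is meaningful.\<close>

lemma mnI:
  assumes "v \<in> \<int>" "t0 \<in> {0..1}" "g t0 = v" "\<And>t. t \<in> {0..1} \<Longrightarrow> v \<le> g t" "\<And>t. t \<in> {0..1} \<Longrightarrow> g t \<le> B"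
  shows "mn g = v"
  unfolding mn_def
proof (rule Min_eqI)
  have "{x. \<exists>t\<in>{0..1}. x = g t \<and> x \<in> \<int>} \<subseteq> of_int ` {\<lfloor>v\<rfloor>..\<lfloor>B\<rfloor>}"
  proof
    fix x assume "x \<in> {x. \<exists>t\<in>{0..1}. x = g t \<and> x \<in> \<int>}"
    then obtain t where "t \<in> {0..1}" "x = g t" "x \<in> \<int>" by blast
    then have "v \<le> x" "x \<le> B" using assms by auto
    obtain n where n: "x = of_int n" using \<open>x \<in> \<int>\<close> by (elim Ints_cases)
    have "n \<in> {\<lfloor>v\<rfloor>..\<lfloor>B\<rfloor>}" using \<open>v \<le> x\<close> \<open>x \<le> B\<close> n floor_mono[of v x] by (auto simp: le_floor_iff)
    then show "x \<in> of_int ` {\<lfloor>v\<rfloor>..\<lfloor>B\<rfloor>}" using n by blast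
  qed
  then show "finite {x. \<exists>t\<in>{0..1}. x = g t \<and> x \<in> \<int>}" by (rule finite_subset) simp
qed (use assms in auto)

lemma mn_cong: "(\<And>t. t \<in> {0..1} \<Longrightarrow> h t = g t) \<Longrightarrow> mn h = mn g"
  unfolding mn_def by (rule arg_cong[where f = Min]) auto

lemma closed_level: "continuous_on {a..b} h \<Longrightarrow> closed {t\<in>{a..b}. h t = (c::real)}" for a b :: real
  by (rule continuous_closed_preimage_constant) auto

lemma mono_right:
  fixes h :: "real \<Rightarrow> real"
  assumes "continuous_on {a..b} h" "a \<le> b"
    "\<And>t. a \<le> t \<Longrightarrow> t < b \<Longrightarrow> \<exists>e>0. \<forall>u. t < u \<longrightarrow> u < t + e \<longrightarrow> h t \<le> h u"
  shows "h a \<le> h b"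
proof (rule ccontr)
  assume n: "\<not> h a \<le> h b"
  define T where "T = {t\<in>{a..b}. h a \<le> h t}"
  have cl: "closed T" unfolding T_def
    by (rule continuous_on_closed_Collect_le) (use assms in auto)
  have T: "a \<in> T" "bdd_above T" using assms by (auto simp: T_def intro!: bdd_aboveI[of _ b])
  have c: "Sup T \<in> T" using closed_contains_Sup[OF _ _ cl] T by blast
  then have cb: "a \<le> Sup T" "Sup T < b" "h a \<le> h (Sup T)" using n by (auto simp: T_def less_le)
  obtain e where e: "e > 0" "\<forall>u. Sup T < u \<longrightarrow> u < Sup T + e \<longrightarrow> h (Sup T) \<le> h u"
    using assms(3)[OF cb(1,2)] by blast
  define u where "u = min b (Sup T + e / 2)"
  have u: "Sup T < u" "u < Sup T + e" "u \<le> b" using e cb by (auto simp: u_def min_def)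
  then have "u \<in> T" using e(2) cb by (auto simp: T_def intro: order_trans)
  then show False using cSup_upper[OF _ T(2)] u(1) by fastforce
qed

lemma Ints_between: "n \<in> \<int> \<Longrightarrow> x \<in> \<int> \<Longrightarrow> n < x \<Longrightarrow> x < n + 1 \<Longrightarrow> False" for n x :: real
proof -
  assume h: "n \<in> \<int>" "x \<in> \<int>" "n < x" "x < n + 1"
  obtain i j where ij: "n = of_int i" "x = of_int j" using h by (elim Ints_cases) auto
  have "of_int i < (of_int j :: real)" "of_int j < (of_int (i + 1) :: real)" using h ij by simp_all
  then have "i < j" "j < i + 1" by (simp_all only: of_int_less_iff)
  then show False by simp
qed

lemma Ints_less: "n \<in> \<int> \<Longrightarrow> x \<in> \<int> \<Longrightarrow> n < x \<Longrightarrow> n + 1 \<le> x" for n x :: real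
  using Ints_between not_less by blast

text \<open>\<open>PR t\<close> and \<open>PL t\<close> record the signs of the slopes of \<open>h\<close> to the right and to the left of \<open>t\<close>;
  slope zero may carry either sign.\<close>

locale signed =
  fixes h :: "real \<Rightarrow> real" and PR PL :: "real \<Rightarrow> bool"
  assumes cont: "continuous_on {0..1} h"
    and R: "0 \<le> t \<Longrightarrow> t < 1 \<Longrightarrow> \<exists>e>0. \<forall>u. t < u \<longrightarrow> u < t + e \<longrightarrow>
      u < 1 \<and> PR u = PR t \<and> PL u = PR t \<and> (PR t \<longrightarrow> h t \<le> h u) \<and> (\<not> PR t \<longrightarrow> h u \<le> h t)"
    and L: "0 < t \<Longrightarrow> t \<le> 1 \<Longrightarrow> \<exists>e>0. \<forall>u. t - e < u \<longrightarrow> u < t \<longrightarrow>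
      0 < u \<and> PR u = PL t \<and> PL u = PL t \<and> (PL t \<longrightarrow> h u \<le> h t) \<and> (\<not> PL t \<longrightarrow> h t \<le> h u)"
    and turn: "0 < t \<Longrightarrow> t < 1 \<Longrightarrow> h t \<notin> \<int> \<Longrightarrow> PR t \<Longrightarrow> PL t"
    and ends: "h 0 \<in> \<int>" "h 1 \<in> \<int>"
begin

lemma cont_sub: "0 \<le> a \<Longrightarrow> b \<le> 1 \<Longrightarrow> continuous_on {a..b} h"
  by (rule continuous_on_subset[OF cont]) auto

lemma rise:
  assumes "\<And>t. a \<le> t \<Longrightarrow> t < b \<Longrightarrow> PR t" "0 \<le> a" "b \<le> 1" "a \<le> x" "x \<le> y" "y \<le> b"
  shows "h x \<le> h y"
proof (rule mono_right[OF cont_sub])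
  fix t assume "x \<le> t" "t < y"
  then have "0 \<le> t" "t < 1" "PR t" using assms by auto
  then show "\<exists>e>0. \<forall>u. t < u \<longrightarrow> u < t + e \<longrightarrow> h t \<le> h u" using R[of t] by blast
qed (use assms in auto)

lemma fall:
  assumes "\<And>t. a \<le> t \<Longrightarrow> t < b \<Longrightarrow> \<not> PR t" "0 \<le> a" "b \<le> 1" "a \<le> x" "x \<le> y" "y \<le> b"
  shows "h y \<le> h x"
proof -
  have "- h x \<le> - h y"
  proof (rule mono_right[where h = "\<lambda>t. - h t"])
    show "continuous_on {x..y} (\<lambda>t. - h t)" using cont_sub[of x y] assms by (intro continuous_intros) auto
    fix t assume "x \<le> t" "t < y"
    then have "0 \<le> t" "t < 1" "\<not> PR t" using assms by auto
    then show "\<exists>e>0. \<forall>u. t < u \<longrightarrow> u < t + e \<longrightarrow> - h t \<le> - h u"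
      using R[of t] by (metis neg_le_iff_le)
  qed (use assms in auto)
  then show ?thesis by simp
qed

lemma PL_of_PR:
  assumes "0 \<le> a" "a < t" "t \<le> 1" "\<And>u. a \<le> u \<Longrightarrow> u < t \<Longrightarrow> PR u = b" shows "PL t = b"
proof -
  obtain e where e: "e > 0" "\<forall>u. t - e < u \<longrightarrow> u < t \<longrightarrow> PR u = PL t" using L[of t] assms by fastforce
  define u where "u = max a (t - e / 2)"
  have "t - e < u" "u < t" "a \<le> u" using e assms by (auto simp: u_def max_def)
  then show ?thesis using e(2) assms(4) by blast
qed

text \<open>The positive signs are followed to the left as far as they reach. Where they end inside
  the interval the sign turns from negative to positive, and \<open>turn\<close> permits that only
  at an integral value.\<close>

lemma rise_left:
  assumes "0 < b" "b \<le> 1" "PL b"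
  shows "\<exists>a. 0 \<le> a \<and> a < b \<and> (\<forall>t. a \<le> t \<longrightarrow> t < b \<longrightarrow> PR t) \<and> (a = 0 \<or> \<not> PL a) \<and> h a \<in> \<int>"
proof -
  define S where "S = {a. 0 \<le> a \<and> a < b \<and> (\<forall>t. a \<le> t \<longrightarrow> t < b \<longrightarrow> PR t)}"
  obtain e where e: "e > 0" "\<forall>u. b - e < u \<longrightarrow> u < b \<longrightarrow> 0 < u \<and> PR u = PL b"
    using L[of b] assms by blast
  have "max 0 (b - e / 2) \<in> S"
    using e assms by (auto simp: S_def)
  then have ne: "S \<noteq> {}" by blast
  have bd: "bdd_below S" by (rule bdd_belowI[of _ 0]) (auto simp: S_def)
  define c where "c = Inf S"
  have c0: "0 \<le> c" unfolding c_def using ne by (intro cInf_greatest) (auto simp: S_def)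
  have cb: "c < b" unfolding c_def using ne cInf_lower[OF _ bd] by (fastforce simp: S_def)
  have gt: "PR t" if t: "c < t" "t < b" for t
  proof -
    obtain a where "a \<in> S" "a < t" using t(1) cInf_lessD[OF ne] unfolding c_def by blast
    then show ?thesis using t by (auto simp: S_def)
  qed
  obtain f where f: "f > 0" "\<forall>u. c < u \<longrightarrow> u < c + f \<longrightarrow> PR u = PR c" using R[of c] c0 cb assms by fastforce
  have "c < min ((c + b) / 2) (c + f / 2)" "min ((c + b) / 2) (c + f / 2) < c + f" "min ((c + b) / 2) (c + f / 2) < b"
    using f cb by (auto simp: min_def)
  then have pc: "PR c" using f(2) gt by blast
  have all: "\<forall>t. c \<le> t \<longrightarrow> t < b \<longrightarrow> PR t" using gt pc by (auto simp: le_less)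
  have nPL: "c = 0 \<or> \<not> PL c"
  proof (rule ccontr)
    assume "\<not> ?thesis"
    then have c: "0 < c" "PL c" using c0 by auto
    obtain g where g: "g > 0" "\<forall>u. c - g < u \<longrightarrow> u < c \<longrightarrow> PR u = PL c" using L[of c] c cb assms by fastforce
    have "PR t" if "max 0 (c - g / 2) \<le> t" "t < b" for t
    proof (cases "t < c")
      case True
      then have "PR t = PL c" using g that by auto
      then show ?thesis using c by simp
    qed (use all that in auto)
    then have "max 0 (c - g / 2) \<in> S" using c cb g by (auto simp: S_def)
    then have "c \<le> max 0 (c - g / 2)" unfolding c_def by (rule cInf_lower[OF _ bd])
    then show False using g c by (auto simp: max_def split: if_splits)
  qed
  moreover have "h c \<in> \<int>" using nPL turn[of c] pc cb assms c0 ends(1) by (cases "c = 0") auto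
  ultimately show ?thesis using c0 cb all by blast
qed

lemma fall_right:
  assumes "0 \<le> b" "b < 1" "\<not> PR b"
  shows "\<exists>c. b < c \<and> c \<le> 1 \<and> (\<forall>t. b \<le> t \<longrightarrow> t < c \<longrightarrow> \<not> PR t) \<and> h c \<in> \<int>"
proof -
  define S where "S = {c. b < c \<and> c \<le> 1 \<and> (\<forall>t. b \<le> t \<longrightarrow> t < c \<longrightarrow> \<not> PR t)}"
  have ext: "\<exists>c'>c. c' \<le> 1 \<and> (\<forall>t. c \<le> t \<longrightarrow> t < c' \<longrightarrow> \<not> PR t)" if c: "0 \<le> c" "c < 1" "\<not> PR c" for c
  proof -
    obtain e where e: "e > 0" "\<forall>u. c < u \<longrightarrow> u < c + e \<longrightarrow> u < 1 \<and> PR u = PR c"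
      using R[of c] c by blast
    have "\<not> PR t" if "c \<le> t" "t < min 1 (c + e)" for t
      using e that c(3) by (cases "t = c") auto
    moreover have "c < min 1 (c + e)" using e c by simp
    ultimately show ?thesis by (intro exI[of _ "min 1 (c + e)"]) auto
  qed
  have ne: "S \<noteq> {}" using ext[of b] assms unfolding S_def by blast
  have bd: "bdd_above S" by (rule bdd_aboveI[of _ 1]) (auto simp: S_def)
  define c where "c = Sup S"
  have c1: "c \<le> 1" unfolding c_def using ne by (intro cSup_least) (auto simp: S_def)
  obtain y where "y \<in> S" using ne by blast
  then have bc: "b < c" using cSup_upper[OF _ bd, of y] by (auto simp: S_def c_def)
  have lt: "\<not> PR t" if t: "b \<le> t" "t < c" for t
  proof -
    obtain y where "y \<in> S" "t < y" using t(2) less_cSupD[OF ne] unfolding c_def by blast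
    then show ?thesis using t by (auto simp: S_def)
  qed
  have nPL: "\<not> PL c" using PL_of_PR[of b c False] assms bc c1 lt by blast
  have "h c \<in> \<int>"
  proof (cases "c = 1")
    case True
    then show ?thesis using ends by simp
  next
    case False
    have "PR c"
    proof (rule ccontr)
      assume "\<not> PR c"
      then obtain c' where c': "c' > c" "c' \<le> 1" "\<forall>t. c \<le> t \<longrightarrow> t < c' \<longrightarrow> \<not> PR t"
        using ext[of c] False c1 bc assms by auto
      have "\<not> PR t" if "b \<le> t" "t < c'" for t
        using lt[of t] c'(3) that by (cases "t < c") auto
      then have "c' \<in> S" using c' bc unfolding S_def by auto
      then show False using cSup_upper[OF _ bd, of c'] c'(1) by (simp add: c_def)
    qed
    then show ?thesis using nPL turn[of c] bc c1 False assms by auto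
  qed
  then show ?thesis using bc c1 lt by blast
qed

text \<open>By \<open>turn\<close> a point with non-integral value is not a turning point from
  falling to rising, so from it the function goes down on at least one side until an integral value
  is met.\<close>

lemma dip:
  assumes "0 \<le> u" "u \<le> 1" "h u \<notin> \<int>"
  shows "(\<exists>a. 0 \<le> a \<and> a < u \<and> h a \<in> \<int> \<and> (\<forall>x y. a \<le> x \<longrightarrow> x \<le> y \<longrightarrow> y \<le> u \<longrightarrow> h x \<le> h y))
    \<or> (\<exists>c. u < c \<and> c \<le> 1 \<and> h c \<in> \<int> \<and> h c \<le> h u)"
proof -
  have u: "0 < u" "u < 1" using assms ends by (auto simp: less_le)
  show ?thesis
  proof (cases "PL u")
    case True
    then obtain a where a: "0 \<le> a" "a < u" "\<forall>t. a \<le> t \<longrightarrow> t < u \<longrightarrow> PR t" "h a \<in> \<int>"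
      using rise_left[of u] u by auto
    then show ?thesis using rise[of a u] assms by blast
  next
    case False
    then have "\<not> PR u" using turn[of u] u assms by blast
    then obtain c where c: "u < c" "c \<le> 1" "\<forall>t. u \<le> t \<longrightarrow> t < c \<longrightarrow> \<not> PR t" "h c \<in> \<int>"
      using fall_right[of u] u by auto
    then have "h c \<le> h u" using fall[of u c u c] u by auto
    then show ?thesis using c by blast
  qed
qed

lemma bdd: "\<exists>B. \<forall>t\<in>{0..1}. h t \<le> B"
  using continuous_attains_sup[of "{0..1}" h] cont by fastforce

text \<open>If the absolute minimum had a non-integral value, \<open>dip\<close> would exhibit an
  integral value that is no larger, hence equal.\<close>

lemma mn: shows mn_int: "mn h \<in> \<int>" and mn_le: "t \<in> {0..1} \<Longrightarrow> mn h \<le> h t"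
  and mn_att: "\<exists>t\<in>{0..1}. h t = mn h"
proof -
  obtain t0 where t0: "t0 \<in> {0..1}" "\<And>t. t \<in> {0..1} \<Longrightarrow> h t0 \<le> h t"
    using continuous_attains_inf[of "{0..1}" h] cont by fastforce
  have i: "h t0 \<in> \<int>"
  proof (rule ccontr)
    assume n: "h t0 \<notin> \<int>"
    have "\<exists>a\<in>{0..1}. h a \<in> \<int> \<and> h a \<le> h t0" using dip[of t0] n t0(1) by fastforce
    then obtain a where "a \<in> {0..1}" "h a \<in> \<int>" "h a \<le> h t0" by blast
    then have "h a = h t0" using t0(2) by (simp add: order.antisym)
    then show False using n \<open>h a \<in> \<int>\<close> by simp
  qed
  obtain B where "\<forall>t\<in>{0..1}. h t \<le> B" using bdd by blast
  then have "mn h = h t0" using mnI[OF i t0(1)] t0(2) by blast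
  then show "mn h \<in> \<int>" "t \<in> {0..1} \<Longrightarrow> mn h \<le> h t" "\<exists>t\<in>{0..1}. h t = mn h" using i t0 by auto
qed

lemma fpl: shows fpl_mem: "fpl h \<in> {0..1}" and fpl_val: "h (fpl h) = mn h"
  and fpl_gt: "fpl h < t \<Longrightarrow> t \<le> 1 \<Longrightarrow> mn h < h t"
proof -
  let ?S = "{t\<in>{0..1}. h t = mn h}"
  have cl: "closed ?S" by (rule closed_level[OF cont])
  have ne: "?S \<noteq> {}" using mn_att by blast
  have bd: "bdd_above ?S" by (rule bdd_aboveI[of _ 1]) auto
  have in': "fpl h \<in> ?S" unfolding fpl_def by (rule closed_contains_Sup[OF ne bd cl])
  then show "fpl h \<in> {0..1}" "h (fpl h) = mn h" by auto
  show "mn h < h t" if "fpl h < t" "t \<le> 1"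
  proof -
    have t: "t \<in> {0..1}" using that in' by auto
    have "h t \<noteq> mn h" using cSup_upper[OF _ bd, of t] that(1) t unfolding fpl_def by auto
    then show ?thesis using mn_le[OF t] by simp
  qed
qed

lemma fpl_1: "fpl h = 1 \<longleftrightarrow> h 1 = mn h"
  using fpl_val fpl_mem fpl_gt[of 1] by fastforce

lemma fmi:
  assumes "h 1 \<noteq> mn h"
  shows fpl_less: "fpl h < fmi h" and fmi_le: "fmi h \<le> 1" and fmi_val: "h (fmi h) = mn h + 1"
    and fmi_btw: "fpl h < t \<Longrightarrow> t < fmi h \<Longrightarrow> mn h < h t \<and> h t < mn h + 1"
proof -
  let ?S = "{t\<in>{fpl h..1}. h t = mn h + 1}"
  have f: "0 \<le> fpl h" "fpl h < 1" using fpl_mem fpl_1 assms by (auto simp: less_le)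
  have ct: "continuous_on {fpl h..1} h" using cont_sub f by simp
  have cl: "closed ?S" by (rule closed_level[OF ct])
  have "mn h < h 1" using fpl_gt f by simp
  then have h1: "mn h + 1 \<le> h 1" using Ints_less mn_int ends by blast
  have ivt: "\<exists>x\<in>{fpl h..t}. h x = mn h + 1" if "fpl h \<le> t" "t \<le> 1" "mn h + 1 \<le> h t" for t
    using IVT'[of h "fpl h" "mn h + 1" t] fpl_val that continuous_on_subset[OF ct, of "{fpl h..t}"] by fastforce
  have ne: "?S \<noteq> {}" using ivt[of 1] f h1 by fastforce
  have bd: "bdd_below ?S" by (rule bdd_belowI[of _ "fpl h"]) auto
  have in': "fmi h \<in> ?S" unfolding fmi_def by (rule closed_contains_Inf[OF ne bd cl])
  then show "fmi h \<le> 1" "h (fmi h) = mn h + 1" by auto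
  then have "fpl h \<noteq> fmi h" using fpl_val by auto
  then show "fpl h < fmi h" using in' by auto
  show "mn h < h t \<and> h t < mn h + 1" if t: "fpl h < t" "t < fmi h"
  proof
    have t1: "t \<le> 1" using t in' by auto
    show "mn h < h t" using fpl_gt t t1 by simp
    show "h t < mn h + 1"
    proof (rule ccontr)
      assume "\<not> h t < mn h + 1"
      then obtain x where x: "x \<in> {fpl h..t}" "h x = mn h + 1" using ivt[of t] t t1 by auto
      then have "x \<in> ?S" using t1 by auto
      then have "fmi h \<le> x" unfolding fmi_def by (rule cInf_lower[OF _ bd])
      then show False using x t by auto
    qed
  qed
qed

text \<open>At \<open>fpl h\<close> a falling sign contradicts that this is the last minimum. Later
  it would lead, by \<open>fall_right\<close>, down to an integral value strictly between
  \<open>mn h\<close> and \<open>mn h + 1\<close>.\<close>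

lemma PR_fseg:
  assumes "h 1 \<noteq> mn h" "fpl h \<le> t" "t < fmi h"
  shows "PR t"
proof (rule ccontr)
  assume n: "\<not> PR t"
  have t: "0 \<le> t" "t < 1" using assms fpl_mem fmi_le by auto
  show False
  proof (cases "t = fpl h")
    case True
    obtain e where e: "e > 0" "\<forall>u. t < u \<longrightarrow> u < t + e \<longrightarrow> u < 1 \<and> h u \<le> h t" using R[OF t] n by blast
    then have "t < t + e / 2" "t + e / 2 < t + e" by auto
    then have "t + e / 2 < 1 \<and> h (t + e / 2) \<le> h t" using e(2) by blast
    moreover from this have "mn h < h (t + e / 2)" using fpl_gt[of "t + e / 2"] True e(1) by auto
    ultimately show False using True fpl_val by auto
  next
    case False
    obtain c where c: "t < c" "c \<le> 1" "\<forall>u. t \<le> u \<longrightarrow> u < c \<longrightarrow> \<not> PR u" "h c \<in> \<int>"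
      using fall_right[OF t n] by blast
    have "h c \<le> h t" using fall[of t c t c] c t by auto
    moreover have "h t < mn h + 1" using fmi_btw[of t] assms False by auto
    moreover have "mn h < h c" using fpl_gt[of c] c assms by auto
    ultimately show False using Ints_between[OF mn_int c(4)] by linarith
  qed
qed

text \<open>A smaller value would be non-integral. Applied to it, \<open>dip\<close> yields an
  integral value strictly between \<open>mn h\<close> and \<open>mn h + 1\<close>, or a monotone
  rise that starts at or before \<open>fmi h\<close> and so cannot end below
  \<open>mn h + 1\<close>.\<close>

lemma after_fmi:
  assumes "h 1 \<noteq> mn h" "fmi h \<le> t" "t \<le> 1"
  shows "mn h + 1 \<le> h t"
proof (rule ccontr)
  assume n: "\<not> mn h + 1 \<le> h t"
  have ft: "fpl h < t" using assms fpl_less by auto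
  have lo: "mn h < h t" using fpl_gt ft assms by simp
  have ni: "h t \<notin> \<int>" using Ints_between[OF mn_int, of "h t"] lo n by auto
  have t0: "0 \<le> t" using ft fpl_mem by auto
  from dip[OF t0 assms(3) ni] show False
  proof
    assume "\<exists>a. 0 \<le> a \<and> a < t \<and> h a \<in> \<int> \<and> (\<forall>x y. a \<le> x \<longrightarrow> x \<le> y \<longrightarrow> y \<le> t \<longrightarrow> h x \<le> h y)"
    then obtain a where a: "0 \<le> a" "a < t" "h a \<in> \<int>" "\<forall>x y. a \<le> x \<longrightarrow> x \<le> y \<longrightarrow> y \<le> t \<longrightarrow> h x \<le> h y" by blast
    show False
    proof (cases "a \<le> fmi h")
      case True
      then have "h (fmi h) \<le> h t" using a(4) assms by auto
      then show False using n fmi_val assms by simp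
    next
      case False
      then have "mn h < h a" using fpl_gt[of a] fpl_less assms a by auto
      moreover have "h a \<le> h t" using a by auto
      ultimately show False using Ints_between[OF mn_int a(3)] n by linarith
    qed
  next
    assume "\<exists>c. t < c \<and> c \<le> 1 \<and> h c \<in> \<int> \<and> h c \<le> h t"
    then obtain c where c: "t < c" "c \<le> 1" "h c \<in> \<int>" "h c \<le> h t" by blast
    then have "mn h < h c" using fpl_gt ft by auto
    then show False using Ints_between[OF mn_int c(3)] n c(4) by linarith
  qed
qed

text \<open>Flat pieces carry signs too, so the interval whose labels f reflects may have to begin
  before \<open>fpl h\<close>: it is extended to the left over the plateau of the minimum while the
  sign is positive. The sign at \<open>p\<close> is then the one needed to reflect the germ
  there.\<close>

lemma fseg_start:
  assumes h1: "h 1 \<noteq> mn h"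
  shows "\<exists>p. 0 \<le> p \<and> p \<le> fpl h \<and> (\<forall>t. p \<le> t \<longrightarrow> t \<le> fpl h \<longrightarrow> h t = mn h) \<and> (\<forall>t. p \<le> t \<longrightarrow> t < fmi h \<longrightarrow> PR t)
    \<and> (\<forall>t. p < t \<longrightarrow> t \<le> fmi h \<longrightarrow> PL t) \<and> (p = 0 \<or> \<not> PL p)"
proof -
  have f: "0 \<le> fpl h" "fpl h < 1" "fpl h < fmi h" "fmi h \<le> 1"
    using fpl_mem fpl_1 fpl_less fmi_le h1 by (auto simp: less_le)
  have "\<exists>p. 0 \<le> p \<and> p \<le> fpl h \<and> (\<forall>t. p \<le> t \<longrightarrow> t \<le> fpl h \<longrightarrow> h t = mn h) \<and> (\<forall>t. p \<le> t \<longrightarrow> t < fmi h \<longrightarrow> PR t)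
     \<and> (p = 0 \<or> \<not> PL p)"
  proof (cases "fpl h = 0 \<or> \<not> PL (fpl h)")
    case True
    then show ?thesis using PR_fseg[OF h1] fpl_val f by (intro exI[of _ "fpl h"]) auto
  next
    case False
    then obtain a where a: "0 \<le> a" "a < fpl h" "\<forall>t. a \<le> t \<longrightarrow> t < fpl h \<longrightarrow> PR t" "a = 0 \<or> \<not> PL a"
      using rise_left[of "fpl h"] f by auto
    have "h t = mn h" if "a \<le> t" "t \<le> fpl h" for t
      using rise[of a "fpl h" t "fpl h"] a that f fpl_val mn_le[of t] by auto
    moreover have "PR t" if "a \<le> t" "t < fmi h" for t
      using a(3) PR_fseg[OF h1, of t] that by (cases "t < fpl h") auto
    ultimately show ?thesis using a by (intro exI[of _ a]) auto
  qed
  then obtain p where p: "0 \<le> p" "p \<le> fpl h" "\<forall>t. p \<le> t \<longrightarrow> t \<le> fpl h \<longrightarrow> h t = mn h"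
    "\<forall>t. p \<le> t \<longrightarrow> t < fmi h \<longrightarrow> PR t" "p = 0 \<or> \<not> PL p" by blast
  moreover have "PL t" if "p < t" "t \<le> fmi h" for t
    using PL_of_PR[of p t True] p f that by auto
  ultimately show ?thesis by blast
qed

text \<open>This closed form avoids the times \<open>fpl h\<close> and \<open>fmi h\<close>, which
  jump when \<open>h\<close> varies. Lipschitz dependence on \<open>h\<close> and monotonicity in
  \<open>t\<close> are read off from it.\<close>

lemma fphi_Inf:
  assumes "h 1 \<noteq> mn h" "t \<in> {0..1}"
  shows "fphi h t = min 1 (Inf (h ` {t..1}) - mn h)"
proof -
  note F = fpl_mem fpl_less[OF assms(1)] fmi_le[OF assms(1)]
  have "Inf (h ` {t..1}) = mn h" if "t \<le> fpl h"
  proof (rule cInf_eq_minimum)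
    show "mn h \<in> h ` {t..1}" using that F fpl_val by (force intro!: image_eqI[of _ _ "fpl h"])
  qed (use mn_le assms in auto)
  moreover have "Inf (h ` {t..1}) = h t" if "fpl h < t" "t \<le> fmi h"
  proof (rule cInf_eq_minimum)
    show "h t \<in> h ` {t..1}" using assms by auto
    fix x assume "x \<in> h ` {t..1}"
    then obtain u where u: "x = h u" "t \<le> u" "u \<le> 1" by auto
    have up: "h x \<le> h y" if "t \<le> x" "x \<le> y" "y \<le> fmi h" for x y
      using rise[of "fpl h" "fmi h" x y] PR_fseg[OF assms(1)] F that \<open>fpl h < t\<close> by auto
    show "h t \<le> x"
    proof (cases "u \<le> fmi h")
      case True
      then show ?thesis using up u by simp
    next
      case False
      then have "h t \<le> h (fmi h)" "mn h + 1 \<le> h u" using up that after_fmi[OF assms(1)] u by auto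
      then show ?thesis using fmi_val[OF assms(1)] u by simp
    qed
  qed
  moreover have "mn h + 1 \<le> Inf (h ` {t..1})" if "fmi h < t"
    by (rule cInf_greatest) (use that after_fmi[OF assms(1)] assms in auto)
  moreover have "h t \<le> mn h + 1" if "fpl h < t" "t \<le> fmi h"
    using fmi_btw[OF assms(1), of t] fmi_val[OF assms(1)] that by (cases "t = fmi h") auto
  ultimately show ?thesis unfolding fphi_def by (auto simp: min_def)
qed

text \<open>The factor 2 is the diagonal entry: on the moving segment \<open>h\<close> is reflected
  at the level \<open>mn h\<close>. The new minimum is first reached at \<open>fmi h\<close>, so e
  will act on the same segment and undo f.\<close>

lemma f_transform:
  assumes h1: "h 1 \<noteq> mn h"
  defines "g \<equiv> \<lambda>t. h t - 2 * fphi h t"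
  shows "mn g = mn h - 1" "epl g = fmi h" "emi g = fpl h" "t \<in> {0..1} \<Longrightarrow> epsi g t = fphi h t" "g 0 \<noteq> mn g"
proof -
  note F = fpl_mem fpl_val fpl_less[OF h1] fmi_le[OF h1] fmi_val[OF h1]
  have g1: "t \<le> fpl h \<Longrightarrow> g t = h t" and g2: "fpl h < t \<Longrightarrow> t \<le> fmi h \<Longrightarrow> g t = 2 * mn h - h t"
    and g3: "fmi h < t \<Longrightarrow> g t = h t - 2" for t
    using F by (auto simp: g_def fphi_def)
  have btw: "mn h < h t \<and> h t \<le> mn h + 1" if "fpl h < t" "t \<le> fmi h" for t
    using fmi_btw[OF h1, of t] F that by (cases "t = fmi h") auto
  have ge: "mn h - 1 < g t" if "t \<in> {0..1}" "t < fmi h" for t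
    using that mn_le[of t] g1[of t] g2[of t] fmi_btw[OF h1, of t] by (cases "t \<le> fpl h") auto
  have ge': "mn h - 1 \<le> g t" if "t \<in> {0..1}" for t
    using that ge[of t] g3[of t] g2[of "fmi h"] after_fmi[OF h1, of t] F by (cases t "fmi h" rule: linorder_cases) auto
  have gf: "g (fmi h) = mn h - 1" using g2[of "fmi h"] F by simp
  obtain B where B: "\<forall>t\<in>{0..1}. h t \<le> B" using bdd by blast
  have gB: "g t \<le> B" if "t \<in> {0..1}" for t
  proof -
    have "0 \<le> fphi h t" using btw[of t] by (auto simp: fphi_def)
    then show ?thesis using B that by (force simp: g_def)
  qed
  show m: "mn g = mn h - 1"
    by (rule mnI[of _ "fmi h"]) (use mn_int gf ge' gB F in auto)
  show ep: "epl g = fmi h" unfolding epl_def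
  proof (rule cInf_eq_minimum)
    show "fmi h \<in> {t \<in> {0..1}. g t = mn g}" using m gf F by auto
    fix x assume "x \<in> {t \<in> {0..1}. g t = mn g}"
    then show "fmi h \<le> x" using ge[of x] m by force
  qed
  show em: "emi g = fpl h" unfolding emi_def ep
  proof (rule cSup_eq_maximum)
    show "fpl h \<in> {t \<in> {0..fmi h}. g t = mn g + 1}" using m g1[of "fpl h"] F by auto
    fix x assume "x \<in> {t \<in> {0..fmi h}. g t = mn g + 1}"
    then show "x \<le> fpl h" using g2[of x] btw[of x] m by force
  qed
  show "epsi g t = fphi h t" if "t \<in> {0..1}"
    using g2[of t] by (auto simp: epsi_def ep em m fphi_def)
  show "g 0 \<noteq> mn g" using g1[of 0] F mn_le[of 0] m by auto
qed

text \<open>Time reversal exchanges left and right and negates slopes. It turns every statement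
  about f into one about e.\<close>

lemma rev: "signed (\<lambda>t. h (1 - t)) (\<lambda>t. \<not> PL (1 - t)) (\<lambda>t. \<not> PR (1 - t))"
proof
  show "continuous_on {0..1} (\<lambda>t. h (1 - t))"
    by (rule continuous_on_compose2[OF cont]) (auto intro!: continuous_intros)
  fix t :: real
  show "\<exists>e>0. \<forall>u. t < u \<longrightarrow> u < t + e \<longrightarrow> u < 1 \<and> (\<not> PL (1 - u)) = (\<not> PL (1 - t)) \<and> (\<not> PR (1 - u)) = (\<not> PL (1 - t))
     \<and> (\<not> PL (1 - t) \<longrightarrow> h (1 - t) \<le> h (1 - u)) \<and> (\<not> \<not> PL (1 - t) \<longrightarrow> h (1 - u) \<le> h (1 - t))" if t: "0 \<le> t" "t < 1"
  proof -
    obtain e where e: "e > 0" "\<forall>u. (1 - t) - e < u \<longrightarrow> u < 1 - t \<longrightarrow>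
      0 < u \<and> PR u = PL (1 - t) \<and> PL u = PL (1 - t) \<and> (PL (1 - t) \<longrightarrow> h u \<le> h (1 - t)) \<and> (\<not> PL (1 - t) \<longrightarrow> h (1 - t) \<le> h u)"
      using L[of "1 - t"] t by auto
    show ?thesis
    proof (intro exI[of _ e] conjI allI impI e(1))
      fix u assume "t < u" "u < t + e"
      then have "(1 - t) - e < 1 - u" "1 - u < 1 - t" by auto
      note this = e(2)[rule_format, OF this]
      then show "u < 1" "(\<not> PL (1 - u)) = (\<not> PL (1 - t))" "(\<not> PR (1 - u)) = (\<not> PL (1 - t))"
        "\<not> PL (1 - t) \<Longrightarrow> h (1 - t) \<le> h (1 - u)" "\<not> \<not> PL (1 - t) \<Longrightarrow> h (1 - u) \<le> h (1 - t)" by auto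
    qed
  qed
  show "\<exists>e>0. \<forall>u. t - e < u \<longrightarrow> u < t \<longrightarrow> 0 < u \<and> (\<not> PL (1 - u)) = (\<not> PR (1 - t)) \<and> (\<not> PR (1 - u)) = (\<not> PR (1 - t))
     \<and> (\<not> PR (1 - t) \<longrightarrow> h (1 - u) \<le> h (1 - t)) \<and> (\<not> \<not> PR (1 - t) \<longrightarrow> h (1 - t) \<le> h (1 - u))" if t: "0 < t" "t \<le> 1"
  proof -
    obtain e where e: "e > 0" "\<forall>u. 1 - t < u \<longrightarrow> u < (1 - t) + e \<longrightarrow>
      u < 1 \<and> PR u = PR (1 - t) \<and> PL u = PR (1 - t) \<and> (PR (1 - t) \<longrightarrow> h (1 - t) \<le> h u) \<and> (\<not> PR (1 - t) \<longrightarrow> h u \<le> h (1 - t))"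
      using R[of "1 - t"] t by auto
    show ?thesis
    proof (intro exI[of _ e] conjI allI impI e(1))
      fix u assume "t - e < u" "u < t"
      then have "1 - t < 1 - u" "1 - u < (1 - t) + e" by auto
      note this = e(2)[rule_format, OF this]
      then show "0 < u" "(\<not> PL (1 - u)) = (\<not> PR (1 - t))" "(\<not> PR (1 - u)) = (\<not> PR (1 - t))"
        "\<not> PR (1 - t) \<Longrightarrow> h (1 - u) \<le> h (1 - t)" "\<not> \<not> PR (1 - t) \<Longrightarrow> h (1 - t) \<le> h (1 - u)" by auto
    qed
  qed
  show "0 < t \<Longrightarrow> t < 1 \<Longrightarrow> h (1 - t) \<notin> \<int> \<Longrightarrow> \<not> PL (1 - t) \<Longrightarrow> \<not> PR (1 - t)" using turn[of "1 - t"] by auto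
qed (use ends in auto)

lemma mn_rev: "mn (\<lambda>t. h (1 - t)) = mn h"
proof -
  have "{x. \<exists>t\<in>{0..1}. x = h (1 - t) \<and> x \<in> \<int>} = {x. \<exists>t\<in>{0..1}. x = h t \<and> x \<in> \<int>}"
  proof (intro set_eqI iffI; clarsimp)
    fix t :: real assume t: "0 \<le> t" "t \<le> 1"
    show "h (1 - t) \<in> \<int> \<Longrightarrow> \<exists>u\<in>{0..1}. h (1 - t) = h u" using t by (intro bexI[of _ "1 - t"]) auto
    show "h t \<in> \<int> \<Longrightarrow> \<exists>u\<in>{0..1}. h t = h (1 - u)" using t by (intro bexI[of _ "1 - t"]) auto
  qed
  then show ?thesis by (simp add: mn_def)
qed

lemma epl_rev: "epl h = 1 - fpl (\<lambda>t. h (1 - t))"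
proof -
  interpret r: signed "\<lambda>t. h (1 - t)" "\<lambda>t. \<not> PL (1 - t)" "\<lambda>t. \<not> PR (1 - t)" by (rule rev)
  show ?thesis unfolding epl_def
  proof (rule cInf_eq_minimum)
    show "1 - fpl (\<lambda>t. h (1 - t)) \<in> {t \<in> {0..1}. h t = mn h}"
      using r.fpl_mem r.fpl_val by (auto simp: mn_rev)
    fix x assume x: "x \<in> {t \<in> {0..1}. h t = mn h}"
    show "1 - fpl (\<lambda>t. h (1 - t)) \<le> x"
      using r.fpl_gt[of "1 - x"] x by (force simp: mn_rev)
  qed
qed

lemma emi_rev: assumes "h 0 \<noteq> mn h" shows "emi h = 1 - fmi (\<lambda>t. h (1 - t))"
proof -
  interpret r: signed "\<lambda>t. h (1 - t)" "\<lambda>t. \<not> PL (1 - t)" "\<lambda>t. \<not> PR (1 - t)" by (rule rev)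
  have h1: "h (1 - 1) \<noteq> mn (\<lambda>t. h (1 - t))" using assms by (simp add: mn_rev)
  note F = r.fpl_mem r.fpl_val r.fpl_less[OF h1] r.fmi_le[OF h1] r.fmi_val[OF h1] r.fmi_btw[OF h1]
  show ?thesis unfolding emi_def
  proof (rule cSup_eq_maximum)
    show "1 - fmi (\<lambda>t. h (1 - t)) \<in> {t \<in> {0..epl h}. h t = mn h + 1}"
      using F(1-5) by (auto simp: mn_rev epl_rev)
    fix x assume x: "x \<in> {t \<in> {0..epl h}. h t = mn h + 1}"
    then have "fpl (\<lambda>t. h (1 - t)) \<le> 1 - x" "h x = mn h + 1" by (auto simp: epl_rev)
    then show "x \<le> 1 - fmi (\<lambda>t. h (1 - t))"
      using F(6)[of "1 - x"] F(2) by (cases "fpl (\<lambda>t. h (1 - t)) = 1 - x") (force simp: mn_rev)+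
  qed
qed

lemma epsi_rev:
  assumes "h 0 \<noteq> mn h" shows "epsi h t = 1 - fphi (\<lambda>t. h (1 - t)) (1 - t)"
proof -
  interpret r: signed "\<lambda>t. h (1 - t)" "\<lambda>t. \<not> PL (1 - t)" "\<lambda>t. \<not> PR (1 - t)" by (rule rev)
  have h1: "h (1 - 1) \<noteq> mn (\<lambda>t. h (1 - t))" using assms by (simp add: mn_rev)
  note F = r.fpl_val r.fpl_less[OF h1] r.fmi_val[OF h1]
  have v: "h (epl h) = mn h" "h (emi h) = mn h + 1" using F by (auto simp: epl_rev emi_rev[OF assms] mn_rev)
  have fp: "fpl (\<lambda>t. h (1 - t)) = 1 - epl h" and fm: "fmi (\<lambda>t. h (1 - t)) = 1 - emi h"
    by (simp_all add: epl_rev emi_rev[OF assms])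
  have "emi h < epl h" using F(2) fp fm by simp
  then show ?thesis
    unfolding epsi_def fphi_def mn_rev fp fm using v
    by (cases t "epl h" rule: linorder_cases; cases t "emi h" rule: linorder_cases) auto
qed

lemma e_facts:
  assumes "h 0 \<noteq> mn h"
  shows emi_ge: "0 \<le> emi h" and emi_less: "emi h < epl h" and epl_le: "epl h \<le> 1"
    and emi_val: "h (emi h) = mn h + 1" and epl_val: "h (epl h) = mn h"
    and e_btw: "emi h < t \<Longrightarrow> t < epl h \<Longrightarrow> mn h < h t \<and> h t < mn h + 1"
    and before_emi: "0 \<le> t \<Longrightarrow> t \<le> emi h \<Longrightarrow> mn h + 1 \<le> h t"
    and eseg_end: "\<exists>q. epl h \<le> q \<and> q \<le> 1 \<and> (\<forall>t. epl h \<le> t \<longrightarrow> t \<le> q \<longrightarrow> h t = mn h)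
      \<and> (\<forall>t. emi h \<le> t \<longrightarrow> t < q \<longrightarrow> \<not> PR t) \<and> (\<forall>t. emi h < t \<longrightarrow> t \<le> q \<longrightarrow> \<not> PL t) \<and> (q = 1 \<or> PR q)"
proof -
  interpret r: signed "\<lambda>t. h (1 - t)" "\<lambda>t. \<not> PL (1 - t)" "\<lambda>t. \<not> PR (1 - t)" by (rule rev)
  have h1: "h (1 - 1) \<noteq> mn (\<lambda>t. h (1 - t))" using assms by (simp add: mn_rev)
  note F = r.fpl_mem r.fpl_val r.fpl_less[OF h1] r.fmi_le[OF h1] r.fmi_val[OF h1]
  show "0 \<le> emi h" "emi h < epl h" "epl h \<le> 1" "h (emi h) = mn h + 1" "h (epl h) = mn h"
    using F by (auto simp: epl_rev emi_rev[OF assms] mn_rev)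
  show "mn h < h t \<and> h t < mn h + 1" if "emi h < t" "t < epl h"
    using r.fmi_btw[OF h1, of "1 - t"] that by (auto simp: epl_rev emi_rev[OF assms] mn_rev)
  show "mn h + 1 \<le> h t" if "0 \<le> t" "t \<le> emi h"
    using r.after_fmi[OF h1, of "1 - t"] that by (auto simp: emi_rev[OF assms] mn_rev)
  obtain p where p: "0 \<le> p" "p \<le> fpl (\<lambda>t. h (1 - t))"
    "\<And>t. p \<le> t \<Longrightarrow> t \<le> fpl (\<lambda>t. h (1 - t)) \<Longrightarrow> h (1 - t) = mn h"
    "\<And>t. p \<le> t \<Longrightarrow> t < fmi (\<lambda>t. h (1 - t)) \<Longrightarrow> \<not> PL (1 - t)"
    "\<And>t. p < t \<Longrightarrow> t \<le> fmi (\<lambda>t. h (1 - t)) \<Longrightarrow> \<not> PR (1 - t)" "p = 0 \<or> PR (1 - p)"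
    using r.fseg_start[OF h1] by (auto simp: mn_rev)
  show "\<exists>q. epl h \<le> q \<and> q \<le> 1 \<and> (\<forall>t. epl h \<le> t \<longrightarrow> t \<le> q \<longrightarrow> h t = mn h)
      \<and> (\<forall>t. emi h \<le> t \<longrightarrow> t < q \<longrightarrow> \<not> PR t) \<and> (\<forall>t. emi h < t \<longrightarrow> t \<le> q \<longrightarrow> \<not> PL t) \<and> (q = 1 \<or> PR q)"
  proof (intro exI[of _ "1 - p"] conjI allI impI)
    show "epl h \<le> 1 - p" "1 - p \<le> 1" "1 - p = 1 \<or> PR (1 - p)" using p by (auto simp: epl_rev)
    fix t
    show "epl h \<le> t \<Longrightarrow> t \<le> 1 - p \<Longrightarrow> h t = mn h" using p(3)[of "1 - t"] by (simp add: epl_rev)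
    show "emi h \<le> t \<Longrightarrow> t < 1 - p \<Longrightarrow> \<not> PR t" using p(5)[of "1 - t"] by (simp add: emi_rev[OF assms])
    show "emi h < t \<Longrightarrow> t \<le> 1 - p \<Longrightarrow> \<not> PL t" using p(4)[of "1 - t"] by (simp add: emi_rev[OF assms])
  qed
qed

lemma epl_0: "epl h = 0 \<longleftrightarrow> h 0 = mn h"
proof
  show "epl h = 0 \<Longrightarrow> h 0 = mn h" using e_facts(2)[of] emi_ge by fastforce
  assume "h 0 = mn h"
  then show "epl h = 0" unfolding epl_def by (intro cInf_eq_minimum) auto
qed

lemma e_transform:
  assumes h0: "h 0 \<noteq> mn h"
  defines "g \<equiv> \<lambda>t. h t + 2 * epsi h t"
  shows "mn g = mn h + 1" "fpl g = emi h" "fmi g = epl h" "t \<in> {0..1} \<Longrightarrow> fphi g t = epsi h t" "g 1 \<noteq> mn g"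
proof -
  note F = emi_ge[OF h0] emi_less[OF h0] epl_le[OF h0] emi_val[OF h0] epl_val[OF h0]
  have g1: "t \<le> emi h \<Longrightarrow> g t = h t" and g2: "emi h < t \<Longrightarrow> t \<le> epl h \<Longrightarrow> g t = 2 * mn h + 2 - h t"
    and g3: "epl h < t \<Longrightarrow> g t = h t + 2" for t
    using F by (auto simp: g_def epsi_def)
  have btw: "mn h \<le> h t \<and> h t < mn h + 1" if "emi h < t" "t \<le> epl h" for t
    using e_btw[OF h0, of t] F that by (cases "t = epl h") auto
  have gt: "mn h + 1 < g t" if "emi h < t" "t \<le> 1" for t
    using that g2[of t] g3[of t] btw[of t] mn_le[of t] F by (cases "t \<le> epl h") auto
  have ge: "mn h + 1 \<le> g t" if "t \<in> {0..1}" for t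
    using that gt[of t] g1[of t] before_emi[OF h0, of t] by (cases "t \<le> emi h") auto
  have ge2: "mn h + 2 \<le> g t" if "epl h \<le> t" "t \<le> 1" for t
    using that g2[of t] g3[of t] F mn_le[of t] by (cases "t = epl h") auto
  obtain B where B: "\<forall>t\<in>{0..1}. h t \<le> B" using bdd by blast
  have gB: "g t \<le> B + 2" if "t \<in> {0..1}" for t
  proof -
    have "epsi h t \<le> 1" using btw[of t] by (auto simp: epsi_def)
    then show ?thesis using B that by (force simp: g_def)
  qed
  show m: "mn g = mn h + 1"
    by (rule mnI[of _ "emi h"]) (use mn_int g1[of "emi h"] ge gB F in auto)
  show fp: "fpl g = emi h" unfolding fpl_def
  proof (rule cSup_eq_maximum)
    show "emi h \<in> {t \<in> {0..1}. g t = mn g}" using m g1[of "emi h"] F by auto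
    fix x assume "x \<in> {t \<in> {0..1}. g t = mn g}"
    then show "x \<le> emi h" using gt[of x] m by force
  qed
  show fm: "fmi g = epl h" unfolding fmi_def fp
  proof (rule cInf_eq_minimum)
    show "epl h \<in> {t \<in> {emi h..1}. g t = mn g + 1}" using m g2[of "epl h"] F by auto
    fix x assume x: "x \<in> {t \<in> {emi h..1}. g t = mn g + 1}"
    show "epl h \<le> x"
    proof (rule ccontr)
      assume "\<not> epl h \<le> x"
      then show False using x g2[of x] e_btw[OF h0, of x] g1[of x] m F by (cases "x = emi h") auto
    qed
  qed
  show "fphi g t = epsi h t" if "t \<in> {0..1}"
    using g2[of t] by (auto simp: epsi_def fp fm m fphi_def)
  show "g 1 \<noteq> mn g" using gt[of 1] F m by auto
qed

end

lemma mn_lip: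
  assumes "signed h P Q" "signed h' P' Q'" "\<And>t. t \<in> {0..1} \<Longrightarrow> \<bar>h t - h' t\<bar> \<le> K"
  shows "\<bar>mn h - mn h'\<bar> \<le> K"
proof -
  interpret A: signed h P Q by fact
  interpret B: signed h' P' Q' by fact
  obtain t t' where "t \<in> {0..1}" "h t = mn h" "t' \<in> {0..1}" "h' t' = mn h'"
    using A.mn_att B.mn_att by blast
  then show ?thesis using assms(3)[of t] assms(3)[of t'] A.mn_le[of t'] B.mn_le[of t] by linarith
qed

text \<open>When the minima agree, the closed forms differ only in the infima of the two functions
  over the same interval.\<close>

lemma fphi_lip:
  assumes "signed h P Q" "signed h' P' Q'" "\<And>t. t \<in> {0..1} \<Longrightarrow> \<bar>h t - h' t\<bar> \<le> K"
    and m: "mn h = mn h'" "h 1 \<noteq> mn h" "h' 1 \<noteq> mn h'" and t: "t \<in> {0..1}"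
  shows "\<bar>fphi h t - fphi h' t\<bar> \<le> K"
proof -
  interpret A: signed h P Q by fact
  interpret B: signed h' P' Q' by fact
  have le: "Inf (f ` {t..1}) \<le> Inf (g ` {t..1}) + K"
    if "\<And>u. u \<in> {t..1} \<Longrightarrow> f u \<le> g u + K" "\<And>u. u \<in> {t..1} \<Longrightarrow> m \<le> f u" for f g :: "real \<Rightarrow> real" and m
  proof -
    have bd: "bdd_below (f ` {t..1})" by (rule bdd_belowI[of _ m]) (use that in auto)
    have "Inf (f ` {t..1}) - K \<le> Inf (g ` {t..1})"
    proof (rule cInf_greatest)
      fix x assume "x \<in> g ` {t..1}"
      then obtain u where u: "u \<in> {t..1}" "x = g u" by blast
      then have "Inf (f ` {t..1}) \<le> f u" by (intro cInf_lower bd) auto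
      then show "Inf (f ` {t..1}) - K \<le> x" using that(1)[OF u(1)] u by simp
    qed (use t in auto)
    then show ?thesis by simp
  qed
  have b: "h u \<le> h' u + K" "h' u \<le> h u + K" "mn h \<le> h u" "mn h' \<le> h' u" if "u \<in> {t..1}" for u
    using assms(3)[of u] A.mn_le[of u] B.mn_le[of u] t that by (auto simp: abs_le_iff)
  have "Inf (h ` {t..1}) \<le> Inf (h' ` {t..1}) + K"
    by (rule le[of _ _ "mn h"]) (use b in auto)
  moreover have "Inf (h' ` {t..1}) \<le> Inf (h ` {t..1}) + K"
    by (rule le[of _ _ "mn h'"]) (use b in auto)
  moreover have "0 \<le> K" using assms(3)[OF t] by linarith
  ultimately show ?thesis
    unfolding A.fphi_Inf[OF m(2) t] B.fphi_Inf[OF m(3) t] m(1) by (auto simp: min_def abs_le_iff)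
qed

lemma epsi_lip:
  assumes "signed h P Q" "signed h' P' Q'" "\<And>t. t \<in> {0..1} \<Longrightarrow> \<bar>h t - h' t\<bar> \<le> K"
    and m: "mn h = mn h'" "h 0 \<noteq> mn h" "h' 0 \<noteq> mn h'" and t: "t \<in> {0..1}"
  shows "\<bar>epsi h t - epsi h' t\<bar> \<le> K"
proof -
  interpret A: signed h P Q by fact
  interpret B: signed h' P' Q' by fact
  have "\<bar>fphi (\<lambda>t. h (1 - t)) (1 - t) - fphi (\<lambda>t. h' (1 - t)) (1 - t)\<bar> \<le> K"
    by (rule fphi_lip[OF A.rev B.rev]) (use assms(3) m t in \<open>auto simp: A.mn_rev B.mn_rev\<close>)
  then show ?thesis unfolding A.epsi_rev[OF m(2)] B.epsi_rev[OF m(3)] by simp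
qed

section \<open>Labelled paths and root operators\<close>

lemma continuous_on_locally_affine:
  fixes g :: "real \<Rightarrow> real"
  assumes R: "\<And>t. 0 \<le> t \<Longrightarrow> t < 1 \<Longrightarrow> \<exists>c. \<exists>e>0. \<forall>u. t < u \<longrightarrow> u < t + e \<longrightarrow> g u = g t + (u - t) * c"
    and L: "\<And>t. 0 < t \<Longrightarrow> t \<le> 1 \<Longrightarrow> \<exists>c. \<exists>e>0. \<forall>u. t - e < u \<longrightarrow> u < t \<longrightarrow> g u = g t - (t - u) * c"
  shows "continuous_on {0..1} g"
  unfolding continuous_on_iff
proof (intro ballI allI impI)
  fix t r :: real assume t: "t \<in> {0..1}" and r: "0 < r"
  have small: "\<bar>d * c\<bar> < r" if "\<bar>d\<bar> < r / (\<bar>c\<bar> + 1)" for d c :: real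
  proof -
    have "\<bar>d * c\<bar> \<le> \<bar>d\<bar> * (\<bar>c\<bar> + 1)" by (simp add: abs_mult mult_left_mono)
    also have "\<dots> < r" using that by (simp add: field_simps)
    finally show ?thesis .
  qed
  have right: "\<exists>k>0. \<forall>u. t < u \<longrightarrow> u < t + k \<longrightarrow> \<bar>g u - g t\<bar> < r" if t1: "t < 1"
  proof -
    obtain c e where e: "e > 0" "\<forall>u. t < u \<longrightarrow> u < t + e \<longrightarrow> g u = g t + (u - t) * c" using R[of t] t t1 by auto
    have "\<bar>g u - g t\<bar> < r" if "t < u" "u < t + min e (r / (\<bar>c\<bar> + 1))" for u
      using e that small[of "u - t" c] by auto
    moreover have "0 < min e (r / (\<bar>c\<bar> + 1))" using e r by simp
    ultimately show ?thesis by blast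
  qed
  have left: "\<exists>k>0. \<forall>u. t - k < u \<longrightarrow> u < t \<longrightarrow> \<bar>g u - g t\<bar> < r" if t0: "0 < t"
  proof -
    obtain c e where e: "e > 0" "\<forall>u. t - e < u \<longrightarrow> u < t \<longrightarrow> g u = g t - (t - u) * c" using L[of t] t t0 by auto
    have "\<bar>g u - g t\<bar> < r" if "t - min e (r / (\<bar>c\<bar> + 1)) < u" "u < t" for u
      using e that small[of "t - u" c] by auto
    moreover have "0 < min e (r / (\<bar>c\<bar> + 1))" using e r by simp
    ultimately show ?thesis by blast
  qed
  obtain k1 where k1: "k1 > 0" "\<forall>u. t < u \<longrightarrow> u < t + k1 \<longrightarrow> u \<le> 1 \<longrightarrow> \<bar>g u - g t\<bar> < r"
    using right t that[of 1] by (cases "t < 1") auto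
  obtain k2 where k2: "k2 > 0" "\<forall>u. t - k2 < u \<longrightarrow> u < t \<longrightarrow> 0 \<le> u \<longrightarrow> \<bar>g u - g t\<bar> < r"
    using left t that[of 1] by (cases "0 < t") auto
  show "\<exists>k>0. \<forall>u\<in>{0..1}. dist u t < k \<longrightarrow> dist (g u) (g t) < r"
  proof (intro exI[of _ "min k1 k2"] conjI ballI impI)
    show "0 < min k1 k2" using k1 k2 by simp
    fix u assume u: "u \<in> {0..1}" "dist u t < min k1 k2"
    then show "dist (g u) (g t) < r"
      using k1 k2 r by (cases u t rule: linorder_cases) (auto simp: dist_real_def abs_less_iff)
  qed
qed

lemma e_cong:
  assumes eq: "\<And>t. t \<in> {0..1} \<Longrightarrow> h t = g t" and ep: "epl g \<in> {0..1}"
  shows "epl h = epl g" "emi h = emi g" "t \<in> {0..1} \<Longrightarrow> epsi h t = epsi g t"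
proof -
  have m: "mn h = mn g" by (rule mn_cong) (rule eq)
  have "{t \<in> {0..1}. h t = mn h} = {t \<in> {0..1}. g t = mn g}" using eq m by auto
  then show 1: "epl h = epl g" by (simp add: epl_def)
  have "{t \<in> {0..epl g}. h t = mn h + 1} = {t \<in> {0..epl g}. g t = mn g + 1}" using eq m ep by auto
  then show 2: "emi h = emi g" by (simp add: emi_def 1)
  show "t \<in> {0..1} \<Longrightarrow> epsi h t = epsi g t" using eq by (simp add: epsi_def 1 2 m)
qed

lemma f_cong:
  assumes eq: "\<And>t. t \<in> {0..1} \<Longrightarrow> h t = g t" and fp: "fpl g \<in> {0..1}"
  shows "fpl h = fpl g" "fmi h = fmi g" "t \<in> {0..1} \<Longrightarrow> fphi h t = fphi g t"
proof -
  have m: "mn h = mn g" by (rule mn_cong) (rule eq)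
  have "{t \<in> {0..1}. h t = mn h} = {t \<in> {0..1}. g t = mn g}" using eq m by auto
  then show 1: "fpl h = fpl g" by (simp add: fpl_def)
  have "{t \<in> {fpl g..1}. h t = mn h + 1} = {t \<in> {fpl g..1}. g t = mn g + 1}" using eq m fp by auto
  then show 2: "fmi h = fmi g" by (simp add: fmi_def 1)
  show "t \<in> {0..1} \<Longrightarrow> fphi h t = fphi g t" using eq by (simp add: fphi_def 1 2 m)
qed

section \<open>Paths with labelled directions\<close>

context km
begin

text \<open>\<open>R t\<close> labels the direction leaving \<open>t\<close> and \<open>Lf t\<close>
  the one arriving there; germs run from \<open>R t\<close> to \<open>Lf t\<close>. The leg of
  \<open>R t\<close> is prescribed by the time, and \<open>Lf t\<close> inherits its leg from the
  times just before.\<close>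

definition lp :: "nat \<Rightarrow> (nat \<Rightarrow> 'l vec) \<Rightarrow> (real \<Rightarrow> 'l vec) \<Rightarrow> (real \<Rightarrow> 'l lab) \<Rightarrow> (real \<Rightarrow> 'l lab) \<Rightarrow> bool" where
  "lp n d x R Lf \<longleftrightarrow> 0 < n \<and> x 0 = 0 \<and> (\<forall>l. vH (x 1) l \<in> \<int>) \<and>
    (\<forall>t. 0 \<le> t \<longrightarrow> t < 1 \<longrightarrow> fst (R t) = nat \<lfloor>real n * t\<rfloor> \<and> inW (snd (R t)) \<and>
      (\<exists>e>0. \<forall>u. t < u \<longrightarrow> u < t + e \<longrightarrow> u < 1 \<and> R u = R t \<and> Lf u = R t \<and> x u = x t + (u - t) *\<^sub>R dv d (R t))) \<and>
    (\<forall>t. 0 < t \<longrightarrow> t \<le> 1 \<longrightarrow>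
      (\<exists>e>0. \<forall>u. t - e < u \<longrightarrow> u < t \<longrightarrow> 0 < u \<and> R u = Lf t \<and> Lf u = Lf t \<and> x u = x t - (t - u) *\<^sub>R dv d (Lf t))) \<and>
    (\<forall>t. 0 < t \<longrightarrow> t < 1 \<longrightarrow> germ d (x t) (R t) (Lf t))"

lemma lpD:
  assumes "lp n d x R Lf"
  shows "0 < n" "x 0 = 0" "vH (x 1) l \<in> \<int>"
    "0 \<le> t \<Longrightarrow> t < 1 \<Longrightarrow> fst (R t) = nat \<lfloor>real n * t\<rfloor>" "0 \<le> t \<Longrightarrow> t < 1 \<Longrightarrow> inW (snd (R t))"
    "0 \<le> t \<Longrightarrow> t < 1 \<Longrightarrow> \<exists>e>0. \<forall>u. t < u \<longrightarrow> u < t + e \<longrightarrow> u < 1 \<and> R u = R t \<and> Lf u = R t \<and> x u = x t + (u - t) *\<^sub>R dv d (R t)"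
    "0 < t \<Longrightarrow> t \<le> 1 \<Longrightarrow> \<exists>e>0. \<forall>u. t - e < u \<longrightarrow> u < t \<longrightarrow> 0 < u \<and> R u = Lf t \<and> Lf u = Lf t \<and> x u = x t - (t - u) *\<^sub>R dv d (Lf t)"
    "0 < t \<Longrightarrow> t < 1 \<Longrightarrow> germ d (x t) (R t) (Lf t)"
  using assms unfolding lp_def by blast+

lemma lp_cont:
  assumes "lp n d x R Lf"
  shows "continuous_on {0..1} (\<lambda>t. vH (x t) l)" "continuous_on {0..1} (\<lambda>t. vC (x t) l)"
proof -
  have R: "\<exists>c. \<exists>e>0. \<forall>u. t < u \<longrightarrow> u < t + e \<longrightarrow> F (x u) = F (x t) + (u - t) * c"
    if "0 \<le> t" "t < 1" "\<And>a b c. F (a + c *\<^sub>R b) = F a + c * F b" for F t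
    using lpD(6)[OF assms that(1,2)] that(3) by metis
  have L: "\<exists>c. \<exists>e>0. \<forall>u. t - e < u \<longrightarrow> u < t \<longrightarrow> F (x u) = F (x t) - (t - u) * c"
    if "0 < t" "t \<le> 1" "\<And>a b c. F (a - c *\<^sub>R b) = F a - c * F b" for F t
    using lpD(7)[OF assms that(1,2)] that(3) by metis
  show "continuous_on {0..1} (\<lambda>t. vH (x t) l)"
    by (rule continuous_on_locally_affine; rule R[where F = "\<lambda>v. vH v l"] L[where F = "\<lambda>v. vH v l"]; simp)
  show "continuous_on {0..1} (\<lambda>t. vC (x t) l)"
    by (rule continuous_on_locally_affine; rule R[where F = "\<lambda>v. vC v l"] L[where F = "\<lambda>v. vC v l"]; simp)
qed

lemma lexpos_slope: "lexpos d [] j D \<Longrightarrow> 0 \<le> vH (dv d D) j" "\<not> lexpos d [] j D \<Longrightarrow> vH (dv d D) j \<le> 0"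
  by (auto simp: lexpos_def)

text \<open>Only the condition \<open>turn\<close> uses the germs: by \<open>germ_sign\<close> a
  positive outgoing label forces a positive incoming one where the pairing is not integral.\<close>

lemma lp_signed:
  assumes "lp n d x R Lf"
  shows "signed (\<lambda>t. vH (x t) j) (\<lambda>t. lexpos d [] j (R t)) (\<lambda>t. lexpos d [] j (Lf t))"
proof
  show "continuous_on {0..1} (\<lambda>t. vH (x t) j)" by (rule lp_cont[OF assms])
  show "vH (x 0) j \<in> \<int>" "vH (x 1) j \<in> \<int>" using lpD(2,3)[OF assms] by auto
  fix t :: real
  show "\<exists>e>0. \<forall>u. t < u \<longrightarrow> u < t + e \<longrightarrow> u < 1 \<and> lexpos d [] j (R u) = lexpos d [] j (R t) \<and>
     lexpos d [] j (Lf u) = lexpos d [] j (R t) \<and> (lexpos d [] j (R t) \<longrightarrow> vH (x t) j \<le> vH (x u) j) \<and>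
     (\<not> lexpos d [] j (R t) \<longrightarrow> vH (x u) j \<le> vH (x t) j)" if t: "0 \<le> t" "t < 1"
  proof -
    obtain e where e: "e > 0" "\<And>u. t < u \<Longrightarrow> u < t + e \<Longrightarrow> u < 1 \<and> R u = R t \<and> Lf u = R t \<and> x u = x t + (u - t) *\<^sub>R dv d (R t)"
      using lpD(6)[OF assms t] by blast
    show ?thesis
      using e lexpos_slope[of d j "R t"] by (intro exI[of _ e]) (auto simp: mult_nonneg_nonpos)
  qed
  show "\<exists>e>0. \<forall>u. t - e < u \<longrightarrow> u < t \<longrightarrow> 0 < u \<and> lexpos d [] j (R u) = lexpos d [] j (Lf t) \<and>
     lexpos d [] j (Lf u) = lexpos d [] j (Lf t) \<and> (lexpos d [] j (Lf t) \<longrightarrow> vH (x u) j \<le> vH (x t) j) \<and>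
     (\<not> lexpos d [] j (Lf t) \<longrightarrow> vH (x t) j \<le> vH (x u) j)" if t: "0 < t" "t \<le> 1"
  proof -
    obtain e where e: "e > 0" "\<And>u. t - e < u \<Longrightarrow> u < t \<Longrightarrow> 0 < u \<and> R u = Lf t \<and> Lf u = Lf t \<and> x u = x t - (t - u) *\<^sub>R dv d (Lf t)"
      using lpD(7)[OF assms t] by blast
    show ?thesis
      using e lexpos_slope[of d j "Lf t"] by (intro exI[of _ e]) (auto simp: mult_nonneg_nonpos)
  qed
  show "0 < t \<Longrightarrow> t < 1 \<Longrightarrow> vH (x t) j \<notin> \<int> \<Longrightarrow> lexpos d [] j (R t) \<Longrightarrow> lexpos d [] j (Lf t)"
    using germ_sign lpD(8)[OF assms] by blast
qed

definition reflR :: "'l \<Rightarrow> real \<Rightarrow> real \<Rightarrow> (real \<Rightarrow> 'l lab) \<Rightarrow> real \<Rightarrow> 'l lab" where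
  "reflR j p q R t = (if p \<le> t \<and> t < q then sD j (R t) else R t)"

definition reflL :: "'l \<Rightarrow> real \<Rightarrow> real \<Rightarrow> (real \<Rightarrow> 'l lab) \<Rightarrow> real \<Rightarrow> 'l lab" where
  "reflL j p q Lf t = (if p < t \<and> t \<le> q then sD j (Lf t) else Lf t)"

definition reflx :: "'l \<Rightarrow> real \<Rightarrow> real \<Rightarrow> (real \<Rightarrow> 'l vec) \<Rightarrow> real \<Rightarrow> 'l vec" where
  "reflx j p q x t = (if t \<le> p then x t else if t \<le> q then x t - (vH (x t) j - vH (x p) j) *\<^sub>R al j
     else x t - (vH (x q) j - vH (x p) j) *\<^sub>R al j)"

text \<open>The germ is reflected on one end at each of \<open>p\<close> and \<open>q\<close> and on
  both ends in between. The conditions \<open>atp\<close>, \<open>same\<close> and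
  \<open>atq\<close> are what the three lifting properties require.\<close>

lemma lp_refl:
  assumes L: "lp n d x R Lf" and pq: "0 \<le> p" "p < q" "q \<le> 1"
    and int: "vH (x p) j \<in> \<int>" "vH (x q) j \<in> \<int>"
    and same: "\<And>t. p < t \<Longrightarrow> t < q \<Longrightarrow> lexpos d [] j (R t) \<longleftrightarrow> lexpos d [] j (Lf t)"
    and atp: "0 < p \<Longrightarrow> \<not> (lexpos d [] j (R p) \<and> lexpos d [] j (Lf p))"
    and atq: "q < 1 \<Longrightarrow> lexpos d [] j (R q) \<or> lexpos d [] j (Lf q)"
    and x': "\<And>t. t \<in> {0..1} \<Longrightarrow> x' t = reflx j p q x t"
  shows "lp n d x' (reflR j p q R) (reflL j p q Lf)"
proof -
  note D = lpD[OF L]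
  have mid: "x' t = x t - (vH (x t) j - vH (x p) j) *\<^sub>R al j" if "p \<le> t" "t \<le> q" for t
    using that pq by (auto simp: x' reflx_def)
  have lo: "x' t = x t" if "0 \<le> t" "t \<le> p" for t using that pq by (auto simp: x' reflx_def)
  have hi: "x' t = x t - (vH (x q) j - vH (x p) j) *\<^sub>R al j" if "q \<le> t" "t \<le> 1" for t
    using that pq by (auto simp: x' reflx_def)
  have md: "x' u = x' t + c *\<^sub>R dv d (sD j E)" if "p \<le> t" "t \<le> q" "p \<le> u" "u \<le> q" "x u = x t + c *\<^sub>R dv d E" for t u c E
    using that by (simp add: mid s_def algebra_simps)
  show ?thesis
    unfolding lp_def
  proof (intro conjI allI impI)
    show "0 < n" by (rule D)
    show "x' 0 = 0" using D(2) lo[of 0] pq by simp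
    show "vH (x' 1) l \<in> \<int>" for l
      using hi[of 1] D(3)[of l] int pq by simp
    fix t :: real
    {
      assume t: "0 \<le> t" "t < 1"
      show "fst (reflR j p q R t) = nat \<lfloor>real n * t\<rfloor>" "inW (snd (reflR j p q R t))"
        using D(4,5)[OF t] by (auto simp: reflR_def inW_s)
      obtain e where e: "e > 0" "\<And>u. t < u \<Longrightarrow> u < t + e \<Longrightarrow> u < 1 \<and> R u = R t \<and> Lf u = R t \<and> x u = x t + (u - t) *\<^sub>R dv d (R t)"
        using D(6)[OF t] by blast
      show "\<exists>e>0. \<forall>u. t < u \<longrightarrow> u < t + e \<longrightarrow> u < 1 \<and> reflR j p q R u = reflR j p q R t \<and>
          reflL j p q Lf u = reflR j p q R t \<and> x' u = x' t + (u - t) *\<^sub>R dv d (reflR j p q R t)"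
      proof -
        consider "t < p" | "p \<le> t" "t < q" | "q \<le> t" by linarith
        then show ?thesis
        proof cases
          case 1
          show ?thesis
          proof (intro exI[of _ "min e (p - t)"] conjI allI impI)
            fix u assume u: "t < u" "u < t + min e (p - t)"
            then have *: "u < 1 \<and> R u = R t \<and> Lf u = R t \<and> x u = x t + (u - t) *\<^sub>R dv d (R t)" using e(2) by simp
            show "u < 1" "reflR j p q R u = reflR j p q R t" "reflL j p q Lf u = reflR j p q R t"
              "x' u = x' t + (u - t) *\<^sub>R dv d (reflR j p q R t)"
              using * 1 u t lo[of u] lo[of t] by (auto simp: reflR_def reflL_def)
          qed (use e 1 in simp)
        next
          case 2
          show ?thesis
          proof (intro exI[of _ "min e (q - t)"] conjI allI impI)
            fix u assume u: "t < u" "u < t + min e (q - t)"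
            then have *: "u < 1 \<and> R u = R t \<and> Lf u = R t \<and> x u = x t + (u - t) *\<^sub>R dv d (R t)" using e(2) by simp
            show "u < 1" "reflR j p q R u = reflR j p q R t" "reflL j p q Lf u = reflR j p q R t"
              "x' u = x' t + (u - t) *\<^sub>R dv d (reflR j p q R t)"
              using * 2 u md[of t u "u - t" "R t"] by (auto simp: reflR_def reflL_def)
          qed (use e 2 in simp)
        next
          case 3
          show ?thesis
          proof (intro exI[of _ e] conjI allI impI)
            fix u assume u: "t < u" "u < t + e"
            then have *: "u < 1 \<and> R u = R t \<and> Lf u = R t \<and> x u = x t + (u - t) *\<^sub>R dv d (R t)" using e(2) by simp
            show "u < 1" "reflR j p q R u = reflR j p q R t" "reflL j p q Lf u = reflR j p q R t"
              "x' u = x' t + (u - t) *\<^sub>R dv d (reflR j p q R t)"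
              using * 3 u t hi[of t] hi[of u] by (auto simp: reflR_def reflL_def)
          qed (use e in simp)
        qed
      qed
    }
    {
      assume t: "0 < t" "t \<le> 1"
      obtain e where e: "e > 0" "\<And>u. t - e < u \<Longrightarrow> u < t \<Longrightarrow> 0 < u \<and> R u = Lf t \<and> Lf u = Lf t \<and> x u = x t - (t - u) *\<^sub>R dv d (Lf t)"
        using D(7)[OF t] by blast
      show "\<exists>e>0. \<forall>u. t - e < u \<longrightarrow> u < t \<longrightarrow> 0 < u \<and> reflR j p q R u = reflL j p q Lf t \<and>
          reflL j p q Lf u = reflL j p q Lf t \<and> x' u = x' t - (t - u) *\<^sub>R dv d (reflL j p q Lf t)"
      proof -
        consider "t \<le> p" | "p < t" "t \<le> q" | "q < t" by linarith
        then show ?thesis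
        proof cases
          case 1
          show ?thesis
          proof (intro exI[of _ e] conjI allI impI)
            fix u assume u: "t - e < u" "u < t"
            then have *: "0 < u \<and> R u = Lf t \<and> Lf u = Lf t \<and> x u = x t - (t - u) *\<^sub>R dv d (Lf t)" using e(2) by simp
            show "0 < u" "reflR j p q R u = reflL j p q Lf t" "reflL j p q Lf u = reflL j p q Lf t"
              "x' u = x' t - (t - u) *\<^sub>R dv d (reflL j p q Lf t)"
              using * 1 u t lo[of u] lo[of t] by (auto simp: reflR_def reflL_def)
          qed (use e in simp)
        next
          case 2
          show ?thesis
          proof (intro exI[of _ "min e (t - p)"] conjI allI impI)
            fix u assume u: "t - min e (t - p) < u" "u < t"
            then have *: "0 < u \<and> R u = Lf t \<and> Lf u = Lf t \<and> x u = x t - (t - u) *\<^sub>R dv d (Lf t)" using e(2) by simp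
            then have "x u = x t + (u - t) *\<^sub>R dv d (Lf t)" by (simp add: algebra_simps)
            then have "x' u = x' t + (u - t) *\<^sub>R dv d (sD j (Lf t))" using md[of t u "u - t" "Lf t"] 2 u by auto
            then show "0 < u" "reflR j p q R u = reflL j p q Lf t" "reflL j p q Lf u = reflL j p q Lf t"
              "x' u = x' t - (t - u) *\<^sub>R dv d (reflL j p q Lf t)"
              using * 2 u by (auto simp: reflR_def reflL_def algebra_simps)
          qed (use e 2 in simp)
        next
          case 3
          show ?thesis
          proof (intro exI[of _ "min e (t - q)"] conjI allI impI)
            fix u assume u: "t - min e (t - q) < u" "u < t"
            then have *: "0 < u \<and> R u = Lf t \<and> Lf u = Lf t \<and> x u = x t - (t - u) *\<^sub>R dv d (Lf t)" using e(2) by simp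
            show "0 < u" "reflR j p q R u = reflL j p q Lf t" "reflL j p q Lf u = reflL j p q Lf t"
              "x' u = x' t - (t - u) *\<^sub>R dv d (reflL j p q Lf t)"
              using * 3 u t hi[of t] hi[of u] by (auto simp: reflR_def reflL_def)
          qed (use e 3 in simp)
        qed
      qed
    }
    {
      assume t: "0 < t" "t < 1"
      have W: "inW (snd (R t))" using D(5) t by simp
      have g: "germ d (x t) (R t) (Lf t)" using D(8) t by simp
      \<comment> \<open>From \<open>q\<close> on the path is translated by an integral multiple of
        \<open>al j\<close>, which changes no integrality and hence no step.\<close>
      have shift: "step d (x' t) = step d (x t)" if "q \<le> t"
      proof (rule step_cong)
        have "x' t = x t + (vH (x p) j - vH (x q) j) *\<^sub>R al j" using hi[of t] that t by (simp add: algebra_simps)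
        then show "phi v i (x' t) \<in> \<int> \<longleftrightarrow> phi v i (x t) \<in> \<int>" for v i
          using int_shift[of "vH (x p) j - vH (x q) j"] int by simp
      qed
      consider "t < p" | "t = p" | "p < t" "t < q" | "t = q" | "q < t" by linarith
      then show "germ d (x' t) (reflR j p q R t) (reflL j p q Lf t)"
      proof cases
        case 1
        then show ?thesis using g lo[of t] t by (simp add: reflR_def reflL_def)
      next
        case 2
        have "germ d (x t) (sD j (R t)) (Lf t)"
          by (rule germ_left[OF g _ W]) (use int atp 2 t in auto)
        then show ?thesis using 2 lo[of t] t pq by (simp add: reflR_def reflL_def)
      next
        case 3
        have "germ d (x' t) (sD j (R t)) (sD j (Lf t))"
          by (rule germ_both[OF g W same[OF 3] int(1)]) (use mid[of t] 3 in \<open>simp add: s_def algebra_simps\<close>)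
        then show ?thesis using 3 by (simp add: reflR_def reflL_def)
      next
        case 4
        have "germ d (x t) (R t) (sD j (Lf t))"
          by (rule germ_right[OF g _ W]) (use int atq 4 t in auto)
        then show ?thesis using 4 shift pq by (simp add: reflR_def reflL_def)
      next
        case 5
        then show ?thesis using g shift by (simp add: reflR_def reflL_def)
      qed
    }
  qed
qed

text \<open>Outside the unit interval the path is left alone, so that f and e are inverse to each
  other as functions on the whole line.\<close>

definition fop :: "'l \<Rightarrow> (real \<Rightarrow> 'l vec) \<Rightarrow> (real \<Rightarrow> 'l vec) option" where
  "fop j x = (let h = \<lambda>t. vH (x t) j in if fpl h = 1 then None
     else Some (\<lambda>t. if t \<in> {0..1} then x t - fphi h t *\<^sub>R al j else x t))"

definition eop :: "'l \<Rightarrow> (real \<Rightarrow> 'l vec) \<Rightarrow> (real \<Rightarrow> 'l vec) option" where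
  "eop j x = (let h = \<lambda>t. vH (x t) j in if epl h = 0 then None
     else Some (\<lambda>t. if t \<in> {0..1} then x t + epsi h t *\<^sub>R al j else x t))"

definition reflected :: "nat \<Rightarrow> (nat \<Rightarrow> 'l vec) \<Rightarrow> 'l \<Rightarrow> (real \<Rightarrow> 'l vec) \<Rightarrow> (real \<Rightarrow> 'l lab) \<Rightarrow> (real \<Rightarrow> 'l lab)
    \<Rightarrow> (real \<Rightarrow> 'l vec) \<Rightarrow> (real \<Rightarrow> 'l lab) \<Rightarrow> (real \<Rightarrow> 'l lab) \<Rightarrow> bool" where
  "reflected n d j x R Lf x' R' Lf' \<longleftrightarrow> lp n d x' R' Lf' \<and>
    (\<exists>p q. 0 \<le> p \<and> p < q \<and> q \<le> 1 \<and> vH (x p) j \<in> \<int> \<and> vH (x q) j \<in> \<int> \<and> R' = reflR j p q R \<and> Lf' = reflL j p q Lf \<and>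
       (\<forall>t\<in>{0..1}. x' t = reflx j p q x t))"

lemma lp_fop:
  assumes lpx: "lp n d x R Lf" and f: "fop j x = Some x'"
  shows "\<exists>R' Lf'. reflected n d j x R Lf x' R' Lf'"
proof -
  define h where "h = (\<lambda>t. vH (x t) j)"
  interpret signed h "\<lambda>t. lexpos d [] j (R t)" "\<lambda>t. lexpos d [] j (Lf t)"
    unfolding h_def by (rule lp_signed[OF lpx])
  have h1: "h 1 \<noteq> mn h" and x': "x' = (\<lambda>t. if t \<in> {0..1} then x t - fphi h t *\<^sub>R al j else x t)"
    using f fpl_1 by (auto simp: fop_def h_def[symmetric] split: if_splits)
  obtain p where p: "0 \<le> p" "p \<le> fpl h" "\<And>t. p \<le> t \<Longrightarrow> t \<le> fpl h \<Longrightarrow> h t = mn h"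
    "\<And>t. p \<le> t \<Longrightarrow> t < fmi h \<Longrightarrow> lexpos d [] j (R t)" "\<And>t. p < t \<Longrightarrow> t \<le> fmi h \<Longrightarrow> lexpos d [] j (Lf t)"
    "p = 0 \<or> \<not> lexpos d [] j (Lf p)"
    using fseg_start[OF h1] by blast
  note F = fpl_less[OF h1] fmi_le[OF h1] fmi_val[OF h1]
  have hp: "h p = mn h" using p by simp
  have hx: "vH (x t) j = h t" for t by (simp add: h_def)
  \<comment> \<open>Reflecting from \<open>p\<close> on instead of from \<open>fpl h\<close> on
    gives the same path, because the pairing with \<open>j\<close> is constant between the two
    times.\<close>
  have rx: "x' t = reflx j p (fmi h) x t" if "t \<in> {0..1}" for t
  proof -
    consider "t \<le> p" | "p < t" "t \<le> fpl h" | "fpl h < t" "t \<le> fmi h" | "fmi h < t" by linarith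
    then show ?thesis
    proof cases
      case 1
      then show ?thesis using that p by (simp add: x' reflx_def fphi_def)
    next
      case 2
      then show ?thesis using that p(3)[of t] hp F by (simp add: x' reflx_def fphi_def hx)
    next
      case 3
      then show ?thesis using that p hp F by (simp add: x' reflx_def fphi_def hx)
    next
      case 4
      then show ?thesis using that p hp F by (simp add: x' reflx_def fphi_def hx)
    qed
  qed
  have "lp n d x' (reflR j p (fmi h) R) (reflL j p (fmi h) Lf)"
    by (rule lp_refl[OF lpx]) (use p F hp mn_int rx in \<open>auto simp: hx\<close>)
  then show ?thesis unfolding reflected_def using p F hp mn_int rx hx
    by (intro exI[of _ "reflR j p (fmi h) R"] exI[of _ "reflL j p (fmi h) Lf"] conjI exI[of _ p] exI[of _ "fmi h"]) auto
qed

lemma lp_eop: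
  assumes lpx: "lp n d x R Lf" and f: "eop j x = Some x'"
  shows "\<exists>R' Lf'. reflected n d j x R Lf x' R' Lf'"
proof -
  define h where "h = (\<lambda>t. vH (x t) j)"
  interpret signed h "\<lambda>t. lexpos d [] j (R t)" "\<lambda>t. lexpos d [] j (Lf t)"
    unfolding h_def by (rule lp_signed[OF lpx])
  have h0: "h 0 \<noteq> mn h" and x': "x' = (\<lambda>t. if t \<in> {0..1} then x t + epsi h t *\<^sub>R al j else x t)"
    using f epl_0 by (auto simp: eop_def h_def[symmetric] split: if_splits)
  obtain q where q: "epl h \<le> q" "q \<le> 1" "\<And>t. epl h \<le> t \<Longrightarrow> t \<le> q \<Longrightarrow> h t = mn h"
    "\<And>t. emi h \<le> t \<Longrightarrow> t < q \<Longrightarrow> \<not> lexpos d [] j (R t)" "\<And>t. emi h < t \<Longrightarrow> t \<le> q \<Longrightarrow> \<not> lexpos d [] j (Lf t)"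
    "q = 1 \<or> lexpos d [] j (R q)"
    using eseg_end[OF h0] by blast
  note F = emi_ge[OF h0] emi_less[OF h0] epl_le[OF h0] emi_val[OF h0]
  have hq: "h q = mn h" using q by simp
  have hx: "vH (x t) j = h t" for t by (simp add: h_def)
  have rx: "x' t = reflx j (emi h) q x t" if "t \<in> {0..1}" for t
  proof -
    consider "t \<le> emi h" | "emi h < t" "t \<le> epl h" | "epl h < t" "t \<le> q" | "q < t" by linarith
    then show ?thesis
    proof cases
      case 1
      then show ?thesis using that by (simp add: x' reflx_def epsi_def)
    next
      case 2
      then show ?thesis using that q F by (simp add: x' reflx_def epsi_def hx algebra_simps)
    next
      case 3
      then show ?thesis using that q(3)[of t] F by (simp add: x' reflx_def epsi_def hx algebra_simps)
    next
      case 4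
      then show ?thesis using that q hq F by (simp add: x' reflx_def epsi_def hx algebra_simps)
    qed
  qed
  have "lp n d x' (reflR j (emi h) q R) (reflL j (emi h) q Lf)"
    by (rule lp_refl[OF lpx]) (use q F hq mn_int rx in \<open>auto simp: hx\<close>)
  then show ?thesis unfolding reflected_def using q F hq mn_int rx hx
    by (intro exI[of _ "reflR j (emi h) q R"] exI[of _ "reflL j (emi h) q Lf"] conjI exI[of _ "emi h"] exI[of _ q]) auto
qed

lemma eop_fop:
  assumes lpx: "lp n d x R Lf" and f: "fop j x = Some y"
  shows "eop j y = Some x" "mn (\<lambda>t. vH (y t) j) = mn (\<lambda>t. vH (x t) j) - 1"
proof -
  define h where "h = (\<lambda>t. vH (x t) j)"
  interpret signed h "\<lambda>t. lexpos d [] j (R t)" "\<lambda>t. lexpos d [] j (Lf t)"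
    unfolding h_def by (rule lp_signed[OF lpx])
  have h1: "h 1 \<noteq> mn h" and y: "y = (\<lambda>t. if t \<in> {0..1} then x t - fphi h t *\<^sub>R al j else x t)"
    using f fpl_1 by (auto simp: fop_def h_def[symmetric] split: if_splits)
  define k where "k = (\<lambda>t. vH (y t) j)"
  define g where "g = (\<lambda>t. h t - 2 * fphi h t)"
  have kg: "k t = g t" if "t \<in> {0..1}" for t using that by (simp add: k_def g_def y h_def)
  note T = f_transform[OF h1, folded g_def]
  note F = fpl_mem fpl_less[OF h1] fmi_le[OF h1]
  have ep: "epl g \<in> {0..1}" "epl g \<noteq> 0" using T F by auto
  note C = e_cong[OF kg ep(1)]
  show "mn (\<lambda>t. vH (y t) j) = mn (\<lambda>t. vH (x t) j) - 1"
    using mn_cong[of k g] kg T(1) by (simp add: k_def h_def)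
  show "eop j y = Some x" unfolding eop_def Let_def k_def[symmetric]
    using ep C T(4) by (auto simp: y fun_eq_iff)
qed

lemma fop_eop:
  assumes lpx: "lp n d x R Lf" and f: "eop j x = Some y"
  shows "fop j y = Some x" "mn (\<lambda>t. vH (y t) j) = mn (\<lambda>t. vH (x t) j) + 1"
proof -
  define h where "h = (\<lambda>t. vH (x t) j)"
  interpret signed h "\<lambda>t. lexpos d [] j (R t)" "\<lambda>t. lexpos d [] j (Lf t)"
    unfolding h_def by (rule lp_signed[OF lpx])
  have h0: "h 0 \<noteq> mn h" and y: "y = (\<lambda>t. if t \<in> {0..1} then x t + epsi h t *\<^sub>R al j else x t)"
    using f epl_0 by (auto simp: eop_def h_def[symmetric] split: if_splits)
  define k where "k = (\<lambda>t. vH (y t) j)"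
  define g where "g = (\<lambda>t. h t + 2 * epsi h t)"
  have kg: "k t = g t" if "t \<in> {0..1}" for t using that by (simp add: k_def g_def y h_def)
  note T = e_transform[OF h0, folded g_def]
  note F = emi_ge[OF h0] emi_less[OF h0] epl_le[OF h0]
  have ep: "fpl g \<in> {0..1}" "fpl g \<noteq> 1" using T F by auto
  note C = f_cong[OF kg ep(1)]
  show "mn (\<lambda>t. vH (y t) j) = mn (\<lambda>t. vH (x t) j) + 1"
    using mn_cong[of k g] kg T(1) by (simp add: k_def h_def)
  show "fop j y = Some x" unfolding fop_def Let_def k_def[symmetric]
    using ep C T(4) by (auto simp: y fun_eq_iff)
qed

lemma fop_None: "lp n d x R Lf \<Longrightarrow> fop j x = None \<longleftrightarrow> vH (x 1) j = mn (\<lambda>t. vH (x t) j)"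
  using signed.fpl_1[OF lp_signed] by (auto simp: fop_def Let_def)

lemma eop_None: "lp n d x R Lf \<Longrightarrow> eop j x = None \<longleftrightarrow> mn (\<lambda>t. vH (x t) j) = 0"
  using signed.epl_0[OF lp_signed, of n d x R Lf j] lpD(2)[of n d x R Lf] by (auto simp: eop_def Let_def)

end

section \<open>Words in the root operators and deformation of paths\<close>

text \<open>Real induction. It carries a property of labels along a leg: to the right by local
  constancy, across a time by the germ there.\<close>

lemma interval_induct:
  fixes a b :: real
  assumes "P a" "a \<le> b"
    and R: "\<And>t. a \<le> t \<Longrightarrow> t < b \<Longrightarrow> P t \<Longrightarrow> \<exists>e>0. \<forall>u. t < u \<longrightarrow> u < t + e \<longrightarrow> P u"
    and L: "\<And>t. a < t \<Longrightarrow> t \<le> b \<Longrightarrow> (\<And>u. a \<le> u \<Longrightarrow> u < t \<Longrightarrow> P u) \<Longrightarrow> P t"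
    and t: "a \<le> t" "t \<le> b"
  shows "P t"
proof -
  define S where "S = {c. a \<le> c \<and> c \<le> b \<and> (\<forall>u. a \<le> u \<longrightarrow> u \<le> c \<longrightarrow> P u)}"
  have aS: "a \<in> S" using assms(1,2) by (auto simp: S_def intro: order.antisym)
  have bd: "bdd_above S" by (auto simp: S_def intro: bdd_aboveI[of _ b])
  define c where "c = Sup S"
  have ac: "a \<le> c" unfolding c_def by (rule cSup_upper[OF aS bd])
  have cb: "c \<le> b" unfolding c_def using aS by (intro cSup_least) (auto simp: S_def)
  have low: "P u" if au: "a \<le> u" and uc: "u < c" for u
  proof -
    obtain v where "v \<in> S" "u < v" using less_cSupD[of S u] uc aS by (auto simp: c_def)
    then show ?thesis using au by (auto simp: S_def)
  qed
  have Pc: "P c" using L[of c] low assms(1) ac cb by (cases "a = c") auto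
  have "c = b"
  proof (rule ccontr)
    assume "c \<noteq> b"
    then have "c < b" using cb by simp
    then obtain e where e: "e > 0" "\<forall>u. c < u \<longrightarrow> u < c + e \<longrightarrow> P u" using R[OF ac _ Pc] by blast
    define v where "v = min b (c + e / 2)"
    have "P u" if "a \<le> u" "u \<le> v" for u
      using that low Pc e by (cases u c rule: linorder_cases) (auto simp: v_def)
    then have "v \<in> S" using ac \<open>c < b\<close> e by (auto simp: S_def v_def)
    then have "v \<le> c" unfolding c_def by (rule cSup_upper[OF _ bd])
    then show False using e \<open>c < b\<close> by (auto simp: v_def)
  qed
  then show ?thesis using low Pc t by (cases "t = c") auto
qed

text \<open>By connectedness a non-constant image would contain an interval, which is
  uncountable.\<close>

lemma continuous_rational_const:
  fixes g :: "real \<Rightarrow> real"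
  assumes "continuous_on {0..1} g" "\<And>s. s \<in> {0..1} \<Longrightarrow> g s \<in> \<rat>" "s \<in> {0..1}"
  shows "g s = g 0"
proof (rule ccontr)
  assume ne: "g s \<noteq> g 0"
  have c: "continuous_on {0..s} g" by (rule continuous_on_subset[OF assms(1)]) (use assms(3) in auto)
  have "connected (g ` {0..s})" by (rule connected_continuous_image[OF c]) auto
  then have sub: "{min (g 0) (g s)..max (g 0) (g s)} \<subseteq> g ` {0..s}"
    using assms(3) by (intro connected_contains_Icc) (auto simp: min_def max_def)
  have "g ` {0..s} \<subseteq> \<rat>" using assms(2,3) by auto
  then have "countable {min (g 0) (g s)..max (g 0) (g s)}"
    using sub countable_rat countable_subset by (metis order.trans)
  then show False using ne uncountable_closed_interval[of "min (g 0) (g s)" "max (g 0) (g s)"] by simp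
qed

lemma lipschitz_rational_const:
  fixes g :: "real \<Rightarrow> real"
  assumes "\<And>s s'. s \<in> {0..1} \<Longrightarrow> s' \<in> {0..1} \<Longrightarrow> \<bar>g s - g s'\<bar> \<le> K * \<bar>s - s'\<bar>"
    and "\<And>s. s \<in> {0..1} \<Longrightarrow> g s \<in> \<rat>" "s \<in> {0..1}"
  shows "g s = g 0"
proof (rule continuous_rational_const[OF _ assms(2,3)])
  show "continuous_on {0..1} g"
    unfolding continuous_on_iff
  proof (intro ballI allI impI)
    fix x e :: real assume x: "x \<in> {0..1}" and e: "0 < e"
    have "dist (g y) (g x) < e" if y: "y \<in> {0..1}" "dist y x < e / (\<bar>K\<bar> + 1)" for y
    proof -
      have "\<bar>g y - g x\<bar> \<le> K * \<bar>y - x\<bar>" using assms(1) x y by blast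
      also have "\<dots> \<le> (\<bar>K\<bar> + 1) * \<bar>y - x\<bar>" by (rule mult_right_mono) auto
      also have "\<dots> < e" using y(2) by (simp add: dist_real_def field_simps)
      finally show ?thesis by (simp add: dist_real_def)
    qed
    moreover have "0 < e / (\<bar>K\<bar> + 1)" using e by simp
    ultimately show "\<exists>k>0. \<forall>y\<in>{0..1}. dist y x < k \<longrightarrow> dist (g y) (g x) < e" by blast
  qed
qed

section \<open>Words in e and f acting on labelled paths\<close>

context km
begin

fun opr :: "bool \<times> 'l \<Rightarrow> (real \<Rightarrow> 'l vec) \<Rightarrow> (real \<Rightarrow> 'l vec) option" where
  "opr (True, j) = fop j"
| "opr (False, j) = eop j"

fun run :: "(bool \<times> 'l) list \<Rightarrow> (real \<Rightarrow> 'l vec) \<Rightarrow> (real \<Rightarrow> 'l vec) option" where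
  "run [] x = Some x"
| "run (c # C) x = Option.bind (run C x) (opr c)"

lemma run_append: "run (C @ C') x = Option.bind (run C' x) (run C)"
  by (induction C) (auto split: bind_splits)

lemma run_ConsE:
  assumes "run (c # C) x = Some y" obtains z where "run C x = Some z" "opr c z = Some y"
  using assms by (auto simp: bind_eq_Some_conv)

lemma opr_lp: "lp n d x R Lf \<Longrightarrow> opr c x = Some y \<Longrightarrow> \<exists>R' Lf'. reflected n d (snd c) x R Lf y R' Lf'"
  by (cases c rule: opr.cases) (auto dest: lp_fop lp_eop)

lemma run_lp: "lp n d x R Lf \<Longrightarrow> run C x = Some y \<Longrightarrow> \<exists>R' Lf'. lp n d y R' Lf'"
proof (induction C arbitrary: y)
  case (Cons c C)
  obtain z where z: "run C x = Some z" "opr c z = Some y" using Cons.prems(2) by (rule run_ConsE)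
  obtain R1 L1 where "lp n d z R1 L1" using Cons.IH[OF Cons.prems(1) z(1)] by blast
  then show ?case using opr_lp[of n d z R1 L1 c y] z(2) by (auto simp: reflected_def)
qed auto

definition inop :: "bool \<times> 'l \<Rightarrow> bool \<times> 'l" where
  "inop c = (\<not> fst c, snd c)"

definition inw :: "(bool \<times> 'l) list \<Rightarrow> (bool \<times> 'l) list" where
  "inw C = rev (map inop C)"

lemma inop_inop [simp]: "inop (inop c) = c"
  by (simp add: inop_def)

lemma opr_inop: "lp n d x R Lf \<Longrightarrow> opr c x = Some y \<Longrightarrow> opr (inop c) y = Some x"
  by (cases c rule: opr.cases) (auto simp: inop_def dest: eop_fop(1) fop_eop(1))

lemma run_inw: "lp n d x R Lf \<Longrightarrow> run C x = Some y \<Longrightarrow> run (inw C) y = Some x"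
proof (induction C arbitrary: y)
  case (Cons c C)
  obtain z where z: "run C x = Some z" "opr c z = Some y" using Cons.prems(2) by (rule run_ConsE)
  obtain R1 L1 where l: "lp n d z R1 L1" using run_lp[OF Cons.prems(1) z(1)] by blast
  show ?case using Cons.IH[OF Cons.prems(1) z(1)] opr_inop[OF l z(2)]
    by (simp add: inw_def run_append)
qed (simp add: inw_def)

lemma run_eq_iff:
  assumes "lp n d x R Lf" "run C x = Some y" "run C' x = Some y'"
  shows "y = y' \<longleftrightarrow> run (inw C @ C') x = Some x"
proof
  show "y = y' \<Longrightarrow> run (inw C @ C') x = Some x" using run_inw[OF assms(1,2)] assms by (simp add: run_append)
  assume "run (inw C @ C') x = Some x"
  then have 1: "run (inw C) y' = Some x" using assms by (simp add: run_append)
  obtain R1 L1 where l: "lp n d y' R1 L1" using run_lp[OF assms(1,3)] by blast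
  have "inw (inw C) = C" by (simp add: inw_def rev_map comp_def)
  then have "run C x = Some y'" using run_inw[OF l 1] by simp
  then show "y = y'" using assms by simp
qed

lemma opr_form:
  assumes "opr c x = Some y"
  shows "\<exists>g. (\<forall>t. y t = x t + g t *\<^sub>R al (snd c)) \<and> (\<forall>t. t \<notin> {0..1} \<longrightarrow> g t = 0)"
proof (cases c rule: opr.cases)
  case (1 j)
  then show ?thesis using assms
    by (intro exI[of _ "\<lambda>t. if t \<in> {0..1} then - fphi (\<lambda>t. vH (x t) j) t else 0"])
      (auto simp: fop_def Let_def split: if_splits)
next
  case (2 j)
  then show ?thesis using assms
    by (intro exI[of _ "\<lambda>t. if t \<in> {0..1} then epsi (\<lambda>t. vH (x t) j) t else 0"])
      (auto simp: eop_def Let_def split: if_splits)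
qed

text \<open>Operators move points along simple roots only, and \<open>vC\<close> records by how
  much. Two paths reached from the same source can thus be compared by \<open>vC\<close>
  alone.\<close>

lemma run_span:
  assumes "run C x = Some y" "finite M" "snd ` set C \<subseteq> M"
  shows "y t = x t - (\<Sum>m\<in>M. (vC (y t) m - vC (x t) m) *\<^sub>R al m)"
    and "m \<notin> M \<Longrightarrow> vC (y t) m = vC (x t) m" and "t \<notin> {0..1} \<Longrightarrow> y t = x t"
proof -
  have "y t = x t - (\<Sum>m\<in>M. (vC (y t) m - vC (x t) m) *\<^sub>R al m) \<and> (\<forall>m. m \<notin> M \<longrightarrow> vC (y t) m = vC (x t) m)
     \<and> (t \<notin> {0..1} \<longrightarrow> y t = x t)" using assms
  proof (induction C arbitrary: y)
    case (Cons c C)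
    obtain z where z: "run C x = Some z" "opr c z = Some y" using Cons.prems(1) by (rule run_ConsE)
    obtain g where g: "\<And>t. y t = z t + g t *\<^sub>R al (snd c)" "\<And>t. t \<notin> {0..1} \<Longrightarrow> g t = 0"
      using opr_form[OF z(2)] by blast
    have c: "snd c \<in> M" using Cons.prems by auto
    have IH: "z t = x t - (\<Sum>m\<in>M. (vC (z t) m - vC (x t) m) *\<^sub>R al m)" "\<forall>m. m \<notin> M \<longrightarrow> vC (z t) m = vC (x t) m"
      "t \<notin> {0..1} \<longrightarrow> z t = x t"
      using Cons.IH[OF z(1)] Cons.prems by auto
    have v: "vC (y t) m - vC (x t) m = (vC (z t) m - vC (x t) m) - (if m = snd c then g t else 0)" for m
      by (simp add: g)
    have "(\<Sum>m\<in>M. (vC (y t) m - vC (x t) m) *\<^sub>R al m) = (\<Sum>m\<in>M. (vC (z t) m - vC (x t) m) *\<^sub>R al m) - g t *\<^sub>R al (snd c)"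
      unfolding v scaleR_diff_left sum_subtractf using c Cons.prems(2) by (simp add: if_distrib[of "\<lambda>r. r *\<^sub>R _"] cong: if_cong)
    then have "y t = x t - (\<Sum>m\<in>M. (vC (y t) m - vC (x t) m) *\<^sub>R al m)" using IH(1) g(1)[of t] by simp
    moreover have "vC (y t) m = vC (x t) m" if "m \<notin> M" for m using v[of m] IH(2) that c by (cases "m = snd c") auto
    moreover have "y t = x t" if "t \<notin> {0..1}" using IH(3) g(1)[of t] g(2)[OF that] that by simp
    ultimately show ?case by blast
  qed auto
  then show "y t = x t - (\<Sum>m\<in>M. (vC (y t) m - vC (x t) m) *\<^sub>R al m)"
    "m \<notin> M \<Longrightarrow> vC (y t) m = vC (x t) m" "t \<notin> {0..1} \<Longrightarrow> y t = x t" by auto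
qed

lemma run_eqI:
  assumes "run C x = Some y" "\<And>t m. t \<in> {0..1} \<Longrightarrow> vC (y t) m = vC (x t) m" shows "y = x"
proof
  fix t show "y t = x t"
    using run_span(1,3)[OF assms(1), of "snd ` set C" t] assms(2)[of t] by (cases "t \<in> {0..1}") auto
qed

text \<open>The multiple of \<open>al j\<close> added at time \<open>t\<close> is an integer or differs by an integer from \<open>vH (x t) j\<close>.\<close>

lemma opr_rat:
  assumes l: "lp n d x R Lf" and o: "opr c x = Some y" and t: "t \<in> {0..1}"
    and K: "\<And>l. vH (x t) l \<in> K" "\<And>l. vC (x t) l \<in> K" and KR: "K = \<rat> \<or> K = \<int>"
  shows "vH (y t) l \<in> K" "vC (y t) l \<in> K"
proof -
  have KI: "of_int i \<in> K" for i using KR by auto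
  have Kd: "u - v \<in> K" "u + v \<in> K" "u * v \<in> K" "- u \<in> K" if "u \<in> K" "v \<in> K" for u v
    using that KR by auto
  have K0: "0 \<in> K" "1 \<in> K" using KI[of 0] KI[of 1] by auto
  have "\<exists>g\<in>K. y t = x t + g *\<^sub>R al (snd c)"
  proof (cases c rule: opr.cases)
    case (1 j)
    define h where "h = (\<lambda>t. vH (x t) j)"
    have "mn h \<in> \<int>" unfolding h_def by (rule signed.mn_int[OF lp_signed[OF l]])
    then have "mn h \<in> K" using KI by (auto elim: Ints_cases)
    then have "- fphi h t \<in> K" using Kd K K0 by (auto simp: fphi_def h_def)
    moreover have "y t = x t + (- fphi h t) *\<^sub>R al j"
      using o 1 t by (auto simp: fop_def h_def Let_def split: if_splits)
    ultimately show ?thesis using 1 by (metis snd_conv)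
  next
    case (2 j)
    define h where "h = (\<lambda>t. vH (x t) j)"
    have "mn h \<in> \<int>" unfolding h_def by (rule signed.mn_int[OF lp_signed[OF l]])
    then have "mn h \<in> K" using KI by (auto elim: Ints_cases)
    then have "epsi h t \<in> K" using Kd K K0 by (auto simp: epsi_def h_def)
    moreover have "y t = x t + epsi h t *\<^sub>R al j"
      using o 2 t by (auto simp: eop_def h_def Let_def split: if_splits)
    ultimately show ?thesis using 2 by auto
  qed
  then obtain g where g: "g \<in> K" "y t = x t + g *\<^sub>R al (snd c)" by blast
  show "vH (y t) l \<in> K" unfolding g(2) vec_simps al_simps by (intro Kd K g KI)
  show "vC (y t) l \<in> K" using g Kd[of "vC (x t) l" g] K[of l] by (auto simp: K0)
qed

lemma run_rat:
  assumes "lp n d x R Lf" "run C x = Some y" "t \<in> {0..1}"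
    and "\<And>l. vH (x t) l \<in> K" "\<And>l. vC (x t) l \<in> K" "K = \<rat> \<or> K = \<int>"
  shows "vH (y t) l \<in> K" "vC (y t) l \<in> K"
proof -
  have "(\<forall>l. vH (y t) l \<in> K) \<and> (\<forall>l. vC (y t) l \<in> K)" using assms(2)
  proof (induction C arbitrary: y)
    case (Cons c C)
    obtain z where z: "run C x = Some z" "opr c z = Some y" using Cons.prems by (rule run_ConsE)
    obtain R1 L1 where l: "lp n d z R1 L1" using run_lp[OF assms(1) z(1)] by blast
    show ?case using opr_rat[OF l z(2) assms(3) _ _ assms(6)] Cons.IH[OF z(1)] by blast
  qed (use assms in auto)
  then show "vH (y t) l \<in> K" "vC (y t) l \<in> K" by auto
qed

lemma opr_end:
  assumes "lp n d x R Lf" "opr c x = Some y"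
  shows "y 1 = x 1 - (if fst c then 1 else - 1) *\<^sub>R al (snd c)"
proof (cases c rule: opr.cases)
  case (1 j)
  define h where "h = (\<lambda>t. vH (x t) j)"
  interpret signed h "\<lambda>t. lexpos d [] j (R t)" "\<lambda>t. lexpos d [] j (Lf t)"
    unfolding h_def by (rule lp_signed[OF assms(1)])
  have f: "fpl h \<noteq> 1" "y = (\<lambda>t. if t \<in> {0..1} then x t - fphi h t *\<^sub>R al j else x t)"
    using assms(2) 1 by (auto simp: fop_def h_def Let_def split: if_splits)
  then have "h 1 \<noteq> mn h" using fpl_1 by simp
  then have "fphi h 1 = 1" using f(1) fpl_mem fmi_le fmi_val
    by (cases "fmi h = 1") (auto simp: fphi_def)
  then show ?thesis using 1 f by simp
next
  case (2 j)
  define h where "h = (\<lambda>t. vH (x t) j)"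
  interpret signed h "\<lambda>t. lexpos d [] j (R t)" "\<lambda>t. lexpos d [] j (Lf t)"
    unfolding h_def by (rule lp_signed[OF assms(1)])
  have f: "epl h \<noteq> 0" "y = (\<lambda>t. if t \<in> {0..1} then x t + epsi h t *\<^sub>R al j else x t)"
    using assms(2) 2 by (auto simp: eop_def h_def Let_def split: if_splits)
  then have n: "h 0 \<noteq> mn h" using epl_0 by simp
  have "epsi h 1 = 1" using emi_less[OF n] epl_le[OF n] epl_val[OF n]
    by (cases "epl h = 1") (auto simp: epsi_def)
  then show ?thesis using 2 f by simp
qed

text \<open>The height of the drop in weight: every f subtracts one simple root at the end of the
  path, every e gives one back.\<close>

definition ht :: "(bool \<times> 'l) list \<Rightarrow> int" where
  "ht C = sum_list (map (\<lambda>c. if fst c then 1 else - 1) C)"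

lemma run_ht:
  assumes "lp n d x R Lf" "run C x = Some y" "finite M" "snd ` set C \<subseteq> M"
  shows "(\<Sum>m\<in>M. vC (y 1) m) = (\<Sum>m\<in>M. vC (x 1) m) + ht C"
  using assms(2,4)
proof (induction C arbitrary: y)
  case (Cons c C)
  obtain z where z: "run C x = Some z" "opr c z = Some y" using Cons.prems(1) by (rule run_ConsE)
  obtain R1 L1 where l: "lp n d z R1 L1" using run_lp[OF assms(1) z(1)] by blast
  have "vC (y 1) m = vC (z 1) m + (if m = snd c then (if fst c then 1 else - 1) else 0)" for m
    using opr_end[OF l z(2)] by simp
  then show ?case using Cons.IH[OF z(1)] Cons.prems(2) assms(3) by (simp add: sum.distrib ht_def)
qed (simp add: ht_def)

text \<open>Along a family of paths depending in a Lipschitz way on a parameter, the minima are integers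
  and hence constant, so every composition of root operators vanishes at all parameters or at none.\<close>

definition lipf :: "(real \<Rightarrow> real \<Rightarrow> 'l vec) \<Rightarrow> bool" where
  "lipf X \<longleftrightarrow> (\<forall>l. \<exists>K. \<forall>s\<in>{0..1}. \<forall>s'\<in>{0..1}. \<forall>t\<in>{0..1}.
     \<bar>vH (X s t) l - vH (X s' t) l\<bar> \<le> K * \<bar>s - s'\<bar> \<and> \<bar>vC (X s t) l - vC (X s' t) l\<bar> \<le> K * \<bar>s - s'\<bar>)"

definition fam :: "nat \<Rightarrow> (real \<Rightarrow> nat \<Rightarrow> 'l vec) \<Rightarrow> (real \<Rightarrow> real \<Rightarrow> 'l vec) \<Rightarrow> bool" where
  "fam n d X \<longleftrightarrow> lipf X \<and> (\<forall>s\<in>{0..1}. \<exists>R Lf. lp n (d s) (X s) R Lf)"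

lemma fam_mn:
  fixes s :: real
  assumes "fam n d X" "s \<in> {0..1}"
  shows "mn (\<lambda>t. vH (X s t) j) = mn (\<lambda>t. vH (X 0 t) j)"
proof -
  have sg: "\<exists>P Q. signed (\<lambda>t. vH (X s t) j) P Q" if "s \<in> {0..1}" for s
    using assms(1) that lp_signed unfolding fam_def by meson
  obtain K where K: "\<And>s s' t. s \<in> {0..1} \<Longrightarrow> s' \<in> {0..1} \<Longrightarrow> t \<in> {0..1} \<Longrightarrow>
      \<bar>vH (X s t) j - vH (X s' t) j\<bar> \<le> K * \<bar>s - s'\<bar>"
    using assms(1) unfolding fam_def lipf_def by meson
  show ?thesis
  proof (rule lipschitz_rational_const[where g = "\<lambda>s. mn (\<lambda>t. vH (X s t) j)" and K = K])
    show "s \<in> {0..1}" by fact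
    fix s :: real assume s: "s \<in> {0..1}"
    show "mn (\<lambda>t. vH (X s t) j) \<in> \<rat>" using sg[OF s] signed.mn_int by (meson Ints_subset_Rats subsetD)
    fix s' :: real assume s': "s' \<in> {0..1}"
    show "\<bar>mn (\<lambda>t. vH (X s t) j) - mn (\<lambda>t. vH (X s' t) j)\<bar> \<le> K * \<bar>s - s'\<bar>"
      using sg[OF s] sg[OF s'] mn_lip K[OF s s'] by meson
  qed
qed

lemma fam_end:
  fixes s :: real
  assumes "fam n d X" "s \<in> {0..1}"
  shows "vH (X s 1) j = vH (X 0 1) j"
proof -
  obtain K where K: "\<And>s s' t. s \<in> {0..1} \<Longrightarrow> s' \<in> {0..1} \<Longrightarrow> t \<in> {0..1} \<Longrightarrow>
      \<bar>vH (X s t) j - vH (X s' t) j\<bar> \<le> K * \<bar>s - s'\<bar>"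
    using assms(1) unfolding fam_def lipf_def by meson
  show ?thesis
  proof (rule lipschitz_rational_const[where g = "\<lambda>s. vH (X s 1) j" and K = K])
    show "vH (X s 1) j \<in> \<rat>" if "s \<in> {0..1}" for s
      using assms(1) that lpD(3) unfolding fam_def by (meson Ints_subset_Rats subsetD)
  qed (use K assms(2) in auto)
qed

lemma lipf_shift:
  assumes X: "lipf X" and G: "\<exists>K. \<forall>s\<in>{0..1}. \<forall>s'\<in>{0..1}. \<forall>t\<in>{0..1}. \<bar>g s t - g s' t\<bar> \<le> K * \<bar>s - s'\<bar>"
    and Y: "\<And>s t. s \<in> {0..1} \<Longrightarrow> t \<in> {0..1} \<Longrightarrow> Y s t = X s t + g s t *\<^sub>R al j"
  shows "lipf Y"
  unfolding lipf_def
proof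
  fix l
  obtain K where K: "\<And>s s' t. s \<in> {0..1} \<Longrightarrow> s' \<in> {0..1} \<Longrightarrow> t \<in> {0..1} \<Longrightarrow>
      \<bar>vH (X s t) l - vH (X s' t) l\<bar> \<le> K * \<bar>s - s'\<bar> \<and> \<bar>vC (X s t) l - vC (X s' t) l\<bar> \<le> K * \<bar>s - s'\<bar>"
    using X unfolding lipf_def by meson
  obtain K' where K': "\<And>s s' t. s \<in> {0..1} \<Longrightarrow> s' \<in> {0..1} \<Longrightarrow> t \<in> {0..1} \<Longrightarrow> \<bar>g s t - g s' t\<bar> \<le> K' * \<bar>s - s'\<bar>"
    using G by meson
  define A where "A = \<bar>real_of_int (a l j)\<bar> + 1"
  have A: "1 \<le> A" "\<bar>real_of_int (a l j)\<bar> \<le> A" by (auto simp: A_def)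
  show "\<exists>K. \<forall>s\<in>{0..1}. \<forall>s'\<in>{0..1}. \<forall>t\<in>{0..1}.
     \<bar>vH (Y s t) l - vH (Y s' t) l\<bar> \<le> K * \<bar>s - s'\<bar> \<and> \<bar>vC (Y s t) l - vC (Y s' t) l\<bar> \<le> K * \<bar>s - s'\<bar>"
  proof (intro exI[of _ "K + A * K'"] ballI)
    fix s s' t :: real assume s: "s \<in> {0..1}" "s' \<in> {0..1}" "t \<in> {0..1}"
    have g: "\<bar>g s t - g s' t\<bar> \<le> K' * \<bar>s - s'\<bar>" using K' s by blast
    have m: "\<bar>(g s t - g s' t) * r\<bar> \<le> A * K' * \<bar>s - s'\<bar>" if "\<bar>r\<bar> \<le> A" for r
    proof -
      have "\<bar>(g s t - g s' t) * r\<bar> \<le> (K' * \<bar>s - s'\<bar>) * A"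
        unfolding abs_mult using g that by (intro mult_mono) auto
      then show ?thesis by (simp add: ac_simps)
    qed
    have "vH (Y s t) l - vH (Y s' t) l = (vH (X s t) l - vH (X s' t) l) + (g s t - g s' t) * real_of_int (a l j)"
      using Y s by (simp add: algebra_simps)
    moreover have "vC (Y s t) l - vC (Y s' t) l = (vC (X s t) l - vC (X s' t) l) + (g s t - g s' t) * (if l = j then -1 else 0)"
      using Y s by (simp add: algebra_simps)
    ultimately show "\<bar>vH (Y s t) l - vH (Y s' t) l\<bar> \<le> (K + A * K') * \<bar>s - s'\<bar> \<and> \<bar>vC (Y s t) l - vC (Y s' t) l\<bar> \<le> (K + A * K') * \<bar>s - s'\<bar>"
      using abs_triangle_ineq[of "vH (X s t) l - vH (X s' t) l" "(g s t - g s' t) * real_of_int (a l j)"]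
        abs_triangle_ineq[of "vC (X s t) l - vC (X s' t) l" "(g s t - g s' t) * (if l = j then -1 else 0)"]
        K[OF s] m[OF A(2)] m[of "if l = j then -1 else 0"] A(1) unfolding distrib_right by (simp split: if_splits)
  qed
qed

text \<open>Whether an operator vanishes depends only on the minimum and on the value at the end,
  both of which are constant in the parameter. By \<open>fphi_lip\<close> and
  \<open>epsi_lip\<close> the images form a Lipschitz family again.\<close>

lemma fam_opr:
  assumes F: "fam n d X"
  shows "(\<forall>s\<in>{0..1}. opr c (X s) = None) \<or>
    (\<exists>Y. fam n d Y \<and> (\<forall>s\<in>{0..1}. opr c (X s) = Some (Y s)))"
proof (cases "opr c (X 0) = None")
  have l: "\<exists>R Lf. lp n (d s) (X s) R Lf" if "s \<in> {0..1}" for s using F that by (simp add: fam_def)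
  have iff: "opr c (X s) = None \<longleftrightarrow> opr c (X 0) = None" if s: "s \<in> {0..1}" for s
  proof -
    obtain R Lf R0 L0 where "lp n (d s) (X s) R Lf" "lp n (d 0) (X 0) R0 L0" using l[OF s] l[of 0] by auto
    then show ?thesis using fam_mn[OF F s] fam_end[OF F s] fop_None eop_None
      by (cases c rule: opr.cases) auto
  qed
  {
    case True
    then show ?thesis using iff by blast
  next
    case False
    define Y where "Y s = the (opr c (X s))" for s
    have Y: "opr c (X s) = Some (Y s)" if "s \<in> {0..1}" for s using iff[OF that] False by (simp add: Y_def)
    define j where "j = snd c"
    define h where "h s = (\<lambda>t. vH (X s t) j)" for s
    have sg: "\<exists>P Q. signed (h s) P Q" if "s \<in> {0..1}" for s using l[OF that] lp_signed unfolding h_def by meson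
    have m: "mn (h s) = mn (h s')" if "s \<in> {0..1}" "s' \<in> {0..1}" for s s'
      using fam_mn[OF F that(1)] fam_mn[OF F that(2)] by (simp add: h_def)
    obtain K where K: "\<And>s s' t. s \<in> {0..1} \<Longrightarrow> s' \<in> {0..1} \<Longrightarrow> t \<in> {0..1} \<Longrightarrow> \<bar>h s t - h s' t\<bar> \<le> K * \<bar>s - s'\<bar>"
      using F unfolding fam_def lipf_def h_def by meson
    have X: "lipf X" using F by (simp add: fam_def)
    have "lipf Y"
    proof (cases "fst c")
      case True
      then have c: "c = (True, j)" by (cases c) (auto simp: j_def)
      have Y': "Y s t = X s t + (- fphi (h s) t) *\<^sub>R al j" if "s \<in> {0..1}" "t \<in> {0..1}" for s t
        using Y[OF that(1)] that(2) by (auto simp: c fop_def h_def Let_def fun_eq_iff split: if_splits)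
      have e: "h s 1 \<noteq> mn (h s)" if s: "s \<in> {0..1}" for s
      proof -
        obtain R Lf where "lp n (d s) (X s) R Lf" using l[OF s] by blast
        then show ?thesis using Y[OF s] fop_None[of n "d s" "X s" R Lf j] by (simp add: c h_def)
      qed
      have "\<bar>- fphi (h s) t - - fphi (h s') t\<bar> \<le> K * \<bar>s - s'\<bar>" if s: "s \<in> {0..1}" "s' \<in> {0..1}" "t \<in> {0..1}" for s s' t
      proof -
        obtain P Q P' Q' where "signed (h s) P Q" "signed (h s') P' Q'" using sg s by meson
        then show ?thesis using fphi_lip[of "h s" P Q "h s'" P' Q' "K * \<bar>s - s'\<bar>" t] K[OF s(1,2)] s m[OF s(1,2)] e[OF s(1)] e[OF s(2)] by simp
      qed
      then show ?thesis by (intro lipf_shift[where g = "\<lambda>s t. - fphi (h s) t", OF X _ Y']) blast+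
    next
      case False
      then have c: "c = (False, j)" by (cases c) (auto simp: j_def)
      have Y': "Y s t = X s t + epsi (h s) t *\<^sub>R al j" if "s \<in> {0..1}" "t \<in> {0..1}" for s t
        using Y[OF that(1)] that(2) by (auto simp: c eop_def h_def Let_def fun_eq_iff split: if_splits)
      have e: "h s 0 \<noteq> mn (h s)" if s: "s \<in> {0..1}" for s
      proof -
        obtain R Lf where "lp n (d s) (X s) R Lf" using l[OF s] by blast
        then show ?thesis using Y[OF s] eop_None[of n "d s" "X s" R Lf j] lpD(2)[of n "d s" "X s" R Lf] by (simp add: c h_def)
      qed
      have "\<bar>epsi (h s) t - epsi (h s') t\<bar> \<le> K * \<bar>s - s'\<bar>" if s: "s \<in> {0..1}" "s' \<in> {0..1}" "t \<in> {0..1}" for s s' t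
      proof -
        obtain P Q P' Q' where "signed (h s) P Q" "signed (h s') P' Q'" using sg s by meson
        then show ?thesis using epsi_lip[of "h s" P Q "h s'" P' Q' "K * \<bar>s - s'\<bar>" t] K[OF s(1,2)] s m[OF s(1,2)] e[OF s(1)] e[OF s(2)] by simp
      qed
      then show ?thesis by (intro lipf_shift[where g = "\<lambda>s t. epsi (h s) t", OF X _ Y']) blast+
    qed
    moreover have "\<exists>R Lf. lp n (d s) (Y s) R Lf" if s: "s \<in> {0..1}" for s
      using l[OF s] opr_lp[OF _ Y[OF s]] unfolding reflected_def by meson
    ultimately show ?thesis using Y unfolding fam_def by blast
  }
qed

lemma fam_run:
  assumes "fam n d X"
  shows "(\<forall>s\<in>{0..1}. run C (X s) = None) \<or>
    (\<exists>Y. fam n d Y \<and> (\<forall>s\<in>{0..1}. run C (X s) = Some (Y s)))"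
proof (induction C)
  case (Cons c C)
  then show ?case
  proof
    assume "\<exists>Y. fam n d Y \<and> (\<forall>s\<in>{0..1}. run C (X s) = Some (Y s))"
    then obtain Y where Y: "fam n d Y" "\<forall>s\<in>{0..1}. run C (X s) = Some (Y s)" by blast
    then show ?case using fam_opr[OF Y(1), of c] by simp
  qed simp
qed (use assms in auto)

end

section \<open>Polygons and paths with nonnegative pairings\<close>

context km
begin

definition polyg :: "nat \<Rightarrow> (nat \<Rightarrow> 'l vec) \<Rightarrow> (real \<Rightarrow> 'l vec) \<Rightarrow> bool" where
  "polyg n d x \<longleftrightarrow> 0 < n \<and> x 0 = 0 \<and>
    (\<forall>k<n. \<forall>t. real k / n \<le> t \<longrightarrow> t \<le> real (Suc k) / n \<longrightarrow> x t = x (real k / n) + (t - real k / n) *\<^sub>R d k)"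

lemma polygD:
  assumes "polyg n d x"
  shows "0 < n" "x 0 = 0" "k < n \<Longrightarrow> real k \<le> n * t \<Longrightarrow> n * t \<le> real k + 1 \<Longrightarrow> x t = x (real k / n) + (t - real k / n) *\<^sub>R d k"
proof -
  show n: "0 < n" "x 0 = 0" using assms unfolding polyg_def by blast+
  assume k: "k < n" "real k \<le> n * t" "n * t \<le> real k + 1"
  have "real k / n \<le> t" "t \<le> real (Suc k) / n" using k n by (simp_all add: field_simps)
  then show "x t = x (real k / n) + (t - real k / n) *\<^sub>R d k" using assms k(1) unfolding polyg_def by blast
qed

lemma polyg_diff:
  assumes P: "polyg n d x" and k: "k < n" and t: "real k \<le> n * t" "n * t \<le> real k + 1"
    and u: "real k \<le> n * u" "n * u \<le> real k + 1"
  shows "x u = x t + (u - t) *\<^sub>R d k"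
  unfolding polygD(3)[OF P k t] polygD(3)[OF P k u] by (simp add: algebra_simps)

text \<open>All labels carry the identity, and a vertex is one change of leg. Its clause is void at
  a lattice point, trivial between equal directions, and true when the left direction is dominant,
  since then every positive coroot is positive on it after perturbation by
  \<open>rho\<close>.\<close>

lemma lp_polyg:
  assumes P: "polyg n d x" and e: "\<And>l. vH (x 1) l \<in> \<int>"
    and v: "\<And>k. 0 < k \<Longrightarrow> k < n \<Longrightarrow> (\<forall>l. vH (x (real k / n)) l \<in> \<int>) \<or> d k = d (k - 1) \<or> domt (d (k - 1))"
  shows "lp n d x (\<lambda>t. (nat \<lfloor>real n * t\<rfloor>, id)) (\<lambda>t. (nat (\<lceil>real n * t\<rceil> - 1), id))"
  unfolding lp_def
proof (intro conjI allI impI)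
  show n: "0 < n" "x 0 = 0" by (rule polygD[OF P])+
  show "vH (x 1) l \<in> \<int>" for l by (rule e)
  fix t :: real
  {
    assume t: "0 \<le> t" "t < 1"
    show "fst (nat \<lfloor>real n * t\<rfloor>, id) = nat \<lfloor>real n * t\<rfloor>" "inW (snd (nat \<lfloor>real n * t\<rfloor>, id))" by (simp_all add: inW_id)
    define k where "k = nat \<lfloor>real n * t\<rfloor>"
    have kf: "\<lfloor>real n * t\<rfloor> = int k" using t by (simp add: k_def)
    have k: "real k \<le> n * t" "n * t < real k + 1" using kf by linarith+
    have kn: "k < n"
    proof -
      have "n * t < real n * 1" using t n by (intro mult_strict_left_mono) auto
      then have "real k < n" using k(1) by simp
      then show ?thesis by simp
    qed
    show "\<exists>e>0. \<forall>u. t < u \<longrightarrow> u < t + e \<longrightarrow> u < 1 \<and> (nat \<lfloor>real n * u\<rfloor>, id) = (nat \<lfloor>real n * t\<rfloor>, id) \<and>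
       (nat (\<lceil>real n * u\<rceil> - 1), id) = (nat \<lfloor>real n * t\<rfloor>, id) \<and> x u = x t + (u - t) *\<^sub>R dv d (nat \<lfloor>real n * t\<rfloor>, id)"
    proof (intro exI[of _ "(real k + 1) / n - t"] conjI allI impI)
      show "0 < (real k + 1) / n - t" using k n by (simp add: field_simps)
      fix u assume u: "t < u" "u < t + ((real k + 1) / n - t)"
      have nu: "n * t < n * u" "n * u < real k + 1" using u n by (simp_all add: field_simps)
      have f: "\<lfloor>real n * u\<rfloor> = int k" "\<lceil>real n * u\<rceil> = int k + 1" using nu k by linarith+
      have "n * u < real n * 1" using nu kn by linarith
      then show "u < 1" using n by (metis mult_less_cancel_left_pos of_nat_0_less_iff)
      show "(nat \<lfloor>real n * u\<rfloor>, id) = (nat \<lfloor>real n * t\<rfloor>, id)" "(nat (\<lceil>real n * u\<rceil> - 1), id) = (nat \<lfloor>real n * t\<rfloor>, id)"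
        by (simp_all add: f kf)
      show "x u = x t + (u - t) *\<^sub>R dv d (nat \<lfloor>real n * t\<rfloor>, id)"
        using polyg_diff[OF P kn, of t u] k nu by (simp add: kf dv_def)
    qed
  }
  {
    assume t: "0 < t" "t \<le> 1"
    define k where "k = nat (\<lceil>real n * t\<rceil> - 1)"
    have "0 < real n * t" using t n by simp
    then have kf: "\<lceil>real n * t\<rceil> = int k + 1" unfolding k_def by linarith
    have k: "real k < n * t" "n * t \<le> real k + 1" using kf by linarith+
    have kn: "k < n"
    proof -
      have "n * t \<le> real n * 1" using t n by (intro mult_left_mono) auto
      then have "real k < n" using k(1) by simp
      then show ?thesis by simp
    qed
    show "\<exists>e>0. \<forall>u. t - e < u \<longrightarrow> u < t \<longrightarrow> 0 < u \<and> (nat \<lfloor>real n * u\<rfloor>, id) = (nat (\<lceil>real n * t\<rceil> - 1), id) \<and>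
       (nat (\<lceil>real n * u\<rceil> - 1), id) = (nat (\<lceil>real n * t\<rceil> - 1), id) \<and> x u = x t - (t - u) *\<^sub>R dv d (nat (\<lceil>real n * t\<rceil> - 1), id)"
    proof (intro exI[of _ "t - real k / n"] conjI allI impI)
      show "0 < t - real k / n" using k n by (simp add: field_simps)
      fix u assume u: "t - (t - real k / n) < u" "u < t"
      have nu: "n * u < n * t" "real k < n * u" using u n by (simp_all add: field_simps)
      have f: "\<lfloor>real n * u\<rfloor> = int k" "\<lceil>real n * u\<rceil> = int k + 1" using nu k by linarith+
      have "n * 0 < n * u" using nu by simp
      then show "0 < u" using n by (simp add: zero_less_mult_iff)
      show "(nat \<lfloor>real n * u\<rfloor>, id) = (nat (\<lceil>real n * t\<rceil> - 1), id)" "(nat (\<lceil>real n * u\<rceil> - 1), id) = (nat (\<lceil>real n * t\<rceil> - 1), id)"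
        by (simp_all add: f kf)
      show "x u = x t - (t - u) *\<^sub>R dv d (nat (\<lceil>real n * t\<rceil> - 1), id)"
        using polyg_diff[OF P kn, of t u] k nu unfolding kf by (simp add: dv_def algebra_simps)
    qed
  }
  {
    assume t: "0 < t" "t < 1"
    show "germ d (x t) (nat \<lfloor>real n * t\<rfloor>, id) (nat (\<lceil>real n * t\<rceil> - 1), id)"
    proof (cases "real n * t \<in> \<int>")
      case False
      then have "real n * t \<noteq> of_int \<lfloor>real n * t\<rfloor>" by (metis Ints_of_int)
      then have "\<lceil>real n * t\<rceil> - 1 = \<lfloor>real n * t\<rfloor>" by (simp add: ceiling_altdef)
      then show ?thesis by simp
    next
      case True
      then obtain i where i: "real n * t = of_int i" by (elim Ints_cases)
      have "0 < real n * t" using t n by simp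
      moreover have "real n * t < real n * 1" using t n by (intro mult_strict_left_mono) auto
      ultimately have i0: "0 < i" "i < int n" using i by simp_all
      define k where "k = nat i"
      have k: "0 < k" "k < n" "real n * t = real k" using i0 i by (auto simp: k_def)
      have tk: "t = real k / n" using k n by (simp add: field_simps)
      have fl: "nat \<lfloor>real n * t\<rfloor> = k" "nat (\<lceil>real n * t\<rceil> - 1) = k - 1" using k by auto
      have "lexpos d w i (k - 1, id)" if h: "pos w i" "phi w i (x t) \<notin> \<int>" "lexpos d w i (k, id)" for w i
        using v[OF k(1,2)]
      proof (elim disjE)
        assume "\<forall>l. vH (x (real k / n)) l \<in> \<int>"
        then show ?thesis using h(2) phi_int tk by blast
      next
        assume "d k = d (k - 1)"
        then show ?thesis using h(3) by (simp add: lexpos_def dv_def)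
      next
        assume "domt (d (k - 1))"
        then have "0 \<le> phi w i (d (k - 1))" "0 < phi w i rho" using h(1) unfolding pos_def by blast+
        then show ?thesis by (auto simp: lexpos_def dv_def)
      qed
      then have "step d (x t) (k, id) (k - 1, id)" using k(1) inW_id unfolding step_def by simp
      then show ?thesis unfolding fl by (rule r_into_rtranclp)
    qed
  }
qed

lemma step_real_vC:
  assumes "pos u k" "lexpos d u k D" "D' = tD u k D"
  shows "vC (dv d D) m \<le> vC (dv d D') m"
proof -
  have "dv d D' = dv d D - phi u k (dv d D) *\<^sub>R rt u k" using assms(3) by (simp add: act_refw)
  moreover have "phi u k (dv d D) * vC (rt u k) m \<le> 0"
    using assms(1,2) by (intro mult_nonneg_nonpos) (auto simp: lexpos_def pos_def)
  ultimately show ?thesis by simp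
qed

text \<open>From right to left, each reflection subtracts a nonnegative multiple of a positive root
  and so raises \<open>vC\<close>, while a change of leg between equal directions alters
  nothing.\<close>

lemma germ_vC:
  assumes "germ d x N M"
  shows "fst M \<le> fst N" "(\<And>k. fst M \<le> k \<Longrightarrow> k \<le> fst N \<Longrightarrow> d k = d (fst N)) \<Longrightarrow> vC (dv d N) m \<le> vC (dv d M) m"
proof -
  have "fst M \<le> fst N \<and> ((\<forall>k. fst M \<le> k \<longrightarrow> k \<le> fst N \<longrightarrow> d k = d (fst N)) \<longrightarrow> vC (dv d N) m \<le> vC (dv d M) m)" using assms
  proof (induction rule: converse_rtranclp_induct)
    case (step N D)
    from step(1) consider (real) u k where "pos u k" "lexpos d u k N" "D = tD u k N"
      | (gen) "fst N = Suc (fst D)" "snd D = snd N" unfolding step_def by blast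
    then show ?case
    proof cases
      case real
      then have "fst D = fst N" by (simp add: tD_def)
      then show ?thesis using step.IH step_real_vC[OF real, of m] unfolding \<open>fst D = fst N\<close> by (blast intro: order.trans)
    next
      case gen
      show ?thesis
      proof (intro conjI impI)
        show "fst M \<le> fst N" using step.IH gen by simp
        assume h: "\<forall>k. fst M \<le> k \<longrightarrow> k \<le> fst N \<longrightarrow> d k = d (fst N)"
        have e: "d k = d (fst N)" if "fst M \<le> k" "k \<le> fst N" for k using h that by blast
        have eD: "d (fst D) = d (fst N)" by (rule e) (use step.IH gen in auto)
        have "d k = d (fst D)" if "fst M \<le> k" "k \<le> fst D" for k
          unfolding eD by (rule e) (use that gen in auto)
        then have "vC (dv d D) m \<le> vC (dv d M) m" using step.IH by blast
        moreover have "dv d D = dv d N" unfolding dv_def eD gen(2) ..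
        ultimately show "vC (dv d N) m \<le> vC (dv d M) m" by simp
      qed
    qed
  qed simp
  then show "fst M \<le> fst N" "(\<And>k. fst M \<le> k \<Longrightarrow> k \<le> fst N \<Longrightarrow> d k = d (fst N)) \<Longrightarrow> vC (dv d N) m \<le> vC (dv d M) m"
    by blast+
qed

lemma domt_right_slope:
  assumes l: "lp n d z R Lf" and D: "\<And>t l. t \<in> {0..1} \<Longrightarrow> 0 \<le> vH (z t) l"
    and t: "0 \<le> t" "t < 1" and z: "vH (z t) j = 0"
  shows "0 \<le> vH (dv d (R t)) j"
proof -
  obtain e where e: "e > 0" "\<forall>u. t < u \<longrightarrow> u < t + e \<longrightarrow> u < 1 \<and> R u = R t \<and> Lf u = R t \<and> z u = z t + (u - t) *\<^sub>R dv d (R t)"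
    using lpD(6)[OF l t] by blast
  have *: "t + e / 2 < 1" "z (t + e / 2) = z t + (e / 2) *\<^sub>R dv d (R t)"
    using e(2)[rule_format, of "t + e / 2"] e(1) by auto
  have "0 \<le> vH (z (t + e / 2)) j" using D[of "t + e / 2"] * t e by auto
  then show ?thesis unfolding *(2) using z e by (simp add: zero_le_mult_iff)
qed

text \<open>A path with nonnegative pairings follows its first, dominant, direction as long as the legs of
  its shape do: the first direction is dominant, later ones have \<open>vC\<close> at most that of the first one.\<close>

lemma dominant_start:
  assumes l: "lp n d z R Lf" and D: "\<And>t l. t \<in> {0..1} \<Longrightarrow> 0 \<le> vH (z t) l"
    and k: "0 < k" "k \<le> n" and dk: "\<And>j. j < k \<Longrightarrow> d j = d 0" and d0: "domt (d 0)"
  shows "0 \<le> t \<Longrightarrow> real n * t \<le> real k \<Longrightarrow> z t = t *\<^sub>R d 0"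
    and "dv d (Lf (real k / n)) = d 0 \<and> fst (Lf (real k / n)) = k - 1 \<and> inW (snd (Lf (real k / n)))"
proof -
  note LP = lpD[OF l]
  have n: "0 < n" by (rule LP)
  define b where "b = real k / n"
  have b: "0 < b" "b \<le> 1" using k n by (auto simp: b_def)
  have leg: "fst (R t) < k" if "0 \<le> t" "t < b" for t
  proof -
    have "t < 1" using that b by simp
    then have "fst (R t) = nat \<lfloor>real n * t\<rfloor>" using LP(4) that by simp
    moreover have "real n * t < k" using that n by (simp add: b_def field_simps)
    ultimately show ?thesis using that by (simp add: nat_less_iff floor_less_iff)
  qed
  have W: "\<exists>w. snd (R t) = act w" if "0 \<le> t" "t < b" for t using LP(5)[of t] that b by (simp add: inW_def)
  have dvR: "\<exists>w. dv d (R t) = act w (d 0)" if "0 \<le> t" "t < b" for t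
    using W[OF that] dk[OF leg[OF that]] by (auto simp: dv_def)
  define P where "P t \<longleftrightarrow> z t = t *\<^sub>R d 0 \<and> (t < b \<longrightarrow> dv d (R t) = d 0)" for t
  have base: "P 0"
  proof -
    have "domt (dv d (R 0))" unfolding domt_def using domt_right_slope[OF l D] LP(2) by simp
    then have "dv d (R 0) = d 0" using dvR[of 0] b d0 act_dom_unique by auto
    then show ?thesis using LP(2) by (simp add: P_def)
  qed
  have left: "z t = t *\<^sub>R d 0 \<and> dv d (Lf t) = d 0 \<and> fst (Lf t) < k \<and> (\<exists>u. 0 \<le> u \<and> u < t \<and> t - u < 1 / n \<and> R u = Lf t)"
    if t: "0 < t" "t \<le> b" and P: "\<And>u. 0 \<le> u \<Longrightarrow> u < t \<Longrightarrow> P u" for t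
  proof -
    obtain e where e: "e > 0" "\<forall>u. t - e < u \<longrightarrow> u < t \<longrightarrow> 0 < u \<and> R u = Lf t \<and> Lf u = Lf t \<and> z u = z t - (t - u) *\<^sub>R dv d (Lf t)"
      using LP(7)[of t] t b by auto
    \<comment> \<open>The bound \<open>1 / (2 * n)\<close> keeps \<open>u\<close> within the leg
      that ends at \<open>b\<close>; this later determines the leg of the left label at
      \<open>k / n\<close>.\<close>
    define u where "u = t - min (e / 2) (1 / (2 * n))"
    have "t - e < u" "u < t" using e n by (auto simp: u_def)
    then have u: "0 < u" "R u = Lf t" "z u = z t - (t - u) *\<^sub>R dv d (Lf t)" "u < t" using e by blast+
    have Pu: "z u = u *\<^sub>R d 0" "dv d (Lf t) = d 0" using P[of u] u t by (auto simp: P_def)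
    have "z t = u *\<^sub>R d 0 + (t - u) *\<^sub>R d 0" using Pu u(3) by (simp add: algebra_simps)
    then have "z t = t *\<^sub>R d 0" by (simp add: algebra_simps)
    moreover have "t - u < 1 / n" using n by (auto simp: u_def min_def field_simps)
    moreover have "fst (Lf t) < k" using leg[of u] u t by simp
    ultimately show ?thesis using Pu(2) u less_imp_le[OF u(1)] by blast
  qed
  have all: "P t" if "0 \<le> t" "t \<le> b" for t
  proof (rule interval_induct[where P = P and a = 0 and b = b])
    fix t assume t: "0 \<le> t" "t < b" "P t"
    obtain e where e: "e > 0" "\<forall>u. t < u \<longrightarrow> u < t + e \<longrightarrow> u < 1 \<and> R u = R t \<and> Lf u = R t \<and> z u = z t + (u - t) *\<^sub>R dv d (R t)"
      using LP(6)[of t] t b by auto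
    have "P u" if "t < u" "u < t + e" for u
      using e(2)[rule_format, OF that] t by (auto simp: P_def algebra_simps)
    then show "\<exists>e>0. \<forall>u. t < u \<longrightarrow> u < t + e \<longrightarrow> P u" using e(1) by blast
  next
    fix t assume t: "0 < t" "t \<le> b" and Pu: "\<And>u. 0 \<le> u \<Longrightarrow> u < t \<Longrightarrow> P u"
    note Lt = left[OF t Pu]
    have "dv d (R t) = d 0" if tb: "t < b"
    proof -
      have g: "germ d (z t) (R t) (Lf t)" using LP(8) t tb b by simp
      have dd: "d j = d 0" if "j \<le> fst (R t)" for j by (rule dk) (use that leg[of t] t tb in simp)
      obtain w where w: "dv d (R t) = act w (d 0)" using dvR[of t] t tb by auto
      \<comment> \<open>From left to right \<open>vC\<close> can only drop, but the dominant
        \<open>d 0\<close> already has the least \<open>vC\<close> in its orbit; so the direction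
        does not change.\<close>
      have "vC (dv d (R t)) m \<le> vC (dv d (Lf t)) m" for m
        by (rule germ_vC(2)[OF g]) (metis dd order.refl)
      then show ?thesis using act_dom_eq[OF d0, of w] Lt w by simp
    qed
    then show "P t" using Lt by (simp add: P_def)
  qed (use base b that in auto)
  show "0 \<le> t \<Longrightarrow> real n * t \<le> real k \<Longrightarrow> z t = t *\<^sub>R d 0"
    using all[of t] n by (simp add: P_def b_def field_simps)
  obtain u where u: "0 \<le> u" "u < b" "b - u < 1 / n" "R u = Lf b" and Lb: "dv d (Lf b) = d 0" using left[of b] all b by auto
  have "fst (R u) = nat \<lfloor>real n * u\<rfloor>" "inW (snd (R u))" using LP(4,5)[of u] u b by auto
  moreover have "\<lfloor>real n * u\<rfloor> = int k - 1"
  proof -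
    have nb: "n * b = k" using n by (simp add: b_def)
    have "real n * u < n * b" "real n * (b - u) < n * (1 / n)" using u n by (intro mult_strict_left_mono; simp)+
    then have "real n * u < k" "real k - 1 < n * u" using n nb by (simp_all add: right_diff_distrib)
    then show ?thesis by linarith
  qed
  ultimately show "dv d (Lf (real k / n)) = d 0 \<and> fst (Lf (real k / n)) = k - 1 \<and> inW (snd (Lf (real k / n)))"
    using Lb u k by (auto simp: b_def nat_diff_distrib)
qed

lemma pos_rev_iff: "pos (rev w) j \<longleftrightarrow> 0 < vH (act w rho) j"
proof
  show "pos (rev w) j \<Longrightarrow> 0 < vH (act w rho) j" by (simp add: pos_def phi_rev)
  assume "0 < vH (act w rho) j"
  then show "pos (rev w) j"
    using pos_dich[of "rev w" j] phi_snoc_same[of "rev w" j rho] by (auto simp: pos_def phi_rev)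
qed

text \<open>Simple reflections fixing \<open>d k\<close> are integral at \<open>x\<close>, so the
  lifting properties shorten \<open>w\<close> until it is the identity. A chain ending in
  \<open>(k, act [])\<close> cannot end with a reflection, as \<open>d k\<close> and
  \<open>rho\<close> are dominant. Its last step is therefore the change of leg from
  \<open>d (Suc k)\<close>, whose \<open>vC\<close> is zero, and the reflections before it only
  raised \<open>vC\<close>.\<close>

lemma vertex_vC:
  assumes "germ d x N (k, act w)" "act w (d k) = d k" "fst N = Suc k" "inW (snd N)"
    and d: "domt (d k)" and x: "\<And>j. vH (d k) j = 0 \<Longrightarrow> vH x j = 0"
    and N: "\<And>j. vH (d k) j = 0 \<Longrightarrow> 0 \<le> vH (dv d N) j" and c: "\<And>m. vC (d (Suc k)) m = 0"
  shows "vC (dv d N) m \<le> 0"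
  using assms(1-4) N
proof (induction "len w" arbitrary: w N rule: less_induct)
  case less
  let ?M = "(k, act w)"
  have dM: "dv d ?M = d k" using less.prems(2) by (simp add: dv_def)
  show ?case
  proof (cases "\<forall>j. lexpos d [] j ?M")
    case False
    then obtain j where j: "\<not> lexpos d [] j ?M" by blast
    have dj: "vH (d k) j = 0" and rj: "vH (act w rho) j \<le> 0"
      using j d unfolding lexpos_def dM phi_Nil domt_def by (auto simp: less_eq_real_def)
    have "vH (act w rho) j \<noteq> 0" using phi_rho_nz[of "[]" j w] by simp
    then have len: "len (j # w) < len w" using rj by (intro len_Cons_less) simp
    have xj: "vH x j \<in> \<int>" using x[OF dj] by simp
    have sd: "act (j # w) (d k) = d k" using less.prems(2) dj by (simp add: s_def)
    have sM: "sD j ?M = (k, act (j # w))" by (auto simp: sD_def)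
    show ?thesis
    proof (cases "lexpos d [] j N")
      case True
      have "germ d x N (sD j ?M)" by (rule germ_right[OF less.prems(1) xj less.prems(4)]) (use True in simp)
      then show ?thesis using less.hyps[OF len, of N] sd less.prems sM by simp
    next
      case nN: False
      \<comment> \<open>With zero slope, reflecting \<open>N\<close> changes its label but not its
        direction, so the claim may be proved for the reflected label.\<close>
      then have z: "vH (dv d N) j = 0" using lexpos_slope(2)[OF nN] less.prems(5)[OF dj] by simp
      have eq: "dv d (sD j N) = dv d N" using z by (simp add: s_def)
      have g: "germ d x (sD j N) ?M" by (rule germ_left[OF less.prems(1) xj less.prems(4)]) (use j in simp)
      have "germ d x (sD j N) (sD j ?M)"
        by (rule germ_right[OF g xj]) (use nN less.prems(4) inW_s lexpos_sD_same in auto)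
      then have "vC (dv d (sD j N)) m \<le> 0"
        using less.hyps[OF len, of "sD j N"] sd less.prems sM inW_s eq by simp
      then show ?thesis unfolding eq .
    qed
  next
    case True
    have "pos (rev w) j" for j
    proof (cases "0 < vH (d k) j")
      case True
      show ?thesis
      proof (rule ccontr)
        assume "\<not> pos (rev w) j"
        then have "pos (rev w @ [j]) j" using pos_dich by blast
        then have "0 \<le> phi (rev w @ [j]) j (d k)" using d by (simp add: pos_def)
        then show False using True less.prems(2) by (simp add: phi_snoc_same phi_rev)
      qed
    next
      case False
      then show ?thesis using True[rule_format, of j] unfolding lexpos_def dM phi_Nil pos_rev_iff by simp
    qed
    then have "act (rev w) = act []" by (rule act_id_if_pos)
    then have w: "act w = act []" using act_cong_rev[of "rev w" "[]"] by simp
    have "fst N \<le> Suc k \<longrightarrow> N = ?M \<or> (fst N = Suc k \<and> vC (dv d N) m \<le> 0)" using less.prems(1)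
    proof (induction rule: converse_rtranclp_induct)
      case (step N D)
      from step(1) consider (real) u i where "pos u i" "lexpos d u i N" "D = tD u i N"
        | (gen) "fst N = Suc (fst D)" "snd D = snd N" unfolding step_def by blast
      then show ?case
      proof cases
        case real
        have f: "fst D = fst N" using real by (simp add: tD_def)
        \<comment> \<open>A reflection ending at the identity would start from a label on which its
          own coroot is negative, against \<open>lexpos\<close>.\<close>
        have "D \<noteq> ?M"
        proof
          assume D: "D = ?M"
          have N: "snd N y = act (refw u i) y" for y
          proof -
            have "act (refw u i) (snd N y) = y" using D real(3) w by (auto simp: tD_def fun_eq_iff comp_def)
            then show ?thesis using act_rev(1)[of "refw u i" "snd N y"] by (simp add: refw_def)
          qed
          have neg: "phi u i (act (refw u i) y) = - phi u i y" for y by (simp add: act_refw phi_lin)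
          have "0 \<le> phi u i (d k)" "0 < phi u i rho" using real(1) d by (auto simp: pos_def)
          moreover have "dv d N = act (refw u i) (d k)" using N D f by (simp add: dv_def)
          ultimately show False using real(2) unfolding lexpos_def N by (auto simp: neg)
        qed
        then show ?thesis using step.IH f step_real_vC[OF real, of m] by auto
      next
        case gen
        show ?thesis
        proof
          assume "fst N \<le> Suc k"
          then have "D = ?M" using step.IH gen by auto
          then have "fst N = Suc k" "snd N = act []" using gen w by auto
          then show "N = ?M \<or> (fst N = Suc k \<and> vC (dv d N) m \<le> 0)" using c by (simp add: dv_def)
        qed
      qed
    qed simp
    then show ?thesis using less.prems(3) by auto
  qed
qed

text \<open>Within a leg \<open>germ_vC\<close> lets the \<open>vC\<close> of the direction only
  decrease with time. So a nonpositive value at the start of the leg stays nonpositive, and the path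
  inherits the monotonicity.\<close>

lemma leg_vC_mono:
  assumes l: "lp n d z R Lf" and k: "k < n" and st: "vC (dv d (R (real k / n))) m \<le> 0"
    and t: "real k \<le> n * t" "t \<le> u" "n * u \<le> real k + 1"
  shows "vC (z u) m \<le> vC (z t) m"
proof -
  note LP = lpD[OF l]
  have n: "0 < n" by (rule LP)
  define p q where "p = real k / n" and "q = (real k + 1) / n"
  have pq: "0 \<le> p" "p < q" "q \<le> 1" using n k by (auto simp: p_def q_def divide_right_mono field_simps)
  have leg: "fst (R t) = k" if "p \<le> t" "t < q" for t
  proof -
    have "real k \<le> n * t" "n * t < real k + 1" using that n by (auto simp: p_def q_def field_simps)
    then have "\<lfloor>real n * t\<rfloor> = int k" by linarith
    then show ?thesis using LP(4)[of t] that pq by simp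
  qed
  define P where "P t \<longleftrightarrow> (t < q \<longrightarrow> vC (dv d (R t)) m \<le> 0)" for t
  have P: "P t" if t: "p \<le> t" "t \<le> q" for t
  proof (rule interval_induct[where P = P and a = p and b = q])
    show "P p" using st by (simp add: P_def p_def)
    fix t assume t: "p \<le> t" "t < q" "P t"
    obtain e where e: "e > 0" "\<forall>u. t < u \<longrightarrow> u < t + e \<longrightarrow> u < 1 \<and> R u = R t \<and> Lf u = R t \<and> z u = z t + (u - t) *\<^sub>R dv d (R t)"
      using LP(6)[of t] t pq by auto
    then show "\<exists>e>0. \<forall>u. t < u \<longrightarrow> u < t + e \<longrightarrow> P u" using t by (auto simp: P_def)
  next
    fix t assume t: "p < t" "t \<le> q" and Pu: "\<And>u. p \<le> u \<Longrightarrow> u < t \<Longrightarrow> P u"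
    show "P t" unfolding P_def
    proof
      assume tq: "t < q"
      obtain e where e: "e > 0" "\<forall>u. t - e < u \<longrightarrow> u < t \<longrightarrow> 0 < u \<and> R u = Lf t \<and> Lf u = Lf t \<and> z u = z t - (t - u) *\<^sub>R dv d (Lf t)"
        using LP(7)[of t] t pq by auto
      define u where "u = max p (t - e / 2)"
      have u: "p \<le> u" "u < t" "t - e < u" using t e by (auto simp: u_def)
      then have "R u = Lf t" using e by blast
      then have Lt: "vC (dv d (Lf t)) m \<le> 0" "fst (Lf t) = k" using Pu[of u] leg[of u] u tq t by (auto simp: P_def)
      have g: "germ d (z t) (R t) (Lf t)" using LP(8) t tq pq by simp
      have "vC (dv d (R t)) m \<le> vC (dv d (Lf t)) m"
        by (rule germ_vC(2)[OF g]) (use Lt leg[of t] t tq in auto)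
      then show "vC (dv d (R t)) m \<le> 0" using Lt by simp
    qed
  qed (use pq t in auto)
  have tu: "p \<le> t" "u \<le> q" using t n by (auto simp: p_def q_def field_simps)
  have "- vC (z t) m \<le> - vC (z u) m"
  proof (rule mono_right[where h = "\<lambda>t. - vC (z t) m"])
    show "continuous_on {t..u} (\<lambda>t. - vC (z t) m)"
      by (intro continuous_intros continuous_on_subset[OF lp_cont(2)[OF l]]) (use tu pq in auto)
    show "t \<le> u" by fact
    fix r assume r: "t \<le> r" "r < u"
    obtain e where e: "e > 0" "\<forall>u. r < u \<longrightarrow> u < r + e \<longrightarrow> u < 1 \<and> R u = R r \<and> Lf u = R r \<and> z u = z r + (u - r) *\<^sub>R dv d (R r)"
      using LP(6)[of r] r tu pq by auto
    have s0: "vC (dv d (R r)) m \<le> 0" using P[of r] r tu by (auto simp: P_def)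
    have "- vC (z r) m \<le> - vC (z v) m" if "r < v" "v < r + e" for v
    proof -
      have "z v = z r + (v - r) *\<^sub>R dv d (R r)" using e that by blast
      then show ?thesis using s0 that by (simp add: mult_nonneg_nonpos)
    qed
    then show "\<exists>e>0. \<forall>v. r < v \<longrightarrow> v < r + e \<longrightarrow> - vC (z r) m \<le> - vC (z v) m" using e(1) by blast
  qed
  then show ?thesis by simp
qed

end

lemma continuous_zero_on_Rats:
  fixes g :: "real \<Rightarrow> real"
  assumes c: "continuous_on {0..1} g" and z: "\<And>t. t \<in> \<rat> \<Longrightarrow> p \<le> t \<Longrightarrow> t \<le> 1 \<Longrightarrow> g t = 0"
    and p: "0 \<le> p" "p < 1" and t: "p \<le> t" "t \<le> 1"
  shows "g t = 0"
proof (rule ccontr)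
  assume ne: "g t \<noteq> 0"
  then obtain e where e: "e > 0" "\<forall>u\<in>{0..1}. dist u t < e \<longrightarrow> dist (g u) (g t) < \<bar>g t\<bar>"
    using c p t unfolding continuous_on_iff by (metis atLeastAtMost_iff order.trans zero_less_abs_iff)
  have "max p (t - e) < min 1 (t + e)" using p t e by auto
  then obtain q where q: "q \<in> \<rat>" "max p (t - e) < q" "q < min 1 (t + e)" using Rats_dense_in_real by blast
  have "g q = 0" using z q by simp
  moreover have "dist (g q) (g t) < \<bar>g t\<bar>" using e(2) q p by (auto simp: dist_real_def abs_less_iff)
  ultimately show False by (simp add: dist_real_def)
qed

section \<open>Highest weight paths and their comparison\<close>

context km
begin

definition nneg :: "(real \<Rightarrow> 'l vec) \<Rightarrow> bool" where
  "nneg x \<longleftrightarrow> (\<forall>t\<in>{0..1}. \<forall>l. 0 \<le> vH (x t) l)"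

lemma lp_nneg_iff:
  assumes "lp n d x R Lf" shows "nneg x \<longleftrightarrow> (\<forall>j. mn (\<lambda>t. vH (x t) j) = 0)"
proof -
  have *: "(\<forall>t\<in>{0..1}. 0 \<le> vH (x t) j) \<longleftrightarrow> mn (\<lambda>t. vH (x t) j) = 0" for j
  proof -
    interpret signed "\<lambda>t. vH (x t) j" "\<lambda>t. lexpos d [] j (R t)" "\<lambda>t. lexpos d [] j (Lf t)"
      by (rule lp_signed[OF assms])
    have "mn (\<lambda>t. vH (x t) j) \<le> 0" using mn_le[of 0] lpD(2)[OF assms] by simp
    then show ?thesis using mn_le mn_att by fastforce
  qed
  then show ?thesis unfolding nneg_def by blast
qed

text \<open>A highest weight property: from everything that words in e and f reach, the operators e
  alone lead back to \<open>x\<close>.\<close>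

definition good :: "(real \<Rightarrow> 'l vec) \<Rightarrow> bool" where
  "good x \<longleftrightarrow> (\<forall>C y. run C x = Some y \<longrightarrow> (\<exists>E. (\<forall>c\<in>set E. \<not> fst c) \<and> run E y = Some x))"

text \<open>A path with nonnegative pairings is killed by every e, so the word leading back is
  empty.\<close>

lemma good_nneg_eq:
  assumes l: "lp n d x R Lf" and g: "good x" and r: "run C x = Some y" and y: "nneg y"
  shows "y = x"
proof -
  obtain E where E: "\<forall>c\<in>set E. \<not> fst c" "run E y = Some x" using g r unfolding good_def by blast
  obtain R1 L1 where ly: "lp n d y R1 L1" using run_lp[OF l r] by blast
  show ?thesis
  proof (cases E rule: rev_cases)
    case (snoc E' c)
    then obtain j where c: "c = (False, j)" using E(1) by (cases c) auto
    have "eop j y = None" using eop_None[OF ly] lp_nneg_iff[OF ly] y by blast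
    then show ?thesis using E(2) snoc c by (simp add: run_append)
  qed (use E in auto)
qed

text \<open>What an isomorphism of the two generated crystals amounts to in terms of words: the same
  words vanish, the same words fix the source, and all minima agree.\<close>

definition cmp :: "(real \<Rightarrow> 'l vec) \<Rightarrow> (real \<Rightarrow> 'l vec) \<Rightarrow> bool" where
  "cmp x y \<longleftrightarrow> (\<forall>C. (run C x = None \<longleftrightarrow> run C y = None) \<and> (run C x = Some x \<longleftrightarrow> run C y = Some y) \<and>
     (\<forall>x' y' j. run C x = Some x' \<longrightarrow> run C y = Some y' \<longrightarrow> mn (\<lambda>t. vH (x' t) j) = mn (\<lambda>t. vH (y' t) j)))"

lemma cmp_refl: "cmp x x"
  by (auto simp: cmp_def)

lemma cmp_trans: assumes "cmp x y" "cmp y z" shows "cmp x z"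
  unfolding cmp_def
proof (intro allI conjI impI)
  fix C
  show "run C x = None \<longleftrightarrow> run C z = None" "run C x = Some x \<longleftrightarrow> run C z = Some z"
    using assms unfolding cmp_def by blast+
  fix x' z' j assume r: "run C x = Some x'" "run C z = Some z'"
  obtain y' where "run C y = Some y'" using assms r unfolding cmp_def by (metis not_Some_eq)
  then show "mn (\<lambda>t. vH (x' t) j) = mn (\<lambda>t. vH (z' t) j)" using assms r unfolding cmp_def by metis
qed

text \<open>Minima are constant along the family. So a word fixing \<open>X 1\<close> sends
  \<open>X 0\<close> to a path with nonnegative pairings, which is \<open>X 0\<close> by goodness.
  The converse is the assumption \<open>fix0\<close>; it also transports goodness.\<close>

lemma fam_cmp:
  assumes F: "fam n d X" and g: "good (X 0)" and nn: "\<And>r. r \<in> {0..1} \<Longrightarrow> nneg (X r)"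
    and fix0: "\<And>C. run C (X 0) = Some (X 0) \<Longrightarrow> run C (X 1) = Some (X 1)"
  shows "good (X 1) \<and> cmp (X 0) (X 1)"
proof -
  obtain R0 L0 R1 L1 where l: "lp n (d 0) (X 0) R0 L0" "lp n (d 1) (X 1) R1 L1"
    using F unfolding fam_def by fastforce
  have run: "(run C (X 0) = None \<and> run C (X 1) = None) \<or>
      (\<exists>y z. run C (X 0) = Some y \<and> run C (X 1) = Some z \<and> (\<forall>j. mn (\<lambda>t. vH (z t) j) = mn (\<lambda>t. vH (y t) j)))" for C
    using fam_run[OF F, of C]
  proof
    assume "\<exists>Y. fam n d Y \<and> (\<forall>s\<in>{0..1}. run C (X s) = Some (Y s))"
    then obtain Y where Y: "fam n d Y" "\<And>r. r \<in> {0..1} \<Longrightarrow> run C (X r) = Some (Y r)" by blast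
    show ?thesis using Y(2)[of 0] Y(2)[of 1] fam_mn[OF Y(1), of 1] by auto
  qed auto
  have fix1: "run C (X 0) = Some (X 0)" if h: "run C (X 1) = Some (X 1)" for C
  proof -
    obtain y where y: "run C (X 0) = Some y" "\<forall>j. mn (\<lambda>t. vH (X 1 t) j) = mn (\<lambda>t. vH (y t) j)"
      using run[of C] h by auto
    obtain R2 L2 where ly: "lp n (d 0) y R2 L2" using run_lp[OF l(1) y(1)] by blast
    have "nneg y" using y(2) lp_nneg_iff[OF ly] lp_nneg_iff[OF l(2)] nn[of 1] by simp
    then show ?thesis using good_nneg_eq[OF l(1) g y(1)] y(1) by simp
  qed
  have "cmp (X 0) (X 1)" unfolding cmp_def
  proof (intro allI conjI impI)
    fix C
    show "run C (X 0) = None \<longleftrightarrow> run C (X 1) = None" using run[of C] by auto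
    show "run C (X 0) = Some (X 0) \<longleftrightarrow> run C (X 1) = Some (X 1)" using fix0 fix1 by blast
    fix y z j assume "run C (X 0) = Some y" "run C (X 1) = Some z"
    then show "mn (\<lambda>t. vH (y t) j) = mn (\<lambda>t. vH (z t) j)" using run[of C] by auto
  qed
  moreover have "good (X 1)" unfolding good_def
  proof (intro allI impI)
    fix C z assume z: "run C (X 1) = Some z"
    then obtain y where y: "run C (X 0) = Some y" using run[of C] by auto
    obtain E where E: "\<forall>c\<in>set E. \<not> fst c" "run E y = Some (X 0)" using g y unfolding good_def by blast
    then have "run (E @ C) (X 0) = Some (X 0)" using y by (simp add: run_append)
    then have "run (E @ C) (X 1) = Some (X 1)" by (rule fix0)
    then show "\<exists>E. (\<forall>c\<in>set E. \<not> fst c) \<and> run E z = Some (X 1)" using E(1) z by (auto simp: run_append)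
  qed
  ultimately show ?thesis by blast
qed

text \<open>The rationality argument covers only the times from vertex \<open>k + 1\<close> on,
  since before that the deformed path need not be rational at rational times. The first
  \<open>k\<close> legs are forced by \<open>dominant_start\<close>. On the remaining leg
  \<open>vC\<close> is nonincreasing and vanishes at both ends.\<close>

lemma stage_fix:
  assumes F: "fam n d X" and nn: "nneg (X 0)" and k: "0 < k" "k < n"
    and dk: "\<And>r j. r \<in> {0..1} \<Longrightarrow> j < k \<Longrightarrow> d r j = d r 0" and d0: "\<And>r. r \<in> {0..1} \<Longrightarrow> domt (d r 0)"
    and dC: "\<And>r j m. r \<in> {0..1} \<Longrightarrow> vC (d r j) m = 0"
    and XC: "\<And>r t m. r \<in> {0..1} \<Longrightarrow> t \<in> {0..1} \<Longrightarrow> vC (X r t) m = 0"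
    and XR: "\<And>r t l. r \<in> {0..1} \<Longrightarrow> t \<in> {0..1} \<Longrightarrow> t \<in> \<rat> \<Longrightarrow> real k + 1 \<le> real n * t \<Longrightarrow> vH (X r t) l \<in> \<rat>"
    and C: "run C (X 0) = Some (X 0)" and r: "r \<in> {0..1}"
  shows "run C (X r) = Some (X r)"
proof -
  obtain Y where Y: "fam n d Y" "\<And>r. r \<in> {0..1} \<Longrightarrow> run C (X r) = Some (Y r)"
    using fam_run[OF F, of C] C by force
  have Y0: "Y 0 = X 0" using Y(2)[of 0] C by simp
  have lX: "\<exists>R Lf. lp n (d r) (X r) R Lf" if "r \<in> {0..1}" for r using F that by (simp add: fam_def)
  obtain R0 L0 where l0: "lp n (d 0) (X 0) R0 L0" using lX[of 0] by auto
  define z where "z = Y r"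
  obtain R Lf where l: "lp n (d r) z R Lf" using Y(1) r unfolding fam_def z_def by blast
  have "nneg z" using lp_nneg_iff[OF l] lp_nneg_iff[OF l0] fam_mn[OF Y(1) r] nn Y0 by (simp add: z_def)
  then have zn: "\<And>t l. t \<in> {0..1} \<Longrightarrow> 0 \<le> vH (z t) l" by (simp add: nneg_def)
  have n: "0 < n" using k by simp
  have ds1: "z t = t *\<^sub>R d r 0" if "0 \<le> t" "real n * t \<le> real k" for t
    using dominant_start(1)[OF l zn k(1) less_imp_le[OF k(2)] dk[OF r] d0[OF r] that] by blast
  have ds2: "dv (d r) (Lf (real k / n)) = d r 0 \<and> fst (Lf (real k / n)) = k - 1 \<and> inW (snd (Lf (real k / n)))"
    using dominant_start(2)[OF l zn k(1) less_imp_le[OF k(2)] dk[OF r] d0[OF r]] by blast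
  have start: "vC (z t) m = 0" if "0 \<le> t" "real n * t \<le> real k" for t m using ds1[OF that] dC[OF r] by simp
  have rat: "vC (z t) m = 0" if t: "t \<in> {0..1}" "t \<in> \<rat>" "real k + 1 \<le> real n * t" for t m
  proof -
    obtain K where K: "\<And>s s'. s \<in> {0..1} \<Longrightarrow> s' \<in> {0..1} \<Longrightarrow> \<bar>vC (Y s t) m - vC (Y s' t) m\<bar> \<le> K * \<bar>s - s'\<bar>"
      using Y(1) t(1) unfolding fam_def lipf_def by meson
    have "vC (Y r t) m = vC (Y 0 t) m"
    proof (rule lipschitz_rational_const[where g = "\<lambda>r. vC (Y r t) m" and K = K, OF K _ r])
      fix r' :: real assume r': "r' \<in> {0..1}"
      obtain R' L' where l': "lp n (d r') (X r') R' L'" using lX[OF r'] by blast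
      show "vC (Y r' t) m \<in> \<rat>"
        by (rule run_rat(2)[OF l' Y(2)[OF r'] t(1)]) (use XR XC r' t in auto)
    qed
    then show ?thesis using XC[of 0 t m] t by (simp add: z_def Y0)
  qed
  define p where "p = (real k + 1) / n"
  have p: "0 \<le> p" "p \<le> 1" "p \<in> \<rat>" "n * p = real k + 1" using k n by (auto simp: p_def)
  have tail: "vC (z t) m = 0" if t: "p \<le> t" "t \<le> 1" for t m
  proof (cases "p = 1")
    case True
    then show ?thesis using rat[of t m] t p by simp
  next
    case False
    show ?thesis
    proof (rule continuous_zero_on_Rats[where g = "\<lambda>t. vC (z t) m" and p = p, OF lp_cont(2)[OF l]])
      fix t assume t: "t \<in> \<rat>" "p \<le> t" "t \<le> 1"
      \<comment> \<open>Translates the lower bound \<open>p\<close> on the time into the vertex form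
        required by \<open>rat\<close>.\<close>
      have "n * p \<le> real n * t" using t n by (intro mult_left_mono) auto
      then show "vC (z t) m = 0" using rat[of t m] t p by simp
    qed (use False p t in auto)
  qed
  define q where "q = real k / n"
  have q: "0 < q" "q < 1" "n * q = real k" using k n by (auto simp: q_def)
  obtain w where w: "snd (Lf q) = act w" using ds2 by (auto simp: inW_def q_def)
  have Lq: "Lf q = (k - 1, act w)" "act w (d r (k - 1)) = d r (k - 1)"
    using ds2 w dk[OF r, of "k - 1"] k by (auto simp: q_def dv_def prod_eq_iff)
  have zq: "z q = q *\<^sub>R d r 0" using ds1[of q] q by simp
  have dk1: "d r (k - 1) = d r 0" by (rule dk[OF r]) (use k in simp)
  have fq: "fst (R q) = k" using lpD(4)[OF l, of q] q by simp
  \<comment> \<open>The direction leaving the moving vertex. Simple coroots vanishing on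
    \<open>d r 0\<close> vanish at the vertex as well, so nonnegativity of the path makes the
    corresponding slopes nonnegative, as \<open>vertex_vC\<close> requires.\<close>
  have st: "vC (dv (d r) (R q)) m \<le> 0" for m
  proof (rule vertex_vC[where k = "k - 1"])
    show "germ (d r) (z q) (R q) (k - 1, act w)" using lpD(8)[OF l, of q] q Lq by simp
    show "act w (d r (k - 1)) = d r (k - 1)" by (rule Lq)
    show "fst (R q) = Suc (k - 1)" using fq k by simp
    show "inW (snd (R q))" using lpD(5)[OF l, of q] q by simp
    show "domt (d r (k - 1))" unfolding dk1 by (rule d0[OF r])
    show "vH (z q) j = 0" if "vH (d r (k - 1)) j = 0" for j using that zq dk1 by simp
    then show "0 \<le> vH (dv (d r) (R q)) j" if "vH (d r (k - 1)) j = 0" for j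
      using domt_right_slope[OF l zn, of q j] that q by simp
    show "vC (d r (Suc (k - 1))) m = 0" for m by (rule dC[OF r])
  qed
  have mid: "vC (z t) m = 0" if t: "q \<le> t" "t \<le> p" for t m
  proof -
    have nt: "real k \<le> real n * t" "real n * t \<le> real k + 1" using t n by (auto simp: q_def p_def field_simps)
    have "vC (z t) m \<le> vC (z q) m" "vC (z p) m \<le> vC (z t) m"
      by (rule leg_vC_mono[OF l k(2)]; use st nt t p q in \<open>simp add: q_def\<close>)+
    then show ?thesis using start[of q m] tail[of p m] q p by simp
  qed
  have "vC (z t) m = vC (X r t) m" if t: "t \<in> {0..1}" for t m
  proof -
    consider "real n * t \<le> real k" | "q \<le> t" "t \<le> p" | "p \<le> t" using n by (fastforce simp: q_def p_def field_simps)
    then show ?thesis using start mid tail XC[OF r t] t by cases auto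
  qed
  then have "z = X r" using run_eqI[of C "X r" z] Y(2)[OF r] by (simp add: z_def)
  then show ?thesis using Y(2)[OF r] by (simp add: z_def)
qed

text \<open>All directions lie in the orbit of the dominant \<open>v\<close>, so the heights of
  reachable paths are nonnegative. Applying e as long as some minimum is nonzero therefore stops, at
  a path with nonnegative pairings, which \<open>dominant_start\<close> identifies with the straight
  one.\<close>

lemma good_straight:
  assumes y: "\<And>t. t \<in> {0..1} \<Longrightarrow> y t = t *\<^sub>R v" and v: "domt v" "\<And>l. vH v l \<in> \<int>" "\<And>m. vC v m = 0"
  shows "good y" "\<exists>R Lf. lp 1 (\<lambda>_. v) y R Lf"
proof -
  have P: "polyg 1 (\<lambda>_. v) y" unfolding polyg_def using y by auto
  have "vH (y 1) l \<in> \<int>" for l using y[of 1] v(2) by simp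
  then obtain R Lf where l: "lp 1 (\<lambda>_. v) y R Lf" using lp_polyg[OF P] by auto
  then show "\<exists>R Lf. lp 1 (\<lambda>_. v) y R Lf" by blast
  have yC: "vC (y t) m = 0" if "t \<in> {0..1}" for t m using that y v by simp
  have posC: "0 \<le> vC (z 1) m" if z: "lp 1 (\<lambda>_. v) z R' L'" for z R' L' m
  proof -
    have "vC (z 0) m \<le> vC (z 1) m"
    proof (rule mono_right[where h = "\<lambda>t. vC (z t) m"])
      show "continuous_on {0..1} (\<lambda>t. vC (z t) m)" by (rule lp_cont(2)[OF z])
      fix t :: real assume t: "0 \<le> t" "t < 1"
      obtain e where e: "e > 0" "\<forall>u. t < u \<longrightarrow> u < t + e \<longrightarrow> u < 1 \<and> R' u = R' t \<and> L' u = R' t \<and> z u = z t + (u - t) *\<^sub>R dv (\<lambda>_. v) (R' t)"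
        using lpD(6)[OF z t] by blast
      obtain w where "snd (R' t) = act w" using lpD(5)[OF z t] by (auto simp: inW_def)
      then have "0 \<le> vC (dv (\<lambda>_. v) (R' t)) m" using act_dom_ge[OF v(1), of m w] v(3) by (simp add: dv_def)
      then have "vC (z t) m \<le> vC (z u) m" if "t < u" "u < t + e" for u
        using e(2)[rule_format, OF that] that by simp
      then show "\<exists>e>0. \<forall>u. t < u \<longrightarrow> u < t + e \<longrightarrow> vC (z t) m \<le> vC (z u) m" using e(1) by blast
    qed simp
    then show ?thesis using lpD(2)[OF z] by simp
  qed
  \<comment> \<open>The height is the sum of the coefficients at the end, all nonnegative by
    \<open>posC\<close>; it serves as the termination measure below.\<close>
  have ht0: "0 \<le> ht C" if rz: "run C y = Some z" for C z
  proof -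
    obtain R' L' where z: "lp 1 (\<lambda>_. v) z R' L'" using run_lp[OF l rz] by blast
    have "0 \<le> (\<Sum>m\<in>snd ` set C. vC (z 1) m)" by (rule sum_nonneg) (use posC[OF z] in simp)
    also have "\<dots> = real_of_int (ht C)" using run_ht[OF l rz, of "snd ` set C"] yC[of 1] by simp
    finally show ?thesis by simp
  qed
  have "\<exists>E. (\<forall>c\<in>set E. \<not> fst c) \<and> run E z = Some y" if "run C y = Some z" for C z
    using that
  proof (induction "nat (ht C)" arbitrary: C z rule: less_induct)
    case less
    obtain R' L' where z: "lp 1 (\<lambda>_. v) z R' L'" using run_lp[OF l less.prems] by blast
    show ?case
    proof (cases "nneg z")
      case True
      then have "\<And>t l. t \<in> {0..1} \<Longrightarrow> 0 \<le> vH (z t) l" by (simp add: nneg_def)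
      then have "z t = t *\<^sub>R v" if "t \<in> {0..1}" for t
        using dominant_start(1)[OF z, of 1 t] v(1) that by simp
      then have "z = y" using run_eqI[OF less.prems] y by simp
      then show ?thesis by (intro exI[of _ "[]"]) auto
    next
      case False
      then obtain j where "mn (\<lambda>t. vH (z t) j) \<noteq> 0" using lp_nneg_iff[OF z] by blast
      then obtain z' where z': "eop j z = Some z'" using eop_None[OF z] by blast
      then have r: "run ((False, j) # C) y = Some z'" using less.prems by simp
      have "nat (ht ((False, j) # C)) < nat (ht C)" using ht0[OF r] by (simp add: ht_def)
      then obtain E where "\<forall>c\<in>set E. \<not> fst c" "run E z' = Some y" using less.hyps r by blast
      then show ?thesis using z' by (intro exI[of _ "E @ [(False, j)]"]) (auto simp: run_append)
    qed
  qed
  then show "good y" by (auto simp: good_def)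
qed


lemma polyg_lin:
  assumes "polyg n d x" "polyg n d' x'"
  shows "polyg n (\<lambda>k. c *\<^sub>R d k + c' *\<^sub>R d' k) (\<lambda>t. c *\<^sub>R x t + c' *\<^sub>R x' t)"
  unfolding polyg_def
proof (intro conjI allI impI)
  show "0 < n" "c *\<^sub>R x 0 + c' *\<^sub>R x' 0 = 0" using assms unfolding polyg_def by auto
  fix k t assume "k < n" "real k / n \<le> t" "t \<le> real (Suc k) / n"
  then have e: "x t = x (real k / n) + (t - real k / n) *\<^sub>R d k" "x' t = x' (real k / n) + (t - real k / n) *\<^sub>R d' k"
    using assms unfolding polyg_def by blast+
  show "c *\<^sub>R x t + c' *\<^sub>R x' t = c *\<^sub>R x (real k / n) + c' *\<^sub>R x' (real k / n)
      + (t - real k / n) *\<^sub>R (c *\<^sub>R d k + c' *\<^sub>R d' k)" unfolding e by (simp add: algebra_simps)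
qed

lemma polyg_dir:
  assumes "polyg n d x" "k < n"
  shows "d k = real n *\<^sub>R (x (real (Suc k) / n) - x (real k / n))"
proof -
  have n: "0 < n" by (rule polygD(1)[OF assms(1)])
  have e: "x (real (Suc k) / n) = x (real k / n) + (real (Suc k) / n - real k / n) *\<^sub>R d k"
    using assms unfolding polyg_def by (meson order.refl divide_right_mono of_nat_0_le_iff of_nat_le_iff le_SucI)
  have "real (Suc k) / n - real k / n = 1 / n" by (simp add: diff_divide_distrib[symmetric])
  then show ?thesis unfolding e using n by simp
qed

lemma polyg_rat:
  assumes P: "polyg n d x" and lat: "\<And>k l. k \<le> n \<Longrightarrow> vH (x (real k / n)) l \<in> \<int>"
    and t: "t \<in> {0..1}" "t \<in> \<rat>"
  shows "vH (x t) l \<in> \<rat>"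
proof (cases "t = 1")
  case True
  then show ?thesis using lat[of n l] polygD(1)[OF P] by (auto simp: Ints_subset_Rats[THEN subsetD])
next
  case False
  have n: "0 < n" by (rule polygD(1)[OF P])
  define k where "k = nat \<lfloor>real n * t\<rfloor>"
  have "0 \<le> real n * t" using t by simp
  then have kf: "\<lfloor>real n * t\<rfloor> = int k" by (simp add: k_def)
  have k: "real k \<le> real n * t" "real n * t < real k + 1" using kf by linarith+
  have "real n * t < real n * 1" using t False n by (intro mult_strict_left_mono) auto
  then have kn: "k < n" using k by simp
  have R: "vH (x (real j / n)) l \<in> \<rat>" if "j \<le> n" for j using lat[OF that] Ints_subset_Rats by blast
  have "vH (d k) l \<in> \<rat>" unfolding polyg_dir[OF P kn] using R[of k] R[of "Suc k"] kn by (simp del: of_nat_Suc)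
  moreover have "x t = x (real k / n) + (t - real k / n) *\<^sub>R d k" using polygD(3)[OF P kn] k by simp
  ultimately show ?thesis using R[of k] t kn by simp
qed

theorem straight_compare:
  assumes P0: "polyg n d0 x" and lat: "\<And>k l. k \<le> n \<Longrightarrow> vH (x (real k / n)) l \<in> \<int>"
    and xC: "\<And>t m. t \<in> {0..1} \<Longrightarrow> vC (x t) m = 0" and nn: "nneg x"
  defines "y \<equiv> \<lambda>t. if t \<in> {0..1} then t *\<^sub>R x 1 else x t"
  shows "good x" "good y" "cmp y x"
proof -
  have n: "0 < n" and x0: "x 0 = 0" by (rule polygD[OF P0])+
  \<comment> \<open>Beyond the last leg \<open>d0\<close> is arbitrary; zero there makes
    \<open>vC\<close> vanish for every index.\<close>
  define d where "d k = (if k < n then d0 k else 0)" for k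
  have P: "polyg n d x" unfolding polyg_def
  proof (intro conjI allI impI)
    fix k t assume k: "k < n" "real k / n \<le> t" "t \<le> real (Suc k) / n"
    then have "x t = x (real k / n) + (t - real k / n) *\<^sub>R d0 k" using P0 unfolding polyg_def by blast
    then show "x t = x (real k / n) + (t - real k / n) *\<^sub>R d k" unfolding d_def by (simp only: k(1) if_True)
  qed (rule n x0)+
  have kn1: "real k / n \<in> {0..1}" if "k \<le> n" for k using that n by simp
  have dC: "vC (d k) m = 0" for k m
  proof (cases "k < n")
    case True
    then show ?thesis using polyg_dir[OF P True] xC[OF kn1, of k m] xC[OF kn1, of "Suc k" m]
      by (simp del: of_nat_Suc)
  qed (simp add: d_def)
  have x1: "vH (x 1) l \<in> \<int>" for l using lat[of n l] n by simp
  have lx: "lp n d x (\<lambda>t. (nat \<lfloor>real n * t\<rfloor>, id)) (\<lambda>t. (nat (\<lceil>real n * t\<rceil> - 1), id))"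
    by (rule lp_polyg[OF P x1]) (use lat in \<open>auto intro: less_imp_le\<close>)
  \<comment> \<open>The first \<open>k\<close> legs are replaced by the chord to the vertex
    \<open>k / n\<close>. Then \<open>Q n\<close> is the straight path and \<open>Q 1\<close> the
    given one, and from \<open>Q (Suc k)\<close> to \<open>Q k\<close> only the vertex
    \<open>k / n\<close> moves, taking the two adjacent straight pieces along.\<close>
  define Q where "Q k = (\<lambda>t. if t \<in> {0..1} \<and> real n * t \<le> real k then (real n * t / real k) *\<^sub>R x (real k / n) else x t)" for k
  define Qd where "Qd k j = (if j < k then (real n / real k) *\<^sub>R x (real k / n) else d j)" for k j
  have Qhi: "Q k t = x t" if "0 < k" "real k \<le> real n * t" for k t
  proof (cases "real n * t = real k")
    case True
    then have "t = real k / n" using n by (simp add: field_simps)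
    then show ?thesis using that n by (simp add: Q_def)
  qed (use that in \<open>simp add: Q_def\<close>)
  have PQ: "polyg n (Qd k) (Q k)" if k: "0 < k" "k \<le> n" for k
    unfolding polyg_def
  proof (intro conjI allI impI)
    show "0 < n" "Q k 0 = 0" using n x0 by (simp_all add: Q_def)
    fix j t assume j: "j < n" "real j / n \<le> t" "t \<le> real (Suc j) / n"
    have "0 \<le> real j / n" by simp
    moreover have "real (Suc j) / n \<le> 1" using kn1[of "Suc j"] j(1) by simp
    ultimately have "0 \<le> t" "t \<le> 1" using j(2,3) by linarith+
    then have t: "t \<in> {0..1}" "real j / n \<in> {0..1}" using kn1[of j] j(1) by auto
    have nt: "real j \<le> real n * t" "real n * t \<le> real j + 1" using j n by (simp_all add: field_simps)
    show "Q k t = Q k (real j / n) + (t - real j / n) *\<^sub>R Qd k j"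
    proof (cases "j < k")
      case True
      then have "real j + 1 \<le> real k" by simp
      then have "Q k t = (real n * t / real k) *\<^sub>R x (real k / n)" "Q k (real j / n) = (real j / real k) *\<^sub>R x (real k / n)"
        using t nt n by (simp_all add: Q_def)
      moreover have "real n * t / real k = real j / real k + (t - real j / n) * (real n / real k)"
        using n k by (simp add: field_simps)
      ultimately show ?thesis using True by (simp add: Qd_def scaleR_add_left)
    next
      case False
      have "Q k t = x t" "Q k (real j / n) = x (real j / n)" using Qhi[OF k(1)] nt False n by auto
      then show ?thesis using polygD(3)[OF P j(1) nt] False by (simp add: Qd_def)
    qed
  qed
  have Qnn: "0 \<le> vH (Q k t) l" if "t \<in> {0..1}" "k \<le> n" for k t l
    using that nn kn1[OF that(2)] by (auto simp: Q_def nneg_def)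
  have QC: "vC (Q k t) m = 0" if "t \<in> {0..1}" "k \<le> n" for k t m
    using that xC kn1[OF that(2)] by (auto simp: Q_def)
  have bdd: "\<exists>B. \<forall>t\<in>{0..1}. \<bar>vH (x t) l\<bar> \<le> B" for l
  proof -
    have "continuous_on {0..1} (\<lambda>t. \<bar>vH (x t) l\<bar>)" by (intro continuous_intros lp_cont(1)[OF lx])
    then show ?thesis using continuous_attains_sup[of "{0..1::real}" "\<lambda>t. \<bar>vH (x t) l\<bar>"] by fastforce
  qed
  have Qb: "\<bar>vH (Q k t) l\<bar> \<le> B" if B: "\<forall>t\<in>{0..1}. \<bar>vH (x t) l\<bar> \<le> B" and t: "t \<in> {0..1}" "0 < k" "k \<le> n" for k t l B
  proof (cases "real n * t \<le> real k")
    case True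
    have "0 \<le> B" using B[rule_format, of 0] by simp
    have "\<bar>real n * t / real k\<bar> * \<bar>vH (x (real k / n)) l\<bar> \<le> 1 * B"
      using B kn1[OF t(3)] t True \<open>0 \<le> B\<close> by (intro mult_mono) (auto simp: abs_mult)
    then show ?thesis using True t by (simp add: Q_def abs_mult)
  next
    case False
    then show ?thesis using B t by (simp add: Q_def)
  qed
  have stage: "good (Q k) \<and> cmp (Q (Suc k)) (Q k)" if k: "0 < k" "k < n" and g: "good (Q (Suc k))" for k
  proof -
    define X where "X r = (\<lambda>t. (1 - r) *\<^sub>R Q (Suc k) t + r *\<^sub>R Q k t)" for r :: real
    define D where "D r = (\<lambda>j. (1 - r) *\<^sub>R Qd (Suc k) j + r *\<^sub>R Qd k j)" for r :: real
    have PX: "polyg n (D r) (X r)" for r unfolding X_def D_def by (rule polyg_lin) (rule PQ; use k in simp)+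
    have Xhi: "X r t = x t" if "real k + 1 \<le> real n * t" for r t
      using Qhi[of k t] Qhi[of "Suc k" t] that k by (simp add: X_def flip: scaleR_add_left)
    have X0: "X 0 = Q (Suc k)" "X 1 = Q k" by (auto simp: X_def)
    have dom: "domt (D r j)" if "r \<in> {0..1}" "j < k" for r j
      using that nn kn1[of k] kn1[of "Suc k"] k by (auto simp: domt_def D_def Qd_def nneg_def simp del: of_nat_Suc intro!: add_nonneg_nonneg mult_nonneg_nonneg)
    have same: "D r j = D r 0" if "j < k" for r j using that k by (simp add: D_def Qd_def)
    have lX: "\<exists>R Lf. lp n (D r) (X r) R Lf" if r: "r \<in> {0..1}" for r
    proof -
      have "vH (X r 1) l \<in> \<int>" for l using Xhi[of 1 r] x1 k by simp
      \<comment> \<open>The three alternatives of \<open>lp_polyg\<close> serve the vertices before,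
        at and after the moving vertex \<open>k / n\<close>.\<close>
      moreover have "(\<forall>l. vH (X r (real j / n)) l \<in> \<int>) \<or> D r j = D r (j - 1) \<or> domt (D r (j - 1))" if j: "0 < j" "j < n" for j
      proof -
        consider "j < k" | "j = k" | "k < j" by linarith
        then show ?thesis
        proof cases
          case 1
          then show ?thesis using same[of j r] same[of "j - 1" r] by simp
        next
          case 2
          then show ?thesis using dom[OF r, of "j - 1"] k by simp
        next
          case 3
          then have "X r (real j / n) = x (real j / n)" using n by (intro Xhi) simp
          then show ?thesis using lat[of j] j by simp
        qed
      qed
      ultimately show ?thesis using lp_polyg[OF PX[of r]] by blast
    qed
    have "lipf X" unfolding lipf_def
    proof
      fix l
      obtain B where B: "\<forall>t\<in>{0..1}. \<bar>vH (x t) l\<bar> \<le> B" using bdd by blast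
      show "\<exists>K. \<forall>s\<in>{0..1}. \<forall>s'\<in>{0..1}. \<forall>t\<in>{0..1}.
          \<bar>vH (X s t) l - vH (X s' t) l\<bar> \<le> K * \<bar>s - s'\<bar> \<and> \<bar>vC (X s t) l - vC (X s' t) l\<bar> \<le> K * \<bar>s - s'\<bar>"
      proof (intro exI[of _ "2 * B"] ballI conjI)
        fix s s' t :: real assume s: "s \<in> {0..1}" "s' \<in> {0..1}" "t \<in> {0..1}"
        have b: "\<bar>vH (Q k t) l\<bar> \<le> B" "\<bar>vH (Q (Suc k) t) l\<bar> \<le> B" using Qb[OF B s(3)] k by auto
        have "vH (X s t) l - vH (X s' t) l = (vH (Q k t) l - vH (Q (Suc k) t) l) * (s - s')"
          by (simp add: X_def algebra_simps)
        moreover have "\<bar>(vH (Q k t) l - vH (Q (Suc k) t) l) * (s - s')\<bar> \<le> 2 * B * \<bar>s - s'\<bar>"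
          unfolding abs_mult using b by (intro mult_right_mono) auto
        ultimately show "\<bar>vH (X s t) l - vH (X s' t) l\<bar> \<le> 2 * B * \<bar>s - s'\<bar>" by simp
        have "0 \<le> B" using b by simp
        then show "\<bar>vC (X s t) l - vC (X s' t) l\<bar> \<le> 2 * B * \<bar>s - s'\<bar>" using QC[OF s(3)] k by (simp add: X_def)
      qed
    qed
    then have F: "fam n D X" using lX by (simp add: fam_def)
    have nX: "nneg (X r)" if "r \<in> {0..1}" for r
      using that Qnn k by (auto simp: nneg_def X_def intro!: add_nonneg_nonneg mult_nonneg_nonneg)
    have "run C (X 1) = Some (X 1)" if C: "run C (X 0) = Some (X 0)" for C
    proof (rule stage_fix[OF F nX k same _ _ _ _ C])
      show "domt (D r 0)" if "r \<in> {0..1}" for r using dom[OF that k(1)] .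
      show "vC (D r j) m = 0" for r j m using dC xC kn1[of k] kn1[of "Suc k"] k by (simp add: D_def Qd_def del: of_nat_Suc)
      show "vC (X r t) m = 0" if "t \<in> {0..1}" for r t m using QC[OF that] k by (simp add: X_def)
      show "vH (X r t) l \<in> \<rat>" if "t \<in> {0..1}" "t \<in> \<rat>" "real k + 1 \<le> real n * t" for r t l
        unfolding Xhi[OF that(3)] by (rule polyg_rat[OF P lat that(1,2)])
    qed auto
    then show ?thesis using fam_cmp[OF F _ nX] g unfolding X0 by blast
  qed
  have Qn: "Q n = y"
  proof
    fix t show "Q n t = y t"
    proof (cases "t \<in> {0..1}")
      case True
      then have "real n * t \<le> real n * 1" by (intro mult_left_mono) auto
      then show ?thesis using True n by (simp add: Q_def y_def)
    next
      case False
      then show ?thesis unfolding Q_def y_def by (simp only: simp_thms if_False)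
    qed
  qed
  have "domt (x 1)" using nn by (simp add: domt_def nneg_def)
  then show gy: "good y" by (rule good_straight(1)[rotated]) (use x1 xC in \<open>auto simp: y_def\<close>)
  have all: "good (Q k) \<and> cmp (Q n) (Q k)" if "0 < k" "k \<le> n" for k
    using that(2,1)
  proof (induction rule: inc_induct)
    case base
    then show ?case using gy Qn cmp_refl by simp
  next
    case (step k)
    then show ?case using stage[of k] cmp_trans by auto
  qed
  have "Q 1 = x"
  proof
    fix t show "Q 1 t = x t"
    proof (cases "t \<in> {0..1} \<and> real n * t \<le> 1")
      case True
      have "x t = x (real 0 / n) + (t - real 0 / n) *\<^sub>R d 0"
        by (rule polygD(3)[OF P n]) (use True in auto)
      moreover have "d 0 = real n *\<^sub>R (x (1 / n) - x 0)" using polyg_dir[OF P n] by simp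
      ultimately have "x t = (real n * t) *\<^sub>R x (1 / n)" by (simp add: x0 mult.commute)
      then show ?thesis using True by (simp add: Q_def)
    qed (auto simp: Q_def)
  qed
  then show "good x" "cmp y x" using all[of 1] n Qn by auto
qed

end

section \<open>Ramps\<close>

text \<open>Here \<open>c\<close> is the last of the vertices \<open>k / n\<close> strictly before \<open>T\<close>.\<close>

definition ramp :: "nat \<Rightarrow> real \<Rightarrow> real \<Rightarrow> real" where
  "ramp n T t = (let c = (real_of_int \<lceil>n * T\<rceil> - 1) / n in if t \<le> c then 0 else if t \<le> T then (t - c) / (T - c) else 1)"

lemma ramp_start_less: assumes "0 < n" shows "(real_of_int \<lceil>real n * T\<rceil> - 1) / n < T"
proof -
  have "real_of_int \<lceil>real n * T\<rceil> - 1 < n * T" by linarith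
  then show ?thesis using assms by (simp add: field_simps)
qed

lemma ramp_1:
  assumes "0 < n" shows ramp_eq_1: "ramp n T t = 1 \<longleftrightarrow> T \<le> t" and ramp_le_1: "ramp n T t \<le> 1"
proof -
  define c where "c = (real_of_int \<lceil>real n * T\<rceil> - 1) / n"
  have c: "c < T" unfolding c_def by (rule ramp_start_less[OF assms])
  have r: "ramp n T t = (if t \<le> c then 0 else if t \<le> T then (t - c) / (T - c) else 1)"
    unfolding ramp_def Let_def c_def ..
  show "ramp n T t = 1 \<longleftrightarrow> T \<le> t" "ramp n T t \<le> 1" using c by (auto simp: r field_simps)
qed

lemma ramp_le_imp: "0 < n \<Longrightarrow> (\<And>t. t \<in> {0..1} \<Longrightarrow> ramp n T t \<le> ramp n T' t) \<Longrightarrow> T \<in> {0..1} \<Longrightarrow> T' \<le> T"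
  using ramp_eq_1[of n T T] ramp_eq_1[of n T' T] ramp_le_1[of n T' T] by fastforce

text \<open>All ramps are at most 1 and reach 1 exactly at their parameter, so the sum first attains
  \<open>c\<close> at the largest parameter \<open>T 0\<close>. It is thus determined by the sum,
  and its ramp can be removed.\<close>

lemma ramp_sum_inj:
  fixes T T' :: "nat \<Rightarrow> real"
  assumes n: "0 < n" and T: "\<And>k. k < c \<Longrightarrow> T k \<in> {0..1}" "\<And>j k. j \<le> k \<Longrightarrow> k < c \<Longrightarrow> T k \<le> T j"
    and T': "\<And>k. k < c \<Longrightarrow> T' k \<in> {0..1}" "\<And>j k. j \<le> k \<Longrightarrow> k < c \<Longrightarrow> T' k \<le> T' j"
    and eq: "\<And>t. t \<in> {0..1} \<Longrightarrow> (\<Sum>k<c. ramp n (T k) t) = (\<Sum>k<c. ramp n (T' k) t)" and k: "k < c"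
  shows "T k = T' k"
  using T T' eq k
proof (induction c arbitrary: T T' k)
  case (Suc c)
  have le: "T' 0 \<le> T 0" if T: "\<And>k. k < Suc c \<Longrightarrow> T k \<in> {0..1}" "\<And>j k. j \<le> k \<Longrightarrow> k < Suc c \<Longrightarrow> T k \<le> T j"
    and eq: "\<And>t. t \<in> {0..1} \<Longrightarrow> (\<Sum>k<Suc c. ramp n (T k) t) = (\<Sum>k<Suc c. ramp n (T' k) t)" for T T'
  proof -
    have "ramp n (T k) (T 0) = 1" if "k < Suc c" for k using T(2)[of 0 k] that n by (simp add: ramp_eq_1)
    then have "(\<Sum>k<Suc c. ramp n (T' k) (T 0)) = real (Suc c)" using eq[of "T 0"] T(1)[of 0] by simp
    then have "(\<Sum>k<Suc c. 1 - ramp n (T' k) (T 0)) = 0" by (simp add: sum_subtractf)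
    then have "1 - ramp n (T' 0) (T 0) = 0"
      by (subst (asm) sum_nonneg_eq_0_iff) (use ramp_le_1[OF n] in \<open>auto simp del: sum.lessThan_Suc\<close>)
    then show ?thesis using ramp_eq_1[OF n, of "T' 0" "T 0"] by simp
  qed
  have T0: "T 0 = T' 0"
    using le[of T T'] le[of T' T] Suc.prems(1-5) by (simp add: order.antisym)
  show ?case
  proof (cases k)
    case 0
    then show ?thesis using T0 by simp
  next
    case (Suc j)
    have "T (Suc j) = T' (Suc j)"
    proof (rule Suc.IH[where T = "\<lambda>k. T (Suc k)" and T' = "\<lambda>k. T' (Suc k)"])
      fix t :: real assume "t \<in> {0..1}"
      then have "(\<Sum>k<Suc c. ramp n (T k) t) = (\<Sum>k<Suc c. ramp n (T' k) t)" by (rule Suc.prems(5))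
      then show "(\<Sum>k<c. ramp n (T (Suc k)) t) = (\<Sum>k<c. ramp n (T' (Suc k)) t)"
        unfolding sum.lessThan_Suc_shift using T0 by simp
    qed (use Suc.prems Suc in auto)
    then show ?thesis using Suc by simp
  qed
qed simp

lemma (in signed) fphi_le: assumes "h 1 \<noteq> mn h" "t \<in> {0..1}" shows "fphi h t \<le> h t - mn h"
  using mn_le[OF assms(2)] after_fmi[OF assms(1), of t] assms(2) by (auto simp: fphi_def)

lemma (in signed) fphi_nonneg: assumes "h 1 \<noteq> mn h" "t \<in> {0..1}" shows "0 \<le> fphi h t"
  using mn_le[OF assms(2)] by (simp add: fphi_def)

text \<open>A form of \<open>fphi_Inf\<close> suited to comparing the new ramp with the ramps
  already present.\<close>

lemma (in signed) fphi_greatest: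
  assumes "h 1 \<noteq> mn h" "t \<in> {0..1}" "c \<le> 1" "\<And>u. t \<le> u \<Longrightarrow> u \<le> 1 \<Longrightarrow> c \<le> h u - mn h"
  shows "c \<le> fphi h t"
proof -
  have "c + mn h \<le> Inf (h ` {t..1})" using assms by (intro cInf_greatest) (auto simp: le_diff_eq)
  then show ?thesis unfolding fphi_Inf[OF assms(1,2)] using assms(3) by simp
qed

lemma (in signed) fphi_mono:
  assumes "h 1 \<noteq> mn h" "t \<in> {0..1}" "t \<le> u" "u \<le> 1" shows "fphi h t \<le> fphi h u"
proof (rule fphi_greatest[OF assms(1)])
  have h: "fphi h t \<le> 1" "fphi h t \<le> Inf (h ` {t..1}) - mn h" unfolding fphi_Inf[OF assms(1,2)] by auto
  show "fphi h t \<le> 1" by (rule h)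
  fix v assume "u \<le> v" "v \<le> 1"
  moreover have "bdd_below (h ` {t..1})" using mn_le assms(2) by (intro bdd_belowI[of _ "mn h"]) auto
  ultimately have "Inf (h ` {t..1}) \<le> h v" using assms by (intro cInf_lower) auto
  then show "fphi h t \<le> h v - mn h" using h(2) by simp
qed (use assms in auto)

section \<open>Paths whose tangents are integral at the start of each leg\<close>

context km
begin

text \<open>Following the present direction back to the beginning of the leg leads to integral
  pairings. For a lattice polygon that point is the vertex itself; the property survives the root
  operators and makes the ramps linear.\<close>

definition latp :: "nat \<Rightarrow> (nat \<Rightarrow> 'l vec) \<Rightarrow> (real \<Rightarrow> 'l vec) \<Rightarrow> (real \<Rightarrow> 'l lab) \<Rightarrow> bool" where
  "latp n d x R \<longleftrightarrow> (\<forall>t l. 0 \<le> t \<longrightarrow> t < 1 \<longrightarrow> vH (x t) l - (t - real (fst (R t)) / n) * vH (dv d (R t)) l \<in> \<int>)"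

text \<open>The traced-back point is either unchanged, or shifted by an integral multiple of
  \<open>al j\<close>, or reflected and then shifted in this way.\<close>

lemma latp_reflected:
  assumes r: "reflected n d j x R Lf x' R' Lf'" and L: "latp n d x R"
  shows "latp n d x' R'"
  unfolding latp_def
proof (intro allI impI)
  fix t :: real and l assume t: "0 \<le> t" "t < 1"
  obtain p q where pq: "0 \<le> p" "p < q" "q \<le> 1" "vH (x p) j \<in> \<int>" "vH (x q) j \<in> \<int>" "R' = reflR j p q R"
    and x': "x' t = reflx j p q x t"
    using r t unfolding reflected_def by auto
  define tau where "tau = t - real (fst (R t)) / n"
  have I: "vH (x t) l - tau * vH (dv d (R t)) l \<in> \<int>" for l using L t unfolding latp_def tau_def by blast
  have f: "fst (R' t) = fst (R t)" by (simp add: pq reflR_def)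
  consider "t < p" | "t = p" | "p < t" "t < q" | "q \<le> t" by linarith
  then have "vH (x' t) l - tau * vH (dv d (R' t)) l \<in> \<int>"
  proof cases
    case 1
    then show ?thesis using I by (simp add: x' pq reflx_def reflR_def)
  next
    case 4
    then have "vH (x' t) l - tau * vH (dv d (R' t)) l = (vH (x t) l - tau * vH (dv d (R t)) l) - (vH (x q) j - vH (x p) j) * of_int (a l j)"
      using pq by (simp add: x' reflx_def reflR_def)
    then show ?thesis using I pq(4,5) by simp
  next
    case 2
    have "vH (x' t) l - tau * vH (dv d (R' t)) l = (vH (x t) l - tau * vH (dv d (R t)) l)
        - ((vH (x t) j - tau * vH (dv d (R t)) j) - vH (x p) j) * of_int (a l j)"
      using x' pq unfolding 2 by (simp add: reflx_def reflR_def vH_s algebra_simps)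
    then show ?thesis using I[of l] I[of j] pq(4) by simp
  next
    case 3
    then have "vH (x' t) l - tau * vH (dv d (R' t)) l = (vH (x t) l - tau * vH (dv d (R t)) l)
        - ((vH (x t) j - tau * vH (dv d (R t)) j) - vH (x p) j) * of_int (a l j)"
      by (simp add: x' pq reflx_def reflR_def vH_s algebra_simps)
    then show ?thesis using I[of l] I[of j] pq(4) by simp
  qed
  then show "vH (x' t) l - (t - real (fst (R' t)) / n) * vH (dv d (R' t)) l \<in> \<int>" by (simp add: f tau_def)
qed

lemma run_latp:
  assumes "lp n d x R Lf" "latp n d x R" "run C x = Some y"
  shows "\<exists>R' Lf'. lp n d y R' Lf' \<and> latp n d y R'"
  using assms(3)
proof (induction C arbitrary: y)
  case (Cons c C)
  obtain z where z: "run C x = Some z" "opr c z = Some y" using Cons.prems by (rule run_ConsE)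
  obtain R1 L1 where "lp n d z R1 L1" "latp n d z R1" using Cons.IH[OF z(1)] by blast
  moreover obtain R' L' where r: "reflected n d (snd c) z R1 L1 y R' L'"
    using opr_lp[of n d z R1 L1 c y] calculation z(2) by blast
  ultimately show ?case using latp_reflected[OF r] r unfolding reflected_def by blast
qed (use assms in auto)

lemma lattice_polyg:
  assumes P: "polyg n d x" and lat: "\<And>k l. k \<le> n \<Longrightarrow> vH (x (real k / n)) l \<in> \<int>"
  shows "\<exists>R Lf. lp n d x R Lf \<and> latp n d x R"
proof -
  have n: "0 < n" by (rule polygD(1)[OF P])
  define R :: "real \<Rightarrow> 'l lab" where "R = (\<lambda>t. (nat \<lfloor>real n * t\<rfloor>, id))"
  have "lp n d x R (\<lambda>t. (nat (\<lceil>real n * t\<rceil> - 1), id))" unfolding R_def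
    by (rule lp_polyg[OF P]) (use lat[of n] n lat in \<open>auto intro: less_imp_le\<close>)
  moreover have "latp n d x R" unfolding latp_def
  proof (intro allI impI)
    fix t :: real and l assume t: "0 \<le> t" "t < 1"
    define k where "k = nat \<lfloor>real n * t\<rfloor>"
    have kf: "\<lfloor>real n * t\<rfloor> = int k" using t by (simp add: k_def)
    have k: "real k \<le> real n * t" "real n * t < real k + 1" using kf by linarith+
    have "real n * t < real n * 1" using t n by (intro mult_strict_left_mono) auto
    then have kn: "k < n" using k by simp
    have "x t = x (real k / n) + (t - real k / n) *\<^sub>R d k" using polygD(3)[OF P kn] k by simp
    then have "vH (x t) l - (t - real k / n) * vH (d k) l = vH (x (real k / n)) l" by simp
    moreover have "R t = (k, id)" by (simp add: R_def k_def)
    ultimately show "vH (x t) l - (t - real (fst (R t)) / n) * vH (dv d (R t)) l \<in> \<int>"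
      using lat[of k l] kn by (simp add: dv_def)
  qed
  ultimately show ?thesis by blast
qed

text \<open>Expresses an image through root coefficients only, so that slopes at different times of
  a leg can be compared through \<open>vC\<close>.\<close>

lemma act_span:
  assumes "\<And>m. vC v m = 0" "finite M" "set w \<subseteq> M"
  shows "act w v = v - (\<Sum>m\<in>M. vC (act w v) m *\<^sub>R al m) \<and> (\<forall>m. m \<notin> M \<longrightarrow> vC (act w v) m = 0)"
  using assms(3)
proof (induction w)
  case (Cons j w)
  define y c where "y = act w v" and "c = vH (act w v) j"
  have j: "j \<in> M" using Cons.prems by auto
  have e: "act (j # w) v = y - c *\<^sub>R al j" by (simp add: s_def y_def c_def)
  have v: "vC (act (j # w) v) m = vC y m + (if m = j then c else 0)" for m unfolding e by simp
  have IH: "y = v - (\<Sum>m\<in>M. vC y m *\<^sub>R al m)" "\<forall>m. m \<notin> M \<longrightarrow> vC y m = 0" using Cons by (auto simp: y_def)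
  have "(\<Sum>m\<in>M. vC (act (j # w) v) m *\<^sub>R al m) = (\<Sum>m\<in>M. vC y m *\<^sub>R al m) + c *\<^sub>R al j"
    unfolding v scaleR_add_left sum.distrib using j assms(2) by (simp add: if_distrib[of "\<lambda>r. r *\<^sub>R _"] cong: if_cong)
  moreover have "act (j # w) v = v - (\<Sum>m\<in>M. vC y m *\<^sub>R al m) - c *\<^sub>R al j" unfolding e by (subst IH(1)) (rule refl)
  ultimately have "act (j # w) v = v - (\<Sum>m\<in>M. vC (act (j # w) v) m *\<^sub>R al m)" by (simp add: algebra_simps)
  moreover have "vC (act (j # w) v) m = 0" if "m \<notin> M" for m using v[of m] IH(2) that j by (cases "m = j") auto
  ultimately show ?case by blast
qed (use assms in auto)

text \<open>A germ inside a leg consists of reflections only, and read from left to right these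
  lower \<open>vC\<close>.\<close>

lemma leg_slope_vC:
  assumes l: "lp n d z R Lf" and k: "k < n" and tu: "real k \<le> real n * t" "t \<le> u" "real n * u < real k + 1"
  shows "vC (dv d (R u)) m \<le> vC (dv d (R t)) m"
proof -
  note LP = lpD[OF l]
  have n: "0 < n" by (rule LP)
  have "real k + 1 \<le> real n" using k by simp
  then have "real n * u < real n * 1" using tu by linarith
  then have u1: "u < 1" using n by (metis mult_less_cancel_left_pos of_nat_0_less_iff)
  have "real n * 0 \<le> real n * t" using tu(1) by (metis mult_zero_right of_nat_0_le_iff order.trans)
  then have t0: "0 \<le> t" using n by (simp add: zero_le_mult_iff)
  have leg: "fst (R v) = k" if v: "t \<le> v" "v \<le> u" for v
  proof -
    have "real n * t \<le> real n * v" "real n * v \<le> real n * u" using v n by (auto intro: mult_left_mono)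
    then have "\<lfloor>real n * v\<rfloor> = int k" using tu by linarith
    then show ?thesis using LP(4)[of v] v u1 t0 by simp
  qed
  define P where "P v \<longleftrightarrow> (v \<le> u \<longrightarrow> vC (dv d (R v)) m \<le> vC (dv d (R t)) m)" for v
  have "P u"
  proof (rule interval_induct[where P = P and a = t and b = u])
    fix v assume v: "t \<le> v" "v < u" "P v"
    obtain e where e: "e > 0" "\<forall>u. v < u \<longrightarrow> u < v + e \<longrightarrow> u < 1 \<and> R u = R v \<and> Lf u = R v \<and> z u = z v + (u - v) *\<^sub>R dv d (R v)"
      using LP(6)[of v] v u1 t0 by auto
    then show "\<exists>e>0. \<forall>u. v < u \<longrightarrow> u < v + e \<longrightarrow> P u" using v by (intro exI[of _ e]) (auto simp: P_def)
  next
    fix v assume v: "t < v" "v \<le> u" and Pu: "\<And>u. t \<le> u \<Longrightarrow> u < v \<Longrightarrow> P u"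
    obtain e where e: "e > 0" "\<forall>u. v - e < u \<longrightarrow> u < v \<longrightarrow> 0 < u \<and> R u = Lf v \<and> Lf u = Lf v \<and> z u = z v - (v - u) *\<^sub>R dv d (Lf v)"
      using LP(7)[of v] v u1 t0 by auto
    define v' where "v' = max t (v - e / 2)"
    have v': "t \<le> v'" "v' < v" "v - e < v'" using v e by (auto simp: v'_def)
    then have "R v' = Lf v" using e by blast
    then have Lv: "vC (dv d (Lf v)) m \<le> vC (dv d (R t)) m" "fst (Lf v) = k" using Pu[of v'] leg[of v'] v' v by (auto simp: P_def)
    have g: "germ d (z v) (R v) (Lf v)" using LP(8) v u1 t0 by simp
    have "fst (R v) = k" using leg v by simp
    then have "vC (dv d (R v)) m \<le> vC (dv d (Lf v)) m"
      by (intro germ_vC(2)[OF g]) (use Lv in auto)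
    then show "P v" using Lv by (simp add: P_def)
  qed (use tu in \<open>auto simp: P_def\<close>)
  then show ?thesis by (simp add: P_def)
qed

lemma leg_slope_vH:
  assumes l: "lp n d z R Lf" and k: "k < n" and tu: "real k \<le> real n * t" "t \<le> u" "real n * u < real k + 1"
    and dC: "\<And>k m. vC (d k) m = 0" and fresh: "\<And>t. t \<in> {0..1} \<Longrightarrow> vC (z t) j = 0"
  shows "vH (dv d (R u)) j \<le> vH (dv d (R t)) j"
proof -
  note LP = lpD[OF l]
  have n: "0 < n" by (rule LP)
  have "real k + 1 \<le> real n" using k by simp
  then have "real n * u < real n * 1" using tu by linarith
  then have u1: "u < 1" using n by (metis mult_less_cancel_left_pos of_nat_0_less_iff)
  have "real n * 0 \<le> real n * t" using tu(1) by (metis mult_zero_right of_nat_0_le_iff order.trans)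
  then have t0: "0 \<le> t" using n by (simp add: zero_le_mult_iff)
  have leg: "fst (R v) = k" if v: "t \<le> v" "v \<le> u" for v
  proof -
    have "real n * t \<le> real n * v" "real n * v \<le> real n * u" using v n by (auto intro: mult_left_mono)
    then have "\<lfloor>real n * v\<rfloor> = int k" using tu by linarith
    then show ?thesis using LP(4)[of v] v u1 t0 by simp
  qed
  have fr: "vC (dv d (R v)) j = 0" if v: "0 \<le> v" "v < 1" for v
  proof -
    obtain e where e: "e > 0" "\<forall>u. v < u \<longrightarrow> u < v + e \<longrightarrow> u < 1 \<and> R u = R v \<and> Lf u = R v \<and> z u = z v + (u - v) *\<^sub>R dv d (R v)"
      using LP(6)[OF v] by auto
    have *: "v + e / 2 < 1" "z (v + e / 2) = z v + (e / 2) *\<^sub>R dv d (R v)"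
      using e(2)[rule_format, of "v + e / 2"] e(1) by auto
    have "vC (z (v + e / 2)) j = 0" "vC (z v) j = 0" by (rule fresh; use *(1) v e(1) in simp)+
    then show ?thesis unfolding *(2) using e by simp
  qed
  obtain w w' where w: "snd (R t) = act w" "snd (R u) = act w'" using LP(5)[of t] LP(5)[of u] t0 u1 tu by (auto simp: inW_def)
  have dR: "dv d (R t) = act w (d k)" "dv d (R u) = act w' (d k)" using w leg[of t] leg[of u] tu by (simp_all add: dv_def)
  define M where "M = set w \<union> set w'"
  have f: "vH (act v (d k)) j = vH (d k) j - (\<Sum>m\<in>M. vC (act v (d k)) m * of_int (a j m))" if "v = w \<or> v = w'" for v
  proof -
    have S: "vH (\<Sum>m\<in>N. g m *\<^sub>R al m) j = (\<Sum>m\<in>N. g m * of_int (a j m))" if "finite N" for N g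
      using that by (induction N rule: finite_induct) auto
    have fM: "finite M" by (simp add: M_def)
    have "act v (d k) = d k - (\<Sum>m\<in>M. vC (act v (d k)) m *\<^sub>R al m)"
      using act_span[OF dC fM, of v k] that by (auto simp: M_def)
    then have "vH (act v (d k)) j = vH (d k - (\<Sum>m\<in>M. vC (act v (d k)) m *\<^sub>R al m)) j" by (rule arg_cong)
    then show ?thesis using S[OF fM] by simp
  qed
  have "(\<Sum>m\<in>M. vC (dv d (R t)) m * of_int (a j m)) \<le> (\<Sum>m\<in>M. vC (dv d (R u)) m * of_int (a j m))"
  proof (rule sum_mono)
    fix m
    show "vC (dv d (R t)) m * of_int (a j m) \<le> vC (dv d (R u)) m * of_int (a j m)"
    proof (cases "m = j")
      case True
      then show ?thesis using fr[of t] fr[of u] t0 u1 tu by simp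
    next
      case False
      then have "real_of_int (a j m) \<le> 0" using a_off[of j m] by simp
      then show ?thesis using leg_slope_vC[OF l k tu, of m] by (rule mult_right_mono_neg[rotated])
    qed
  qed
  then show ?thesis using f[of w] f[of w'] by (simp add: dR)
qed

text \<open>On each leg \<open>h\<close> is concave and nonnegative, and its tangents start at
  integral levels. Consequently the last zero is a vertex, the value 1 is reached no later than the
  next vertex, and \<open>h\<close> is linear in between.\<close>

lemma fphi_ramp:
  assumes l: "lp n d x R Lf" and lat: "latp n d x R" and dC: "\<And>k m. vC (d k) m = 0"
    and fresh: "\<And>t. t \<in> {0..1} \<Longrightarrow> vC (x t) j = 0" and nn: "\<And>t. t \<in> {0..1} \<Longrightarrow> 0 \<le> vH (x t) j"
    and e1: "vH (x 1) j \<noteq> 0"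
  defines "h \<equiv> \<lambda>t. vH (x t) j"
  shows "\<exists>T\<in>{0<..1}. \<forall>t\<in>{0..1}. fphi h t = ramp n T t"
proof -
  note LP = lpD[OF l]
  have n: "0 < n" by (rule LP)
  interpret signed h "\<lambda>t. lexpos d [] j (R t)" "\<lambda>t. lexpos d [] j (Lf t)"
    unfolding h_def by (rule lp_signed[OF l])
  have h0: "h 0 = 0" using LP(2) by (simp add: h_def)
  have hn: "0 \<le> h t" if "t \<in> {0..1}" for t using nn that by (simp add: h_def)
  have m0: "mn h = 0" using mn_le[of 0] mn_att hn h0 by fastforce
  have h1: "h 1 \<noteq> mn h" using e1 m0 by (simp add: h_def)
  define sl where "sl t = vH (dv d (R t)) j" for t
  have right: "\<exists>e>0. \<forall>u. t < u \<longrightarrow> u < t + e \<longrightarrow> u < 1 \<and> sl u = sl t \<and> h u = h t + (u - t) * sl t"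
    if t: "0 \<le> t" "t < 1" for t
  proof -
    obtain e where e: "e > 0" "\<forall>u. t < u \<longrightarrow> u < t + e \<longrightarrow> u < 1 \<and> R u = R t \<and> Lf u = R t \<and> x u = x t + (u - t) *\<^sub>R dv d (R t)"
      using LP(6)[OF t] by blast
    then show ?thesis by (intro exI[of _ e]) (auto simp: sl_def h_def)
  qed
  have conc: "h (real k / n) + (t - real k / n) * sl t \<le> h t"
    if k: "k < n" and t: "real k \<le> real n * t" "real n * t < real k + 1" for k t
  proof -
    have kt: "real k / n \<le> t" using t(1) n by (simp add: field_simps)
    have "real k + 1 \<le> real n" using k by simp
    then have "real n * t < real n * 1" using t by linarith
    then have t1: "t < 1" using n by (metis mult_less_cancel_left_pos of_nat_0_less_iff)
    have k0: "0 \<le> real k / n" by simp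
    have "h (real k / n) - (real k / n) * sl t \<le> h t - t * sl t"
    proof (rule mono_right[where h = "\<lambda>u. h u - u * sl t"])
      show "continuous_on {real k / n..t} (\<lambda>u. h u - u * sl t)"
        by (intro continuous_intros cont_sub) (use t1 in auto)
      fix u assume u: "real k / n \<le> u" "u < t"
      have u0: "0 \<le> u" using u k0 by linarith
      obtain e where e: "e > 0" "\<forall>v. u < v \<longrightarrow> v < u + e \<longrightarrow> v < 1 \<and> sl v = sl u \<and> h v = h u + (v - u) * sl u"
        using right[OF u0] u t1 by auto
      have "real k \<le> real n * u" using u n by (simp add: field_simps)
      then have "sl t \<le> sl u" unfolding sl_def
        by (rule leg_slope_vH[OF l k]) (use u t dC fresh in auto)
      then have "h u - u * sl t \<le> h v - v * sl t" if v: "u < v" "v < u + e" for v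
        using e(2)[rule_format, OF v] mult_left_mono[of "sl t" "sl u" "v - u"] v by (simp add: algebra_simps)
      then show "\<exists>e>0. \<forall>v. u < v \<longrightarrow> v < u + e \<longrightarrow> h u - u * sl t \<le> h v - v * sl t" using e(1) by blast
    qed (rule kt)
    then show ?thesis by (simp add: algebra_simps)
  qed
  define fp fm where "fp = fpl h" and "fm = fmi h"
  have f: "0 \<le> fp" "fp < fm" "fm \<le> 1" "h fp = 0" "h fm = 1"
    using fpl_mem fpl_val fpl_less[OF h1] fmi_le[OF h1] fmi_val[OF h1] m0 by (auto simp: fp_def fm_def)
  define k where "k = nat \<lfloor>real n * fp\<rfloor>"
  have kf: "\<lfloor>real n * fp\<rfloor> = int k" using f by (simp add: k_def)
  have k: "real k \<le> real n * fp" "real n * fp < real k + 1" using kf by linarith+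
  have "real n * fp < real n * 1" using f n by (intro mult_strict_left_mono) auto
  then have kn: "k < n" using k by simp
  have slp: "0 < sl fp"
  proof -
    obtain e where e: "e > 0" "\<forall>u. fp < u \<longrightarrow> u < fp + e \<longrightarrow> u < 1 \<and> sl u = sl fp \<and> h u = h fp + (u - fp) * sl fp"
      using right[of fp] f by auto
    have "fp + e / 2 < 1" "h (fp + e / 2) = (e / 2) * sl fp" using e(2)[rule_format, of "fp + e / 2"] e(1) f by auto
    moreover have "0 < h (fp + e / 2)" using fpl_gt[of "fp + e / 2"] calculation e(1) m0 by (simp add: fp_def)
    ultimately have "0 < e / 2 * sl fp" by simp
    then show ?thesis using e(1) by (simp add: zero_less_mult_iff)
  qed
  \<comment> \<open>By concavity the slope at \<open>fp\<close> is the least on its leg so far.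
    Being positive, it leaves no room for a zero after the start of the leg, where \<open>h\<close>
    is nonnegative.\<close>
  have fpk: "fp = real k / n"
  proof -
    have "h (real k / n) + (fp - real k / n) * sl fp \<le> 0" using conc[OF kn k] f by simp
    moreover have "0 \<le> h (real k / n)" using hn kn by simp
    ultimately have "(fp - real k / n) * sl fp \<le> 0" by linarith
    then have "fp - real k / n \<le> 0" using slp by (simp add: mult_le_0_iff)
    then show ?thesis using k n by (simp add: field_simps)
  qed
  \<comment> \<open>A vertex strictly between \<open>fp\<close> and \<open>fm\<close> would have an
    integral pairing strictly between 0 and 1.\<close>
  have fmk: "real n * fm \<le> real k + 1"
  proof (rule ccontr)
    assume c: "\<not> real n * fm \<le> real k + 1"
    define q where "q = (real k + 1) / n"
    have q: "q < fm" "fp < q" using c n by (auto simp: q_def fpk field_simps)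
    then have q1: "q < 1" "0 \<le> q" using f by auto
    have nq: "real n * q = real k + 1" using n by (simp add: q_def)
    have "\<lfloor>real n * q\<rfloor> = int k + 1" unfolding nq by linarith
    then have "fst (R q) = Suc k" using LP(4)[of q] q1 by (simp add: nat_add_distrib)
    moreover have "q = real (Suc k) / n" by (simp add: q_def add.commute)
    moreover have "vH (x q) j - (q - real (fst (R q)) / n) * vH (dv d (R q)) j \<in> \<int>" using lat q1 unfolding latp_def by blast
    ultimately have "h q \<in> \<int>" by (simp add: h_def)
    moreover have "0 < h q" "h q < 1" using fmi_btw[OF h1, of q] q m0 by (auto simp: fp_def fm_def)
    ultimately show False using Ints_between[of 0 "h q"] by simp
  qed
  have leg: "real k \<le> real n * t" "real n * t < real k + 1" if "fp \<le> t" "t < fm" for t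
  proof -
    have "real n * fp \<le> real n * t" "real n * t < real n * fm" using that n by (auto intro: mult_left_mono)
    then show "real k \<le> real n * t" "real n * t < real k + 1" using k fmk by linarith+
  qed
  \<comment> \<open>The tangent at \<open>t\<close> meets the start of the leg at an integral level.
    This level is nonnegative by \<open>conc\<close> and less than 1 because \<open>h t < 1\<close>
    and the slope is nonnegative, so it is 0.\<close>
  have lin: "h t = (t - fp) * sl t" if t: "fp \<le> t" "t < fm" for t
  proof -
    have "\<lfloor>real n * t\<rfloor> = int k" using leg[OF t] by linarith
    then have "fst (R t) = k" using LP(4)[of t] t f by simp
    moreover have "0 \<le> t" "t < 1" using t f by simp_all
    then have "vH (x t) j - (t - real (fst (R t)) / n) * vH (dv d (R t)) j \<in> \<int>" using lat unfolding latp_def by blast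
    ultimately have I: "h t - (t - fp) * sl t \<in> \<int>" by (simp add: h_def sl_def fpk)
    have "0 \<le> h t - (t - fp) * sl t" using conc[OF kn leg[OF t]] f by (simp flip: fpk)
    moreover have "0 \<le> sl t" unfolding sl_def
      by (rule lexpos_slope(1)[OF PR_fseg[OF h1]]) (use t in \<open>auto simp: fp_def fm_def\<close>)
    then have "0 \<le> (t - fp) * sl t" using t by simp
    moreover have "h t < 1" using fmi_btw[OF h1, of t] t m0 f by (cases "t = fp") (auto simp: fp_def fm_def)
    ultimately show ?thesis using Ints_between[OF _ I, of 0] by (cases "(t - fp) * sl t < h t") auto
  qed
  define P where "P t \<longleftrightarrow> h t = (t - fp) * sl fp \<and> (t < fm \<longrightarrow> sl t = sl fp)" for t
  have P: "P t" if t: "fp \<le> t" "t \<le> fm" for t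
  proof (rule interval_induct[where P = P and a = fp and b = fm])
    show "P fp" using f by (simp add: P_def)
    fix t assume t: "fp \<le> t" "t < fm" "P t"
    obtain e where e: "e > 0" "\<forall>u. t < u \<longrightarrow> u < t + e \<longrightarrow> u < 1 \<and> sl u = sl t \<and> h u = h t + (u - t) * sl t"
      using right[of t] t f by auto
    have "P u" if u: "t < u" "u < t + e" for u
      using e(2)[rule_format, OF u] t by (simp add: P_def algebra_simps)
    then show "\<exists>e>0. \<forall>u. t < u \<longrightarrow> u < t + e \<longrightarrow> P u" using e(1) by blast
  next
    fix t assume t: "fp < t" "t \<le> fm" and Pu: "\<And>u. fp \<le> u \<Longrightarrow> u < t \<Longrightarrow> P u"
    obtain e where e: "e > 0" "\<forall>u. t - e < u \<longrightarrow> u < t \<longrightarrow> 0 < u \<and> R u = Lf t \<and> Lf u = Lf t \<and> x u = x t - (t - u) *\<^sub>R dv d (Lf t)"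
      using LP(7)[of t] t f by auto
    define u where "u = max fp (t - e / 2)"
    have u: "fp \<le> u" "u < t" "t - e < u" using t e by (auto simp: u_def)
    then have "R u = Lf t" "x u = x t - (t - u) *\<^sub>R dv d (Lf t)" using e by blast+
    then have "h u = h t - (t - u) * sl u" by (simp add: h_def sl_def)
    moreover have "h u = (u - fp) * sl fp" "sl u = sl fp" using Pu[OF u(1,2)] u t by (auto simp: P_def)
    ultimately have ht: "h t = (t - fp) * sl fp" by (simp add: algebra_simps)
    moreover have "sl t = sl fp" if "t < fm" using lin[of t] ht t that by simp
    ultimately show "P t" by (simp add: P_def)
  qed (use f t in auto)
  have s1: "(fm - fp) * sl fp = 1" using P[of fm] f by (simp add: P_def)
  have "real n * fp < real n * fm" using f n by (intro mult_strict_left_mono) auto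
  then have "\<lceil>real n * fm\<rceil> = int k + 1" using k fmk n unfolding fpk by (simp, linarith)
  then have c: "(real_of_int \<lceil>real n * fm\<rceil> - 1) / n = fp" by (simp add: fpk)
  have "fphi h t = ramp n fm t" if "t \<in> {0..1}" for t
  proof -
    have "h t = (t - fp) / (fm - fp)" if t: "fp \<le> t" "t \<le> fm" for t
    proof -
      have "sl fp = 1 / (fm - fp)" using s1 f by (simp add: field_simps)
      then show ?thesis using P[OF t] by (simp add: P_def)
    qed
    then show ?thesis using m0 unfolding ramp_def c fphi_def fp_def[symmetric] fm_def[symmetric] by (simp add: Let_def)
  qed
  moreover have "fm \<in> {0<..1}" using f by auto
  ultimately show ?thesis by blast
qed

definition FW :: "'l list \<Rightarrow> (bool \<times> 'l) list" where
  "FW W = map (Pair True) W"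

lemma snd_FW [simp]: "snd ` set (FW W) = set W"
  by (force simp: FW_def)

lemma run_FW_Cons: "run (FW (l # W)) x = Option.bind (run (FW W) x) (fop l)"
  by (simp add: FW_def)

lemma fop_vC:
  assumes l: "lp n d x R Lf" and f: "fop j x = Some y" and t: "t \<in> {0..1}"
  shows "vC (y t) m = vC (x t) m + (if m = j then fphi (\<lambda>t. vH (x t) j) t else 0)"
    and "vH (y t) m = vH (x t) m - fphi (\<lambda>t. vH (x t) j) t * of_int (a m j)"
    and "0 \<le> fphi (\<lambda>t. vH (x t) j) t"
    and "t \<le> u \<Longrightarrow> u \<le> 1 \<Longrightarrow> fphi (\<lambda>t. vH (x t) j) t \<le> fphi (\<lambda>t. vH (x t) j) u"
proof -
  have y: "y t = x t - fphi (\<lambda>t. vH (x t) j) t *\<^sub>R al j" using f t by (auto simp: fop_def Let_def split: if_splits)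
  show "vC (y t) m = vC (x t) m + (if m = j then fphi (\<lambda>t. vH (x t) j) t else 0)"
    "vH (y t) m = vH (x t) m - fphi (\<lambda>t. vH (x t) j) t * of_int (a m j)" unfolding y by simp_all
  have ne: "vH (x 1) j \<noteq> mn (\<lambda>t. vH (x t) j)" using fop_None[OF l, of j] f by simp
  show "0 \<le> fphi (\<lambda>t. vH (x t) j) t" by (rule signed.fphi_nonneg[OF lp_signed[OF l] ne t])
  show "t \<le> u \<Longrightarrow> u \<le> 1 \<Longrightarrow> fphi (\<lambda>t. vH (x t) j) t \<le> fphi (\<lambda>t. vH (x t) j) u"
    by (rule signed.fphi_mono[OF lp_signed[OF l] ne t])
qed

text \<open>Each f adds a nonnegative multiple, increasing in time and ending at 1, to the
  coefficient of its index, and it raises the pairings with all other indices because off-diagonal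
  entries are nonpositive.\<close>

lemma FW_vC:
  assumes l: "lp n d x R Lf" and xC: "\<And>t m. t \<in> {0..1} \<Longrightarrow> vC (x t) m = 0" and r: "run (FW W) x = Some y"
  shows "t \<in> {0..1} \<Longrightarrow> 0 \<le> vC (y t) m"
    and "t \<in> {0..1} \<Longrightarrow> t \<le> u \<Longrightarrow> u \<le> 1 \<Longrightarrow> vC (y t) m \<le> vC (y u) m"
    and "vC (y 1) m = count_list W m"
    and "t \<in> {0..1} \<Longrightarrow> m \<notin> set W \<Longrightarrow> vC (y t) m = 0"
    and "t \<in> {0..1} \<Longrightarrow> m \<notin> set W \<Longrightarrow> vH (x t) m \<le> vH (y t) m"
proof -
  have "(\<forall>t\<in>{0..1}. 0 \<le> vC (y t) m \<and> (\<forall>u. t \<le> u \<longrightarrow> u \<le> 1 \<longrightarrow> vC (y t) m \<le> vC (y u) m)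
     \<and> (m \<notin> set W \<longrightarrow> vC (y t) m = 0 \<and> vH (x t) m \<le> vH (y t) m)) \<and> vC (y 1) m = count_list W m"
    using r
  proof (induction W arbitrary: y)
    case Nil
    then show ?case using xC by (auto simp: FW_def)
  next
    case (Cons j W)
    obtain z where z: "run (FW W) x = Some z" "fop j z = Some y"
      using Cons.prems by (auto simp: run_FW_Cons bind_eq_Some_conv)
    obtain R1 L1 where lz: "lp n d z R1 L1" using run_lp[OF l z(1)] by blast
    note V = fop_vC[OF lz z(2)] and IH = Cons.IH[OF z(1)]
    have e: "vC (y 1) m = count_list (j # W) m"
      using opr_end[OF lz, of "(True, j)" y] z(2) IH by auto
    have "0 \<le> vC (y t) m" if "t \<in> {0..1}" for t
      using V(1)[OF that, of m] V(3)[OF that] IH that by (auto split: if_splits)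
    moreover have "vC (y t) m \<le> vC (y u) m" if t: "t \<in> {0..1}" "t \<le> u" "u \<le> 1" for t u
    proof -
      have u: "u \<in> {0..1}" using t by auto
      have "vC (z t) m \<le> vC (z u) m" using IH t by blast
      then show ?thesis using V(1)[OF t(1), of m] V(1)[OF u, of m] V(4)[OF t] by (auto split: if_splits)
    qed
    moreover have "vC (y t) m = 0 \<and> vH (x t) m \<le> vH (y t) m" if t: "t \<in> {0..1}" and m: "m \<notin> set (j # W)" for t
    proof -
      have "real_of_int (a m j) \<le> 0" using a_off[of m j] m by simp
      then have "fphi (\<lambda>t. vH (z t) j) t * of_int (a m j) \<le> 0" using V(3)[OF t] by (rule mult_nonneg_nonpos[rotated])
      then show ?thesis using V(1)[OF t, of m] V(2)[OF t, of m] IH t m by fastforce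
    qed
    ultimately show ?case using e by blast
  qed
  then show "t \<in> {0..1} \<Longrightarrow> 0 \<le> vC (y t) m"
    "t \<in> {0..1} \<Longrightarrow> t \<le> u \<Longrightarrow> u \<le> 1 \<Longrightarrow> vC (y t) m \<le> vC (y u) m"
    "vC (y 1) m = count_list W m"
    "t \<in> {0..1} \<Longrightarrow> m \<notin> set W \<Longrightarrow> vC (y t) m = 0"
    "t \<in> {0..1} \<Longrightarrow> m \<notin> set W \<Longrightarrow> vH (x t) m \<le> vH (y t) m" by blast+
qed

end

section \<open>Splitting imaginary indices into real copies\<close>

lemma pairR_diff: "pairR h (\<lambda>b. u b - v b) = pairR h u - pairR h v"
  by (simp add: pairR_def right_diff_distrib sum_subtractf)

lemma pairR_add: "pairR h (\<lambda>b. u b + v b) = pairR h u + pairR h v"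
  by (simp add: pairR_def distrib_left sum.distrib)

lemma pairR_scale: "pairR h (\<lambda>b. c * u b) = c * pairR h u"
  by (simp add: pairR_def sum_distrib_left ac_simps)

lemma pairR_sum: "pairR h (\<lambda>b. \<Sum>m\<in>M. g m b) = (\<Sum>m\<in>M. pairR h (g m))"
  unfolding pairR_def sum_distrib_left by (rule sum.swap)

lemma pairR_of_int: "pairR h (\<lambda>b. real_of_int (\<mu> b)) = real_of_int (pairZ h \<mu>)"
  by (simp add: pairR_def pairZ_def)

lemma clamp_id [simp]: "clamp (clamp s) = clamp s" and clamp_mem [simp]: "clamp s \<in> {0..1}"
  and clamp_bounds [simp]: "0 \<le> clamp s" "clamp s \<le> 1" and clamp_eq: "s \<in> {0..1} \<Longrightarrow> clamp s = s"
  by (auto simp: clamp_def)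

lemma mH_mn: "mH cor i p = mn (Hf cor i p)"
  by (simp add: mH_def mn_def)

lemma f_op_fphi:
  "f_op cor al i p = (if fpl (Hf cor i p) = 1 then None
     else Some (\<lambda>s b. p (clamp s) b - fphi (Hf cor i p) (clamp s) * real_of_int (al i b)))"
  unfolding f_op_def Let_def mH_mn fpl_def[symmetric] fmi_def[symmetric]
  by (auto simp: fphi_def embR_def fun_eq_iff)

lemma e_re_epsi:
  "e_re cor al i p = (if epl (Hf cor i p) = 0 then None
     else Some (\<lambda>s b. p (clamp s) b + epsi (Hf cor i p) (clamp s) * real_of_int (al i b)))"
  unfolding e_re_def Let_def mH_mn epl_def[symmetric] emi_def[symmetric]
  by (auto simp: epsi_def embR_def fun_eq_iff algebra_simps)

text \<open>Every imaginary index is replaced by infinitely many real copies, of which each is applied at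
  most once; a real index keeps the single copy \<open>0\<close>.\<close>

locale bc =
  fixes I :: "'i set" and cor al :: "'i \<Rightarrow> 'b \<Rightarrow> int"
  assumes BC: "BC_datum I cor al"
begin

abbreviation rl :: "'i \<Rightarrow> bool" where "rl i \<equiv> is_real cor al i"

definition valid :: "'i \<times> nat \<Rightarrow> bool" where
  "valid l \<longleftrightarrow> fst l \<in> I \<and> (rl (fst l) \<longrightarrow> snd l = 0)"

text \<open>Different copies of an imaginary index pair by its diagonal entry, which is nonpositive
  as an off-diagonal entry must be. Invalid labels are orthogonal to all others, so that the matrix
  lives on the whole type.\<close>

definition A :: "'i \<times> nat \<Rightarrow> 'i \<times> nat \<Rightarrow> int" where
  "A l m = (if l = m then 2 else if valid l \<and> valid m then cartan cor al (fst l) (fst m) else 0)"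

lemma cartan_diag: "i \<in> I \<Longrightarrow> \<not> rl i \<Longrightarrow> cartan cor al i i \<le> 0"
  using BC unfolding BC_datum_def is_real_def by blast

lemma cartan_off: "i \<in> I \<Longrightarrow> j \<in> I \<Longrightarrow> i \<noteq> j \<Longrightarrow> cartan cor al i j \<le> 0"
  using BC unfolding BC_datum_def by blast

lemma cartan_zero: "i \<in> I \<Longrightarrow> j \<in> I \<Longrightarrow> cartan cor al i j = 0 \<Longrightarrow> cartan cor al j i = 0"
  using BC unfolding BC_datum_def by (cases "i = j") auto

sublocale K: km A
proof
  show "A l l = 2" for l by (simp add: A_def)
  show "A l m \<le> 0" if "l \<noteq> m" for l m
  proof (cases "fst l = fst m")
    case True
    then show ?thesis using that cartan_diag[of "fst l"] by (auto simp: A_def valid_def prod_eq_iff)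
  next
    case False
    then show ?thesis using that cartan_off[of "fst l" "fst m"] by (auto simp: A_def valid_def)
  qed
  show "A m l = 0" if "A l m = 0" for l m
    using that cartan_zero[of "fst l" "fst m"] by (auto simp: A_def valid_def split: if_splits)
qed

definition base :: "'b path \<Rightarrow> real \<Rightarrow> ('i \<times> nat) vec" where
  "base \<pi> t = (if t \<in> {0..1} then Vec (\<lambda>l. if valid l then pairR (cor (fst l)) (\<pi> t) else 0) (\<lambda>_. 0) else 0)"

lemma vC_base [simp]: "vC (base \<pi> t) m = 0"
  by (simp add: base_def)

lemma vH_base: "t \<in> {0..1} \<Longrightarrow> valid l \<Longrightarrow> vH (base \<pi> t) l = pairR (cor (fst l)) (\<pi> t)"
  by (simp add: base_def)

text \<open>Forgets the copies: what was subtracted along \<open>(i, k)\<close> is subtracted along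
  the original simple root \<open>al i\<close>.\<close>

definition prj :: "'b path \<Rightarrow> (real \<Rightarrow> ('i \<times> nat) vec) \<Rightarrow> 'b path" where
  "prj \<pi> x = (\<lambda>s b. \<pi> (clamp s) b
     - (\<Sum>m | vC (x (clamp s)) m \<noteq> 0. vC (x (clamp s)) m * real_of_int (al (fst m) b)))"

lemma prj_sum:
  assumes "finite M" "\<And>m. m \<notin> M \<Longrightarrow> vC (x (clamp s)) m = 0"
  shows "prj \<pi> x s b = \<pi> (clamp s) b - (\<Sum>m\<in>M. vC (x (clamp s)) m * real_of_int (al (fst m) b))"
proof -
  have "(\<Sum>m | vC (x (clamp s)) m \<noteq> 0. vC (x (clamp s)) m * real_of_int (al (fst m) b))
      = (\<Sum>m\<in>M. vC (x (clamp s)) m * real_of_int (al (fst m) b))"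
    using assms by (intro sum.mono_neutral_left) auto
  then show ?thesis by (simp add: prj_def)
qed

lemma prj_clamp [simp]: "prj \<pi> x (clamp s) = prj \<pi> x s"
  by (simp add: prj_def)

definition okw :: "('i \<times> nat) list \<Rightarrow> bool" where
  "okw W \<longleftrightarrow> (\<forall>l\<in>set W. valid l \<and> (\<not> rl (fst l) \<longrightarrow> count_list W l \<le> 1))"

lemma okw_Cons: "okw (l # W) \<longleftrightarrow> valid l \<and> (rl (fst l) \<or> l \<notin> set W) \<and> okw W"
  by (auto simp: okw_def count_list_0_iff Suc_le_eq split: if_splits)

lemma Hf_prj:
  assumes r: "K.run (K.FW W) (base \<pi>) = Some x" and W: "okw W" and l: "valid l" "rl (fst l) \<or> l \<notin> set W"
    and t: "t \<in> {0..1}"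
  shows "Hf cor (fst l) (prj \<pi> x) t = vH (x t) l"
proof -
  have fW: "finite (set W)" "snd ` set (K.FW W) \<subseteq> set W" by simp_all
  note sp = K.run_span(1)[OF r fW, of t, unfolded vC_base diff_0_right] K.run_span(2)[OF r fW, unfolded vC_base]
  have p: "prj \<pi> x t = (\<lambda>b. \<pi> t b - (\<Sum>m\<in>set W. vC (x t) m * real_of_int (al (fst m) b)))"
    using prj_sum[OF fW(1), of x t \<pi>] sp(2) by (simp add: clamp_eq[OF t] fun_eq_iff)
  have S: "vH (\<Sum>m\<in>N. g m *\<^sub>R K.al m) l = (\<Sum>m\<in>N. g m * of_int (A l m))" if "finite N" for N g
    using that by (induction N rule: finite_induct) auto
  have "Hf cor (fst l) (prj \<pi> x) t = pairR (cor (fst l)) (\<pi> t)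
      - (\<Sum>m\<in>set W. vC (x t) m * real_of_int (cartan cor al (fst l) (fst m)))"
    unfolding Hf_def p pairR_diff pairR_sum pairR_scale pairR_of_int cartan_def ..
  also have "(\<Sum>m\<in>set W. vC (x t) m * real_of_int (cartan cor al (fst l) (fst m)))
      = (\<Sum>m\<in>set W. vC (x t) m * real_of_int (A l m))"
  proof (rule sum.cong)
    fix m assume "m \<in> set W"
    then show "vC (x t) m * real_of_int (cartan cor al (fst l) (fst m)) = vC (x t) m * real_of_int (A l m)"
      using W l by (auto simp: okw_def A_def is_real_def)
  qed simp
  also have "pairR (cor (fst l)) (\<pi> t) - \<dots> = vH (base \<pi> t - (\<Sum>m\<in>set W. vC (x t) m *\<^sub>R K.al m)) l"
    using t l by (simp add: S vH_base)
  also have "\<dots> = vH (x t) l" by (simp only: sp(1)[symmetric])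
  finally show ?thesis .
qed

lemma prj_shift:
  assumes fin: "finite M" "\<And>t m. m \<notin> M \<Longrightarrow> vC (x t) m = 0"
    and y: "\<And>t. t \<in> {0..1} \<Longrightarrow> y t = x t + g t *\<^sub>R K.al l"
  shows "prj \<pi> y s b = prj \<pi> x s b + g (clamp s) * real_of_int (al (fst l) b)"
proof -
  define t where "t = clamp s"
  have v: "vC (y t) m = vC (x t) m - (if m = l then g t else 0)" for m
    using y[of t] by (simp add: t_def)
  have M: "finite (insert l M)" "\<And>m. m \<notin> insert l M \<Longrightarrow> vC (x (clamp s)) m = 0" "\<And>m. m \<notin> insert l M \<Longrightarrow> vC (y (clamp s)) m = 0"
    using fin v by (auto simp: t_def)
  have "(\<Sum>m\<in>insert l M. vC (y t) m * real_of_int (al (fst m) b))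
      = (\<Sum>m\<in>insert l M. vC (x t) m * real_of_int (al (fst m) b)) - g t * real_of_int (al (fst l) b)"
    unfolding v left_diff_distrib sum_subtractf using M(1)
    by (simp add: if_distrib[of "\<lambda>r. r * _"] sum.delta cong: if_cong)
  then show ?thesis using prj_sum[where x = x and s = s, OF M(1,2)] prj_sum[where x = y and s = s, OF M(1,3)] by (simp add: t_def)
qed

lemma f_op_prj:
  assumes lp: "K.lp n d x R Lf" and r: "K.run (K.FW W) (base \<pi>) = Some x" and W: "okw W"
    and l: "valid l" "rl (fst l) \<or> l \<notin> set W"
  shows "f_op cor al (fst l) (prj \<pi> x) = map_option (prj \<pi>) (K.fop l x)"
proof -
  define g H where "g = (\<lambda>t. vH (x t) l)" and "H = Hf cor (fst l) (prj \<pi> x)"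
  have eq: "H t = g t" if "t \<in> {0..1}" for t unfolding H_def g_def by (rule Hf_prj[OF r W l that])
  have "fpl g \<in> {0..1}" unfolding g_def by (rule signed.fpl_mem[OF K.lp_signed[OF lp]])
  note C = f_cong[OF eq this]
  show ?thesis
  proof (cases "fpl g = 1")
    case True
    then show ?thesis using C by (simp add: f_op_fphi K.fop_def Let_def flip: g_def H_def)
  next
    case False
    define y where "y = (\<lambda>t. if t \<in> {0..1} then x t - fphi g t *\<^sub>R K.al l else x t)"
    have f: "K.fop l x = Some y" using False by (simp add: K.fop_def Let_def y_def flip: g_def)
    have z: "vC (x t) m = 0" if "m \<notin> set W" for t m using K.run_span(2)[OF r, of "set W"] that by simp
    have "prj \<pi> y s b = prj \<pi> x s b - fphi H (clamp s) * real_of_int (al (fst l) b)" for s b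
      using z prj_shift[where M = "set W" and x = x and y = y and g = "\<lambda>t. - fphi g t" and l = l and \<pi> = \<pi> and s = s and b = b] C(3)[of "clamp s"] by (simp add: y_def)
    then show ?thesis using False C by (auto simp: f_op_fphi f fun_eq_iff simp flip: g_def H_def)
  qed
qed

lemma e_re_prj:
  assumes lp: "K.lp n d x R Lf" and r: "K.run (K.FW W) (base \<pi>) = Some x" and W: "okw W"
    and l: "valid l" "rl (fst l)"
  shows "e_re cor al (fst l) (prj \<pi> x) = map_option (prj \<pi>) (K.eop l x)"
proof -
  define g H where "g = (\<lambda>t. vH (x t) l)" and "H = Hf cor (fst l) (prj \<pi> x)"
  have eq: "H t = g t" if "t \<in> {0..1}" for t unfolding H_def g_def by (rule Hf_prj[OF r W l(1) _ that]) (use l in simp)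
  interpret signed g "\<lambda>t. K.lexpos d [] l (R t)" "\<lambda>t. K.lexpos d [] l (Lf t)"
    unfolding g_def by (rule K.lp_signed[OF lp])
  have "epl g \<in> {0..1}"
  proof (cases "g 0 = mn g")
    case True
    then show ?thesis using epl_0 by simp
  next
    case False
    then show ?thesis using emi_ge[OF False] emi_less[OF False] epl_le[OF False] by simp
  qed
  note C = e_cong[OF eq this]
  show ?thesis
  proof (cases "epl g = 0")
    case True
    then show ?thesis using C by (simp add: e_re_epsi K.eop_def Let_def flip: g_def H_def)
  next
    case False
    define y where "y = (\<lambda>t. if t \<in> {0..1} then x t + epsi g t *\<^sub>R K.al l else x t)"
    have f: "K.eop l x = Some y" using False by (simp add: K.eop_def Let_def y_def flip: g_def)
    have z: "vC (x t) m = 0" if "m \<notin> set W" for t m using K.run_span(2)[OF r, of "set W"] that by simp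
    have "prj \<pi> y s b = prj \<pi> x s b + epsi H (clamp s) * real_of_int (al (fst l) b)" for s b
      using z prj_shift[where M = "set W" and x = x and y = y and g = "\<lambda>t. epsi g t" and l = l and \<pi> = \<pi> and s = s and b = b] C(3)[of "clamp s"] by (simp add: y_def)
    then show ?thesis using False C by (auto simp: e_re_epsi f fun_eq_iff simp flip: g_def H_def)
  qed
qed

end

context bc
begin

text \<open>Words act from the right, so an imaginary letter receives as copy number the count of
  its earlier applications.\<close>

fun lift :: "'i list \<Rightarrow> ('i \<times> nat) list" where
  "lift [] = []"
| "lift (i # ws) = (i, if rl i then 0 else count_list ws i) # lift ws"

lemma map_fst_lift [simp]: "map fst (lift ws) = ws"
  by (induction ws) auto

lemma lift_mem: "(i, k) \<in> set (lift ws) \<Longrightarrow> i \<in> set ws \<and> (if rl i then k = 0 else k < count_list ws i)"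
  by (induction ws) (auto split: if_splits)

lemma okw_lift: "ws \<in> lists I \<Longrightarrow> okw (lift ws)"
proof (induction ws)
  case (Cons i ws)
  have "(i, count_list ws i) \<notin> set (lift ws)" if "\<not> rl i" using lift_mem[of i _ ws] that by fastforce
  then show ?case using Cons by (auto simp: okw_Cons valid_def)
qed (simp add: okw_def)

lemma count_list_le_length: "count_list ws i \<le> length ws"
  by (induction ws) auto

end

text \<open>What a starting path has to provide; instantiated by the concatenation and by the
  straight path. By \<open>pc\<close> a path is determined by its values on the unit interval, so
  that equality of functions is the right notion.\<close>

locale bpath = bc I cor al for I :: "'i set" and cor al :: "'i \<Rightarrow> 'b \<Rightarrow> int" +
  fixes \<pi> :: "'b path" and n :: nat and d :: "nat \<Rightarrow> ('i \<times> nat) vec"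
  assumes pc: "\<pi> (clamp s) = \<pi> s" and pg: "K.polyg n d (base \<pi>)"
    and lat: "k \<le> n \<Longrightarrow> vH (base \<pi> (real k / n)) l \<in> \<int>" and dC: "vC (d k) m = 0"
    and nn: "K.nneg (base \<pi>)" and gd: "K.good (base \<pi>)"
begin

abbreviation reach :: "('i \<times> nat) list \<Rightarrow> (real \<Rightarrow> ('i \<times> nat) vec) option" where
  "reach W \<equiv> K.run (K.FW W) (base \<pi>)"

lemma n_pos: "0 < n"
  by (rule K.polygD(1)[OF pg])

lemma base_lp: "\<exists>R Lf. K.lp n d (base \<pi>) R Lf \<and> K.latp n d (base \<pi>) R"
  by (rule K.lattice_polyg[OF pg]) (rule lat)

lemma reach_lp: "reach W = Some x \<Longrightarrow> \<exists>R Lf. K.lp n d x R Lf \<and> K.latp n d x R"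
  using base_lp K.run_latp by blast

lemma reach_Cons:
  assumes "reach (l # W) = Some y" obtains x where "reach W = Some x" "K.fop l x = Some y"
  using assms by (auto simp: K.run_FW_Cons bind_eq_Some_conv)

lemma reach_vC:
  assumes "reach W = Some x"
  shows "t \<in> {0..1} \<Longrightarrow> t \<le> u \<Longrightarrow> u \<le> 1 \<Longrightarrow> vC (x t) m \<le> vC (x u) m"
    and "vC (x 1) m = count_list W m"
    and "m \<notin> set W \<Longrightarrow> vC (x t) m = 0"
    and "t \<in> {0..1} \<Longrightarrow> m \<notin> set W \<Longrightarrow> 0 \<le> vH (x t) m"
proof -
  obtain R Lf where l: "K.lp n d (base \<pi>) R Lf" using base_lp by blast
  note F = K.FW_vC[OF l vC_base assms]
  show "t \<in> {0..1} \<Longrightarrow> t \<le> u \<Longrightarrow> u \<le> 1 \<Longrightarrow> vC (x t) m \<le> vC (x u) m" by (rule F(2))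
  show "vC (x 1) m = count_list W m" by (rule F(3))
  show "m \<notin> set W \<Longrightarrow> vC (x t) m = 0" using K.run_span(2)[OF assms, of "set W"] by simp
  show "t \<in> {0..1} \<Longrightarrow> m \<notin> set W \<Longrightarrow> 0 \<le> vH (x t) m"
    using F(5)[of t m] nn unfolding K.nneg_def by (blast intro: order.trans)
qed

lemma apply_F_reach: "okw W \<Longrightarrow> apply_F cor al (map fst W) \<pi> = map_option (prj \<pi>) (reach W)"
proof (induction W)
  case Nil
  have "prj \<pi> (base \<pi>) = \<pi>" by (auto simp: prj_def pc)
  then show ?case by (simp add: K.FW_def)
next
  case (Cons l W)
  have W: "okw W" "valid l" "rl (fst l) \<or> l \<notin> set W" using Cons.prems by (auto simp: okw_Cons)
  show ?case
  proof (cases "reach W")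
    case None
    then show ?thesis using Cons.IH W by (simp add: K.run_FW_Cons)
  next
    case (Some x)
    obtain R Lf where l: "K.lp n d x R Lf" using reach_lp[OF Some] by blast
    show ?thesis using Cons.IH W f_op_prj[OF l Some W] Some by (simp add: K.run_FW_Cons)
  qed
qed

lemma orbit_iff: "p \<in> F_orbit I cor al \<pi> \<longleftrightarrow> (\<exists>W x. okw W \<and> reach W = Some x \<and> p = prj \<pi> x)"
proof
  assume "p \<in> F_orbit I cor al \<pi>"
  then obtain ws where ws: "ws \<in> lists I" "apply_F cor al ws \<pi> = Some p" by (auto simp: F_orbit_def)
  have "map_option (prj \<pi>) (reach (lift ws)) = Some p"
    using apply_F_reach[OF okw_lift[OF ws(1)]] ws(2) by simp
  then show "\<exists>W x. okw W \<and> reach W = Some x \<and> p = prj \<pi> x" using okw_lift[OF ws(1)] by blast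
next
  assume "\<exists>W x. okw W \<and> reach W = Some x \<and> p = prj \<pi> x"
  then obtain W x where W: "okw W" "reach W = Some x" "p = prj \<pi> x" by blast
  then have "map fst W \<in> lists I" by (auto simp: okw_def valid_def)
  then show "p \<in> F_orbit I cor al \<pi>" using W apply_F_reach[OF W(1)] by (auto simp: F_orbit_def)
qed

text \<open>Each copy of an imaginary index contributes a ramp. The ramps get larger from one copy to the
  next, because the pairing with the next copy dominates the ramps already present.\<close>

lemma ramps:
  assumes i: "i \<in> I" "\<not> rl i"
  shows "ws \<in> lists I \<Longrightarrow> reach (lift ws) = Some x \<Longrightarrow> \<exists>T.
    (\<forall>k<count_list ws i. T k \<in> {0..1} \<and> (\<forall>t\<in>{0..1}. vC (x t) (i, k) = ramp n (T k) t)) \<and>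
    (\<forall>j k. j \<le> k \<longrightarrow> k < count_list ws i \<longrightarrow> T k \<le> T j) \<and>
    (\<forall>k<count_list ws i. \<forall>c\<ge>count_list ws i. \<forall>t\<in>{0..1}. vC (x t) (i, k) \<le> vH (x t) (i, c))"
proof (induction ws arbitrary: x)
  case (Cons j ws)
  define l where "l = (j, if rl j then 0 else count_list ws j)"
  define c where "c = count_list ws i"
  have ws: "ws \<in> lists I" using Cons.prems by simp
  have "reach (l # lift ws) = Some x" using Cons.prems(2) by (simp add: l_def)
  then obtain x0 where x0: "reach (lift ws) = Some x0" "K.fop l x0 = Some x" by (rule reach_Cons)
  obtain R Lf where lp: "K.lp n d x0 R Lf" and la: "K.latp n d x0 R" using reach_lp[OF x0(1)] by blast
  obtain T where T1: "\<forall>k<c. T k \<in> {0..1} \<and> (\<forall>t\<in>{0..1}. vC (x0 t) (i, k) = ramp n (T k) t)"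
    and T2: "\<forall>j k. j \<le> k \<longrightarrow> k < c \<longrightarrow> T k \<le> T j"
    and T3: "\<forall>k<c. \<forall>c'\<ge>c. \<forall>t\<in>{0..1}. vC (x0 t) (i, k) \<le> vH (x0 t) (i, c')"
    using Cons.IH[OF ws x0(1), folded c_def] by (elim exE conjE) (rule that; assumption)
  have T: "\<And>k. k < c \<Longrightarrow> T k \<in> {0..1}" "\<And>k t. k < c \<Longrightarrow> t \<in> {0..1} \<Longrightarrow> vC (x0 t) (i, k) = ramp n (T k) t"
    "\<And>j k. j \<le> k \<Longrightarrow> k < c \<Longrightarrow> T k \<le> T j"
    "\<And>k c' t. k < c \<Longrightarrow> c \<le> c' \<Longrightarrow> t \<in> {0..1} \<Longrightarrow> vC (x0 t) (i, k) \<le> vH (x0 t) (i, c')"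
    using T1 T2 T3 by blast+
  note V = K.fop_vC[OF lp x0(2)]
  have up: "vH (x0 t) m \<le> vH (x t) m" if t: "t \<in> {0..1}" and m: "m \<noteq> l" for t m
  proof -
    have "real_of_int (A m l) \<le> 0" using K.a_off[OF m] by simp
    then have "fphi (\<lambda>t. vH (x0 t) l) t * of_int (A m l) \<le> 0" using V(3)[OF t] by (rule mult_nonneg_nonpos[rotated])
    then show ?thesis using V(2)[OF t, of m] by simp
  qed
  have same: "vC (x t) m = vC (x0 t) m" if "t \<in> {0..1}" "m \<noteq> l" for t m using V(1)[OF that(1), of m] that(2) by simp
  show ?case
  proof (cases "j = i")
    case False
    then have l: "(i, k) \<noteq> l" for k by (simp add: l_def)
    have "count_list (j # ws) i = c" using False by (simp add: c_def)
    moreover have "vC (x t) (i, k) \<le> vH (x t) (i, c')" if "k < c" "c \<le> c'" "t \<in> {0..1}" for k c' t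
      using T(4)[OF that] up[OF that(3) l, of c'] same[OF that(3) l, of k] by simp
    ultimately show ?thesis using T(1-3) same[OF _ l] by (intro exI[of _ T]) auto
  next
    case True
    then have l: "l = (i, c)" using i by (simp add: l_def c_def)
    have lW: "(i, c') \<notin> set (lift ws)" if "c \<le> c'" for c' using lift_mem[of i c' ws] i that by (auto simp: c_def)
    have cl: "count_list (j # ws) i = Suc c" using True by (simp add: c_def)
    define h where "h = (\<lambda>t. vH (x0 t) l)"
    interpret signed h "\<lambda>t. K.lexpos d [] l (R t)" "\<lambda>t. K.lexpos d [] l (Lf t)"
      unfolding h_def by (rule K.lp_signed[OF lp])
    have hn: "0 \<le> h t" if "t \<in> {0..1}" for t using reach_vC(4)[OF x0(1) that, of l] lW l by (simp add: h_def)
    have m0: "mn h = 0" using mn_le[of 0] mn_att hn K.lpD(2)[OF lp] by (fastforce simp: h_def)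
    have h1: "h 1 \<noteq> mn h" using K.fop_None[OF lp, of l] x0(2) by (simp add: h_def)
    have "\<exists>S\<in>{0<..1}. \<forall>t\<in>{0..1}. fphi h t = ramp n S t" unfolding h_def
      by (rule K.fphi_ramp[OF lp la dC])
        (use reach_vC(3)[OF x0(1), of l] lW l hn h1 m0 in \<open>auto simp: h_def\<close>)
    then obtain S where S: "0 < S" "S \<le> 1" "\<And>t. t \<in> {0..1} \<Longrightarrow> fphi h t = ramp n S t" by auto
    have new: "vC (x t) (i, c) = fphi h t" if "t \<in> {0..1}" for t
      using V(1)[OF that, of l] reach_vC(3)[OF x0(1), of l t] lW l by (simp add: h_def)
    have old: "vC (x t) (i, k) = vC (x0 t) (i, k)" if "t \<in> {0..1}" "k \<noteq> c" for t k
      using same[OF that(1)] that(2) l by simp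
    \<comment> \<open>An old ramp increases with time and is bounded by \<open>h\<close>, so its
      value at \<open>t\<close> lies below all later values of \<open>h\<close>. By
      \<open>fphi_greatest\<close> it lies below the new ramp, which hence reaches 1 no
      later.\<close>
    have ST: "S \<le> T k" if k: "k < c" for k
    proof (rule ramp_le_imp[OF n_pos])
      show "T k \<in> {0..1}" by (rule T(1)[OF k])
      fix t :: real assume t: "t \<in> {0..1}"
      have "ramp n (T k) t \<le> fphi h t"
      proof (rule fphi_greatest[OF h1 t ramp_le_1[OF n_pos]])
        fix u assume u: "t \<le> u" "u \<le> 1"
        then have u': "u \<in> {0..1}" using t by auto
        have "vC (x0 t) (i, k) \<le> vC (x0 u) (i, k)" by (rule reach_vC(1)[OF x0(1) t u])
        also have "\<dots> \<le> h u" unfolding h_def l by (rule T(4)[OF k _ u']) simp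
        finally show "ramp n (T k) t \<le> h u - mn h" using T(2)[OF k t] m0 by simp
      qed
      then show "ramp n (T k) t \<le> ramp n S t" using S(3)[OF t] by simp
    qed
    have row: "vH (x0 t) (i, c') = h t" if "t \<in> {0..1}" "c \<le> c'" for t c'
    proof -
      have v: "valid (i, c')" "valid (i, c)" using i by (auto simp: valid_def)
      show ?thesis
        using Hf_prj[OF x0(1) okw_lift[OF ws] v(1) _ that(1)] Hf_prj[OF x0(1) okw_lift[OF ws] v(2) _ that(1)] lW that(2)
        by (simp add: h_def l)
    qed
    have le: "vC (x t) (i, k) \<le> vH (x t) (i, c')" if k: "k < Suc c" "Suc c \<le> c'" and t: "t \<in> {0..1}" for k c' t
    proof -
      have "vC (x t) (i, k) \<le> vH (x0 t) (i, c')"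
      proof (cases "k = c")
        case True
        then show ?thesis using new[OF t] fphi_le[OF h1 t] m0 row[OF t, of c'] k by simp
      next
        case False
        then show ?thesis using old[OF t] T(4)[of k c' t] k t by simp
      qed
      also have "\<dots> \<le> vH (x t) (i, c')" by (rule up[OF t]) (use k l in simp)
      finally show ?thesis .
    qed
    show ?thesis unfolding cl
    proof (intro exI[of _ "T(c := S)"] conjI allI impI ballI)
      show "(T(c := S)) k \<in> {0..1}" if "k < Suc c" for k using T(1)[of k] S that by (auto simp: less_Suc_eq)
      show "vC (x t) (i, k) = ramp n ((T(c := S)) k) t" if "k < Suc c" "t \<in> {0..1}" for k t
        using that T(2)[of k t] new[OF that(2)] old[OF that(2)] S(3)[OF that(2)] by (auto simp: less_Suc_eq)
      show "(T(c := S)) k \<le> (T(c := S)) j" if "j \<le> k" "k < Suc c" for j k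
        using that T(3)[of j k] ST[of j] by (auto simp: less_Suc_eq)
    qed (use le in auto)
  qed
qed auto

text \<open>Linear independence of the simple roots recovers, for each \<open>i\<close>, the sum of
  the coefficients over its copies. A real index has only one copy. For an imaginary one the value
  at time 1 is the number of ramps, and ordered ramps are determined by their sum.\<close>

lemma prj_inj:
  assumes ws: "ws \<in> lists I" "ws' \<in> lists I" and x: "reach (lift ws) = Some x" "reach (lift ws') = Some x'"
    and eq: "prj \<pi> x = prj \<pi> x'"
  shows "x = x'"
proof -
  \<comment> \<open>A finite box containing all letters of both lifted words, since copy numbers are
    smaller than the lengths.\<close>
  define J N M where "J = set ws \<union> set ws'" and "N = Suc (length ws + length ws')" and "M = J \<times> {..<N}"
  have J: "finite J" "J \<subseteq> I" using ws by (auto simp: J_def)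
  have sub: "set (lift vs) \<subseteq> M" if "vs = ws \<or> vs = ws'" for vs
  proof
    fix m assume m: "m \<in> set (lift vs)"
    have "snd m < N" using lift_mem[of "fst m" "snd m" vs] m count_list_le_length[of vs "fst m"] that
      by (auto simp: N_def split: if_splits)
    then show "m \<in> M" using lift_mem[of "fst m" "snd m" vs] m that by (auto simp: M_def J_def mem_Times_iff)
  qed
  have fM: "finite M" using J by (simp add: M_def)
  have out: "vC (x t) m = 0" "vC (x' t) m = 0" if "m \<notin> M" for t m
    using reach_vC(3)[OF x(1), of m t] reach_vC(3)[OF x(2), of m t] sub that by blast+
  define S where "S y i t = (\<Sum>k<N. vC (y t) (i, k))" for y :: "real \<Rightarrow> ('i \<times> nat) vec" and i t
  have SS: "S x i t = S x' i t" if i: "i \<in> J" and t: "t \<in> {0..1}" for i t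
  proof -
    have p: "prj \<pi> y t b = \<pi> t b - (\<Sum>i\<in>J. S y i t * real_of_int (al i b))" if "y = x \<or> y = x'" for y b
    proof -
      have z: "vC (y (clamp t)) m = 0" if "m \<notin> M" for m using out[OF that] \<open>y = x \<or> y = x'\<close> by auto
      show ?thesis using prj_sum[where x = y and s = t and \<pi> = \<pi> and b = b, OF fM z]
        by (simp add: clamp_eq[OF t] M_def sum.cartesian_product' S_def sum_distrib_right)
    qed
    have "(\<lambda>b. \<Sum>i\<in>J. (S x i t - S x' i t) * real_of_int (al i b)) = (\<lambda>b. 0)"
    proof
      fix b
      have "prj \<pi> x t b = prj \<pi> x' t b" using eq by simp
      then show "(\<Sum>i\<in>J. (S x i t - S x' i t) * real_of_int (al i b)) = 0"
        using p[of x b] p[of x' b] by (simp add: left_diff_distrib sum_subtractf)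
    qed
    moreover have "lin_indep_fam I al" using BC by (simp add: BC_datum_def)
    note li = this[unfolded lin_indep_fam_def, THEN spec[of _ J], THEN spec[of _ "\<lambda>i. S x i t - S x' i t"]]
    ultimately show ?thesis using li J i by simp
  qed
  have vC: "vC (x t) (i, k) = vC (x' t) (i, k)" if t: "t \<in> {0..1}" for t i k
  proof (cases "i \<in> J")
    case False
    then show ?thesis using out[of "(i, k)" t] by (simp add: M_def)
  next
    case i: True
    show ?thesis
    proof (cases "rl i")
      case True
      have z: "vC (y t) (i, Suc k) = 0" if "y = x \<or> y = x'" for y k
        using that reach_vC(3)[OF x(1), of "(i, Suc k)" t] reach_vC(3)[OF x(2), of "(i, Suc k)" t]
          lift_mem[of i "Suc k" ws] lift_mem[of i "Suc k" ws'] True by auto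
      have "S x i t = vC (x t) (i, 0)" "S x' i t = vC (x' t) (i, 0)"
        unfolding S_def N_def sum.lessThan_Suc_shift using z by simp_all
      then show ?thesis using SS[OF i t] z by (cases k) auto
    next
      case False
      have iI: "i \<in> I" using i J by blast
      have R: "\<exists>T. (\<forall>k<count_list vs i. T k \<in> {0..1} \<and> (\<forall>t\<in>{0..1}. vC (y t) (i, k) = ramp n (T k) t)) \<and>
          (\<forall>j k. j \<le> k \<longrightarrow> k < count_list vs i \<longrightarrow> T k \<le> T j) \<and>
          (\<forall>t\<in>{0..1}. S y i t = (\<Sum>k<count_list vs i. ramp n (T k) t)) \<and> S y i 1 = count_list vs i"
        if vs: "vs \<in> lists I" "reach (lift vs) = Some y" "vs = ws \<or> vs = ws'" for vs y
      proof -
        obtain T where T: "\<forall>k<count_list vs i. T k \<in> {0..1} \<and> (\<forall>t\<in>{0..1}. vC (y t) (i, k) = ramp n (T k) t)"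
          "\<forall>j k. j \<le> k \<longrightarrow> k < count_list vs i \<longrightarrow> T k \<le> T j"
          using ramps[OF iI False vs(1,2)] by (elim exE conjE) (rule that; assumption)
        have "count_list vs i \<le> N" using count_list_le_length[of vs i] vs(3) by (auto simp: N_def)
        moreover have "vC (y t) (i, k) = 0" if "\<not> k < count_list vs i" for t k
          using reach_vC(3)[OF vs(2), of "(i, k)" t] lift_mem[of i k vs] False that by auto
        ultimately have s: "S y i t = (\<Sum>k<count_list vs i. vC (y t) (i, k))" for t
          unfolding S_def by (intro sum.mono_neutral_right) auto
        have "S y i t = (\<Sum>k<count_list vs i. ramp n (T k) t)" if "t \<in> {0..1}" for t
          unfolding s using T(1) that by (intro sum.cong) auto
        moreover have "S y i 1 = count_list vs i"
        proof -
          have "vC (y 1) (i, k) = 1" if "k < count_list vs i" for k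
            using T(1) that ramp_eq_1[OF n_pos, of "T k" 1] by auto
          then show ?thesis unfolding s by simp
        qed
        ultimately show ?thesis using T by blast
      qed
      obtain T where Ta: "\<forall>k<count_list ws i. T k \<in> {0..1} \<and> (\<forall>t\<in>{0..1}. vC (x t) (i, k) = ramp n (T k) t)"
        and Tb: "\<forall>j k. j \<le> k \<longrightarrow> k < count_list ws i \<longrightarrow> T k \<le> T j"
        and Tc: "\<forall>t\<in>{0..1}. S x i t = (\<Sum>k<count_list ws i. ramp n (T k) t)" and Td: "S x i 1 = count_list ws i"
        using R[OF ws(1) x(1) disjI1[OF refl]] by (elim exE conjE) (rule that; assumption)
      have T: "\<And>k. k < count_list ws i \<Longrightarrow> T k \<in> {0..1}"
        "\<And>k t. k < count_list ws i \<Longrightarrow> t \<in> {0..1} \<Longrightarrow> vC (x t) (i, k) = ramp n (T k) t"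
        "\<And>j k. j \<le> k \<Longrightarrow> k < count_list ws i \<Longrightarrow> T k \<le> T j"
        "\<And>t. t \<in> {0..1} \<Longrightarrow> S x i t = (\<Sum>k<count_list ws i. ramp n (T k) t)" "S x i 1 = count_list ws i"
        using Ta Tb Tc Td by blast+
      obtain T' where Tpa: "\<forall>k<count_list ws' i. T' k \<in> {0..1} \<and> (\<forall>t\<in>{0..1}. vC (x' t) (i, k) = ramp n (T' k) t)"
        and Tpb: "\<forall>j k. j \<le> k \<longrightarrow> k < count_list ws' i \<longrightarrow> T' k \<le> T' j"
        and Tpc: "\<forall>t\<in>{0..1}. S x' i t = (\<Sum>k<count_list ws' i. ramp n (T' k) t)" and Tpd: "S x' i 1 = count_list ws' i"
        using R[OF ws(2) x(2) disjI2[OF refl]] by (elim exE conjE) (rule that; assumption)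
      have T': "\<And>k. k < count_list ws' i \<Longrightarrow> T' k \<in> {0..1}"
        "\<And>k t. k < count_list ws' i \<Longrightarrow> t \<in> {0..1} \<Longrightarrow> vC (x' t) (i, k) = ramp n (T' k) t"
        "\<And>j k. j \<le> k \<Longrightarrow> k < count_list ws' i \<Longrightarrow> T' k \<le> T' j"
        "\<And>t. t \<in> {0..1} \<Longrightarrow> S x' i t = (\<Sum>k<count_list ws' i. ramp n (T' k) t)" "S x' i 1 = count_list ws' i"
        using Tpa Tpb Tpc Tpd by blast+
      have c: "count_list ws' i = count_list ws i" using T(5) T'(5) SS[OF i, of 1] by simp
      note T' = T'[unfolded c]
      show ?thesis
      proof (cases "k < count_list ws i")
        case True
        have sums: "(\<Sum>k<count_list ws i. ramp n (T k) t) = (\<Sum>k<count_list ws i. ramp n (T' k) t)" if "t \<in> {0..1}" for t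
          using SS[OF i that] unfolding T(4)[OF that] T'(4)[OF that] .
        have "T k = T' k" by (rule ramp_sum_inj[OF n_pos T(1,3) T'(1,3) sums True])
        then show ?thesis using T(2)[OF True t] T'(2)[OF True t] by simp
      next
        case nk: False
        then have "(i, k) \<notin> set (lift ws)" "(i, k) \<notin> set (lift ws')"
          using lift_mem[of i k ws] lift_mem[of i k ws'] False c by auto
        then show ?thesis using reach_vC(3)[OF x(1), of "(i, k)" t] reach_vC(3)[OF x(2), of "(i, k)" t] by simp
      qed
    qed
  qed
  show ?thesis
  proof
    fix t
    have s: "snd ` set (K.FW (lift ws)) \<subseteq> M" "snd ` set (K.FW (lift ws')) \<subseteq> M" using sub by simp_all
    show "x t = x' t"
    proof (cases "t \<in> {0..1}")
      case True
      have "x t = base \<pi> t - (\<Sum>m\<in>M. (vC (x t) m - vC (base \<pi> t) m) *\<^sub>R K.al m)"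
        by (rule K.run_span(1)[OF x(1) fM s(1)])
      also have "(\<Sum>m\<in>M. (vC (x t) m - vC (base \<pi> t) m) *\<^sub>R K.al m) = (\<Sum>m\<in>M. (vC (x' t) m - vC (base \<pi> t) m) *\<^sub>R K.al m)"
        using vC[OF True] by (intro sum.cong) auto
      also have "base \<pi> t - \<dots> = x' t" by (rule K.run_span(1)[OF x(2) fM s(2), symmetric])
      finally show ?thesis .
    next
      case False
      show ?thesis unfolding K.run_span(3)[OF x(1) fM s(1) False] K.run_span(3)[OF x(2) fM s(2) False] ..
    qed
  qed
qed

end

section \<open>The operators e on the orbit under f\<close>

context bpath
begin

text \<open>By goodness some word in e leads from \<open>y\<close> back to the base path; inverted,
  it is a word in f reaching \<open>y\<close>. Its letters are counted by the coefficients at time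
  1, which e does not increase, so no imaginary copy is used twice.\<close>

lemma reach_eop:
  assumes W: "okw W" "reach W = Some x" and e: "K.eop l x = Some y"
  shows "\<exists>V. okw V \<and> reach V = Some y"
proof -
  obtain R Lf where lb: "K.lp n d (base \<pi>) R Lf" using base_lp by blast
  obtain R1 L1 where lx: "K.lp n d x R1 L1" using reach_lp[OF W(2)] by blast
  have "K.run ((False, l) # K.FW W) (base \<pi>) = Some y" using W(2) e by simp
  then obtain E where E: "\<forall>c\<in>set E. \<not> fst c" "K.run E y = Some (base \<pi>)"
    using gd unfolding K.good_def by blast
  obtain R2 L2 where ly: "K.lp n d y R2 L2" using K.opr_lp[OF lx, of "(False, l)" y] e by (auto simp: K.reflected_def)
  define V where "V = rev (map snd E)"
  have "map K.inop E = K.FW (map snd E)" using E(1) by (auto simp: K.FW_def K.inop_def)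
  then have "K.inw E = K.FW V" by (simp add: K.inw_def V_def K.FW_def rev_map)
  then have rV: "reach V = Some y" using K.run_inw[OF ly E(2)] by simp
  have "vC (y 1) m \<le> vC (x 1) m" for m using K.opr_end[OF lx, of "(False, l)" y] e by simp
  then have c: "count_list V m \<le> count_list W m" for m
    using reach_vC(2)[OF rV, of m] reach_vC(2)[OF W(2), of m] by (metis of_nat_le_iff)
  have "valid m \<and> (\<not> rl (fst m) \<longrightarrow> count_list V m \<le> 1)" if m: "m \<in> set V" for m
  proof -
    have "count_list V m \<noteq> 0" using m by (simp add: count_list_0_iff)
    then have "m \<in> set W" using c[of m] by (metis count_list_0_iff le_0_eq)
    then show ?thesis using W(1) c[of m] by (meson okw_def order.trans)
  qed
  then show ?thesis using rV unfolding okw_def by blast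
qed

lemma e_re_char:
  assumes i: "i \<in> I" "rl i" and b: "b \<in> F_orbit I cor al \<pi>"
  shows "e_re cor al i b = Some q \<longleftrightarrow> q \<in> F_orbit I cor al \<pi> \<and> f_op cor al i q = Some b"
proof
  define l where "l = (i, 0::nat)"
  have l: "valid l" "fst l = i" "rl (fst l)" using i by (auto simp: valid_def l_def)
  {
    assume e: "e_re cor al i b = Some q"
    obtain W x where W: "okw W" "reach W = Some x" "b = prj \<pi> x" using b orbit_iff by blast
    obtain R Lf where lx: "K.lp n d x R Lf" using reach_lp[OF W(2)] by blast
    obtain y where y: "K.eop l x = Some y" "q = prj \<pi> y"
      using e_re_prj[OF lx W(2,1) l(1,3)] e W(3) l(2) by auto
    obtain V where V: "okw V" "reach V = Some y" using reach_eop[OF W(1,2) y(1)] by blast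
    obtain R' L' where ly: "K.lp n d y R' L'" using reach_lp[OF V(2)] by blast
    have "f_op cor al i q = Some b"
      using f_op_prj[OF ly V(2,1) l(1)] l K.fop_eop(1)[OF lx y(1)] y(2) W(3) by simp
    then show "q \<in> F_orbit I cor al \<pi> \<and> f_op cor al i q = Some b" using V y(2) orbit_iff by blast
  }
  {
    assume q: "q \<in> F_orbit I cor al \<pi> \<and> f_op cor al i q = Some b"
    obtain V y where V: "okw V" "reach V = Some y" "q = prj \<pi> y" using q orbit_iff by blast
    obtain R Lf where ly: "K.lp n d y R Lf" using reach_lp[OF V(2)] by blast
    obtain x where x: "K.fop l y = Some x" "b = prj \<pi> x" using f_op_prj[OF ly V(2,1) l(1)] l q V(3) by auto
    have r: "reach (l # V) = Some x" using V(2) x(1) by (simp add: K.run_FW_Cons)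
    have o: "okw (l # V)" using l V(1) by (simp add: okw_Cons)
    obtain R' L' where lx: "K.lp n d x R' L'" using reach_lp[OF r] by blast
    show "e_re cor al i b = Some q"
      using e_re_prj[OF lx r o l(1,3)] K.eop_fop(1)[OF ly x(1)] x(2) V(3) l(2) by simp
  }
qed

lemma imag_H:
  assumes i: "i \<in> I" "\<not> rl i" and b: "b \<in> F_orbit I cor al \<pi>"
  defines "H \<equiv> Hf cor i b"
  shows "continuous_on {0..1} H" "H 0 = 0" "t \<in> {0..1} \<Longrightarrow> 0 \<le> H t" "mn H = 0"
    "fpl H \<noteq> 1 \<Longrightarrow> fpl H \<in> {0..<1} \<and> H (fpl H) = 0 \<and> fpl H < fmi H \<and> fmi H \<le> 1 \<and> H (fmi H) = 1 \<and>
       (\<forall>t. fpl H < t \<longrightarrow> t \<le> 1 \<longrightarrow> 0 < H t) \<and> (\<forall>t. fpl H < t \<longrightarrow> t < fmi H \<longrightarrow> H t < 1) \<and>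
       (\<forall>t. fmi H \<le> t \<longrightarrow> t \<le> 1 \<longrightarrow> 1 \<le> H t)"
    "b (clamp s) = b s"
proof -
  obtain W x where W: "okw W" "reach W = Some x" "b = prj \<pi> x" using b orbit_iff by blast
  obtain R Lf where lx: "K.lp n d x R Lf" using reach_lp[OF W(2)] by blast
  \<comment> \<open>Infinitely many copies guarantee one that does not occur in
    \<open>W\<close>.\<close>
  have "finite (snd ` set W)" by simp
  then obtain k where k: "k \<notin> snd ` set W" using ex_new_if_finite[of "snd ` set W"] infinite_UNIV_nat by blast
  define l where "l = (i, k)"
  have l: "valid l" "fst l = i" "l \<notin> set W" using i k by (force simp: valid_def l_def)+
  define g where "g = (\<lambda>t. vH (x t) l)"
  interpret signed g "\<lambda>t. K.lexpos d [] l (R t)" "\<lambda>t. K.lexpos d [] l (Lf t)"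
    unfolding g_def by (rule K.lp_signed[OF lx])
  have eq: "H t = g t" if "t \<in> {0..1}" for t
    unfolding H_def g_def W(3) l(2)[symmetric] by (rule Hf_prj[OF W(2,1) l(1) _ that]) (use l in simp)
  have gn: "0 \<le> g t" if "t \<in> {0..1}" for t using reach_vC(4)[OF W(2) that l(3)] by (simp add: g_def)
  have g0: "g 0 = 0" using K.lpD(2)[OF lx] by (simp add: g_def)
  have m0: "mn g = 0" using mn_le[of 0] mn_att gn g0 by fastforce
  show "continuous_on {0..1} H" by (rule continuous_on_eq[OF cont]) (simp add: eq)
  show "H 0 = 0" "t \<in> {0..1} \<Longrightarrow> 0 \<le> H t" using eq g0 gn by auto
  show "mn H = 0" using mn_cong[of H g] eq m0 by simp
  show "fpl H \<in> {0..<1} \<and> H (fpl H) = 0 \<and> fpl H < fmi H \<and> fmi H \<le> 1 \<and> H (fmi H) = 1 \<and>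
       (\<forall>t. fpl H < t \<longrightarrow> t \<le> 1 \<longrightarrow> 0 < H t) \<and> (\<forall>t. fpl H < t \<longrightarrow> t < fmi H \<longrightarrow> H t < 1) \<and>
       (\<forall>t. fmi H \<le> t \<longrightarrow> t \<le> 1 \<longrightarrow> 1 \<le> H t)" if "fpl H \<noteq> 1"
  proof -
    have g1: "g 1 \<noteq> mn g" using that f_cong(1)[of H g, OF eq fpl_mem] fpl_1 by simp
    note F = fpl_mem fpl_val fpl_less[OF g1] fmi_le[OF g1] fmi_val[OF g1]
    have r: "0 \<le> fpl g" "fpl g < 1" "0 \<le> fmi g" using F by auto
    have "0 < H t" if "fpl g < t" "t \<le> 1" for t using fpl_gt[OF that] eq[of t] that r m0 by simp
    moreover have "H t < 1" if "fpl g < t" "t < fmi g" for t using fmi_btw[OF g1 that] eq[of t] that r F m0 by simp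
    moreover have "1 \<le> H t" if "fmi g \<le> t" "t \<le> 1" for t using after_fmi[OF g1 that] eq[of t] that r F m0 by simp
    moreover have "H (fpl g) = 0" "H (fmi g) = 1" using eq[of "fpl g"] eq[of "fmi g"] F r m0 by auto
    moreover have "fpl H = fpl g" "fmi H = fmi g"
      using f_cong(1)[of H g, OF eq fpl_mem] f_cong(2)[of H g, OF eq fpl_mem] by simp_all
    ultimately show ?thesis using F r by simp
  qed
  show "b (clamp s) = b s" by (simp add: W(3))
qed

lemma imag_shift_H:
  assumes "q = (\<lambda>s b'. p (clamp s) b' + g (clamp s) * real_of_int (al i b'))" "t \<in> {0..1}"
  shows "Hf cor i q t = Hf cor i p t + g t * real_of_int (cartan cor al i i)"
  unfolding Hf_def assms(1) clamp_eq[OF assms(2)] pairR_add pairR_scale pairR_of_int cartan_def ..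

text \<open>With \<open>c\<close> the negative of the diagonal entry, f multiplies the pairing by
  \<open>1 + c\<close> between its two times and adds \<open>c\<close> afterwards. So the value 1 at
  \<open>fm\<close> becomes \<open>1 + c\<close>, the level at which the imaginary e stops, and e
  acts on the same segment as f.\<close>

lemma e_im_f_op:
  assumes i: "i \<in> I" "\<not> rl i" and q: "q \<in> F_orbit I cor al \<pi>" and f: "f_op cor al i q = Some b"
  shows "e_im cor al i b = Some q"
proof -
  define h where "h = Hf cor i q"
  define c where "c = - real_of_int (cartan cor al i i)"
  have c: "0 \<le> c" "real_of_int (cartan cor al i i) = - c" using cartan_diag[OF i] by (auto simp: c_def)
  note Q = imag_H[OF i q, folded h_def]
  have fp: "fpl h \<noteq> 1" and b: "b = (\<lambda>s b'. q (clamp s) b' + (- fphi h (clamp s)) * real_of_int (al i b'))"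
    using f by (auto simp: f_op_fphi h_def fun_eq_iff split: if_splits)
  define fp fm where "fp = fpl h" and "fm = fmi h"
  have F: "0 \<le> fp" "fp < 1" "h fp = 0" "fp < fm" "fm \<le> 1" "h fm = 1"
    "\<And>t. fp < t \<Longrightarrow> t \<le> 1 \<Longrightarrow> 0 < h t" "\<And>t. fp < t \<Longrightarrow> t < fm \<Longrightarrow> h t < 1" "\<And>t. fm \<le> t \<Longrightarrow> t \<le> 1 \<Longrightarrow> 1 \<le> h t"
    using Q(5)[OF fp] by (auto simp: fp_def fm_def)
  have ph: "fphi h t = (if t \<le> fp then 0 else if t \<le> fm then h t else 1)" for t
    using Q(4) by (simp add: fphi_def fp_def fm_def)
  define G where "G = Hf cor i b"
  have G: "G t = h t + c * fphi h t" if "t \<in> {0..1}" for t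
    using imag_shift_H[OF b that] c by (simp add: G_def h_def)
  have Gn: "0 \<le> G t" if "t \<in> {0..1}" for t
    using G[OF that] Q(3)[OF that] c by (auto simp: ph)
  obtain B where B: "\<And>t. t \<in> {0..1} \<Longrightarrow> h t \<le> B"
    using continuous_attains_sup[of "{0..1}" h] Q(1) by fastforce
  have mG: "mn G = 0"
  proof (rule mnI[where ?t0.0 = 0 and B = "B + c * (1 + \<bar>B\<bar>)"])
    show "G 0 = 0" using G[of 0] Q(2) F(1) by (simp add: ph)
    fix t :: real assume t: "t \<in> {0..1}"
    show "0 \<le> G t" by (rule Gn[OF t])
    have "fphi h t \<le> 1 + \<bar>B\<bar>" using B[OF t] by (auto simp: ph)
    then show "G t \<le> B + c * (1 + \<bar>B\<bar>)" unfolding G[OF t] using B[OF t] c by (intro add_mono mult_left_mono) auto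
  qed auto
  have Gpos: "0 < G t" if "fp < t" "t \<le> 1" for t
    using G[of t] F(1,5) F(7)[OF that] that c by (auto simp: ph intro: add_pos_nonneg)
  have em: "Sup {t \<in> {0..1}. G t = 0} = fp"
  proof (rule cSup_eq_maximum)
    show "fp \<in> {t \<in> {0..1}. G t = 0}" using F G[of fp] by (simp add: ph)
    show "t \<le> fp" if "t \<in> {t \<in> {0..1}. G t = 0}" for t using that Gpos[of t] by force
  qed
  have Gfm: "G fm = 1 + c" using G[of fm] F by (simp add: ph)
  have ep: "Inf {t \<in> {fp..1}. G t = 1 + c} = fm"
  proof (rule cInf_eq_minimum)
    show "fm \<in> {t \<in> {fp..1}. G t = 1 + c}" using F Gfm by simp
    fix t assume t: "t \<in> {t \<in> {fp..1}. G t = 1 + c}"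
    show "fm \<le> t"
    proof (rule ccontr)
      assume n: "\<not> fm \<le> t"
      show False
      proof (cases "t = fp")
        case True
        then show False using t G[of fp] F c by (simp add: ph)
      next
        case False
        then have "h t < 1" using n t F(8)[of t] by auto
        moreover have "G t = h t + c * h t" using False n t F(1) G[of t] by (simp add: ph)
        then have "(1 + c) * (1 - h t) = 0" using t by (simp add: algebra_simps)
        ultimately show False using c by simp
      qed
    qed
  qed
  \<comment> \<open>The extra condition for the imaginary e not to vanish: after f the pairing never
    returns to the level \<open>c\<close>.\<close>
  have late: "c < G t" if "t \<in> {fm..1}" for t
  proof -
    have t: "t \<in> {0..1}" "fp < t" "1 \<le> h t" "fm \<le> t" using that F by auto
    then show ?thesis using G[OF t(1)] c Gfm by (cases "t = fm") (auto simp: ph)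
  qed
  have fn: "(let t = clamp s in if t \<le> fp then b t else if t \<le> fm then (\<lambda>b'. b t b' + (1 / (1 + c)) * G t * real_of_int (al i b'))
      else (\<lambda>b'. b t b' + real_of_int (al i b'))) = q s" for s
  proof -
    define t where "t = clamp s"
    have t: "t \<in> {0..1}" "clamp t = t" "q s = q t" using Q(6)[of s] by (simp_all add: t_def)
    have bt: "b t b' = q t b' - fphi h t * real_of_int (al i b')" for b' unfolding b t(2) by simp
    have "(1 / (1 + c)) * G t = h t" if "fp < t" "t \<le> fm"
      using G[OF t(1)] that c by (simp add: ph field_simps)
    then show ?thesis unfolding t(3) Let_def t_def[symmetric] by (auto simp: bt ph fun_eq_iff)
  qed
  have "fm \<in> {fp..1}" "\<not> G fm < 1 + c" "fp \<noteq> 1" using F(2,4,5) Gfm by auto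
  then have cond: "\<not> (fp = 1 \<or> (\<forall>t\<in>{fp..1}. G t < 1 + c))" "\<not> (\<exists>t\<in>{fm..1}. G t \<le> c)"
    using late linorder_not_le by blast+
  note fn' = ext[of _ q, OF fn, unfolded Let_def]
  show ?thesis
    unfolding e_im_def Let_def mH_mn G_def[symmetric] mG em c(2) add_0 diff_minus_eq_add ep embR_def diff_0_right
    by (simp only: cond if_False fn')
qed

text \<open>Conversely e divides the pairing by \<open>1 + c\<close> up to \<open>ep\<close> and
  lowers it by \<open>c\<close> afterwards. Membership of \<open>q\<close> in the orbit supplies the
  minimum 0 for the new pairing, and the two times of f are then those of e.\<close>

lemma f_op_e_im:
  assumes i: "i \<in> I" "\<not> rl i" and b: "b \<in> F_orbit I cor al \<pi>" and q: "q \<in> F_orbit I cor al \<pi>"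
    and e: "e_im cor al i b = Some q"
  shows "f_op cor al i q = Some b"
proof -
  define G where "G = Hf cor i b"
  define c where "c = - real_of_int (cartan cor al i i)"
  have c: "0 \<le> c" "real_of_int (cartan cor al i i) = - c" using cartan_diag[OF i] by (auto simp: c_def)
  note B = imag_H[OF i b, folded G_def]
  define em where "em = fpl G"
  define ep where "ep = Inf {t \<in> {em..1}. G t = 1 + c}"
  have em_Sup: "Sup {t \<in> {0..1}. G t = 0} = em" using B(4) by (simp add: em_def fpl_def)
  have E: "em \<noteq> 1" "\<exists>t\<in>{em..1}. 1 + c \<le> G t" "\<And>t. t \<in> {ep..1} \<Longrightarrow> c < G t"
    and qd: "q = (\<lambda>s. let t = clamp s in if t \<le> em then b t
       else if t \<le> ep then (\<lambda>b'. b t b' + (1 / (1 + c)) * G t * real_of_int (al i b'))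
       else (\<lambda>b'. b t b' + real_of_int (al i b')))"
    using e unfolding e_im_def Let_def mH_mn G_def[symmetric] B(4) em_Sup c(2) add_0 diff_minus_eq_add ep_def[symmetric] embR_def
    by (auto split: if_splits simp: not_less not_le)
  have F: "0 \<le> em" "em < 1" "G em = 0" "\<And>t. em < t \<Longrightarrow> t \<le> 1 \<Longrightarrow> 0 < G t"
    using B(5) E(1) by (auto simp: em_def)
  have cG: "continuous_on {em..u} G" if "u \<le> 1" for u by (rule continuous_on_subset[OF B(1)]) (use F that in auto)
  let ?S = "{t \<in> {em..1}. G t = 1 + c}"
  obtain t1 where t1: "em \<le> t1" "t1 \<le> 1" "1 + c \<le> G t1" using E(2) by auto
  have ivt: "\<exists>u\<ge>em. u \<le> t \<and> G u = 1 + c" if "em \<le> t" "t \<le> 1" "1 + c \<le> G t" for t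
    using IVT'[of G em "1 + c" t] that F c cG by auto
  have ne: "?S \<noteq> {}" using ivt[OF t1] t1 by force
  have cl: "closed ?S" by (rule closed_level[OF cG]) simp
  have bd: "bdd_below ?S" by (rule bdd_belowI[of _ em]) auto
  have epS: "ep \<in> ?S" unfolding ep_def by (rule closed_contains_Inf[OF ne bd cl])
  have low: "G t < 1 + c" if t: "em \<le> t" "t < ep" for t
  proof (rule ccontr)
    assume "\<not> G t < 1 + c"
    then obtain u where "u \<ge> em" "u \<le> t" "G u = 1 + c" using ivt[of t] t epS by auto
    then have "u \<in> ?S" using t epS by auto
    then have "ep \<le> u" unfolding ep_def by (rule cInf_lower[OF _ bd])
    then show False using \<open>u \<le> t\<close> t by simp
  qed
  have emp: "em < ep" using epS F c by (cases "ep = em") auto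
  define \<psi> where "\<psi> t = (if t \<le> em then 0 else if t \<le> ep then (1 / (1 + c)) * G t else 1)" for t
  have q': "q = (\<lambda>s b'. b (clamp s) b' + \<psi> (clamp s) * real_of_int (al i b'))"
    unfolding qd by (auto simp: \<psi>_def Let_def fun_eq_iff)
  define h where "h = Hf cor i q"
  note Q = imag_H[OF i q, folded h_def]
  have h: "h t = G t - c * \<psi> t" if "t \<in> {0..1}" for t
    using imag_shift_H[OF q' that] c by (simp add: G_def h_def)
  have h1: "h t = G t / (1 + c)" if "em < t" "t \<le> ep" for t
  proof -
    have "t \<in> {0..1}" using that F epS by auto
    then have "h t = G t - c * ((1 / (1 + c)) * G t)" using h that by (simp add: \<psi>_def)
    then show ?thesis using c by (simp add: field_simps)
  qed
  have hem: "h em = 0" using h[of em] F by (simp add: \<psi>_def)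
  have hpos: "0 < h t" if "em < t" "t \<le> 1" for t
  proof (cases "t \<le> ep")
    case True
    then show ?thesis using h1 that F(4)[OF that] c by simp
  next
    case False
    then show ?thesis using h[of t] that F E(3)[of t] epS by (simp add: \<psi>_def)
  qed
  have fp: "fpl h = em" unfolding fpl_def Q(4)
  proof (rule cSup_eq_maximum)
    show "em \<in> {t \<in> {0..1}. h t = 0}" using F hem by simp
    show "t \<le> em" if "t \<in> {t \<in> {0..1}. h t = 0}" for t using that hpos[of t] by force
  qed
  have fm: "fmi h = ep" unfolding fmi_def Q(4) fp
  proof (rule cInf_eq_minimum)
    show "ep \<in> {t \<in> {em..1}. h t = 0 + 1}" using epS emp h1[of ep] c by auto
    fix t assume t: "t \<in> {t \<in> {em..1}. h t = 0 + 1}"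
    show "ep \<le> t"
    proof (rule ccontr)
      assume n: "\<not> ep \<le> t"
      then have "em < t" using t hem by (cases "t = em") auto
      then have "G t / (1 + c) = 1" using h1[of t] n t by simp
      then show False using low[of t] n t c by (simp add: field_simps)
    qed
  qed
  have ph: "fphi h t = \<psi> t" for t
    unfolding fphi_def fp fm \<psi>_def Q(4) using h1[of t] by simp
  have "(\<lambda>s b'. q (clamp s) b' - fphi h (clamp s) * real_of_int (al i b')) = b"
    unfolding ph using B(6) by (simp add: q' fun_eq_iff)
  then show ?thesis using fp E(1) by (simp add: f_op_fphi flip: h_def)
qed

text \<open>Describes e, real or imaginary, as the partial inverse of f within the orbit.
  Compatibility of a bijection with e then follows from compatibility with f.\<close>

lemma c_e_char:
  assumes i: "i \<in> I" and b: "b \<in> F_orbit I cor al \<pi>"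
  shows "c_e cor al (F_orbit I cor al \<pi>) i b = Some q \<longleftrightarrow> q \<in> F_orbit I cor al \<pi> \<and> f_op cor al i q = Some b"
proof (cases "rl i")
  case True
  then show ?thesis using e_re_char[OF i True b] by (simp add: c_e_def e_op_def)
next
  case False
  have "e_im cor al i b = Some q \<longleftrightarrow> f_op cor al i q = Some b" if "q \<in> F_orbit I cor al \<pi>"
    using e_im_f_op[OF i False that] f_op_e_im[OF i False b that] by blast
  moreover have "c_e cor al (F_orbit I cor al \<pi>) i b = Some q \<longleftrightarrow> q \<in> F_orbit I cor al \<pi> \<and> e_im cor al i b = Some q"
    using False by (auto simp: c_e_def e_op_def split: option.splits)
  ultimately show ?thesis by blast
qed

end

section \<open>The isomorphism\<close>

text \<open>The value at \<open>p\<close> is computed with any word reaching \<open>p\<close>: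
  \<open>E\<close> gives independence of the word and injectivity, \<open>N\<close> gives existence
  of the value and surjectivity. The operators e come in only through \<open>CP\<close> and
  \<open>CL\<close>.\<close>

lemma iso_of_words:
  fixes P L :: "'b path"
  assumes N: "\<And>ws. ws \<in> lists I \<Longrightarrow> apply_F cor al ws P = None \<longleftrightarrow> apply_F cor al ws L = None"
    and E: "\<And>ws ws' p p' q q'. ws \<in> lists I \<Longrightarrow> ws' \<in> lists I \<Longrightarrow> apply_F cor al ws P = Some p \<Longrightarrow>
      apply_F cor al ws' P = Some p' \<Longrightarrow> apply_F cor al ws L = Some q \<Longrightarrow> apply_F cor al ws' L = Some q' \<Longrightarrow> p = p' \<longleftrightarrow> q = q'"
    and D: "\<And>ws p q. ws \<in> lists I \<Longrightarrow> apply_F cor al ws P = Some p \<Longrightarrow> apply_F cor al ws L = Some q \<Longrightarrow>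
      c_wt q = c_wt p \<and> (\<forall>i\<in>I. c_eps cor al i q = c_eps cor al i p \<and> c_phi cor al i q = c_phi cor al i p)"
    and CP: "\<And>i b q. i \<in> I \<Longrightarrow> b \<in> F_orbit I cor al P \<Longrightarrow>
      c_e cor al (F_orbit I cor al P) i b = Some q \<longleftrightarrow> q \<in> F_orbit I cor al P \<and> f_op cor al i q = Some b"
    and CL: "\<And>i b q. i \<in> I \<Longrightarrow> b \<in> F_orbit I cor al L \<Longrightarrow>
      c_e cor al (F_orbit I cor al L) i b = Some q \<longleftrightarrow> q \<in> F_orbit I cor al L \<and> f_op cor al i q = Some b"
  shows "\<exists>\<Phi>. crystal_iso I cor al (F_orbit I cor al P) (F_orbit I cor al L) \<Phi>
    \<and> (\<forall>ws\<in>lists I. case apply_F cor al ws P of None \<Rightarrow> apply_F cor al ws L = None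
        | Some p \<Rightarrow> apply_F cor al ws L = Some (\<Phi> p))"
proof -
  define \<Phi> where "\<Phi> p = the (apply_F cor al (SOME ws. ws \<in> lists I \<and> apply_F cor al ws P = Some p) L)" for p
  let ?OP = "F_orbit I cor al P" and ?OL = "F_orbit I cor al L"
  have key: "apply_F cor al ws L = Some (\<Phi> p)" if ws: "ws \<in> lists I" "apply_F cor al ws P = Some p" for ws p
  proof -
    define v where "v = (SOME ws. ws \<in> lists I \<and> apply_F cor al ws P = Some p)"
    have v: "v \<in> lists I" "apply_F cor al v P = Some p"
      using someI[of "\<lambda>ws. ws \<in> lists I \<and> apply_F cor al ws P = Some p" ws] ws unfolding v_def by auto
    obtain q q' where q: "apply_F cor al ws L = Some q" "apply_F cor al v L = Some q'"
      using N[OF ws(1)] N[OF v(1)] ws(2) v(2) by auto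
    have "q = q'" using E[OF ws(1) v(1) ws(2) v(2) q] by simp
    then show ?thesis using q by (simp add: \<Phi>_def flip: v_def)
  qed
  have OP: "\<exists>ws\<in>lists I. apply_F cor al ws P = Some p \<and> apply_F cor al ws L = Some (\<Phi> p)" if "p \<in> ?OP" for p
    using that key by (auto simp: F_orbit_def)
  have OL: "\<Phi> p \<in> ?OL" if "p \<in> ?OP" for p using OP[OF that] by (auto simp: F_orbit_def)
  have surj: "\<exists>p\<in>?OP. q = \<Phi> p" if q: "q \<in> ?OL" for q
  proof -
    obtain ws where ws: "ws \<in> lists I" "apply_F cor al ws L = Some q" using q by (auto simp: F_orbit_def)
    obtain p where p: "apply_F cor al ws P = Some p" using N[OF ws(1)] ws(2) by auto
    then show ?thesis using key[OF ws(1) p] ws by (auto simp: F_orbit_def)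
  qed
  have inj: "p = p'" if p: "p \<in> ?OP" "p' \<in> ?OP" "\<Phi> p = \<Phi> p'" for p p'
  proof -
    obtain ws ws' where ws: "ws \<in> lists I" "ws' \<in> lists I" "apply_F cor al ws P = Some p" "apply_F cor al ws' P = Some p'"
      using p by (auto simp: F_orbit_def)
    show ?thesis using E[OF ws key[OF ws(1,3)] key[OF ws(2,4)]] p(3) by simp
  qed
  have f: "map_option \<Phi> (f_op cor al i p) = f_op cor al i (\<Phi> p)" if i: "i \<in> I" and p: "p \<in> ?OP" for i p
  proof -
    obtain ws where ws: "ws \<in> lists I" "apply_F cor al ws P = Some p" "apply_F cor al ws L = Some (\<Phi> p)" using OP[OF p] by auto
    have iw: "i # ws \<in> lists I" using i ws by simp
    have a: "apply_F cor al (i # ws) P = f_op cor al i p" "apply_F cor al (i # ws) L = f_op cor al i (\<Phi> p)" using ws by simp_all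
    show ?thesis
    proof (cases "f_op cor al i p")
      case None
      then show ?thesis using N[OF iw] a by simp
    next
      case (Some p')
      then show ?thesis using key[OF iw, of p'] a by simp
    qed
  qed
  have fO: "p' \<in> ?OP" if i: "i \<in> I" and p: "p \<in> ?OP" "f_op cor al i p = Some p'" for i p p'
  proof -
    obtain ws where ws: "ws \<in> lists I" "apply_F cor al ws P = Some p" using p by (auto simp: F_orbit_def)
    then have "i # ws \<in> lists I" "apply_F cor al (i # ws) P = Some p'" using i p by simp_all
    then show ?thesis unfolding F_orbit_def by blast
  qed
  have e: "map_option \<Phi> (c_e cor al ?OP i b) = c_e cor al ?OL i (\<Phi> b)" if i: "i \<in> I" and b: "b \<in> ?OP" for i b
  proof (cases "c_e cor al ?OP i b")
    case (Some q)
    then have q: "q \<in> ?OP" "f_op cor al i q = Some b" using CP[OF i b] by auto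
    then have "f_op cor al i (\<Phi> q) = Some (\<Phi> b)" using f[OF i q(1)] by simp
    then show ?thesis using Some CL[OF i OL[OF b], of "\<Phi> q"] OL[OF q(1)] by simp
  next
    \<comment> \<open>An image of \<open>\<Phi> b\<close> under e would come from some
      \<open>q\<close> that f sends to an element with the same value as \<open>b\<close>, so to
      \<open>b\<close> itself by injectivity.\<close>
    case None
    have "c_e cor al ?OL i (\<Phi> b) \<noteq> Some r" for r
    proof
      assume "c_e cor al ?OL i (\<Phi> b) = Some r"
      then have r: "r \<in> ?OL" "f_op cor al i r = Some (\<Phi> b)" using CL[OF i OL[OF b]] by auto
      obtain q where q: "q \<in> ?OP" "r = \<Phi> q" using surj[OF r(1)] by blast
      obtain b' where b': "f_op cor al i q = Some b'" "\<Phi> b' = \<Phi> b" using f[OF i q(1)] r(2) q(2) by auto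
      have "b' = b" by (rule inj[OF fO[OF i q(1) b'(1)] b b'(2)])
      then show False using None CP[OF i b, of q] q b' by simp
    qed
    then show ?thesis using None by (cases "c_e cor al ?OL i (\<Phi> b)") auto
  qed
  have "bij_betw \<Phi> ?OP ?OL" unfolding bij_betw_def inj_on_def using inj OL surj by blast
  moreover have "c_wt (\<Phi> b) = c_wt b \<and> (\<forall>i\<in>I. c_eps cor al i (\<Phi> b) = c_eps cor al i b \<and> c_phi cor al i (\<Phi> b) = c_phi cor al i b)"
    if b: "b \<in> ?OP" for b using OP[OF b] D by blast
  ultimately have "crystal_iso I cor al ?OP ?OL \<Phi>" unfolding crystal_iso_def c_f_def using f e by simp
  moreover have "\<forall>ws\<in>lists I. case apply_F cor al ws P of None \<Rightarrow> apply_F cor al ws L = None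
      | Some p \<Rightarrow> apply_F cor al ws L = Some (\<Phi> p)"
    using key N by (auto split: option.splits)
  ultimately show ?thesis by blast
qed

lemma concat_pi_path:
  fixes lams :: "'b wt list"
  defines "n \<equiv> length lams"
  assumes k: "k < n" and t: "real k \<le> real n * t" "real n * t \<le> real k + 1"
  shows "concat_paths (map pi_path lams) t b = (\<Sum>j<k. real_of_int ((lams ! j) b)) + (real n * t - real k) * real_of_int ((lams ! k) b)"
proof -
  have n: "0 < real n" using k by simp
  have "real n * 0 \<le> real n * t" using t(1) by (metis mult_zero_right of_nat_0_le_iff order.trans)
  moreover have "real k + 1 \<le> real n" using k by simp
  then have "real n * t \<le> real n * 1" using t(2) by linarith
  ultimately have "0 \<le> t" "t \<le> 1" using n by (simp_all add: zero_le_mult_iff)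
  then have ct: "clamp t = t" by (simp add: clamp_def)
  have nth: "(map pi_path lams ! j) s b = clamp s * real_of_int ((lams ! j) b)" if "j < n" for j s
    using that by (simp add: n_def pi_path_def)
  define k' where "k' = min (n - 1) (nat \<lfloor>real n * t\<rfloor>)"
  have k'n: "k' < n" using k by (auto simp: k'_def)
  have s: "(\<Sum>l<k'. (map pi_path lams ! l) 1 b) = (\<Sum>j<k'. real_of_int ((lams ! j) b))"
    using k'n by (intro sum.cong) (auto simp: nth clamp_def)
  have v: "concat_paths (map pi_path lams) t b = (\<Sum>j<k'. real_of_int ((lams ! j) b)) + clamp (real n * t - real k') * real_of_int ((lams ! k') b)"
    unfolding concat_paths_def Let_def ct length_map n_def[symmetric] k'_def[symmetric] s nth[OF k'n] ..
  \<comment> \<open>At the right end of a leg the floor already names the next leg, unless the leg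
    is the last one; the formulas of the two legs agree at that point.\<close>
  consider "k' = k" | "k' = Suc k" "real n * t = real k + 1"
  proof (cases "real n * t = real k + 1")
    case True
    then have "nat \<lfloor>real n * t\<rfloor> = Suc k" by (simp add: nat_add_distrib)
    then have "k' = k \<or> k' = Suc k" using k unfolding k'_def by linarith
    then show ?thesis using that True by blast
  next
    case False
    then have "\<lfloor>real n * t\<rfloor> = int k" using t by linarith
    then have "k' = k" using k unfolding k'_def by simp
    then show ?thesis using that by blast
  qed
  then show ?thesis
  proof cases
    case 1
    then show ?thesis using v t by (simp add: clamp_def)
  next
    case 2
    then show ?thesis using v by (simp add: clamp_def)
  qed
qed

lemma concat_clamp: "concat_paths ps (clamp s) = concat_paths ps s"
  by (simp add: concat_paths_def)

lemma concat_end: "lams \<noteq> [] \<Longrightarrow> concat_paths (map pi_path lams) 1 = pi_path (wsum lams) 1"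
proof
  fix b assume "lams \<noteq> []"
  then obtain n where n: "length lams = Suc n" by (cases lams) auto
  have "concat_paths (map pi_path lams) 1 b = (\<Sum>j<n. real_of_int ((lams ! j) b)) + real_of_int ((lams ! n) b)"
    using concat_pi_path[of n lams 1 b] n by simp
  also have "\<dots> = (\<Sum>j<Suc n. real_of_int ((lams ! j) b))" by simp
  also have "\<dots> = real_of_int (wsum lams b)" by (simp add: wsum_def sum_list_sum_nth n atLeast0LessThan)
  also have "\<dots> = pi_path (wsum lams) 1 b" by (simp add: pi_path_def clamp_def)
  finally show "concat_paths (map pi_path lams) 1 b = pi_path (wsum lams) 1 b" .
qed

theorem theorem4p2p1:
  fixes I :: "'i set" and cor al :: "'i \<Rightarrow> 'b \<Rightarrow> int" and lams :: "('b \<Rightarrow> int) list"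
  assumes "BC_datum I cor al"
    and "lams \<noteq> []"
    and "set lams \<subseteq> WPplus I cor al"
    and "dominant_path I cor (concat_paths (map pi_path lams))"
  shows "\<exists>\<Phi>. crystal_iso I cor al (Bpath I cor al (wsum lams))
                 (F_orbit I cor al (concat_paths (map pi_path lams))) \<Phi>
          \<and> (\<forall>ws\<in>lists I. case apply_F cor al ws (pi_path (wsum lams)) of
                None \<Rightarrow> apply_F cor al ws (concat_paths (map pi_path lams)) = None
              | Some p \<Rightarrow> apply_F cor al ws (concat_paths (map pi_path lams)) = Some (\<Phi> p))"
proof -
  interpret bc I cor al by (unfold_locales) (rule assms(1))
  define n where "n = length lams"
  define La P where "La = concat_paths (map pi_path lams)" and "P = pi_path (wsum lams)"
  have n: "0 < n" using assms(2) by (simp add: n_def)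
  \<comment> \<open>Each leg takes time \<open>1 / n\<close>, so its velocity is \<open>n\<close>
    times the weight.\<close>
  define d where "d k = Vec (\<lambda>l. if valid l then real n * real_of_int (pairZ (cor (fst l)) (lams ! k)) else 0) (\<lambda>_. 0)" for k
  have pair: "pairR h (La t) = (\<Sum>j<k. real_of_int (pairZ h (lams ! j))) + (real n * t - real k) * real_of_int (pairZ h (lams ! k))"
    if "k < n" "real k \<le> real n * t" "real n * t \<le> real k + 1" for h k t
  proof -
    have "La t = (\<lambda>b. (\<Sum>j<k. real_of_int ((lams ! j) b)) + (real n * t - real k) * real_of_int ((lams ! k) b))"
      unfolding La_def using concat_pi_path[of k lams t] that by (auto simp: n_def)
    then show ?thesis by (simp add: pairR_add pairR_scale pairR_sum pairR_of_int)
  qed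
  have leg: "t \<in> {0..1}" if "k < n" "real k \<le> real n * t" "real n * t \<le> real k + 1" for k t
  proof -
    have "real n * 0 \<le> real n * t" using that(2) by (metis mult_zero_right of_nat_0_le_iff order.trans)
    moreover have "real k + 1 \<le> real n" using that(1) by simp
    then have "real n * t \<le> real n * 1" using that(3) by linarith
    ultimately show ?thesis using n by (simp add: zero_le_mult_iff)
  qed
  have pg: "K.polyg n d (base La)" unfolding K.polyg_def
  proof (intro conjI allI impI)
    show "0 < n" by (rule n)
    show "base La 0 = 0" by (rule vec_eqI) (use pair[of 0 0] n in \<open>auto simp: base_def\<close>)
    fix k t assume k: "k < n" "real k / n \<le> t" "t \<le> real (Suc k) / n"
    have t: "real k \<le> real n * t" "real n * t \<le> real k + 1" using k n by (simp_all add: field_simps)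
    have t0: "real k \<le> real n * (real k / n)" "real n * (real k / n) \<le> real k + 1" using n by simp_all
    have m: "t \<in> {0..1}" "real k / n \<in> {0..1}" using leg[OF k(1) t] leg[OF k(1) t0] by auto
    show "base La t = base La (real k / n) + (t - real k / n) *\<^sub>R d k"
    proof (rule vec_eqI)
      fix l
      show "vH (base La t) l = vH (base La (real k / n) + (t - real k / n) *\<^sub>R d k) l"
      proof (cases "valid l")
        case True
        have nk: "real n * (real k / n) = real k" and e: "real n * t - real k = (t - real k / n) * real n"
          using n by (simp_all add: field_simps)
        show ?thesis
          by (simp only: vec_simps vH_base[OF m(1) True] vH_base[OF m(2) True] d_def vec.sel True if_True
              pair[OF k(1) t] pair[OF k(1) t0] nk e diff_self mult_zero_left add_0_right mult.assoc)
      qed (use m in \<open>simp add: base_def d_def\<close>)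
    qed (simp add: d_def)
  qed
  have lat: "vH (base La (real k / n)) l \<in> \<int>" if k: "k \<le> n" for k l
  proof (cases "valid l")
    case True
    have m: "real k / n \<in> {0..1}" using k n by simp
    \<comment> \<open>The leg starting at the vertex, except that the final vertex is the end of leg
      \<open>n - 1\<close>.\<close>
    have "\<exists>j<n. real j \<le> real n * (real k / n) \<and> real n * (real k / n) \<le> real j + 1"
      using k n by (cases "k < n") (auto intro: exI[of _ k] exI[of _ "n - 1"])
    then obtain j where j: "j < n" "real j \<le> real n * (real k / n)" "real n * (real k / n) \<le> real j + 1" by blast
    have nk: "real n * (real k / n) = real k" using n by simp
    show ?thesis unfolding vH_base[OF m True] pair[OF j] nk by (intro Ints_add Ints_mult Ints_diff Ints_sum) auto
  qed (simp add: base_def)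
  have nn: "K.nneg (base La)" unfolding K.nneg_def
  proof (intro ballI allI)
    fix t :: real and l assume t: "t \<in> {0..1}"
    show "0 \<le> vH (base La t) l"
    proof (cases "valid l")
      case True
      obtain S c where S: "finite S" "S \<subseteq> Pplus I cor" "\<forall>\<eta>\<in>S. c \<eta> \<ge> (0::real)"
        "La t = (\<lambda>b. \<Sum>\<eta>\<in>S. c \<eta> * real_of_int (\<eta> b))"
        using bspec[OF assms(4)[unfolded dominant_path_def] t, folded La_def] by (elim exE conjE) (rule that; assumption)
      have "pairR (cor (fst l)) (La t) = (\<Sum>\<eta>\<in>S. c \<eta> * real_of_int (pairZ (cor (fst l)) \<eta>))"
        unfolding S(4) pairR_sum pairR_scale pairR_of_int ..
      also have "0 \<le> \<dots>" using S(2,3) True by (intro sum_nonneg mult_nonneg_nonneg) (auto simp: Pplus_def valid_def)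
      finally show ?thesis using vH_base[OF t True] by simp
    qed (simp add: base_def)
  qed
  define v where "v = base La 1"
  have P1: "P 1 = La 1" unfolding P_def La_def by (rule concat_end[OF assms(2), symmetric])
  \<comment> \<open>In terms of pairings the straight path to the common endpoint is the path that
    \<open>straight_compare\<close> relates to the polygon.\<close>
  have bP: "base P = (\<lambda>t. if t \<in> {0..1} then t *\<^sub>R base La 1 else base La t)"
  proof
    fix t
    show "base P t = (if t \<in> {0..1} then t *\<^sub>R base La 1 else base La t)"
    proof (cases "t \<in> {0..1}")
      case True
      have "P t = (\<lambda>b. t * P 1 b)" using True by (simp add: P_def pi_path_def clamp_eq clamp_def)
      then have "pairR h (P t) = t * pairR h (La 1)" for h by (simp add: pairR_scale P1)
      then show ?thesis using True by (auto intro!: vec_eqI simp: base_def)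
    qed (auto simp: base_def)
  qed
  have cmpr: "K.good (base La)" "K.good (base P)" "K.cmp (base P) (base La)"
    unfolding bP by (rule K.straight_compare[OF pg lat _ nn]; simp)+
  have v: "vH v l \<in> \<int>" "vC v l = 0" "0 \<le> vH v l" for l
    using lat[of n l] n nn[unfolded K.nneg_def, rule_format, of 1 l] by (auto simp: v_def)
  interpret L: bpath I cor al La n d
    by unfold_locales (use pg lat nn cmpr in \<open>auto simp: La_def concat_clamp d_def\<close>)
  interpret P: bpath I cor al P 1 "\<lambda>_. v"
  proof unfold_locales
    show "P (clamp s) = P s" for s by (simp add: P_def pi_path_def)
    show "K.polyg 1 (\<lambda>_. v) (base P)" unfolding K.polyg_def by (auto simp: bP v_def)
    show "vH (base P (real k / real 1)) l \<in> \<int>" if "k \<le> 1" for k l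
      using that v(1)[of l] by (cases k) (auto simp: bP v_def)
    show "vC v m = 0" for m by (rule v)
    show "K.nneg (base P)" using v(3) by (simp add: K.nneg_def bP v_def)
    show "K.good (base P)" by (rule cmpr)
  qed
  have ok: "okw (lift ws)" if "ws \<in> lists I" for ws by (rule okw_lift[OF that])
  have aP: "apply_F cor al ws P = map_option (prj P) (P.reach (lift ws))" if "ws \<in> lists I" for ws
    using P.apply_F_reach[OF ok[OF that]] by simp
  have aL: "apply_F cor al ws La = map_option (prj La) (L.reach (lift ws))" if "ws \<in> lists I" for ws
    using L.apply_F_reach[OF ok[OF that]] by simp
  have none: "P.reach W = None \<longleftrightarrow> L.reach W = None" for W using cmpr(3) unfolding K.cmp_def by blast
  have fixb: "K.run C (base P) = Some (base P) \<longleftrightarrow> K.run C (base La) = Some (base La)" for C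
    using cmpr(3) unfolding K.cmp_def by blast
  have mins: "mn (\<lambda>t. vH (x t) j) = mn (\<lambda>t. vH (z t) j)" if "P.reach W = Some x" "L.reach W = Some z" for W x z j
    using cmpr(3) that unfolding K.cmp_def by blast
  obtain R Lf R' L' where lb: "K.lp n d (base La) R Lf" "K.lp 1 (\<lambda>_. v) (base P) R' L'"
    using L.base_lp P.base_lp by blast
  \<comment> \<open>Equality of two images says that a word in e and f fixes the source, and these
    words are the same for both sources by \<open>cmp\<close>.\<close>
  have eq: "x = x' \<longleftrightarrow> z = z'"
    if "P.reach W = Some x" "P.reach W' = Some x'" "L.reach W = Some z" "L.reach W' = Some z'" for W W' x x' z z'
    unfolding K.run_eq_iff[OF lb(1) that(3,4)] K.run_eq_iff[OF lb(2) that(1,2)] by (rule fixb)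
  have "\<exists>\<Phi>. crystal_iso I cor al (F_orbit I cor al P) (F_orbit I cor al La) \<Phi>
    \<and> (\<forall>ws\<in>lists I. case apply_F cor al ws P of None \<Rightarrow> apply_F cor al ws La = None
        | Some p \<Rightarrow> apply_F cor al ws La = Some (\<Phi> p))"
  proof (rule iso_of_words)
    show "apply_F cor al ws P = None \<longleftrightarrow> apply_F cor al ws La = None" if "ws \<in> lists I" for ws
      using none[of "lift ws"] by (simp add: aP[OF that] aL[OF that])
  next
    fix ws ws' p p' q q'
    assume ws: "ws \<in> lists I" "ws' \<in> lists I" and p: "apply_F cor al ws P = Some p" "apply_F cor al ws' P = Some p'"
      and q: "apply_F cor al ws La = Some q" "apply_F cor al ws' La = Some q'"
    obtain x x' where x: "P.reach (lift ws) = Some x" "P.reach (lift ws') = Some x'" "p = prj P x" "p' = prj P x'"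
      using p by (auto simp: aP[OF ws(1)] aP[OF ws(2)])
    obtain z z' where z: "L.reach (lift ws) = Some z" "L.reach (lift ws') = Some z'" "q = prj La z" "q' = prj La z'"
      using q by (auto simp: aL[OF ws(1)] aL[OF ws(2)])
    show "p = p' \<longleftrightarrow> q = q'"
      using eq[OF x(1,2) z(1,2)] P.prj_inj[OF ws x(1,2)] L.prj_inj[OF ws z(1,2)] x(3,4) z(3,4) by blast
  next
    fix ws p q assume ws: "ws \<in> lists I" and p: "apply_F cor al ws P = Some p" and q: "apply_F cor al ws La = Some q"
    obtain x where x: "P.reach (lift ws) = Some x" "p = prj P x" using p by (auto simp: aP[OF ws])
    obtain z where z: "L.reach (lift ws) = Some z" "q = prj La z" using q by (auto simp: aL[OF ws])
    have c1: "clamp 1 = 1" by (simp add: clamp_def)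
    \<comment> \<open>Both starting paths end at the same weight, and each letter of the word has
      subtracted its simple root exactly once at time 1.\<close>
    have e: "q 1 = p 1"
    proof
      fix b
      have "prj P x 1 b = P 1 b - (\<Sum>m\<in>set (lift ws). vC (x 1) m * real_of_int (al (fst m) b))"
        using prj_sum[of "set (lift ws)" x 1 P b] P.reach_vC(3)[OF x(1), of _ 1] by (simp add: c1)
      moreover have "prj La z 1 b = La 1 b - (\<Sum>m\<in>set (lift ws). vC (z 1) m * real_of_int (al (fst m) b))"
        using prj_sum[of "set (lift ws)" z 1 La b] L.reach_vC(3)[OF z(1), of _ 1] by (simp add: c1)
      ultimately show "q 1 b = p 1 b"
        using P.reach_vC(2)[OF x(1)] L.reach_vC(2)[OF z(1)] P1 by (simp add: x(2) z(2))
    qed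
    have m: "mH cor i q = mH cor i p" if i: "i \<in> I" "rl i" for i
    proof -
      have l: "valid (i, 0)" "rl (fst (i, 0::nat))" using i by (auto simp: valid_def)
      have "mH cor i p = mn (\<lambda>t. vH (x t) (i, 0))" unfolding mH_mn
        by (rule mn_cong) (use Hf_prj[OF x(1) ok[OF ws] l(1) disjI1[OF l(2)]] x(2) in simp)
      moreover have "mH cor i q = mn (\<lambda>t. vH (z t) (i, 0))" unfolding mH_mn
        by (rule mn_cong) (use Hf_prj[OF z(1) ok[OF ws] l(1) disjI1[OF l(2)]] z(2) in simp)
      ultimately show ?thesis using mins[OF x(1) z(1)] by simp
    qed
    show "c_wt q = c_wt p \<and> (\<forall>i\<in>I. c_eps cor al i q = c_eps cor al i p \<and> c_phi cor al i q = c_phi cor al i p)"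
      using e m by (auto simp: c_wt_def c_eps_def c_phi_def Hf_def)
  qed (rule P.c_e_char L.c_e_char; assumption)+
  then show ?thesis unfolding Bpath_def P_def La_def .
qed

end
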